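(* Fix $k\ge 2$, distinct translations $t_1,\dots,t_k\in\mathbb C$, and a probability vector $\mathbf p=(p_1,\dots,p_k)$ with strictly positive entries. Then there exists a set $$E^{\mathbf p}_t\subset \mathcal R^{\mathbf p}_t:=\{\lambda=(\lambda_1,\dots,\lambda_k)\in\mathbb D_*^k:\ s(\lambda,\mathbf p)>2\}$$ of zero Lebesgue measure (in $\mathbb C^k\cong\mathbb R^{2k}$) such that for every $\lambda\in\mathcal R^{\mathbf p}_t\setminus E^{\mathbf p}_t$ the self-similar measure $\nu^{\mathbf p}_{\lambda,t}$ is absolutely continuous with respect to $2$-dimensional Lebesgue measure on $\mathbb C$.
   Context: $\mathbb D_*=\{z\in\mathbb C:0<|z|<1\}$. For $\lambda\in\mathbb D_*^k$ and $t\in\mathbb C^k$, let $g_i(z)=\lambda_i z+t_i$; $\nu^{\mathbf p}_{\lambda,t}$ is the unique Borel probability measure on $\mathbb C$ with $\nu=\sum_{i=1}^k p_i\, g_i\nu$ (pushforwards). The similarity dimension is $s(\lambda,\mathbf p)=\frac{\sum_i p_i\log p_i}{\sum_i p_i\log|\lambda_i|}$. *)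

theory Defs
  imports "HOL-Probability.Probability"
begin

definition ssm_fixed ::
  "real^'n::finite \<Rightarrow> complex^'n \<Rightarrow> complex^'n \<Rightarrow> complex measure \<Rightarrow> bool" where
  "ssm_fixed p lam t \<nu> \<longleftrightarrow>
     sets \<nu> = sets borel \<and> prob_space \<nu> \<and>
     (\<forall>A\<in>sets borel. emeasure \<nu> A =
        (\<Sum>i\<in>UNIV. ennreal (p$i) * emeasure (distr \<nu> borel (\<lambda>z. lam$i * z + t$i)) A))"

definition self_similar_measure ::
  "real^'n::finite \<Rightarrow> complex^'n \<Rightarrow> complex^'n \<Rightarrow> complex measure" where
  "self_similar_measure p lam t = (THE \<nu>. ssm_fixed p lam t \<nu>)"

definition sim_dim :: "complex^'n::finite \<Rightarrow> real^'n \<Rightarrow> real" where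
  "sim_dim lam p = (\<Sum>i\<in>UNIV. p$i * ln (p$i)) / (\<Sum>i\<in>UNIV. p$i * ln (cmod (lam$i)))"

definition punctured_polydisc :: "(complex^'n::finite) set" where
  "punctured_polydisc = {lam. \<forall>i. 0 < cmod (lam$i) \<and> cmod (lam$i) < 1}"

definition region_R :: "real^'n::finite \<Rightarrow> (complex^'n) set" where
  "region_R p = {lam \<in> punctured_polydisc. sim_dim lam p > 2}"

end

theory Submission
  imports Defs "HOL-Complex_Analysis.Complex_Analysis" "HOL-Real_Asymp.Real_Asymp"
begin

text \<open>
  Write the contraction ratios as \<open>exp (\<zeta> * a i + \<i> * b i)\<close> with \<open>a i < 0\<close> and \<open>\<zeta>\<close> in the right
  half-plane. By Fubini it suffices to treat almost every \<open>\<zeta>\<close> for fixed \<open>a\<close> and \<open>b\<close>. The measure is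
  then the law of a random series \<open>X\<close> that is holomorphic in \<open>\<zeta>\<close>. Let \<open>d m\<close> be the entropy dimension of the jet formed by
  \<open>X\<close> and its first \<open>m\<close> derivatives in \<open>\<zeta>\<close>, all coordinates observed at the same scale.

  (1) By compactness and the identity theorem, finitely many derivatives separate words with distinct
  first letters, so some \<open>d m\<close> is at least the similarity dimension \<open>s\<close>.
  (2) Parameters where \<open>d 1 = d 0\<close> but \<open>d m > d (m - 1)\<close> for some \<open>m > 1\<close>, with uniform constants, cannot accumulate:
  Taylor expansion between two such parameters together with submodularity of entropy is contradictory.
  Hence \<open>d 1 > d 0\<close> outside a countable set whenever \<open>d 0 < s\<close>.
  (3) If \<open>c < d 0 + d 1\<close>, the anisotropic box of side \<open>4 powr - j\<close> in \<open>X\<close> and \<open>2 powr - j\<close> in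
  the derivative has mass at most \<open>2 powr (- j * c)\<close> around typical points. Splitting the parameters by the size
  of the derivative of \<open>X u - X v\<close> turns this into a bound for the mean mass of small balls, averaged over \<open>\<zeta>\<close>.
  (4) For \<open>c \<le> 4\<close> this bound gives \<open>d 0 \<ge> c / 2\<close>, which excludes \<open>d 0 < 2\<close> because then \<open>d 1 > d 0\<close>.
  So \<open>d 0 = 2\<close>, hence \<open>d 0 + d 1 > 4\<close>, and with \<open>c > 4\<close> the mean mass of balls of radius \<open>r\<close>
  is of order \<open>r\<^sup>2\<close>, which gives absolute continuity.
\<close>

section \<open>Entropy of finite-valued random variables\<close>

text \<open>The obstacle is the lack of transversality: for two codings u, v the function F = X u -
  X v of \<open>\<zeta>\<close> may be small together with its derivative, and then the parameters
  with |F| small need not form a small set. The gain d 1 > d 0 says that pairs with close values are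
  less often close in the derivative as well. The scales 4^-j and 2^-j are tied by Taylor's formula:
  if |F| \<le> 4^-j and |F'| \<le> 2^-j, both bounds persist up to constants when
  \<open>\<zeta>\<close> moves by 2^-j, so one reference parameter controls a whole square of that
  side. If |F'| is about 2^-j, the part of a small enough such square where |F| \<le> 4^-l has area
  of order 16^-l 4^j. With 4^j squares and box masses 2^(-cj), level j contributes 16^-l 2^((4-c)j),
  so c = 4 is the threshold at which the sum over j converges. Entropy is an average, whereas this
  count needs the masses of individual boxes. Power sums of order q slightly above 1 bridge the two:
  they multiply over independent blocks up to constants and leave exceptional sets of exponentially
  small measure.\<close>

definition pr :: "'a measure \<Rightarrow> ('a \<Rightarrow> 'b) \<Rightarrow> 'b \<Rightarrow> real" where
  "pr M f c = measure M {x. f x = c}"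

definition fin_rv :: "'a measure \<Rightarrow> ('a \<Rightarrow> 'b) \<Rightarrow> bool" where
  "fin_rv M f \<longleftrightarrow> finite (range f) \<and> (\<forall>c. {x. f x = c} \<in> sets M)"

definition ent :: "'a measure \<Rightarrow> ('a \<Rightarrow> 'b) \<Rightarrow> real" where
  "ent M f = - (\<Sum>c\<in>range f. pr M f c * ln (pr M f c))"

text \<open>The exponential of 1 - q times the Renyi entropy of order q.\<close>

definition powsum :: "real \<Rightarrow> 'a measure \<Rightarrow> ('a \<Rightarrow> 'b) \<Rightarrow> real" where
  "powsum q M f = (\<Sum>c\<in>range f. pr M f c powr q)"

lemma fin_rv_finite: "fin_rv M f \<Longrightarrow> finite (range f)"
  by (simp add: fin_rv_def)

lemma fin_rv_sets: "fin_rv M f \<Longrightarrow> {x. f x = c} \<in> sets M"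
  by (simp add: fin_rv_def)

lemma fin_rv_comp:
  assumes "fin_rv M f" shows "fin_rv M (\<lambda>x. \<phi> (f x))"
proof -
  have "{x. \<phi> (f x) = c} = (\<Union>d\<in>{d\<in>range f. \<phi> d = c}. {x. f x = d})" for c
    by auto
  moreover have "finite {d\<in>range f. \<phi> d = c}" for c
    using assms by (auto simp: fin_rv_def)
  moreover have "range (\<lambda>x. \<phi> (f x)) = \<phi> ` range f" by auto
  ultimately show ?thesis
    using assms by (auto simp: fin_rv_def intro!: sets.finite_UN)
qed

lemma fin_rv_Pair:
  assumes "fin_rv M f" "fin_rv M g" shows "fin_rv M (\<lambda>x. (f x, g x))"
proof -
  have "{x. (f x, g x) = c} = {x. f x = fst c} \<inter> {x. g x = snd c}" for c by auto
  then have "{x. (f x, g x) = c} \<in> sets M" for c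
    using assms by (auto simp: fin_rv_def intro!: sets.Int)
  moreover have "finite (range (\<lambda>x. (f x, g x)))"
    by (rule finite_subset[of _ "range f \<times> range g"]) (use assms in \<open>auto simp: fin_rv_def\<close>)
  ultimately show ?thesis by (simp add: fin_rv_def)
qed

lemma pr_nonneg [simp]: "0 \<le> pr M f c" by (simp add: pr_def)

lemma pr_not_in_range: "c \<notin> range f \<Longrightarrow> pr M f c = 0"
proof -
  assume "c \<notin> range f" then have "{x. f x = c} = {}" by auto
  then show ?thesis by (simp add: pr_def)
qed

section \<open>Entropy inequalities for finite-valued variables\<close>

locale fprob = prob_space M for M :: "'a measure" +
  assumes space_UNIV: "space M = UNIV"
begin

lemma pr_comp:
  assumes "fin_rv M f"
  shows "pr M (\<lambda>x. \<phi> (f x)) d = (\<Sum>c\<in>{c\<in>range f. \<phi> c = d}. pr M f c)"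
proof -
  have "{x. \<phi> (f x) = d} = (\<Union>c\<in>{c\<in>range f. \<phi> c = d}. {x. f x = c})" by auto
  then have "pr M (\<lambda>x. \<phi> (f x)) d = measure M (\<Union>c\<in>{c\<in>range f. \<phi> c = d}. {x. f x = c})"
    by (simp add: pr_def)
  also have "\<dots> = (\<Sum>c\<in>{c\<in>range f. \<phi> c = d}. measure M {x. f x = c})"
    by (rule finite_measure_finite_Union)
       (use assms in \<open>auto simp: fin_rv_def disjoint_family_on_def\<close>)
  finally show ?thesis by (simp add: pr_def)
qed

lemma sum_pr_comp:
  assumes "fin_rv M f"
  shows "(\<Sum>d\<in>range (\<lambda>x. \<phi> (f x)). pr M (\<lambda>x. \<phi> (f x)) d * F d) = (\<Sum>c\<in>range f. pr M f c * F (\<phi> c))"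
proof -
  have fr: "finite (range f)" using assms by (rule fin_rv_finite)
  have r: "range (\<lambda>x. \<phi> (f x)) = \<phi> ` range f" by auto
  have "(\<Sum>d\<in>range (\<lambda>x. \<phi> (f x)). pr M (\<lambda>x. \<phi> (f x)) d * F d)
     = (\<Sum>d\<in>\<phi> ` range f. \<Sum>c\<in>{c\<in>range f. \<phi> c = d}. pr M f c * F (\<phi> c))"
    unfolding r pr_comp[OF assms] by (intro sum.cong) (auto simp: sum_distrib_right)
  also have "\<dots> = (\<Sum>c\<in>range f. pr M f c * F (\<phi> c))"
    using sum.image_gen[OF fr, of "\<lambda>c. pr M f c * F (\<phi> c)" \<phi>] by simp
  finally show ?thesis .
qed

lemma sum_pr:
  assumes "fin_rv M f" shows "(\<Sum>c\<in>range f. pr M f c) = 1"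
proof -
  have "pr M (\<lambda>x. ()) () = (\<Sum>c\<in>{c\<in>range f. () = ()}. pr M f c)"
    by (rule pr_comp[OF assms])
  then show ?thesis using prob_space by (simp add: pr_def space_UNIV)
qed

lemma pr_le_1: "pr M f c \<le> 1" by (simp add: pr_def)

lemma pr_mono_comp:
  assumes "fin_rv M f" shows "pr M f c \<le> pr M (\<lambda>x. \<phi> (f x)) (\<phi> c)"
proof -
  have "pr M f c = measure M {x. f x = c}" by (simp add: pr_def)
  also have "\<dots> \<le> measure M {x. \<phi> (f x) = \<phi> c}"
    by (rule finite_measure_mono) (use fin_rv_sets[OF fin_rv_comp[OF assms]] in auto)
  finally show ?thesis by (simp add: pr_def)
qed

lemma pr_pair_fst:
  assumes "fin_rv M f" "fin_rv M g"
  shows "(\<Sum>d\<in>range g. pr M (\<lambda>x. (f x, g x)) (c, d)) = pr M f c"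
proof -
  have "pr M f c = measure M (\<Union>d\<in>range g. {x. (f x, g x) = (c, d)})"
    unfolding pr_def by (intro arg_cong[where f="measure M"]) auto
  also have "\<dots> = (\<Sum>d\<in>range g. measure M {x. (f x, g x) = (c, d)})"
    by (rule finite_measure_finite_Union)
       (use assms fin_rv_sets[OF fin_rv_Pair[OF assms]] in \<open>auto simp: fin_rv_def disjoint_family_on_def\<close>)
  finally show ?thesis by (simp add: pr_def)
qed

text \<open>Gibbs' inequality: \<open>ln x \<le> x - 1\<close> makes the relative entropy with
  respect to a subprobability vector nonnegative. Submodularity and the fibre bound below both come
  from a choice of \<open>Q\<close>.\<close>

lemma ent_gibbs:
  assumes f: "fin_rv M f"
    and Q: "\<And>c. c \<in> range f \<Longrightarrow> 0 \<le> Q c" "\<And>c. pr M f c > 0 \<Longrightarrow> Q c > 0"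
    and S: "(\<Sum>c\<in>range f. Q c) \<le> 1"
  shows "ent M f \<le> - (\<Sum>c\<in>range f. pr M f c * ln (Q c))"
proof -
  have *: "pr M f c * ln (Q c) - pr M f c * ln (pr M f c) \<le> Q c - pr M f c" if "c \<in> range f" for c
  proof (cases "pr M f c = 0")
    case True then show ?thesis using Q(1)[OF that] by simp
  next
    case False
    then have p: "pr M f c > 0" using pr_nonneg[of M f c] by linarith
    then have q: "Q c > 0" using Q by blast
    have "ln (Q c / pr M f c) \<le> Q c / pr M f c - 1"
      using p q by (intro ln_le_minus_one) simp
    then have "pr M f c * ln (Q c / pr M f c) \<le> pr M f c * (Q c / pr M f c - 1)"
      using p by (intro mult_left_mono) auto
    then show ?thesis using p q by (simp add: ln_div algebra_simps)
  qed
  have "(\<Sum>c\<in>range f. pr M f c * ln (Q c) - pr M f c * ln (pr M f c)) \<le> (\<Sum>c\<in>range f. Q c - pr M f c)"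
    by (intro sum_mono *)
  also have "\<dots> \<le> 0" using S sum_pr[OF f] by (simp add: sum_subtractf)
  finally show ?thesis by (simp add: ent_def sum_subtractf)
qed

lemma ent_nonneg: "0 \<le> ent M f"
proof -
  have "pr M f c * ln (pr M f c) \<le> 0" for c
  proof (cases "pr M f c = 0")
    case False
    then have "pr M f c > 0" using pr_nonneg[of M f c] by linarith
    then show ?thesis using pr_le_1[of f c] by (simp add: mult_nonneg_nonpos)
  qed simp
  then show ?thesis unfolding ent_def by (simp add: sum_nonpos)
qed

lemma ent_comp_le:
  assumes f: "fin_rv M f" shows "ent M (\<lambda>x. \<phi> (f x)) \<le> ent M f"
proof -
  have "ent M (\<lambda>x. \<phi> (f x)) = - (\<Sum>c\<in>range f. pr M f c * ln (pr M (\<lambda>x. \<phi> (f x)) (\<phi> c)))"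
    unfolding ent_def by (subst sum_pr_comp[OF f, of \<phi> "\<lambda>d. ln (pr M (\<lambda>x. \<phi> (f x)) d)"]) simp
  also have "\<dots> \<le> ent M f"
  proof -
    have "pr M f c * ln (pr M f c) \<le> pr M f c * ln (pr M (\<lambda>x. \<phi> (f x)) (\<phi> c))" for c
    proof (cases "pr M f c = 0")
      case False
      then have "pr M f c > 0" using pr_nonneg[of M f c] by linarith
      moreover have "pr M f c \<le> pr M (\<lambda>x. \<phi> (f x)) (\<phi> c)" by (rule pr_mono_comp[OF f])
      ultimately show ?thesis by (intro mult_left_mono) auto
    qed simp
    then show ?thesis unfolding ent_def by (simp add: sum_mono)
  qed
  finally show ?thesis .
qed

lemma ent_eq_sum:
  assumes "fin_rv M f"
  shows "ent M (\<lambda>x. \<phi> (f x)) = - (\<Sum>c\<in>range f. pr M f c * ln (pr M (\<lambda>x. \<phi> (f x)) (\<phi> c)))"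
  unfolding ent_def by (subst sum_pr_comp[OF assms, of \<phi> "\<lambda>d. ln (pr M (\<lambda>x. \<phi> (f x)) d)"]) simp

text \<open>Nonnegativity of the conditional mutual information of \<open>f\<close> and
  \<open>h\<close> given \<open>g\<close>. The comparison law \<open>Q\<close> keeps both pair
  marginals and makes \<open>f\<close> and \<open>h\<close> conditionally independent given
  \<open>g\<close>.\<close>

lemma ent_submodular:
  assumes f: "fin_rv M f" and g: "fin_rv M g" and h: "fin_rv M h"
  shows "ent M (\<lambda>x. (f x, g x, h x)) + ent M g \<le> ent M (\<lambda>x. (f x, g x)) + ent M (\<lambda>x. (g x, h x))"
proof -
  let ?w = "\<lambda>x. (f x, g x, h x)"
  have w: "fin_rv M ?w" using f g h by (intro fin_rv_Pair)
  define P where "P = pr M ?w"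
  define A where "A = pr M (\<lambda>x. (f x, g x))"
  define B where "B = pr M (\<lambda>x. (g x, h x))"
  define D where "D = pr M g"
  define Q where "Q = (\<lambda>(a,b,c). A (a,b) * B (b,c) / D b)"
  have nn: "0 \<le> A u" "0 \<le> B v" "0 \<le> D b" for u v b by (auto simp: A_def B_def D_def)
  have PA: "P (a,b,c) \<le> A (a,b)" for a b c
    using pr_mono_comp[OF w, of "(a,b,c)" "\<lambda>(a,b,c). (a,b)"] by (simp add: P_def A_def)
  have PB: "P (a,b,c) \<le> B (b,c)" for a b c
    using pr_mono_comp[OF w, of "(a,b,c)" "\<lambda>(a,b,c). (b,c)"] by (simp add: P_def B_def)
  have PD: "P (a,b,c) \<le> D b" for a b c
    using pr_mono_comp[OF w, of "(a,b,c)" "\<lambda>(a,b,c). b"] by (simp add: P_def D_def)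
  have fr: "finite (range f)" "finite (range g)" "finite (range h)" using f g h by (auto simp: fin_rv_def)
  have "(\<Sum>c\<in>range ?w. Q c) \<le> (\<Sum>c\<in>range f \<times> range g \<times> range h. Q c)"
    using fr nn by (intro sum_mono2) (auto simp: Q_def)
  also have "\<dots> = (\<Sum>a\<in>range f. \<Sum>b\<in>range g. \<Sum>c\<in>range h. A (a,b) * B (b,c) / D b)"
    by (simp add: sum.cartesian_product Q_def)
  also have "\<dots> = (\<Sum>a\<in>range f. \<Sum>b\<in>range g. A (a,b) * D b / D b)"
    unfolding sum_divide_distrib[symmetric] sum_distrib_left[symmetric]
    using pr_pair_fst[OF g h] by (simp add: B_def D_def)
  also have "\<dots> \<le> (\<Sum>a\<in>range f. \<Sum>b\<in>range g. A (a,b))"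
    by (intro sum_mono) (auto simp: nn)
  also have "\<dots> = 1" using pr_pair_fst[OF f g] sum_pr[OF f] by (simp add: A_def)
  finally have S: "(\<Sum>c\<in>range ?w. Q c) \<le> 1" .
  have pos: "P c > 0 \<Longrightarrow> Q c > 0" for c
    using PA PB PD by (cases c) (auto simp: Q_def intro!: divide_pos_pos mult_pos_pos intro: less_le_trans)
  have "ent M ?w \<le> - (\<Sum>c\<in>range ?w. P c * ln (Q c))"
    unfolding P_def by (rule ent_gibbs[OF w]) (use nn pos S in \<open>auto simp: Q_def P_def\<close>)
  also have "\<dots> = - (\<Sum>(a,b,c)\<in>range ?w. P (a,b,c) * ln (A (a,b)) + P (a,b,c) * ln (B (b,c)) - P (a,b,c) * ln (D b))"
  proof -
    have "P (a,b,c) * ln (Q (a,b,c)) = P (a,b,c) * ln (A (a,b)) + P (a,b,c) * ln (B (b,c)) - P (a,b,c) * ln (D b)" for a b c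
    proof (cases "P (a,b,c) = 0")
      case False
      then have "P (a,b,c) > 0" using pr_nonneg[of M ?w] by (metis P_def less_eq_real_def)
      then have "A (a,b) > 0" "B (b,c) > 0" "D b > 0" using PA PB PD by (meson less_le_trans)+
      then show ?thesis by (simp add: Q_def ln_div ln_mult algebra_simps)
    qed simp
    then show ?thesis by (auto intro!: sum.cong)
  qed
  also have "\<dots> = ent M (\<lambda>x. (f x, g x)) + ent M (\<lambda>x. (g x, h x)) - ent M g"
    using ent_eq_sum[OF w, of "\<lambda>(a,b,c). (a,b)"] ent_eq_sum[OF w, of "\<lambda>(a,b,c). (b,c)"]
      ent_eq_sum[OF w, of "\<lambda>(a,b,c). b"]
    by (simp add: P_def A_def B_def D_def case_prod_unfold sum.distrib sum_subtractf)
  finally show ?thesis by simp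
qed

text \<open>The conditional entropy of \<open>f\<close> given \<open>g\<close> is at most
  \<open>ln K\<close>: the comparison law spreads each mass of \<open>g\<close> evenly over
  \<open>K\<close> slots. Every change between two discretizations of nearby points is paid for by
  such a term.\<close>

lemma ent_fibre_Pair:
  assumes f: "fin_rv M f" and g: "fin_rv M g" and K: "K > 0"
    and fib: "\<And>d. real (card {f x |x. g x = d}) \<le> K"
  shows "ent M (\<lambda>x. (g x, f x)) \<le> ent M g + ln K"
proof -
  let ?w = "\<lambda>x. (g x, f x)"
  have w: "fin_rv M ?w" using f g by (intro fin_rv_Pair)
  define Q where "Q = (\<lambda>(d::'c,c::'b). pr M g d / K)"
  have le: "pr M ?w c \<le> pr M g (fst c)" for c
    using pr_mono_comp[OF w, of c fst] by simp
  have rw: "range ?w = (SIGMA d:range g. {f x |x. g x = d})"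
    by (auto simp: image_iff) metis
  have "(\<Sum>c\<in>range ?w. Q c) = (\<Sum>d\<in>range g. \<Sum>c\<in>{f x |x. g x = d}. pr M g d / K)"
    unfolding rw Q_def
    by (subst sum.Sigma) (use f g in \<open>auto simp: fin_rv_def intro: finite_subset[of _ "range f"]\<close>)
  also have "\<dots> \<le> (\<Sum>d\<in>range g. pr M g d)"
  proof (intro sum_mono)
    fix d
    have "real (card {f x |x. g x = d}) * pr M g d \<le> K * pr M g d"
      by (intro mult_right_mono fib) simp
    then show "(\<Sum>c\<in>{f x |x. g x = d}. pr M g d / K) \<le> pr M g d"
      using K by (simp add: divide_le_eq mult.commute)
  qed
  finally have S: "(\<Sum>c\<in>range ?w. Q c) \<le> 1" using sum_pr[OF g] by simp
  have "ent M ?w \<le> - (\<Sum>c\<in>range ?w. pr M ?w c * ln (Q c))"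
  proof (rule ent_gibbs[OF w _ _ S])
    show "0 \<le> Q c" for c using K by (auto simp: Q_def split: prod.split)
    show "0 < Q c" if "0 < pr M ?w c" for c
      using K le[of c] that by (auto simp: Q_def split: prod.split)
  qed
  also have "\<dots> = - (\<Sum>c\<in>range ?w. pr M ?w c * ln (pr M g (fst c)) - pr M ?w c * ln K)"
  proof -
    have "pr M ?w c * ln (Q c) = pr M ?w c * ln (pr M g (fst c)) - pr M ?w c * ln K" for c
    proof (cases "pr M ?w c = 0")
      case False
      then have "pr M g (fst c) > 0" using le[of c] pr_nonneg[of M ?w c] by linarith
      then show ?thesis using K by (simp add: Q_def case_prod_unfold ln_div algebra_simps)
    qed simp
    then show ?thesis by simp
  qed
  also have "\<dots> = ent M g + ln K"
    using ent_eq_sum[OF w, of fst] sum_pr[OF w]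
    by (simp add: sum_subtractf sum_distrib_right[symmetric])
  finally show ?thesis .
qed

lemma ent_fibre:
  assumes "fin_rv M f" "fin_rv M g" "K > 0" "\<And>d. real (card {f x |x. g x = d}) \<le> K"
  shows "ent M f \<le> ent M g + ln K"
  using ent_fibre_Pair[OF assms] ent_comp_le[OF fin_rv_Pair[OF assms(2,1)], of snd] by simp

lemma ent_le_card:
  assumes f: "fin_rv M f" and K: "real (card (range f)) \<le> K"
  shows "ent M f \<le> ln K"
proof -
  have c: "fin_rv M (\<lambda>x. ())" using fin_rv_comp[OF f, of "\<lambda>_. ()"] .
  have "card (range f) > 0" using f by (auto simp: fin_rv_def card_gt_0_iff)
  then have "K > 0" using K by linarith
  moreover have "{f x |x. () = d} = range f" for d by auto
  ultimately have "ent M f \<le> ent M (\<lambda>x. ()) + ln K" by (intro ent_fibre[OF f c]) (use K in auto)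
  moreover have "ent M (\<lambda>x. ()) = 0" using prob_space by (simp add: ent_def pr_def space_UNIV)
  ultimately show ?thesis by simp
qed

text \<open>In the next lemmas \<open>W\<close> plays the role of a random prefix and \<open>\<tau> w\<close> of the map that
  puts the prefix \<open>w\<close> in front of an independent point.\<close>

lemma ent_chain:
  assumes W: "fin_rv M W" and g: "fin_rv M g" and gw: "\<And>w. w \<in> range W \<Longrightarrow> fin_rv M (\<lambda>x. g (\<tau> w x))"
    and prod: "\<And>w d. w \<in> range W \<Longrightarrow> pr M (\<lambda>x. (W x, g x)) (w, d) = pr M W w * pr M (\<lambda>x. g (\<tau> w x)) d"
    and sub: "\<And>w x. w \<in> range W \<Longrightarrow> \<exists>x'. W x' = w \<and> g x' = g (\<tau> w x)"
    and sub2: "\<And>x. \<exists>x'. g x = g (\<tau> (W x) x')"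
  shows "ent M (\<lambda>x. (W x, g x)) = ent M W + (\<Sum>w\<in>range W. pr M W w * ent M (\<lambda>x. g (\<tau> w x)))"
proof -
  let ?p = "\<lambda>w d. pr M (\<lambda>x. g (\<tau> w x)) d"
  have r: "range (\<lambda>x. (W x, g x)) = (SIGMA w:range W. range (\<lambda>x. g (\<tau> w x)))"
  proof (intro set_eqI iffI)
    fix z assume "z \<in> range (\<lambda>x. (W x, g x))"
    then obtain x where "z = (W x, g x)" by auto
    then show "z \<in> (SIGMA w:range W. range (\<lambda>x. g (\<tau> w x)))" using sub2[of x] by auto
  next
    fix z assume "z \<in> (SIGMA w:range W. range (\<lambda>x. g (\<tau> w x)))"
    then obtain x y where "z = (W x, g (\<tau> (W x) y))" by auto
    moreover obtain x' where "W x' = W x" "g x' = g (\<tau> (W x) y)" using sub[of "W x" y] by auto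
    ultimately have "z = (W x', g x')" by simp
    then show "z \<in> range (\<lambda>x. (W x, g x))" by (rule range_eqI)
  qed
  have "ent M (\<lambda>x. (W x, g x)) = - (\<Sum>w\<in>range W. \<Sum>d\<in>range (\<lambda>x. g (\<tau> w x)). pr M W w * ?p w d * ln (pr M W w * ?p w d))"
    unfolding ent_def r
    by (subst sum.Sigma) (use W gw in \<open>auto simp: fin_rv_def prod intro!: sum.cong\<close>)
  also have "\<dots> = - (\<Sum>w\<in>range W. pr M W w * ln (pr M W w) - pr M W w * ent M (\<lambda>x. g (\<tau> w x)))"
  proof -
    have "(\<Sum>d\<in>range (\<lambda>x. g (\<tau> w x)). pr M W w * ?p w d * ln (pr M W w * ?p w d))
       = pr M W w * ln (pr M W w) - pr M W w * ent M (\<lambda>x. g (\<tau> w x))" if "w \<in> range W" for w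
    proof (cases "pr M W w = 0")
      case False
      then have pw: "pr M W w > 0" using pr_nonneg[of M W w] by linarith
      have "pr M W w * ?p w d * ln (pr M W w * ?p w d)
         = ?p w d * (pr M W w * ln (pr M W w)) + pr M W w * (?p w d * ln (?p w d))" for d
      proof (cases "?p w d = 0")
        case False
        then have "?p w d > 0" using pr_nonneg[of M _ d] by (metis less_eq_real_def)
        then show ?thesis using pw by (simp add: ln_mult algebra_simps)
      qed simp
      then show ?thesis using sum_pr[OF gw[OF that]]
        by (simp add: sum.distrib sum_distrib_left[symmetric] sum_distrib_right[symmetric] ent_def)
    qed simp
    then show ?thesis by simp
  qed
  also have "\<dots> = ent M W + (\<Sum>w\<in>range W. pr M W w * ent M (\<lambda>x. g (\<tau> w x)))"
    by (simp add: ent_def[of M W] sum_subtractf)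
  finally show ?thesis .
qed

text \<open>Conditioning on less leaves more entropy: H(g | \<phi> W) \<ge> H(g | W) \<ge> B, by
  submodularity and \<open>ent_chain\<close>. In use \<open>\<phi>\<close> sends a word to its
  discretized position, which may carry much less entropy than the word itself.\<close>

lemma ent_prefix_ge:
  assumes W: "fin_rv M W" and g: "fin_rv M g" and gw: "\<And>w. w \<in> range W \<Longrightarrow> fin_rv M (\<lambda>x. g (\<tau> w x))"
    and prod: "\<And>w d. w \<in> range W \<Longrightarrow> pr M (\<lambda>x. (W x, g x)) (w, d) = pr M W w * pr M (\<lambda>x. g (\<tau> w x)) d"
    and sub: "\<And>w x. w \<in> range W \<Longrightarrow> \<exists>x'. W x' = w \<and> g x' = g (\<tau> w x)"
    and sub2: "\<And>x. \<exists>x'. g x = g (\<tau> (W x) x')"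
    and B: "\<And>w. w \<in> range W \<Longrightarrow> B \<le> ent M (\<lambda>x. g (\<tau> w x))"
  shows "ent M (\<lambda>x. \<phi> (W x)) + B \<le> ent M (\<lambda>x. (\<phi> (W x), g x))"
proof -
  note fw = fin_rv_comp[OF W, of \<phi>]
  have "ent M (\<lambda>x. (g x, \<phi> (W x), W x)) + ent M (\<lambda>x. \<phi> (W x)) \<le> ent M (\<lambda>x. (g x, \<phi> (W x))) + ent M (\<lambda>x. (\<phi> (W x), W x))"
    by (rule ent_submodular[OF g fw W])
  moreover have "ent M (\<lambda>x. (\<phi> (W x), W x)) \<le> ent M W"
    using ent_comp_le[OF W, of "\<lambda>w. (\<phi> w, w)"] .
  moreover have "ent M (\<lambda>x. (W x, g x)) \<le> ent M (\<lambda>x. (g x, \<phi> (W x), W x))"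
    using ent_comp_le[OF fin_rv_Pair[OF g fin_rv_Pair[OF fw W]], of "\<lambda>(a,b,c). (c,a)"] by simp
  moreover have "ent M (\<lambda>x. (g x, \<phi> (W x))) \<le> ent M (\<lambda>x. (\<phi> (W x), g x))"
    using ent_comp_le[OF fin_rv_Pair[OF fw g], of "\<lambda>(a,b). (b,a)"] by simp
  moreover have "B \<le> (\<Sum>w\<in>range W. pr M W w * ent M (\<lambda>x. g (\<tau> w x)))"
  proof -
    have "B = (\<Sum>w\<in>range W. pr M W w * B)"
      using sum_pr[OF W] by (simp add: sum_distrib_right[symmetric])
    also have "\<dots> \<le> (\<Sum>w\<in>range W. pr M W w * ent M (\<lambda>x. g (\<tau> w x)))"
      using B by (intro sum_mono mult_left_mono) auto
    finally show ?thesis .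
  qed
  ultimately show ?thesis using ent_chain[OF W g gw prod sub sub2] by linarith
qed

end

subsection \<open>Power sums of probabilities\<close>

lemma powr_ge_tangent:
  fixes x m q :: real
  assumes "x \<ge> 0" "m > 0" "q \<ge> 1"
  shows "x powr q \<ge> m powr q + q * m powr (q - 1) * (x - m)"
proof (cases "x = 0")
  case True
  have "m powr (q - 1) * m = m powr q" using assms by (simp add: powr_mult_base mult.commute)
  then have "q * m powr (q - 1) * (x - m) = - (q * m powr q)"
    using True by (metis diff_0 mult.assoc mult_minus_right)
  moreover have "1 * m powr q \<le> q * m powr q" using assms by (intro mult_right_mono) auto
  moreover have "x powr q = 0" using True by simp
  ultimately show ?thesis by linarith
next
  case False
  then have x: "x > 0" using assms by simp
  have "(\<lambda>x. x powr q) x - (\<lambda>x. x powr q) m \<ge> (q * m powr (q - 1)) * (x - m)"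
  proof (rule convex_on_imp_above_tangent[where A="{0<..}"])
    show "convex_on {0<..} (\<lambda>x. x powr q)" using powr_convex assms by blast
    show "((\<lambda>x. x powr q) has_real_derivative q * m powr (q - 1)) (at m within {0<..})"
      by (rule has_field_derivative_at_within, rule has_real_derivative_powr) (use assms in auto)
  qed (use x assms in \<open>auto simp: interior_open\<close>)
  then show ?thesis by simp
qed

text \<open>Jensen's inequality for the q-th power with unnormalized weights: sum the tangent
  inequality at the weighted mean \<open>m\<close>.\<close>

lemma weighted_sum_powr_le:
  fixes w x :: "'i \<Rightarrow> real"
  assumes "\<And>i. i \<in> S \<Longrightarrow> w i \<ge> 0" "\<And>i. i \<in> S \<Longrightarrow> x i \<ge> 0" "q \<ge> 1"
  shows "(\<Sum>i\<in>S. w i * x i) powr q \<le> (\<Sum>i\<in>S. w i) powr (q - 1) * (\<Sum>i\<in>S. w i * x i powr q)"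
proof (cases "finite S \<and> (\<Sum>i\<in>S. w i) \<noteq> 0 \<and> (\<Sum>i\<in>S. w i * x i) \<noteq> 0")
  case False
  then have "(\<Sum>i\<in>S. w i * x i) = 0"
    using assms by (cases "finite S") (auto simp: sum_nonneg_eq_0_iff)
  then show ?thesis using assms by (simp add: sum_nonneg)
next
  case True
  define T where "T = (\<Sum>i\<in>S. w i)"
  define m where "m = (\<Sum>i\<in>S. w i * x i) / T"
  have T: "T > 0" using True assms by (simp add: T_def less_le sum_nonneg)
  have sx: "(\<Sum>i\<in>S. w i * x i) > 0" using True assms by (simp add: less_le sum_nonneg)
  then have m: "m > 0" using T by (simp add: m_def)
  have "T * m powr q = (\<Sum>i\<in>S. w i * (m powr q + q * m powr (q - 1) * (x i - m)))"
  proof -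
    have "(\<Sum>i\<in>S. w i * (m powr q + q * m powr (q - 1) * (x i - m)))
       = T * m powr q + q * m powr (q-1) * ((\<Sum>i\<in>S. w i * x i) - T * m)"
      by (simp add: T_def algebra_simps sum.distrib sum_subtractf sum_distrib_left sum_distrib_right)
    moreover have "(\<Sum>i\<in>S. w i * x i) - T * m = 0" using T by (simp add: m_def)
    ultimately show ?thesis by simp
  qed
  also have "\<dots> \<le> (\<Sum>i\<in>S. w i * x i powr q)"
    using assms m by (intro sum_mono mult_left_mono powr_ge_tangent) auto
  finally have *: "T * m powr q \<le> (\<Sum>i\<in>S. w i * x i powr q)" .
  have "(\<Sum>i\<in>S. w i * x i) powr q = (T * m) powr q" using T by (simp add: m_def)
  also have "\<dots> = T powr (q - 1) * (T * m powr q)"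
    using T m by (simp add: powr_mult powr_diff)
  also have "\<dots> \<le> T powr (q - 1) * (\<Sum>i\<in>S. w i * x i powr q)"
    using * by (intro mult_left_mono) auto
  finally show ?thesis by (simp add: T_def)
qed

lemma sum_powr_le_card:
  fixes x :: "'i \<Rightarrow> real"
  assumes "\<And>i. i \<in> S \<Longrightarrow> x i \<ge> 0" "q \<ge> 1" "real (card S) \<le> K"
  shows "(\<Sum>i\<in>S. x i) powr q \<le> K powr (q - 1) * (\<Sum>i\<in>S. x i powr q)"
proof -
  have "(\<Sum>i\<in>S. x i) powr q \<le> real (card S) powr (q - 1) * (\<Sum>i\<in>S. x i powr q)"
    using weighted_sum_powr_le[of S "\<lambda>_. 1" x q] assms by simp
  also have "\<dots> \<le> K powr (q - 1) * (\<Sum>i\<in>S. x i powr q)"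
    using assms by (intro mult_right_mono powr_mono2) (auto intro: sum_nonneg)
  finally show ?thesis .
qed

lemma sum_powr_le_powr_sum:
  fixes x :: "'i \<Rightarrow> real"
  assumes "finite S" "\<And>i. i \<in> S \<Longrightarrow> x i \<ge> 0" "q \<ge> 1"
  shows "(\<Sum>i\<in>S. x i powr q) \<le> (\<Sum>i\<in>S. x i) powr q"
proof -
  define T where "T = (\<Sum>i\<in>S. x i)"
  have le: "x i \<le> T" if "i \<in> S" for i unfolding T_def using assms that by (intro member_le_sum) auto
  have T0: "T \<ge> 0" unfolding T_def using assms by (simp add: sum_nonneg)
  have sp: "y powr q = y * y powr (q - 1)" if "y \<ge> 0" for y :: real
    using that assms by (cases "y = 0") (auto simp: powr_mult_base)
  have "(\<Sum>i\<in>S. x i powr q) = (\<Sum>i\<in>S. x i * x i powr (q - 1))"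
    using assms by (intro sum.cong) (auto simp: sp)
  also have "\<dots> \<le> (\<Sum>i\<in>S. x i * T powr (q - 1))"
    using assms le by (intro sum_mono mult_left_mono powr_mono2) auto
  also have "\<dots> = T powr q" using sp[OF T0] by (simp add: T_def sum_distrib_right)
  finally show ?thesis by (simp add: T_def)
qed

lemma powsum_nonneg: "0 \<le> powsum q M f" by (simp add: powsum_def sum_nonneg)

context fprob
begin

text \<open>The counterpart of \<open>ent_fibre\<close>. Each mass of \<open>g\<close> splits into
  at most \<open>K\<close> joint masses, which costs \<open>K powr (q - 1)\<close> by Jensen;
  merging the joint masses into those of \<open>h\<close> can only increase the sum of q-th
  powers.\<close>

lemma powsum_fibre:
  assumes g: "fin_rv M g" and h: "fin_rv M h" and q: "q \<ge> 1"
    and fib: "\<And>d. real (card {h x |x. g x = d}) \<le> K"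
  shows "powsum q M g \<le> K powr (q - 1) * powsum q M h"
proof -
  let ?w = "\<lambda>x. (g x, h x)" and ?S = "\<lambda>d. {h x |x. g x = d}"
  have K: "K \<ge> 0" using fib[of undefined] by linarith
  have fS: "finite (?S d)" for d using h by (auto simp: fin_rv_def intro: finite_subset[of _ "range h"])
  have fr: "finite (range g)" "finite (range h)" using g h by (auto simp: fin_rv_def)
  have eq: "pr M g d = (\<Sum>e\<in>?S d. pr M ?w (d, e))" for d
  proof -
    have "pr M g d = (\<Sum>e\<in>range h. pr M ?w (d, e))" using pr_pair_fst[OF g h] by simp
    also have "\<dots> = (\<Sum>e\<in>?S d. pr M ?w (d, e))"
      by (rule sum.mono_neutral_right) (use fr in \<open>auto intro!: pr_not_in_range\<close>)
    finally show ?thesis .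
  qed
  have "powsum q M g \<le> (\<Sum>d\<in>range g. K powr (q - 1) * (\<Sum>e\<in>?S d. pr M ?w (d, e) powr q))"
    unfolding powsum_def eq using fib q by (intro sum_mono sum_powr_le_card) auto
  also have "\<dots> \<le> (\<Sum>d\<in>range g. K powr (q - 1) * (\<Sum>e\<in>range h. pr M ?w (d, e) powr q))"
    using fr by (intro sum_mono mult_left_mono sum_mono2) auto
  also have "\<dots> = K powr (q - 1) * (\<Sum>e\<in>range h. \<Sum>d\<in>range g. pr M ?w (d, e) powr q)"
    unfolding sum_distrib_left[symmetric] by (subst sum.swap) simp
  also have "\<dots> \<le> K powr (q - 1) * (\<Sum>e\<in>range h. (\<Sum>d\<in>range g. pr M ?w (d, e)) powr q)"
    using fr q by (intro mult_left_mono sum_mono sum_powr_le_powr_sum) auto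
  also have "\<dots> = K powr (q - 1) * powsum q M h"
  proof -
    have "(\<Sum>d\<in>range g. pr M ?w (d, e)) = pr M h e" for e
    proof -
      have "pr M ?w (d, e) = pr M (\<lambda>x. (h x, g x)) (e, d)" for d
        unfolding pr_def by (intro arg_cong[where f="measure M"]) auto
      then show ?thesis using pr_pair_fst[OF h g] by simp
    qed
    then show ?thesis by (simp add: powsum_def)
  qed
  finally show ?thesis .
qed

text \<open>The counterpart of \<open>ent_prefix_ge\<close>. Inside one cell of
  \<open>\<phi> (W x)\<close> the law of \<open>g\<close> is a mixture of the laws of
  \<open>g (\<tau> w x)\<close>, and by convexity the power sum of a mixture is at most the mixture
  of the power sums.\<close>

lemma powsum_prefix_le:
  assumes W: "fin_rv M W" and g: "fin_rv M g" and gw: "\<And>w. w \<in> range W \<Longrightarrow> fin_rv M (\<lambda>x. g (\<tau> w x))"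
    and q: "q \<ge> 1"
    and prod: "\<And>w d. w \<in> range W \<Longrightarrow> pr M (\<lambda>x. (W x, g x)) (w, d) = pr M W w * pr M (\<lambda>x. g (\<tau> w x)) d"
    and B: "\<And>w. w \<in> range W \<Longrightarrow> powsum q M (\<lambda>x. g (\<tau> w x)) \<le> B"
  shows "powsum q M (\<lambda>x. (\<phi> (W x), g x)) \<le> powsum q M (\<lambda>x. \<phi> (W x)) * B"
proof -
  let ?p = "\<lambda>w d. pr M (\<lambda>x. g (\<tau> w x)) d" and ?R = "range (\<lambda>x. \<phi> (W x))"
  let ?W = "\<lambda>c. {w\<in>range W. \<phi> w = c}"
  have fr: "finite (range W)" "finite (range g)" "finite ?R"
    using W g fin_rv_comp[OF W, of \<phi>] by (auto simp: fin_rv_def)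
  have eq: "pr M (\<lambda>x. (\<phi> (W x), g x)) (c, d) = (\<Sum>w\<in>?W c. pr M W w * ?p w d)" for c d
  proof -
    have "pr M (\<lambda>x. (\<phi> (W x), g x)) (c, d) = (\<Sum>z\<in>{z\<in>range (\<lambda>x. (W x, g x)). (\<phi> (fst z), snd z) = (c, d)}. pr M (\<lambda>x. (W x, g x)) z)"
      using pr_comp[OF fin_rv_Pair[OF W g], of "\<lambda>z. (\<phi> (fst z), snd z)" "(c,d)"] by simp
    also have "\<dots> = (\<Sum>z\<in>?W c \<times> {d}. pr M (\<lambda>x. (W x, g x)) z)"
      by (rule sum.mono_neutral_left) (use fr in \<open>auto intro!: pr_not_in_range\<close>)
    also have "\<dots> = (\<Sum>w\<in>?W c. pr M (\<lambda>x. (W x, g x)) (w, d))"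
      using sum.cartesian_product[of "\<lambda>w d. pr M (\<lambda>x. (W x, g x)) (w,d)" "{d}" "?W c"] by simp
    also have "\<dots> = (\<Sum>w\<in>?W c. pr M W w * ?p w d)" by (intro sum.cong) (auto simp: prod)
    finally show ?thesis .
  qed
  have "powsum q M (\<lambda>x. (\<phi> (W x), g x)) \<le> (\<Sum>z\<in>?R \<times> range g. pr M (\<lambda>x. (\<phi> (W x), g x)) z powr q)"
    unfolding powsum_def by (rule sum_mono2) (use fr in auto)
  also have "\<dots> = (\<Sum>c\<in>?R. \<Sum>d\<in>range g. pr M (\<lambda>x. (\<phi> (W x), g x)) (c, d) powr q)"
    by (simp add: sum.cartesian_product)
  also have "\<dots> \<le> (\<Sum>c\<in>?R. pr M (\<lambda>x. \<phi> (W x)) c powr q * B)"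
  proof (rule sum_mono)
    fix c
    have pc: "(\<Sum>w\<in>?W c. pr M W w) = pr M (\<lambda>x. \<phi> (W x)) c" using pr_comp[OF W, of \<phi> c] by simp
    have "(\<Sum>d\<in>range g. pr M (\<lambda>x. (\<phi> (W x), g x)) (c, d) powr q)
       \<le> (\<Sum>d\<in>range g. pr M (\<lambda>x. \<phi> (W x)) c powr (q - 1) * (\<Sum>w\<in>?W c. pr M W w * ?p w d powr q))"
      unfolding eq pc[symmetric] using q by (intro sum_mono weighted_sum_powr_le) auto
    also have "\<dots> = pr M (\<lambda>x. \<phi> (W x)) c powr (q - 1) * (\<Sum>w\<in>?W c. pr M W w * (\<Sum>d\<in>range g. ?p w d powr q))"
      unfolding sum_distrib_left[symmetric] by (subst sum.swap) (simp add: sum_distrib_left)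
    also have "\<dots> \<le> pr M (\<lambda>x. \<phi> (W x)) c powr (q - 1) * (\<Sum>w\<in>?W c. pr M W w * B)"
    proof (intro mult_left_mono sum_mono)
      fix w assume w: "w \<in> ?W c"
      have "(\<Sum>d\<in>range g. ?p w d powr q) = powsum q M (\<lambda>x. g (\<tau> w x))"
        unfolding powsum_def by (rule sum.mono_neutral_right) (use fr q in \<open>auto simp: pr_not_in_range\<close>)
      then show "(\<Sum>d\<in>range g. ?p w d powr q) \<le> B" using B w by simp
    qed auto
    also have "\<dots> = pr M (\<lambda>x. \<phi> (W x)) c powr q * B"
    proof -
      have "y powr (q - 1) * (y * B) = y powr q * B" if "y \<ge> 0" for y :: real
      proof (cases "y = 0")
        case False
        then have "y powr (q - 1) * y = y powr q" using that by (simp add: powr_mult_base mult.commute)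
        then show ?thesis by (metis mult.assoc)
      qed simp
      then show ?thesis unfolding sum_distrib_right[symmetric] pc by simp
    qed
    finally show "(\<Sum>d\<in>range g. pr M (\<lambda>x. (\<phi> (W x), g x)) (c, d) powr q) \<le> pr M (\<lambda>x. \<phi> (W x)) c powr q * B" .
  qed
  also have "\<dots> = powsum q M (\<lambda>x. \<phi> (W x)) * B" by (simp add: powsum_def sum_distrib_right)
  finally show ?thesis .
qed

text \<open>The derivative of \<open>q \<mapsto> powsum q M f\<close> at \<open>q = 1\<close> is \<open>- ent M f\<close>.\<close>

lemma eventually_powsum_less:
  assumes f: "fin_rv M f" and a: "a < ent M f"
  shows "eventually (\<lambda>q. powsum q M f < exp (- (q - 1) * a)) (at_right 1)"
proof -
  define D where "D q = powsum q M f - exp (- (q - 1) * a)" for q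
  have "((\<lambda>q. pr M f c powr q) has_real_derivative pr M f c * ln (pr M f c)) (at 1)" for c
  proof (cases "pr M f c = 0")
    case False
    then have "pr M f c > 0" using pr_nonneg[of M f c] by linarith
    then show ?thesis by (auto intro!: derivative_eq_intros)
  qed simp
  then have "((\<lambda>q. powsum q M f) has_real_derivative (\<Sum>c\<in>range f. pr M f c * ln (pr M f c))) (at 1)"
    unfolding powsum_def by (intro DERIV_sum) auto
  moreover have "((\<lambda>q. exp (- (q - 1) * a)) has_real_derivative - a) (at 1)"
    by (auto intro!: derivative_eq_intros)
  ultimately have D: "(D has_real_derivative - ent M f + a) (at 1)"
    unfolding D_def ent_def by (auto intro!: derivative_eq_intros)
  have D1: "D 1 = 0"
  proof -
    have "powsum 1 M f = 1" using sum_pr[OF f] by (simp add: powsum_def)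
    then show ?thesis by (simp add: D_def)
  qed
  obtain d where d: "d > 0" "\<And>h. 0 < h \<Longrightarrow> h < d \<Longrightarrow> D (1 + h) < D 1"
    using DERIV_neg_dec_right[OF D] a by auto
  have "D q < 0" if "1 < q" "q < 1 + d" for q using d(2)[of "q - 1"] that D1 by simp
  then show ?thesis unfolding eventually_at_right_field D_def using d(1)
    by (intro exI[of _ "1 + d"]) auto
qed

end

section \<open>Self-similar series along a holomorphic curve of contractions\<close>

text \<open>The prefix at which \<open>y\<close> plus the accumulated \<open>a\<close> first drops
  to 0 or below. The number \<open>n\<close> is fuel that makes the recursion primitive.\<close>

primrec stopn :: "('n \<Rightarrow> real) \<Rightarrow> nat \<Rightarrow> real \<Rightarrow> 'n stream \<Rightarrow> 'n list" where
  "stopn a 0 y \<omega> = []"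
| "stopn a (Suc n) y \<omega> = (if y \<le> 0 then [] else shd \<omega> # stopn a n (y + a (shd \<omega>)) (stl \<omega>))"

text \<open>The contraction ratios are \<open>exp (\<zeta> * a i + \<i> * b i)\<close>, with \<open>\<zeta>\<close> ranging over the right
  half-plane. This curve is chosen because a word \<open>w\<close> then contracts by \<open>exp (Re \<zeta> * A)\<close>, where
  \<open>A\<close> is the sum of \<open>a\<close> along \<open>w\<close>, and the logarithmic derivative of its ratio in \<open>\<zeta>\<close> is the same
  number \<open>A\<close>: words of comparable ratio have comparable logarithmic derivatives.\<close>

locale ifs =
  fixes p :: "'n::finite pmf" and a b :: "'n \<Rightarrow> real" and t :: "'n \<Rightarrow> complex"
  assumes a_neg: "a i < 0" and p_pos: "pmf p i > 0" and t_inj: "inj t"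
begin

abbreviation "\<mu> \<equiv> stream_space (measure_pmf p)"

lemma space_mu [simp]: "space \<mu> = UNIV"
  by (simp add: space_stream_space)

sublocale fprob \<mu>
  using prob_space.prob_space_stream_space[OF prob_space_measure_pmf]
  by (auto simp: fprob_def fprob_axioms_def)

lemma sets_mu [measurable_cong]: "sets \<mu> = sets (stream_space (count_space UNIV))"
  by (rule sets_stream_space_cong) simp

definition c0 :: real where "c0 = Min (range (\<lambda>i. - a i))"
definition c1 :: real where "c1 = Max (range (\<lambda>i. - a i))"
definition T :: real where "T = Max (range (\<lambda>i. cmod (t i)))"

lemma c0_pos: "c0 > 0" unfolding c0_def using a_neg by (subst Min_gr_iff) auto
lemma a_le: "a i \<le> - c0"
proof -
  have "c0 \<le> - a i" unfolding c0_def by (rule Min_le) auto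
  then show ?thesis by simp
qed
lemma a_ge: "- c1 \<le> a i"
proof -
  have "- a i \<le> c1" unfolding c1_def by (rule Max_ge) auto
  then show ?thesis by simp
qed
lemma c1_pos: "c1 > 0" using a_ge[of undefined] a_neg[of undefined] by linarith
lemma t_le: "cmod (t i) \<le> T" unfolding T_def by (rule Max_ge) auto
lemma T_nonneg: "T \<ge> 0" using t_le[of undefined] norm_ge_zero[of "t undefined"] by linarith

section \<open>The series, its derivatives and changes of scale\<close>

definition Aw :: "'n list \<Rightarrow> real" where "Aw w = sum_list (map a w)"
definition Bw :: "'n list \<Rightarrow> real" where "Bw w = sum_list (map b w)"

lemma Aw_simps [simp]: "Aw [] = 0" "Aw (i # w) = a i + Aw w" "Bw [] = 0" "Bw (i # w) = b i + Bw w"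
  by (auto simp: Aw_def Bw_def)

definition As :: "'n stream \<Rightarrow> nat \<Rightarrow> real" where "As \<omega> n = (\<Sum>k<n. a (\<omega> !! k))"
definition Bs :: "'n stream \<Rightarrow> nat \<Rightarrow> real" where "Bs \<omega> n = (\<Sum>k<n. b (\<omega> !! k))"

lemma As_0 [simp]: "As \<omega> 0 = 0" "Bs \<omega> 0 = 0" by (auto simp: As_def Bs_def)

lemma As_Stream: "As (i ## \<omega>) (Suc n) = a i + As \<omega> n" "Bs (i ## \<omega>) (Suc n) = b i + Bs \<omega> n"
  unfolding As_def Bs_def sum.lessThan_Suc_shift by simp_all

lemma As_le: "As \<omega> n \<le> - c0 * n"
proof -
  have "As \<omega> n \<le> (\<Sum>k<n. - c0)" unfolding As_def by (intro sum_mono a_le)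
  then show ?thesis by (simp add: mult.commute)
qed

definition trm :: "nat \<Rightarrow> real \<Rightarrow> complex \<Rightarrow> 'n stream \<Rightarrow> nat \<Rightarrow> complex" where
  "trm j y \<zeta> \<omega> n = of_real (y + As \<omega> n) ^ j * exp (\<zeta> * of_real (y + As \<omega> n) + \<i> * of_real (Bs \<omega> n)) * t (\<omega> !! n)"

text \<open>\<open>V j y \<zeta> \<omega>\<close> is the \<open>j\<close>-th derivative in \<open>\<zeta>\<close> of \<open>exp (y * \<zeta>)\<close> times the series \<open>V 0 0 \<zeta> \<omega>\<close>, whose law
  is the self-similar measure; the factor \<open>exp (y * \<zeta>)\<close> rescales it to the scale at which it is observed.\<close>

definition V :: "nat \<Rightarrow> real \<Rightarrow> complex \<Rightarrow> 'n stream \<Rightarrow> complex" where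
  "V j y \<zeta> \<omega> = (\<Sum>n. trm j y \<zeta> \<omega> n)"

lemma norm_trm: "cmod (trm j y \<zeta> \<omega> n) = \<bar>y + As \<omega> n\<bar> ^ j * exp (Re \<zeta> * (y + As \<omega> n)) * cmod (t (\<omega> !! n))"
  by (simp add: trm_def norm_mult norm_power del: of_real_add)

text \<open>One term of the exponential series bounds the power. Half of a decay rate
  \<open>s\<close> is spent on the polynomial factor, which leaves decay at rate
  \<open>s / 2\<close>.\<close>

lemma power_le_exp:
  assumes "x \<ge> (0::real)" "s > 0" shows "x ^ j \<le> fact j * (2 / s) ^ j * exp (s / 2 * x)"
proof -
  have *: "y ^ j / fact j \<le> exp y" if "y \<ge> 0" for y :: real
  proof -
    have "(\<Sum>n\<in>{j}. y ^ n /\<^sub>R fact n) \<le> (\<Sum>n. y ^ n /\<^sub>R fact n)"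
      using that by (intro sum_le_suminf summable_exp_generic) auto
    moreover have "(\<Sum>n\<in>{j}. y ^ n /\<^sub>R fact n) = y ^ j / fact j"
      by (simp add: divide_inverse mult.commute)
    ultimately show ?thesis by (simp add: exp_def)
  qed
  have "(s / 2 * x) ^ j / fact j \<le> exp (s / 2 * x)" by (rule *) (use assms in auto)
  then have "(s / 2 * x) ^ j \<le> fact j * exp (s / 2 * x)" by (simp add: field_simps)
  then have "(2 / s) ^ j * (s / 2 * x) ^ j \<le> (2 / s) ^ j * (fact j * exp (s / 2 * x))"
    using assms by (intro mult_left_mono) auto
  moreover have "(2 / s) ^ j * (s / 2 * x) ^ j = x ^ j"
    using assms by (simp flip: power_mult_distrib)
  ultimately show ?thesis by (simp add: mult_ac)
qed

text \<open>The bound is uniform over a vertical strip, as the Weierstrass test for the derivative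
  needs. A term can be large only while \<open>y + As \<omega> n\<close> is positive, that is for n
  below |y| / c0; the factor \<open>exp (2 * s' * \<bar>y\<bar>)\<close> pays for these terms, and
  the later ones decay geometrically.\<close>

lemma trm_bound:
  assumes "0 < s" "s \<le> Re \<zeta>" "Re \<zeta> \<le> s'"
  shows "cmod (trm j y \<zeta> \<omega> n) \<le> T * fact j * (2 / s) ^ j * exp (2 * s' * \<bar>y\<bar>) * exp (- s * c0 / 2) ^ n"
proof -
  define x where "x = y + As \<omega> n"
  have x: "x \<le> y - c0 * n" using As_le[of \<omega> n] by (simp add: x_def)
  have c: "c0 * n \<ge> 0" using c0_pos by simp
  have e: "s / 2 * \<bar>x\<bar> + Re \<zeta> * x \<le> 2 * s' * \<bar>y\<bar> - s * c0 / 2 * n"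
  proof (cases "x \<le> 0")
    case True
    have "Re \<zeta> * x \<le> s * x" using True assms by (intro mult_right_mono_neg) auto
    then have "s / 2 * \<bar>x\<bar> + Re \<zeta> * x \<le> s / 2 * x" using True by (simp add: field_simps)
    also have "\<dots> \<le> s / 2 * (y - c0 * n)" using x assms by (intro mult_left_mono) auto
    also have "\<dots> \<le> 2 * s' * \<bar>y\<bar> - s * c0 / 2 * n"
    proof -
      have "s / 2 * y \<le> s / 2 * \<bar>y\<bar>" using assms by (intro mult_left_mono) auto
      also have "\<dots> \<le> 2 * s' * \<bar>y\<bar>" using assms by (intro mult_right_mono) auto
      finally have "s / 2 * y \<le> 2 * s' * \<bar>y\<bar>" .
      then show ?thesis by (simp add: field_simps)
    qed
    finally show ?thesis .
  next
    case False
    then have y: "0 < x" "x \<le> \<bar>y\<bar>" "c0 * n \<le> \<bar>y\<bar>" using x c by auto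
    have "s / 2 * \<bar>x\<bar> \<le> s' / 2 * \<bar>y\<bar>" using assms y by (intro mult_mono) auto
    moreover have "Re \<zeta> * x \<le> s' * \<bar>y\<bar>" using assms y by (intro mult_mono) auto
    moreover have "s / 2 * (c0 * n) \<le> s' / 2 * \<bar>y\<bar>" using assms y c by (intro mult_mono) auto
    ultimately show ?thesis by (simp add: field_simps)
  qed
  have "cmod (trm j y \<zeta> \<omega> n) = \<bar>x\<bar> ^ j * exp (Re \<zeta> * x) * cmod (t (\<omega> !! n))"
    by (simp add: norm_trm x_def)
  also have "\<dots> \<le> (fact j * (2 / s) ^ j * exp (s / 2 * \<bar>x\<bar>)) * exp (Re \<zeta> * x) * T"
    using assms t_le T_nonneg by (intro mult_mono power_le_exp) auto
  also have "\<dots> = T * fact j * (2 / s) ^ j * exp (s / 2 * \<bar>x\<bar> + Re \<zeta> * x)"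
    by (simp add: exp_add)
  also have "\<dots> \<le> T * fact j * (2 / s) ^ j * exp (2 * s' * \<bar>y\<bar> - s * c0 / 2 * n)"
    using e T_nonneg assms by (intro mult_left_mono) auto
  also have "\<dots> = T * fact j * (2 / s) ^ j * exp (2 * s' * \<bar>y\<bar>) * exp (- s * c0 / 2) ^ n"
  proof -
    have "2 * s' * \<bar>y\<bar> - s * c0 / 2 * n = 2 * s' * \<bar>y\<bar> + n * (- s * c0 / 2)" by simp
    then show ?thesis by (simp only: exp_add exp_of_nat_mult mult.assoc)
  qed
  finally show ?thesis .
qed

lemma summable_geo: "0 < s \<Longrightarrow> summable (\<lambda>n. K * exp (- s * c0 / 2) ^ n)"
  using c0_pos by (intro summable_mult summable_geometric) (auto simp: mult_neg_pos)

lemma summable_trm: "Re \<zeta> > 0 \<Longrightarrow> summable (trm j y \<zeta> \<omega>)"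
  by (rule summable_comparison_test'[OF summable_geo[of "Re \<zeta>"] trm_bound]) auto

text \<open>For \<open>y \<le> 0\<close> the constants do not depend on an upper bound for \<open>Re \<zeta>\<close>.\<close>

definition Cb :: "nat \<Rightarrow> real \<Rightarrow> real" where
  "Cb j s = T * fact j * (2 / s) ^ j / (1 - exp (- s * c0 / 2))"

lemma Cb_nonneg: "s > 0 \<Longrightarrow> Cb j s \<ge> 0"
  unfolding Cb_def using T_nonneg c0_pos by (intro divide_nonneg_nonneg mult_nonneg_nonneg) auto

lemma V_bound:
  assumes "0 < s" "s \<le> Re \<zeta>" "y \<le> 0" shows "cmod (V j y \<zeta> \<omega>) \<le> Cb j s"
proof -
  let ?K = "T * fact j * (2 / s) ^ j"
  have b: "cmod (trm j y \<zeta> \<omega> n) \<le> ?K * exp (- s * c0 / 2) ^ n" for n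
  proof -
    define x where "x = y + As \<omega> n"
    have x: "x \<le> - c0 * n" using As_le[of \<omega> n] assms by (simp add: x_def)
    moreover have "c0 * n \<ge> 0" using c0_pos by simp
    ultimately have x0: "x \<le> 0" by simp
    note x = x x0
    have "Re \<zeta> * x \<le> s * x" using x assms by (intro mult_right_mono_neg) auto
    then have "s / 2 * \<bar>x\<bar> + Re \<zeta> * x \<le> s / 2 * x" using x by (simp add: field_simps)
    also have "\<dots> \<le> s / 2 * (- c0 * n)" using x assms by (intro mult_left_mono) auto
    finally have e: "s / 2 * \<bar>x\<bar> + Re \<zeta> * x \<le> n * (- s * c0 / 2)" by (simp add: field_simps)
    have "cmod (trm j y \<zeta> \<omega> n) = \<bar>x\<bar> ^ j * exp (Re \<zeta> * x) * cmod (t (\<omega> !! n))"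
      by (simp add: norm_trm x_def)
    also have "\<dots> \<le> (fact j * (2 / s) ^ j * exp (s / 2 * \<bar>x\<bar>)) * exp (Re \<zeta> * x) * T"
      using assms t_le T_nonneg by (intro mult_mono power_le_exp) auto
    also have "\<dots> = ?K * exp (s / 2 * \<bar>x\<bar> + Re \<zeta> * x)" by (simp add: exp_add)
    also have "\<dots> \<le> ?K * exp (n * (- s * c0 / 2))"
      using e T_nonneg assms by (intro mult_left_mono) auto
    finally show ?thesis unfolding exp_of_nat_mult .
  qed
  have "cmod (V j y \<zeta> \<omega>) \<le> (\<Sum>n. ?K * exp (- s * c0 / 2) ^ n)"
    unfolding V_def by (rule norm_suminf_le[OF b summable_geo]) (use assms in auto)
  also have "\<dots> = Cb j s"
  proof -
    have "norm (exp (- s * c0 / 2)) < 1" using assms c0_pos by (simp add: mult_neg_pos)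
    then have "(\<lambda>n. ?K * exp (- s * c0 / 2) ^ n) sums (?K * (1 / (1 - exp (- s * c0 / 2))))"
      by (intro sums_mult geometric_sums)
    then show ?thesis by (simp add: sums_iff Cb_def)
  qed
  finally show ?thesis .
qed

lemma V_Stream:
  assumes "Re \<zeta> > 0"
  shows "V j y \<zeta> (i ## \<omega>) = of_real y ^ j * exp (\<zeta> * of_real y) * t i + cis (b i) * V j (y + a i) \<zeta> \<omega>"
proof -
  have "V j y \<zeta> (i ## \<omega>) = trm j y \<zeta> (i ## \<omega>) 0 + (\<Sum>n. trm j y \<zeta> (i ## \<omega>) (Suc n))"
    unfolding V_def using suminf_split_head[OF summable_trm[OF assms]] by (simp add: algebra_simps)
  also have "(\<lambda>n. trm j y \<zeta> (i ## \<omega>) (Suc n)) = (\<lambda>n. cis (b i) * trm j (y + a i) \<zeta> \<omega> n)"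
    by (rule ext) (simp add: trm_def As_Stream cis_conv_exp exp_add algebra_simps)
  also have "(\<Sum>n. cis (b i) * trm j (y + a i) \<zeta> \<omega> n) = cis (b i) * V j (y + a i) \<zeta> \<omega>"
    unfolding V_def by (rule suminf_mult[OF summable_trm[OF assms]])
  finally show ?thesis by (simp add: trm_def)
qed

text \<open>A common prefix adds the same summand to both values and drops out. What remains is a
  rotation and a shift of the observation level by \<open>Aw w\<close>; this is the form in which
  self-similarity enters the entropy estimates.\<close>

lemma V_shift_diff:
  assumes "Re \<zeta> > 0"
  shows "V j y \<zeta> (w @- u) - V j y \<zeta> (w @- v) = cis (Bw w) * (V j (y + Aw w) \<zeta> u - V j (y + Aw w) \<zeta> v)"
proof (induction w arbitrary: y)
  case (Cons i w)
  have "V j y \<zeta> ((i # w) @- u) - V j y \<zeta> ((i # w) @- v)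
    = cis (b i) * (V j (y + a i) \<zeta> (w @- u) - V j (y + a i) \<zeta> (w @- v))"
    by (simp add: V_Stream[OF assms] algebra_simps)
  then show ?case by (simp add: Cons cis_mult[symmetric] add.assoc)
qed simp

text \<open>Leibniz' rule for the extra factor \<open>exp (\<zeta> * of_real c)\<close>. A change of
  level acts on jets by a triangular matrix, so lower derivatives leak into higher ones with only
  polynomial weight in \<open>c\<close>.\<close>

lemma V_change:
  assumes "Re \<zeta> > 0"
  shows "V j (y + c) \<zeta> \<omega> = exp (\<zeta> * of_real c) * (\<Sum>l\<le>j. of_nat (j choose l) * of_real c ^ (j - l) * V l y \<zeta> \<omega>)"
proof -
  have "trm j (y + c) \<zeta> \<omega> n = exp (\<zeta> * of_real c) * (\<Sum>l\<le>j. of_nat (j choose l) * of_real c ^ (j - l) * trm l y \<zeta> \<omega> n)" for n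
  proof -
    define x where "x = y + As \<omega> n"
    have "trm j (y + c) \<zeta> \<omega> n = (of_real x + of_real c) ^ j * exp (\<zeta> * of_real c + (\<zeta> * of_real x + \<i> * of_real (Bs \<omega> n))) * t (\<omega> !! n)"
      by (simp add: trm_def x_def algebra_simps)
    also have "\<dots> = exp (\<zeta> * of_real c) * ((\<Sum>l\<le>j. of_nat (j choose l) * of_real x ^ l * of_real c ^ (j - l)) * (exp (\<zeta> * of_real x + \<i> * of_real (Bs \<omega> n)) * t (\<omega> !! n)))"
      unfolding binomial_ring by (simp add: exp_add)
    also have "\<dots> = exp (\<zeta> * of_real c) * (\<Sum>l\<le>j. of_nat (j choose l) * of_real c ^ (j - l) * trm l y \<zeta> \<omega> n)"
      unfolding sum_distrib_right by (simp add: trm_def x_def mult_ac)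
    finally show ?thesis .
  qed
  then have "V j (y + c) \<zeta> \<omega> = (\<Sum>n. exp (\<zeta> * of_real c) * (\<Sum>l\<le>j. of_nat (j choose l) * of_real c ^ (j - l) * trm l y \<zeta> \<omega> n))"
    by (simp add: V_def)
  also have "\<dots> = exp (\<zeta> * of_real c) * (\<Sum>n. \<Sum>l\<le>j. of_nat (j choose l) * of_real c ^ (j - l) * trm l y \<zeta> \<omega> n)"
    using assms by (intro suminf_mult summable_sum summable_mult summable_trm)
  also have "(\<Sum>n. \<Sum>l\<le>j. of_nat (j choose l) * of_real c ^ (j - l) * trm l y \<zeta> \<omega> n)
     = (\<Sum>l\<le>j. \<Sum>n. of_nat (j choose l) * of_real c ^ (j - l) * trm l y \<zeta> \<omega> n)"
    using assms by (intro suminf_sum summable_mult summable_trm)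
  also have "\<dots> = (\<Sum>l\<le>j. of_nat (j choose l) * of_real c ^ (j - l) * V l y \<zeta> \<omega>)"
    unfolding V_def using assms by (intro sum.cong suminf_mult summable_trm) auto
  finally show ?thesis .
qed

lemma V_change_diff:
  assumes \<zeta>: "Re \<zeta> > 0" and D: "\<And>l. l \<le> j \<Longrightarrow> cmod (V l y \<zeta> u - V l y \<zeta> v) \<le> D"
  shows "cmod (V j (y + c) \<zeta> u - V j (y + c) \<zeta> v) \<le> exp (Re \<zeta> * c) * (1 + \<bar>c\<bar>) ^ j * D"
proof -
  have "V j (y + c) \<zeta> u - V j (y + c) \<zeta> v = exp (\<zeta> * of_real c) * (\<Sum>l\<le>j. of_nat (j choose l) * of_real c ^ (j - l) * (V l y \<zeta> u - V l y \<zeta> v))"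
    unfolding V_change[OF \<zeta>] by (simp add: right_diff_distrib sum_subtractf)
  also have "cmod \<dots> \<le> exp (Re \<zeta> * c) * (\<Sum>l\<le>j. cmod (of_nat (j choose l) * of_real c ^ (j - l) * (V l y \<zeta> u - V l y \<zeta> v)))"
    by (auto simp: norm_mult intro!: mult_left_mono order_trans[OF norm_sum])
  also have "\<dots> \<le> exp (Re \<zeta> * c) * (\<Sum>l\<le>j. of_nat (j choose l) * \<bar>c\<bar> ^ (j - l) * D)"
    using D by (intro mult_left_mono sum_mono) (auto simp: norm_mult norm_power intro!: mult_left_mono)
  also have "(\<Sum>l\<le>j. of_nat (j choose l) * \<bar>c\<bar> ^ (j - l) * D) = (1 + \<bar>c\<bar>) ^ j * D"
    unfolding binomial_ring by (simp add: sum_distrib_right)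
  finally show ?thesis by (simp add: mult.assoc)
qed

lemma V_has_derivative:
  assumes "Re \<zeta> > 0"
  shows "((\<lambda>z. V j y z \<omega>) has_field_derivative V (Suc j) y \<zeta> \<omega>) (at \<zeta>)"
proof -
  \<comment> \<open>The strip stays away from Re = 0 and is bounded to the right, so
    \<open>trm_bound\<close> gives one geometric majorant on all of it.\<close>
  define S where "S = {z. Re \<zeta> / 2 < Re z \<and> Re z < Re \<zeta> + 1}"
  have S: "open S" "convex S" "\<zeta> \<in> S"
  proof -
    have eq: "S = {z. Re z > Re \<zeta> / 2} \<inter> {z. Re z < Re \<zeta> + 1}" by (auto simp: S_def)
    show "open S" unfolding eq by (intro open_Int open_halfspace_Re_gt open_halfspace_Re_lt)
    show "convex S" unfolding eq by (intro convex_Int convex_halfspace_Re_gt convex_halfspace_Re_lt)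
    show "\<zeta> \<in> S" using assms by (simp add: S_def)
  qed
  have "((\<lambda>z. \<Sum>n. trm j y z \<omega> n) has_field_derivative (\<Sum>n. trm (Suc j) y \<zeta> \<omega> n)) (at \<zeta>)"
  proof (rule has_field_derivative_series'(2)[of S])
    show "convex S" "\<zeta> \<in> S" "\<zeta> \<in> interior S" using S by (auto simp: interior_open)
    show "summable (\<lambda>n. trm j y \<zeta> \<omega> n)" using summable_trm[OF assms] by simp
    show "((\<lambda>z. trm j y z \<omega> n) has_field_derivative trm (Suc j) y z \<omega> n) (at z within S)" if "z \<in> S" for n z
      unfolding trm_def by (auto intro!: derivative_eq_intros simp: mult_ac)
    show "uniformly_convergent_on S (\<lambda>n z. \<Sum>i<n. trm (Suc j) y z \<omega> i)"
      by (rule Weierstrass_m_test'[OF trm_bound[of "Re \<zeta> / 2" _ "Re \<zeta> + 1"] summable_geo]) (use assms in \<open>auto simp: S_def\<close>)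
  qed
  then show ?thesis by (simp add: V_def[abs_def])
qed

lemma measurable_As [measurable]: "(\<lambda>\<omega>. As \<omega> n) \<in> borel_measurable \<mu>" "(\<lambda>\<omega>. Bs \<omega> n) \<in> borel_measurable \<mu>"
  unfolding As_def Bs_def by measurable

lemma measurable_t_snth [measurable]: "(\<lambda>\<omega>. t (\<omega> !! n)) \<in> borel_measurable \<mu>"
  by measurable

lemma measurable_V_pair [measurable]:
  "(\<lambda>x. V j y (fst x) (snd x)) \<in> borel_measurable (borel \<Otimes>\<^sub>M \<mu>)"
  unfolding V_def trm_def by measurable

lemma measurable_V [measurable (raw)]:
  assumes [measurable]: "f \<in> borel_measurable N" "g \<in> N \<rightarrow>\<^sub>M \<mu>"
  shows "(\<lambda>x. V j y (f x) (g x)) \<in> borel_measurable N"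
proof -
  have "(\<lambda>x. V j y (fst (f x, g x)) (snd (f x, g x))) \<in> borel_measurable N"
    by (rule measurable_compose[OF _ measurable_V_pair]) measurable
  then show ?thesis by simp
qed

subsection \<open>Stopped words\<close>

text \<open>Every letter lowers the level by at least \<open>c0\<close>, so this amount of fuel
  never runs out before the level reaches 0.\<close>

definition stopw :: "real \<Rightarrow> 'n stream \<Rightarrow> 'n list" where
  "stopw y = stopn a (nat \<lceil>y / c0\<rceil>) y"

lemma stopn_Aw:
  assumes "y \<le> c0 * n" shows "y + Aw (stopn a n y \<omega>) \<le> 0"
  using assms
proof (induction n arbitrary: y \<omega>)
  case (Suc n)
  then show ?case using Suc.IH[of "y + a (shd \<omega>)" "stl \<omega>"] a_le[of "shd \<omega>"]
    by (auto simp: algebra_simps)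
qed simp

lemma stopn_Aw_ge:
  assumes "y \<ge> - c1" shows "y + Aw (stopn a n y \<omega>) \<ge> - c1"
  using assms
proof (induction n arbitrary: y \<omega>)
  case (Suc n)
  then show ?case using Suc.IH[of "y + a (shd \<omega>)" "stl \<omega>"] a_ge[of "shd \<omega>"]
    by (auto simp: algebra_simps)
qed simp

lemma stopn_shift: "stopn a n y (stopn a n y \<omega> @- \<omega>') = stopn a n y \<omega>"
  by (induction n arbitrary: y \<omega>) auto

lemma stopn_prefix: "\<exists>\<omega>'. \<omega> = stopn a n y \<omega> @- \<omega>'"
proof (induction n arbitrary: y \<omega>)
  case (Suc n)
  then show ?case
  proof (cases "y \<le> 0")
    case False
    obtain \<omega>' where "stl \<omega> = stopn a n (y + a (shd \<omega>)) (stl \<omega>) @- \<omega>'" using Suc by blast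
    then have "\<omega> = stopn a (Suc n) y \<omega> @- \<omega>'" using False by (simp add: stream_eq_Stream_iff)
    then show ?thesis by blast
  qed auto
qed auto

lemma finite_range_stopn: "finite (range (stopn a n y))"
proof (induction n arbitrary: y)
  case 0 then show ?case by (simp add: image_constant_conv cong: image_cong)
next
  case (Suc n)
  have "range (stopn a (Suc n) y) \<subseteq> insert [] (\<Union>i. (#) i ` range (stopn a n (y + a i)))"
    by auto
  moreover have "finite (insert [] (\<Union>i. (#) i ` range (stopn a n (y + a i))))"
    using Suc by auto
  ultimately show ?case by (rule finite_subset)
qed

lemma measurable_stopn [measurable]: "stopn a n y \<in> \<mu> \<rightarrow>\<^sub>M count_space UNIV"
proof (induction n arbitrary: y)
  case (Suc n)
  note Suc[measurable]
  have "(\<lambda>\<omega>. if y \<le> 0 then [] else shd \<omega> # stopn a n (y + a (shd \<omega>)) (stl \<omega>)) \<in> \<mu> \<rightarrow>\<^sub>M count_space UNIV"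
    by measurable
  then show ?case by (simp cong: measurable_cong)
qed (simp cong: measurable_cong)

lemma fin_rvI:
  assumes "f \<in> \<mu> \<rightarrow>\<^sub>M count_space UNIV" "finite (range f)" shows "fin_rv \<mu> f"
  using assms measurable_sets[OF assms(1), of "{c}" for c] by (auto simp: fin_rv_def vimage_def)

lemma measurable_fin_rv: "fin_rv \<mu> f \<Longrightarrow> f \<in> \<mu> \<rightarrow>\<^sub>M count_space UNIV"
proof -
  assume f: "fin_rv \<mu> f"
  show ?thesis
  proof (rule measurableI)
    fix A
    have "f -` A \<inter> space \<mu> = (\<Union>c\<in>A \<inter> range f. {x. f x = c})" by auto
    then show "f -` A \<inter> space \<mu> \<in> sets \<mu>"
      using f by (auto simp: fin_rv_def intro!: sets.finite_UN)
  qed auto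
qed

lemma measurable_shift_word [measurable]: "(\<lambda>\<omega>. w @- \<omega>) \<in> \<mu> \<rightarrow>\<^sub>M \<mu>"
  by (induction w) auto

lemma fin_rv_shift:
  assumes f: "fin_rv \<mu> f" shows "fin_rv \<mu> (\<lambda>\<omega>. f (w @- \<omega>))"
proof (rule fin_rvI)
  note measurable_fin_rv[OF f, measurable]
  show "(\<lambda>\<omega>. f (w @- \<omega>)) \<in> \<mu> \<rightarrow>\<^sub>M count_space UNIV" by measurable
  show "finite (range (\<lambda>\<omega>. f (w @- \<omega>)))"
    by (rule finite_subset[OF _ fin_rv_finite[OF f]]) auto
qed

lemma fin_rv_stopw: "fin_rv \<mu> (stopw y)"
  unfolding stopw_def using finite_range_stopn by (intro fin_rvI) auto

lemma emeasure_Stream: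
  assumes [measurable]: "Measurable.pred \<mu> Q"
  shows "emeasure \<mu> {\<omega>. Q \<omega>} = (\<Sum>i\<in>UNIV. ennreal (pmf p i) * emeasure \<mu> {\<omega>. Q (i ## \<omega>)})"
proof -
  have "{\<omega>. Q \<omega>} \<in> sets \<mu>" using assms by (simp add: pred_def)
  then have "emeasure \<mu> {\<omega>. Q \<omega>} = (\<integral>\<^sup>+i. emeasure \<mu> {\<omega>. Q (i ## \<omega>)} \<partial>p)"
    using prob_space.emeasure_stream_space[OF prob_space_measure_pmf, of "{\<omega>. Q \<omega>}" p] by simp
  also have "\<dots> = (\<Sum>i\<in>UNIV. ennreal (pmf p i) * emeasure \<mu> {\<omega>. Q (i ## \<omega>)})"
    by (subst nn_integral_measure_pmf) (simp add: nn_integral_count_space_finite)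
  finally show ?thesis .
qed

text \<open>The strong Markov property: given the stopped word, the remaining letters have law
  \<open>\<mu>\<close> again. The induction splits off the first letter.\<close>

lemma emeasure_stopn:
  assumes "w \<in> range (stopn a n y)" "Measurable.pred \<mu> Q"
  shows "emeasure \<mu> {\<omega>. stopn a n y \<omega> = w \<and> Q \<omega>} = emeasure \<mu> {\<omega>. stopn a n y \<omega> = w} * emeasure \<mu> {\<omega>. Q (w @- \<omega>)}"
  using assms
proof (induction n arbitrary: y w Q)
  case 0
  then show ?case using emeasure_space_1 by auto
next
  case (Suc n)
  note [measurable] = Suc.prems(2)
  show ?case
  proof (cases "y \<le> 0")
    case True then show ?thesis using Suc.prems emeasure_space_1 by auto
  next
    case False
    obtain i w' where w: "w = i # w'" "w' \<in> range (stopn a n (y + a i))"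
      using Suc.prems False by auto
    have [measurable]: "Measurable.pred \<mu> (\<lambda>\<omega>. Q (i ## \<omega>))" by measurable
    have eq: "{\<omega>. (stopn a (Suc n) y (k ## \<omega>) = w \<and> R (k ## \<omega>))} = (if k = i then {\<omega>. stopn a n (y + a i) \<omega> = w' \<and> R (i ## \<omega>)} else {})" for R k
      using False w by auto
    have *: "emeasure \<mu> {\<omega>. stopn a (Suc n) y \<omega> = w \<and> R \<omega>} = ennreal (pmf p i) * emeasure \<mu> {\<omega>. stopn a n (y + a i) \<omega> = w' \<and> R (i ## \<omega>)}"
      if [measurable]: "Measurable.pred \<mu> R" for R
    proof -
      have "emeasure \<mu> {\<omega>. stopn a (Suc n) y \<omega> = w \<and> R \<omega>}
         = (\<Sum>k\<in>UNIV. ennreal (pmf p k) * emeasure \<mu> {\<omega>. (stopn a (Suc n) y (k ## \<omega>) = w \<and> R (k ## \<omega>))})"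
        by (rule emeasure_Stream) measurable
      also have "\<dots> = (\<Sum>k\<in>UNIV. if k = i then ennreal (pmf p i) * emeasure \<mu> {\<omega>. stopn a n (y + a i) \<omega> = w' \<and> R (i ## \<omega>)} else 0)"
        unfolding eq by (intro sum.cong) auto
      also have "\<dots> = ennreal (pmf p i) * emeasure \<mu> {\<omega>. stopn a n (y + a i) \<omega> = w' \<and> R (i ## \<omega>)}"
        by simp
      finally show ?thesis .
    qed
    have IH: "emeasure \<mu> {\<omega>. stopn a n (y + a i) \<omega> = w' \<and> Q (i ## \<omega>)}
      = emeasure \<mu> {\<omega>. stopn a n (y + a i) \<omega> = w'} * emeasure \<mu> {\<omega>. Q (i ## (w' @- \<omega>))}"
      by (rule Suc.IH[OF w(2)]) measurable
    show ?thesis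
      using *[of Q] *[of "\<lambda>_. True"] IH Suc.prems(2) by (simp add: w(1) mult.assoc del: stopn.simps)
  qed
qed

lemma pr_stopw:
  assumes "w \<in> range (stopw y)" "fin_rv \<mu> g"
  shows "pr \<mu> (\<lambda>\<omega>. (stopw y \<omega>, g \<omega>)) (w, d) = pr \<mu> (stopw y) w * pr \<mu> (\<lambda>\<omega>. g (w @- \<omega>)) d"
proof -
  note measurable_fin_rv[OF assms(2), measurable]
  have "emeasure \<mu> {\<omega>. stopw y \<omega> = w \<and> g \<omega> = d} = emeasure \<mu> {\<omega>. stopw y \<omega> = w} * emeasure \<mu> {\<omega>. g (w @- \<omega>) = d}"
    unfolding stopw_def by (rule emeasure_stopn) (use assms(1) in \<open>auto simp: stopw_def\<close>)
  then show ?thesis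
    by (simp add: pr_def emeasure_eq_measure ennreal_mult'[symmetric])
qed

lemma stopw_Aw: "y + Aw (stopw y \<omega>) \<le> 0"
proof -
  have "y / c0 \<le> real (nat \<lceil>y / c0\<rceil>)" by linarith
  then have "y \<le> c0 * real (nat \<lceil>y / c0\<rceil>)" using c0_pos by (simp add: field_simps)
  then show ?thesis unfolding stopw_def by (rule stopn_Aw)
qed

lemma stopw_Aw_ge: "y \<ge> 0 \<Longrightarrow> y + Aw (stopw y \<omega>) \<ge> - c1"
  unfolding stopw_def using c1_pos by (intro stopn_Aw_ge) auto

lemma stopw_shift: "stopw y (stopw y \<omega> @- \<omega>') = stopw y \<omega>"
  unfolding stopw_def by (rule stopn_shift)

lemma stopw_shift': "w \<in> range (stopw y) \<Longrightarrow> stopw y (w @- \<omega>) = w"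
  using stopw_shift by auto

lemma stopw_prefix: "\<exists>\<omega>'. \<omega> = stopw y \<omega> @- \<omega>'"
  unfolding stopw_def by (rule stopn_prefix)

lemma ent_stopw_ge:
  assumes g: "fin_rv \<mu> g" and B: "\<And>w. w \<in> range (stopw y) \<Longrightarrow> B \<le> ent \<mu> (\<lambda>x. g (w @- x))"
  shows "ent \<mu> (\<lambda>x. \<phi> (stopw y x)) + B \<le> ent \<mu> (\<lambda>x. (\<phi> (stopw y x), g x))"
proof (rule ent_prefix_ge[OF fin_rv_stopw g fin_rv_shift[OF g] pr_stopw[OF _ g]])
  show "\<exists>x'. stopw y x' = w \<and> g x' = g (w @- x)" if "w \<in> range (stopw y)" for w x
    using stopw_shift'[OF that] by blast
  show "\<exists>x'. g x = g (stopw y x @- x')" for x using stopw_prefix[of x y] by metis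
qed (use B in auto)

lemma powsum_stopw_le:
  assumes g: "fin_rv \<mu> g" and "q \<ge> 1" and B: "\<And>w. w \<in> range (stopw y) \<Longrightarrow> powsum q \<mu> (\<lambda>x. g (w @- x)) \<le> B"
  shows "powsum q \<mu> (\<lambda>x. (\<phi> (stopw y x), g x)) \<le> powsum q \<mu> (\<lambda>x. \<phi> (stopw y x)) * B"
  by (rule powsum_prefix_le[OF fin_rv_stopw g fin_rv_shift[OF g] \<open>q \<ge> 1\<close> pr_stopw[OF _ g]]) (use B in auto)

section \<open>Entropy of stopped words\<close>

definition p_entropy :: real where "p_entropy = - (\<Sum>i\<in>UNIV. pmf p i * ln (pmf p i))"
text \<open>The Lyapunov exponent at the parameter \<open>\<zeta>\<close> is
  \<open>Re \<zeta> * lyap\<close>, so \<open>p_entropy / lyap\<close> is \<open>Re \<zeta>\<close>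
  times the similarity dimension.\<close>

definition lyap :: real where "lyap = - (\<Sum>i\<in>UNIV. pmf p i * a i)"

lemma lyap_pos: "lyap > 0"
proof -
  have "(\<Sum>i\<in>UNIV. pmf p i * - a i) > 0"
    by (rule sum_pos) (use a_neg p_pos in \<open>auto simp: mult_pos_neg\<close>)
  then show ?thesis by (simp add: lyap_def sum_negf)
qed

text \<open>Splitting off the first letter gains \<open>p_entropy\<close> and lowers the level by
  \<open>lyap\<close> on average. The linear function of \<open>y\<close> on the right satisfies the
  same recursion with equality, and it is nonpositive once the word has stopped.\<close>

lemma ent_stopn_ge: "y \<le> c0 * n \<Longrightarrow> ent \<mu> (stopn a n y) \<ge> p_entropy / lyap * y"
proof (induction n arbitrary: y)
  case 0
  have "p_entropy \<ge> 0" unfolding p_entropy_def using p_pos pmf_le_1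
    by (auto intro!: sum_nonpos mult_nonneg_nonpos)
  then have "p_entropy / lyap * y \<le> 0" using 0 lyap_pos by (intro mult_nonneg_nonpos) auto
  then show ?case using ent_nonneg[of "stopn a 0 y"] by linarith
next
  case (Suc n)
  have p_entropy: "p_entropy \<ge> 0" unfolding p_entropy_def using p_pos pmf_le_1
    by (auto intro!: sum_nonpos mult_nonneg_nonpos)
  show ?case
  proof (cases "y \<le> 0")
    case True
    then have "p_entropy / lyap * y \<le> 0" using p_entropy lyap_pos by (intro mult_nonneg_nonpos) auto
    then show ?thesis using ent_nonneg[of "stopn a (Suc n) y"] by linarith
  next
    case False
    let ?g = "stopn a (Suc n) y"
    have g: "fin_rv \<mu> ?g" by (rule fin_rvI[OF measurable_stopn finite_range_stopn])
    have shd: "fin_rv \<mu> shd" by (rule fin_rvI) (auto intro: finite_subset[OF subset_UNIV])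
    have rshd: "range (shd :: 'n stream \<Rightarrow> 'n) = UNIV"
      by (rule surjI[of _ "\<lambda>i. i ## undefined"]) simp
    have prshd: "pr \<mu> shd i = pmf p i" for i
    proof -
      have "emeasure \<mu> {\<omega>. shd \<omega> = i} = (\<Sum>k\<in>UNIV. ennreal (pmf p k) * emeasure \<mu> {\<omega>. shd (k ## \<omega>) = i})"
        by (rule emeasure_Stream) measurable
      also have "\<dots> = (\<Sum>k\<in>UNIV. if k = i then ennreal (pmf p i) else 0)"
        using emeasure_space_1 by (intro sum.cong) auto
      finally show ?thesis by (simp add: pr_def emeasure_eq_measure)
    qed
    have fs: "fin_rv \<mu> (\<lambda>x. ?g (i ## x))" for i using fin_rv_shift[OF g, of "[i]"] by simp
    have "ent \<mu> (\<lambda>x. (shd x, ?g x)) = ent \<mu> shd + (\<Sum>i\<in>range shd. pr \<mu> shd i * ent \<mu> (\<lambda>x. ?g (i ## x)))"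
    proof (rule ent_chain[OF shd g fs])
      fix i d
      note measurable_fin_rv[OF g, measurable]
      have "emeasure \<mu> {\<omega>. (shd \<omega>, ?g \<omega>) = (i, d)} = (\<Sum>k\<in>UNIV. ennreal (pmf p k) * emeasure \<mu> {\<omega>. (shd (k ## \<omega>), ?g (k ## \<omega>)) = (i, d)})"
      proof (rule emeasure_Stream)
        show "Measurable.pred \<mu> (\<lambda>\<omega>. (shd \<omega>, ?g \<omega>) = (i, d))"
          unfolding prod.inject by measurable
      qed
      also have "\<dots> = (\<Sum>k\<in>UNIV. if k = i then ennreal (pmf p i) * emeasure \<mu> {\<omega>. ?g (i ## \<omega>) = d} else 0)"
        by (intro sum.cong) (auto simp del: stopn.simps)
      finally show "pr \<mu> (\<lambda>x. (shd x, ?g x)) (i, d) = pr \<mu> shd i * pr \<mu> (\<lambda>x. ?g (i ## x)) d"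
        by (simp add: prshd emeasure_eq_measure ennreal_mult'[symmetric] del: stopn.simps) (simp add: pr_def emeasure_eq_measure ennreal_mult'[symmetric] del: stopn.simps)
    next
      show "\<exists>x'. shd x' = i \<and> ?g x' = ?g (i ## x)" for i x by (rule exI[of _ "i ## x"]) simp
      show "\<exists>x'. ?g x = ?g (shd x ## x')" for x by (rule exI[of _ "stl x"]) simp
    qed
    moreover have "ent \<mu> shd = p_entropy" by (simp add: ent_def p_entropy_def prshd rshd)
    moreover have "ent \<mu> (\<lambda>x. ?g (i ## x)) \<ge> p_entropy / lyap * (y + a i)" for i
    proof -
      have "ent \<mu> (stopn a n (y + a i)) = ent \<mu> (\<lambda>x. tl (?g (i ## x)))" using False by simp
      also have "\<dots> \<le> ent \<mu> (\<lambda>x. ?g (i ## x))" by (rule ent_comp_le[OF fs])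
      finally show ?thesis using Suc.IH[of "y + a i"] Suc.prems a_le[of i] by (simp add: algebra_simps)
    qed
    then have "(\<Sum>i\<in>range shd. pr \<mu> shd i * ent \<mu> (\<lambda>x. ?g (i ## x))) \<ge> (\<Sum>i\<in>UNIV. pmf p i * (p_entropy / lyap * (y + a i)))"
      unfolding rshd prshd by (intro sum_mono mult_left_mono) auto
    moreover have "(\<Sum>i\<in>UNIV. pmf p i * (p_entropy / lyap * (y + a i))) = p_entropy / lyap * y - p_entropy"
    proof -
      have "(\<Sum>i\<in>UNIV. pmf p i * (p_entropy / lyap * (y + a i))) = p_entropy / lyap * (y * (\<Sum>i\<in>UNIV. pmf p i) + (\<Sum>i\<in>UNIV. pmf p i * a i))"
        by (simp add: sum_distrib_left sum.distrib algebra_simps add_divide_distrib)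
      also have "(\<Sum>i\<in>UNIV. pmf p i) = 1" by (simp add: sum_pmf_eq_1)
      finally show ?thesis using lyap_pos by (simp add: lyap_def field_simps)
    qed
    moreover have "ent \<mu> (\<lambda>x. (shd x, ?g x)) = ent \<mu> (\<lambda>x. (hd (?g x), ?g x))" using False by simp
    moreover have "ent \<mu> (\<lambda>x. (hd (?g x), ?g x)) \<le> ent \<mu> ?g"
      using ent_comp_le[OF g, of "\<lambda>w. (hd w, w)"] .
    ultimately show ?thesis by linarith
  qed
qed

lemma ent_stopw: "ent \<mu> (stopw y) \<ge> p_entropy / lyap * y"
proof -
  have "y / c0 \<le> real (nat \<lceil>y / c0\<rceil>)" by linarith
  then have "y \<le> c0 * real (nat \<lceil>y / c0\<rceil>)" using c0_pos by (simp add: field_simps)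
  then show ?thesis unfolding stopw_def by (rule ent_stopn_ge)
qed

end

section \<open>Entropy of jets at finite scales\<close>

definition fl :: "complex \<Rightarrow> int \<times> int" where "fl z = (\<lfloor>Re z\<rfloor>, \<lfloor>Im z\<rfloor>)"

definition fcell :: "nat \<Rightarrow> (nat \<Rightarrow> 'a \<Rightarrow> complex) \<Rightarrow> 'a \<Rightarrow> (int \<times> int) list" where
  "fcell m X \<omega> = map (\<lambda>j. fl (X j \<omega>)) [0..<Suc m]"

text \<open>Bounds the number of unit cells met by a set of jets whose coordinates have diameter at
  most \<open>C\<close>: there are \<open>2 * Suc m\<close> real coordinates, each meeting at most
  \<open>2 * C + 3\<close> unit intervals.\<close>

definition Kc :: "nat \<Rightarrow> real \<Rightarrow> real" where "Kc m C = (2 * C + 3) ^ (2 * Suc m)"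

lemma fl_eq_imp: assumes "fl z = fl w" shows "cmod (z - w) \<le> 2"
proof -
  have "\<bar>Re (z - w)\<bar> < 1" "\<bar>Im (z - w)\<bar> < 1" using assms by (auto simp: fl_def) linarith+
  then show ?thesis using cmod_le[of "z - w"] by linarith
qed

lemma fcell_eq_iff: "fcell m X \<omega> = fcell m X' \<omega>' \<longleftrightarrow> (\<forall>j\<le>m. fl (X j \<omega>) = fl (X' j \<omega>'))"
  by (auto simp: fcell_def less_Suc_eq_le simp del: upt_Suc)

lemma fcell_eq_imp: "fcell m X \<omega> = fcell m X' \<omega>' \<Longrightarrow> j \<le> m \<Longrightarrow> cmod (X j \<omega> - X' j \<omega>') \<le> 2"
  using fl_eq_imp by (auto simp: fcell_eq_iff)

lemma Kc_pos: "C \<ge> 0 \<Longrightarrow> Kc m C > 0" unfolding Kc_def by (intro zero_less_power) auto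

lemma fcell_card:
  assumes C: "C \<ge> 0" and D: "\<And>\<omega> \<omega>' j. \<omega> \<in> S \<Longrightarrow> \<omega>' \<in> S \<Longrightarrow> j \<le> m \<Longrightarrow> cmod (X j \<omega> - X j \<omega>') \<le> C"
  shows "finite (fcell m X ` S)" "real (card (fcell m X ` S)) \<le> Kc m C"
proof -
  have "finite (fcell m X ` S) \<and> real (card (fcell m X ` S)) \<le> Kc m C"
  proof (cases "S = {}")
    case True then show ?thesis using Kc_pos[OF C, of m] by simp
  next
    case False
    then obtain \<omega>0 where w0: "\<omega>0 \<in> S" by auto
    define k where "k = \<lfloor>C + 1\<rfloor>"
    have k: "k \<ge> 0" "real_of_int k \<le> C + 1" using C by (auto simp: k_def)
    define B where "B j = {fst (fl (X j \<omega>0)) - k .. fst (fl (X j \<omega>0)) + k} \<times> {snd (fl (X j \<omega>0)) - k .. snd (fl (X j \<omega>0)) + k}" for j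
    define L where "L = {xs. length xs = Suc m \<and> (\<forall>j\<le>m. xs ! j \<in> B j)}"
    have cB: "finite (B j)" "card (B j) = nat (2 * k + 1) ^ 2" for j
      using k by (auto simp: B_def card_cartesian_product power2_eq_square)
    have sub: "fcell m X ` S \<subseteq> L"
    proof -
      have "fl (X j \<omega>) \<in> B j" if "\<omega> \<in> S" "j \<le> m" for \<omega> j
      proof -
        have c: "cmod (X j \<omega> - X j \<omega>0) \<le> C" using D that w0 by blast
        have "\<bar>Re (X j \<omega>) - Re (X j \<omega>0)\<bar> \<le> C" "\<bar>Im (X j \<omega>) - Im (X j \<omega>0)\<bar> \<le> C"
          using c abs_Re_le_cmod[of "X j \<omega> - X j \<omega>0"] abs_Im_le_cmod[of "X j \<omega> - X j \<omega>0"] by auto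
        then show ?thesis unfolding B_def fl_def k_def
          by (auto simp: mem_Times_iff) linarith+
      qed
      then show ?thesis by (auto simp: L_def fcell_def less_Suc_eq_le simp del: upt_Suc)
    qed
    have L: "finite L \<and> card L = (nat (2 * k + 1) ^ 2) ^ Suc m"
    proof -
      define f where "f xs = (\<lambda>j\<in>{..m}. xs ! j)" for xs :: "(int \<times> int) list"
      have bij: "bij_betw f L (PiE {..m} B)"
        by (rule bij_betwI[where g="\<lambda>g. map g [0..<Suc m]"])
           (auto simp: f_def L_def less_Suc_eq_le PiE_def extensional_def restrict_def
             intro!: nth_equalityI simp del: upt_Suc)
      then have "card L = (\<Prod>j\<le>m. card (B j))" using bij_betw_same_card card_PiE by fastforce
      moreover have "finite L" using bij cB(1) bij_betw_finite finite_PiE by blast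
      ultimately show ?thesis by (simp add: cB)
    qed
    have "real (card (fcell m X ` S)) \<le> real (card L)" using sub L card_mono by (metis of_nat_mono)
    also have "\<dots> = real (nat (2 * k + 1)) ^ (2 * Suc m)" using L by (simp only: power_mult of_nat_power)
    also have "\<dots> \<le> Kc m C" unfolding Kc_def
      by (intro power_mono) (use k in \<open>auto simp: algebra_simps\<close>)
    finally show ?thesis using finite_subset[OF sub] L by blast
  qed
  then show "finite (fcell m X ` S)" "real (card (fcell m X ` S)) \<le> Kc m C" by auto
qed

lemma fcell_fibre:
  assumes C: "C \<ge> 0" and D: "\<And>\<omega> \<omega>' j. g \<omega> = g \<omega>' \<Longrightarrow> j \<le> m \<Longrightarrow> cmod (X j \<omega> - X j \<omega>') \<le> C"
  shows "real (card {fcell m X \<omega> |\<omega>. g \<omega> = d}) \<le> Kc m C"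
proof -
  have "{fcell m X \<omega> |\<omega>. g \<omega> = d} = fcell m X ` {\<omega>. g \<omega> = d}" by auto
  then show ?thesis using fcell_card(2)[OF C, of "{\<omega>. g \<omega> = d}" m X] D by auto
qed

text \<open>Fekete's lemma for f - C, which is superadditive. The second conclusion, with an error
  that stays bounded in n, allows entropy at a single level to be compared with the limit.\<close>

lemma fekete_superadditive:
  fixes f :: "nat \<Rightarrow> real" and L :: real
  assumes sup: "\<And>n k. f (n + k) \<ge> f n + f k - C" and nn: "\<And>n. f n \<ge> 0" and ub: "\<And>n. f n \<le> L * n + L"
    and C: "C \<ge> 0"
  shows "\<exists>\<beta>. (\<lambda>n. f n / n) \<longlonglongrightarrow> \<beta> \<and> (\<forall>n. f n \<le> \<beta> * n + C)"
proof -
  define g where "g n = f n - C" for n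
  have g: "g (n + k) \<ge> g n + g k" for n k using sup[of n k] by (simp add: g_def)
  have gm: "g (q * n) \<ge> q * g n" if "q \<ge> 1" for q n
    using that
  proof (induction q rule: dec_induct)
    case (step q) then show ?case using g[of n "q * n"] by (simp add: algebra_simps)
  qed simp
  have L: "L \<ge> 0" using ub[of 0] nn[of 0] by simp
  have bdd: "bdd_above ((\<lambda>n. g n / n) ` {1..})"
  proof (rule bdd_aboveI2)
    fix n :: nat assume n: "n \<in> {1..}"
    have "g n \<le> 2 * L * n"
    proof -
      have "L * 1 \<le> L * n" using n L by (intro mult_left_mono) auto
      then show ?thesis using ub[of n] C by (simp add: g_def)
    qed
    then show "g n / n \<le> 2 * L" using n by (simp add: field_simps)
  qed
  define \<beta> where "\<beta> = Sup ((\<lambda>n. g n / n) ` {1..})"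
  have up: "g n / n \<le> \<beta>" if "n \<ge> 1" for n
    unfolding \<beta>_def by (rule cSUP_upper[OF _ bdd]) (use that in auto)
  have up': "f n \<le> \<beta> * n + C" for n
  proof (cases "n = 0")
    case True then show ?thesis using sup[of 0 0] by simp
  next
    case False then show ?thesis using up[of n] by (simp add: g_def field_simps)
  qed
  have "(\<lambda>n. f n / n) \<longlonglongrightarrow> \<beta>"
  proof (rule LIMSEQ_I)
    fix e :: real assume e: "e > 0"
    have "\<exists>x\<in>(\<lambda>n. g n / n) ` {1..}. \<beta> - e / 3 < x"
      unfolding \<beta>_def using bdd e by (subst less_cSup_iff[symmetric]) auto
    then obtain n1 where n1: "n1 \<ge> 1" "\<beta> - e / 3 < g n1 / n1" by auto
    define \<beta>' where "\<beta>' = \<bar>\<beta> - e / 3\<bar>"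
    obtain N where N: "real N > 3 * (C + \<beta>' * n1 + C) / e" "N \<ge> n1" "N \<ge> 1"
    proof -
      obtain N0 :: nat where "real N0 > 3 * (C + \<beta>' * n1 + C) / e" using reals_Archimedean2 by blast
      then show thesis by (intro that[of "N0 + n1"]) (use n1 in auto)
    qed
    show "\<exists>N. \<forall>n\<ge>N. norm (f n / n - \<beta>) < e"
    proof (intro exI allI impI)
      fix n assume n: "n \<ge> N"
      have npos: "real n > 0" using n N by auto
      define q r where "q = n div n1" and "r = n mod n1"
      have qr: "n = q * n1 + r" "r < n1" "q \<ge> 1"
        using n1 n N by (auto simp: q_def r_def div_mult_mod_eq Suc_le_eq div_greater_zero_iff)
      have "f n \<ge> q * g n1 + g r + C"
        using g[of "q * n1" r] gm[OF qr(3), of n1] qr by (simp add: g_def)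
      moreover have "g r \<ge> - C" using nn[of r] by (simp add: g_def)
      moreover have "q * g n1 \<ge> (\<beta> - e / 3) * (q * n1)"
      proof -
        have "g n1 \<ge> (\<beta> - e / 3) * n1" using n1 by (simp add: field_simps)
        then have "q * g n1 \<ge> q * ((\<beta> - e / 3) * n1)" by (intro mult_left_mono) auto
        then show ?thesis by (simp add: mult_ac)
      qed
      moreover have "(\<beta> - e / 3) * (q * n1) \<ge> (\<beta> - e / 3) * n - \<beta>' * n1"
      proof -
        have "(\<beta> - e / 3) * n = (\<beta> - e / 3) * (q * n1) + (\<beta> - e / 3) * r" using qr by (simp add: algebra_simps)
        moreover have "(\<beta> - e / 3) * r \<le> \<beta>' * n1" using qr unfolding \<beta>'_def by (intro mult_mono) auto
        ultimately show ?thesis by linarith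
      qed
      ultimately have lo: "f n \<ge> (\<beta> - e / 3) * n - \<beta>' * n1" by linarith
      have "3 * (C + \<beta>' * n1 + C) / e < n" using N n by (meson less_le_trans of_nat_le_iff)
      then have k: "C + \<beta>' * n1 + C < e / 3 * n" using e by (simp add: field_simps)
      have b0: "\<beta>' * n1 \<ge> 0" by (simp add: \<beta>'_def)
      have "f n < (\<beta> + e) * n" 
      proof -
        have "C < e * n" 
        proof -
          have "C < e / 3 * n" using k b0 C by linarith
          moreover have "e / 3 * n \<le> e * n" using e by (intro mult_right_mono) auto
          ultimately show ?thesis by linarith
        qed
        then show ?thesis using up'[of n] by (simp add: algebra_simps)
      qed
      moreover have "f n > (\<beta> - e) * n"
      proof -
        have "\<beta>' * n1 < e / 3 * n" using k C by linarith
        moreover have "e / 3 * n > 0" using e npos by simp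
        ultimately have "\<beta>' * n1 < (2 * e / 3) * n" by (simp add: field_simps)
        then show ?thesis using lo by (simp add: algebra_simps)
      qed
      ultimately show "norm (f n / n - \<beta>) < e"
        using npos by (simp add: abs_less_iff field_simps)
    qed
  qed
  then show ?thesis using up' by blast
qed

text \<open>Koenig's lemma: a prefix shared by infinitely many members has a one-letter extension
  with the same property.\<close>

lemma stream_compactness:
  fixes x :: "nat \<Rightarrow> 'm::finite stream"
  shows "\<exists>s. \<forall>n. infinite {k. stake n (x k) = stake n s}"
proof -
  have "\<exists>f. \<forall>n. (length (f n) = n \<and> infinite {k. stake n (x k) = f n}) \<and> (\<exists>i. f (Suc n) = f n @ [i])"
  proof (rule dependent_nat_choice)
    show "\<exists>w. length w = 0 \<and> infinite {k. stake 0 (x k) = w}" by (intro exI[of _ "[]"]) simp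
  next
    fix w n assume w: "length w = n \<and> infinite {k. stake n (x k) = w}"
    have "{k. stake n (x k) = w} = (\<Union>i. {k. stake (Suc n) (x k) = w @ [i]})"
      using w by (auto simp: stake_Suc simp del: stake.simps(2))
    moreover have "finite (\<Union>i. {k. stake (Suc n) (x k) = w @ [i]})"
      if "\<forall>i. finite {k. stake (Suc n) (x k) = w @ [i]}" using that by (intro finite_UN_I) auto
    ultimately obtain i where "infinite {k. stake (Suc n) (x k) = w @ [i]}" using w by auto
    then show "\<exists>w'. (length w' = Suc n \<and> infinite {k. stake (Suc n) (x k) = w'}) \<and> (\<exists>i. w' = w @ [i])"
      using w by (intro exI[of _ "w @ [i]"]) auto
  qed
  then obtain f where f: "\<And>n. length (f n) = n" "\<And>n. infinite {k. stake n (x k) = f n}" "\<And>n. \<exists>i. f (Suc n) = f n @ [i]"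
    by blast
  define s where "s = to_stream (\<lambda>n. f (Suc n) ! n)"
  have "stake n s = f n" for n
  proof (induction n)
    case (Suc n)
    obtain i where "f (Suc n) = f n @ [i]" using f(3) by blast
    moreover have "s !! n = f (Suc n) ! n" by (simp add: s_def to_stream_def)
    ultimately show ?case using Suc f(1)[of n] by (simp add: stake_Suc nth_append del: stake.simps(2))
  qed (use f(1)[of 0] in auto)
  then show ?thesis using f(2) by (intro exI[of _ s]) auto
qed

context ifs
begin

section \<open>Jet entropies and their superadditivity\<close>

abbreviation cell :: "nat \<Rightarrow> real \<Rightarrow> complex \<Rightarrow> 'n stream \<Rightarrow> (int \<times> int) list" where
  "cell m y \<zeta> \<equiv> fcell m (\<lambda>j. V j y \<zeta>)"

text \<open>Up to polynomial distortion, the entropy of the jet of order \<open>m\<close> at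
  resolution exp(- y Re \<zeta>): the rescaling in \<open>V\<close> turns that resolution into unit
  cells.\<close>

definition h :: "nat \<Rightarrow> real \<Rightarrow> complex \<Rightarrow> real" where
  "h m y \<zeta> = ent \<mu> (cell m y \<zeta>)"

definition CB :: "nat \<Rightarrow> real \<Rightarrow> real" where "CB m s = (\<Sum>j\<le>m. 2 * Cb j s)"

lemma CB_nonneg: "s > 0 \<Longrightarrow> CB m s \<ge> 0" unfolding CB_def by (intro sum_nonneg) (simp add: Cb_nonneg)

lemma V_diff_CB:
  assumes "Re \<zeta> > 0" "y \<le> 0" "j \<le> m" shows "cmod (V j y \<zeta> u - V j y \<zeta> v) \<le> CB m (Re \<zeta>)"
proof -
  have "cmod (V j y \<zeta> u - V j y \<zeta> v) \<le> 2 * Cb j (Re \<zeta>)"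
    using norm_triangle_ineq4[of "V j y \<zeta> u" "V j y \<zeta> v"] V_bound[of "Re \<zeta>" \<zeta> y j u] V_bound[of "Re \<zeta>" \<zeta> y j v] assms
    by simp
  also have "\<dots> \<le> CB m (Re \<zeta>)" unfolding CB_def
    using assms Cb_nonneg[of "Re \<zeta>"] by (intro member_le_sum[of j "{..m}" "\<lambda>j. 2 * Cb j (Re \<zeta>)"]) auto
  finally show ?thesis .
qed

lemma V_diff_pos:
  assumes "Re \<zeta> > 0" "y \<ge> 0" "j \<le> m"
  shows "cmod (V j y \<zeta> u - V j y \<zeta> v) \<le> exp (Re \<zeta> * y) * (1 + y) ^ m * CB m (Re \<zeta>)"
proof -
  have "cmod (V j (0 + y) \<zeta> u - V j (0 + y) \<zeta> v) \<le> exp (Re \<zeta> * y) * (1 + \<bar>y\<bar>) ^ j * CB m (Re \<zeta>)"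
    using assms by (intro V_change_diff V_diff_CB) auto
  also have "\<dots> \<le> exp (Re \<zeta> * y) * (1 + y) ^ m * CB m (Re \<zeta>)"
    using assms CB_nonneg by (intro mult_right_mono mult_left_mono) (auto intro!: power_increasing)
  finally show ?thesis by simp
qed

lemma cell_finite_range:
  assumes "Re \<zeta> > 0" "y \<ge> 0" shows "finite (range (cell m y \<zeta>))"
    "real (card (range (cell m y \<zeta>))) \<le> Kc m (exp (Re \<zeta> * y) * (1 + y) ^ m * CB m (Re \<zeta>))"
  using fcell_card[of "exp (Re \<zeta> * y) * (1 + y) ^ m * CB m (Re \<zeta>)" UNIV m "\<lambda>j. V j y \<zeta>"]
    V_diff_pos[OF assms] CB_nonneg[of "Re \<zeta>" m] assms by auto

lemma fin_rv_cell:
  assumes "Re \<zeta> > 0" "y \<ge> 0" shows "fin_rv \<mu> (cell m y \<zeta>)"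
proof (rule fin_rvI[OF _ cell_finite_range(1)[OF assms]])
  have [measurable]: "(\<lambda>\<omega>. fl (V j y \<zeta> \<omega>)) \<in> \<mu> \<rightarrow>\<^sub>M count_space UNIV" for j
    unfolding fl_def by measurable
  show "cell m y \<zeta> \<in> \<mu> \<rightarrow>\<^sub>M count_space UNIV"
  proof (induction m)
    case 0 show ?case unfolding fcell_def by simp
  next
    case (Suc m)
    note Suc[measurable]
    have "(\<lambda>\<omega>. cell m y \<zeta> \<omega> @ [fl (V (Suc m) y \<zeta> \<omega>)]) \<in> \<mu> \<rightarrow>\<^sub>M count_space UNIV" by measurable
    then show ?case by (simp add: fcell_def[abs_def])
  qed
qed

text \<open>The constant of \<open>power_le_exp\<close> at rate \<open>s\<close>; the factor
  \<open>exp (s / 2)\<close> appears because that lemma is applied to 1 + x instead of x.\<close>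

definition EE :: "nat \<Rightarrow> real \<Rightarrow> real" where "EE m s = fact m * (2 / s) ^ m * exp (s / 2)"

lemma EE_nonneg: "s > 0 \<Longrightarrow> EE m s \<ge> 0" by (simp add: EE_def)

lemma exp_poly_bound:
  assumes "s > 0" "x \<ge> 0" shows "exp (- s * x) * (1 + x) ^ m \<le> EE m s * exp (- s * x / 2)"
proof -
  have "exp (- s * x) * (1 + x) ^ m \<le> exp (- s * x) * (fact m * (2 / s) ^ m * exp (s / 2 * (1 + x)))"
    using assms by (intro mult_left_mono power_le_exp) auto
  also have "\<dots> = fact m * (2 / s) ^ m * exp (s / 2 * (1 + x) + - s * x)"
    by (simp only: exp_add mult_ac)
  also have "s / 2 * (1 + x) + - s * x = s / 2 + - s * x / 2" by (simp add: field_simps)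
  finally show ?thesis by (simp only: EE_def exp_add mult.assoc)
qed

text \<open>Going up to a coarser level contracts all jet differences. Half of the decay absorbs the
  polynomial leakage from the lower derivatives.\<close>

lemma V_diff_coarsen:
  assumes \<zeta>: "Re \<zeta> > 0" and x: "x \<ge> 0" and j: "j \<le> m" and D: "\<And>l. l \<le> m \<Longrightarrow> cmod (V l (y + x) \<zeta> u - V l (y + x) \<zeta> v) \<le> D"
  shows "cmod (V j y \<zeta> u - V j y \<zeta> v) \<le> EE m (Re \<zeta>) * D * exp (- Re \<zeta> * x / 2)"
proof -
  have D0: "D \<ge> 0" using D[of 0] norm_ge_zero order_trans by blast
  have "cmod (V j (y + x + (- x)) \<zeta> u - V j (y + x + (- x)) \<zeta> v) \<le> exp (Re \<zeta> * (- x)) * (1 + \<bar>- x\<bar>) ^ j * D"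
    using \<zeta> j D by (intro V_change_diff) auto
  also have "\<dots> \<le> exp (- Re \<zeta> * x) * (1 + x) ^ m * D"
    using x j D0 by (intro mult_right_mono) (auto intro!: power_increasing mult_left_mono)
  also have "\<dots> \<le> EE m (Re \<zeta>) * exp (- Re \<zeta> * x / 2) * D"
    using D0 exp_poly_bound[OF \<zeta> x] by (intro mult_right_mono)
  finally show ?thesis by (simp add: mult_ac)
qed

lemma V_diff_refine:
  assumes \<zeta>: "Re \<zeta> > 0" and x: "0 \<le> x" "x \<le> c1" and j: "j \<le> m" and D: "\<And>l. l \<le> m \<Longrightarrow> cmod (V l y \<zeta> u - V l y \<zeta> v) \<le> D"
  shows "cmod (V j (y + x) \<zeta> u - V j (y + x) \<zeta> v) \<le> exp (Re \<zeta> * c1) * (1 + c1) ^ m * D"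
proof -
  have D0: "D \<ge> 0" using D[of 0] norm_ge_zero order_trans by blast
  have "cmod (V j (y + x) \<zeta> u - V j (y + x) \<zeta> v) \<le> exp (Re \<zeta> * x) * (1 + \<bar>x\<bar>) ^ j * D"
    using \<zeta> j D by (intro V_change_diff) auto
  also have "\<dots> \<le> exp (Re \<zeta> * c1) * (1 + c1) ^ m * D"
  proof (intro mult_right_mono mult_mono)
    have "(1 + \<bar>x\<bar>) ^ j \<le> (1 + c1) ^ j" using x by (intro power_mono) auto
    also have "\<dots> \<le> (1 + c1) ^ m" using x j by (intro power_increasing) auto
    finally show "(1 + \<bar>x\<bar>) ^ j \<le> (1 + c1) ^ m" .
  qed (use x \<zeta> D0 in auto)
  finally show ?thesis .
qed

abbreviation u0 :: "'n stream" where "u0 \<equiv> sconst undefined"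

text \<open>A substitute for the cell that depends on the stopped word alone, as the conditioning in
  \<open>ent_stopw_ge\<close> requires. By \<open>V_stopw_diff\<close> the arbitrary tail
  \<open>u0\<close> moves the jet only by a bounded amount.\<close>

definition tcell :: "nat \<Rightarrow> real \<Rightarrow> complex \<Rightarrow> 'n list \<Rightarrow> (int \<times> int) list" where
  "tcell m y \<zeta> w = cell m y \<zeta> (w @- u0)"

lemma tcell_eq: "(\<lambda>\<omega>. tcell m y \<zeta> (stopw y \<omega>)) = fcell m (\<lambda>j \<omega>. V j y \<zeta> (stopw y \<omega> @- u0))"
  by (rule ext) (simp add: tcell_def fcell_def)

lemma V_stopw_diff:
  assumes "Re \<zeta> > 0" "j \<le> m"
  shows "cmod (V j y \<zeta> \<omega> - V j y \<zeta> (stopw y \<omega> @- u0)) \<le> CB m (Re \<zeta>)"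
proof -
  obtain \<omega>' where w: "\<omega> = stopw y \<omega> @- \<omega>'" using stopw_prefix by blast
  have "cmod (V j y \<zeta> (stopw y \<omega> @- \<omega>') - V j y \<zeta> (stopw y \<omega> @- u0)) \<le> CB m (Re \<zeta>)"
    unfolding V_shift_diff[OF assms(1)] using V_diff_CB[OF assms(1) stopw_Aw assms(2)] by (simp add: norm_mult)
  then show ?thesis using w by simp
qed

lemma tcell_V_diff:
  assumes "Re \<zeta> > 0" "j \<le> m" "tcell m y \<zeta> (stopw y u) = tcell m y \<zeta> (stopw y v)"
  shows "cmod (V j y \<zeta> u - V j y \<zeta> v) \<le> 2 * CB m (Re \<zeta>) + 2"
proof -
  have "cmod (V j y \<zeta> (stopw y u @- u0) - V j y \<zeta> (stopw y v @- u0)) \<le> 2"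
    using fcell_eq_imp[of m "\<lambda>j. V j y \<zeta>" "stopw y u @- u0" "\<lambda>j. V j y \<zeta>" "stopw y v @- u0" j] assms
    by (simp add: tcell_def)
  moreover note V_stopw_diff[OF assms(1,2), of y u] V_stopw_diff[OF assms(1,2), of y v]
  ultimately show ?thesis by norm
qed

lemma cell_tV_diff:
  assumes "Re \<zeta> > 0" "j \<le> m" "cell m y \<zeta> u = cell m y \<zeta> v"
  shows "cmod (V j y \<zeta> (stopw y u @- u0) - V j y \<zeta> (stopw y v @- u0)) \<le> 2 * CB m (Re \<zeta>) + 2"
proof -
  have "cmod (V j y \<zeta> u - V j y \<zeta> v) \<le> 2"
    using fcell_eq_imp[of m "\<lambda>j. V j y \<zeta>" u "\<lambda>j. V j y \<zeta>" v j] assms by simp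
  moreover note V_stopw_diff[OF assms(1,2), of y u] V_stopw_diff[OF assms(1,2), of y v]
  ultimately show ?thesis by norm
qed

lemma fin_rv_tcell: "fin_rv \<mu> (\<lambda>\<omega>. tcell m y \<zeta> (stopw y \<omega>))"
  by (rule fin_rv_comp[OF fin_rv_stopw])

text \<open>After the prefix stopped at level \<open>y\<close> comes an independent copy of the
  whole sequence, seen at level \<open>y'\<close> up to a bounded overshoot; so, given the coarse
  position, about \<open>h m' y' \<zeta>\<close> of entropy remains. Two orders are allowed because
  the transfer argument later joins a jet of order r + 1 at a coarse level with one of order r at a
  fine level.\<close>

lemma joint_superadditive:
  assumes \<zeta>: "Re \<zeta> > 0"
  shows "\<exists>C\<ge>0. \<forall>y\<ge>0. \<forall>y'\<ge>0. h m y \<zeta> + h m' y' \<zeta> - C \<le> ent \<mu> (\<lambda>\<omega>. (cell m y \<zeta> \<omega>, cell m' (y + y') \<zeta> \<omega>))"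
proof -
  define C1 where "C1 = 2 * CB m (Re \<zeta>) + 2"
  define C2 where "C2 = exp (Re \<zeta> * c1) * (1 + c1) ^ m' * 2"
  have C1: "C1 \<ge> 0" using CB_nonneg[OF \<zeta>, of m] by (simp add: C1_def)
  have C2: "C2 \<ge> 0" using c1_pos by (simp add: C2_def)
  have "h m y \<zeta> + h m' y' \<zeta> - (2 * ln (Kc m C1) + ln (Kc m' C2)) \<le> ent \<mu> (\<lambda>\<omega>. (cell m y \<zeta> \<omega>, cell m' (y + y') \<zeta> \<omega>))"
    if y: "y \<ge> 0" "y' \<ge> 0" for y y'
  proof -
    let ?g = "cell m' (y + y') \<zeta>" and ?t = "\<lambda>\<omega>. tcell m y \<zeta> (stopw y \<omega>)"
    note c = fin_rv_cell[OF \<zeta> y(1), of m]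
    have g: "fin_rv \<mu> ?g" using fin_rv_cell[OF \<zeta>] y by simp
    \<comment> \<open>The cell at level \<open>y\<close> is exchanged for \<open>tcell\<close> and
      back again in \<open>a1\<close> and \<open>a2\<close>; the independence of prefix and tail is
      used only in \<open>a3\<close>.\<close>
    have a1: "ent \<mu> (cell m y \<zeta>) \<le> ent \<mu> ?t + ln (Kc m C1)"
      by (rule ent_fibre[OF c fin_rv_tcell Kc_pos[OF C1] fcell_fibre[OF C1]])
         (use tcell_V_diff[OF \<zeta>] in \<open>auto simp: C1_def\<close>)
    have a2: "ent \<mu> (\<lambda>\<omega>. (?t \<omega>, ?g \<omega>)) \<le> ent \<mu> (\<lambda>\<omega>. (cell m y \<zeta> \<omega>, ?g \<omega>)) + ln (Kc m C1)"
    proof -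
      have "ent \<mu> (\<lambda>\<omega>. (?t \<omega>, ?g \<omega>)) \<le> ent \<mu> (\<lambda>\<omega>. ((cell m y \<zeta> \<omega>, ?g \<omega>), ?t \<omega>))"
        using ent_comp_le[OF fin_rv_Pair[OF fin_rv_Pair[OF c g] fin_rv_tcell], of "\<lambda>((a,b),c). (c,b)"] by simp
      also have "\<dots> \<le> ent \<mu> (\<lambda>\<omega>. (cell m y \<zeta> \<omega>, ?g \<omega>)) + ln (Kc m C1)"
      proof (rule ent_fibre_Pair[OF fin_rv_tcell fin_rv_Pair[OF c g] Kc_pos[OF C1]])
        fix d
        have "real (card {fcell m (\<lambda>j \<omega>. V j y \<zeta> (stopw y \<omega> @- u0)) \<omega> |\<omega>. (cell m y \<zeta> \<omega>, ?g \<omega>) = d}) \<le> Kc m C1"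
          by (rule fcell_fibre[OF C1]) (use cell_tV_diff[OF \<zeta>] in \<open>auto simp: C1_def\<close>)
        moreover have "tcell m y \<zeta> (stopw y \<omega>) = fcell m (\<lambda>j \<omega>. V j y \<zeta> (stopw y \<omega> @- u0)) \<omega>" for \<omega>
          using fun_cong[OF tcell_eq] .
        ultimately show "real (card {tcell m y \<zeta> (stopw y \<omega>) |\<omega>. (cell m y \<zeta> \<omega>, ?g \<omega>) = d}) \<le> Kc m C1"
          by simp
      qed
      finally show ?thesis .
    qed
    have a3: "ent \<mu> ?t + (h m' y' \<zeta> - ln (Kc m' C2)) \<le> ent \<mu> (\<lambda>\<omega>. (?t \<omega>, ?g \<omega>))"
    proof (rule ent_stopw_ge[OF g])
      fix w assume "w \<in> range (stopw y)"
      then obtain \<omega>0 where w: "w = stopw y \<omega>0" by auto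
      \<comment> \<open>The overshoot of the stopping rule, at most one letter. The tail is seen at
        level \<open>y' - x\<close>, and \<open>V_diff_refine\<close> brings it back to level
        \<open>y'\<close>.\<close>
      define x where "x = - (y + Aw w)"
      have x: "0 \<le> x" "x \<le> c1" using stopw_Aw[of y \<omega>0] stopw_Aw_ge[OF y(1), of \<omega>0] by (auto simp: x_def w)
      have "ent \<mu> (cell m' y' \<zeta>) \<le> ent \<mu> (\<lambda>\<omega>. ?g (w @- \<omega>)) + ln (Kc m' C2)"
      proof (rule ent_fibre[OF fin_rv_cell[OF \<zeta> y(2)] fin_rv_shift[OF g] Kc_pos[OF C2] fcell_fibre[OF C2]])
        fix u v j assume e: "?g (w @- u) = ?g (w @- v)" and j: "j \<le> m'"
        have "cmod (V l (y' - x) \<zeta> u - V l (y' - x) \<zeta> v) \<le> 2" if "l \<le> m'" for l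
        proof -
          have "cmod (V l (y + y') \<zeta> (w @- u) - V l (y + y') \<zeta> (w @- v)) \<le> 2"
            by (rule fcell_eq_imp[OF e that])
          moreover have "y + y' + Aw w = y' - x" by (simp add: x_def)
          ultimately show ?thesis unfolding V_shift_diff[OF \<zeta>] by (simp add: norm_mult)
        qed
        then have "cmod (V j (y' - x + x) \<zeta> u - V j (y' - x + x) \<zeta> v) \<le> C2"
          unfolding C2_def by (intro V_diff_refine[OF \<zeta> x j])
        then show "cmod (V j y' \<zeta> u - V j y' \<zeta> v) \<le> C2" by simp
      qed
      then show "h m' y' \<zeta> - ln (Kc m' C2) \<le> ent \<mu> (\<lambda>\<omega>. ?g (w @- \<omega>))" by (simp add: h_def)
    qed
    show ?thesis using a1 a2 a3 by (simp add: h_def)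
  qed
  then have "\<forall>y\<ge>0. \<forall>y'\<ge>0. h m y \<zeta> + h m' y' \<zeta> - max 0 (2 * ln (Kc m C1) + ln (Kc m' C2)) \<le> ent \<mu> (\<lambda>\<omega>. (cell m y \<zeta> \<omega>, cell m' (y + y') \<zeta> \<omega>))"
    by (meson diff_left_mono max.cobounded2 order_trans)
  then show ?thesis by (intro exI[of _ "max 0 (2 * ln (Kc m C1) + ln (Kc m' C2))"]) auto
qed

text \<open>For equal orders the coarse cell in the joint entropy is redundant: by
  \<open>V_diff_coarsen\<close> the fine cell leaves it only boundedly many values.\<close>

lemma h_superadditive:
  assumes \<zeta>: "Re \<zeta> > 0"
  shows "\<exists>C\<ge>0. \<forall>y\<ge>0. \<forall>y'\<ge>0. h m y \<zeta> + h m y' \<zeta> - C \<le> h m (y + y') \<zeta>"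
proof -
  obtain C where C: "C \<ge> 0" "\<And>y y'. y \<ge> 0 \<Longrightarrow> y' \<ge> 0 \<Longrightarrow> h m y \<zeta> + h m y' \<zeta> - C \<le> ent \<mu> (\<lambda>\<omega>. (cell m y \<zeta> \<omega>, cell m (y + y') \<zeta> \<omega>))"
    using joint_superadditive[OF \<zeta>, of m m] by blast
  define D where "D = EE m (Re \<zeta>) * 2"
  have D: "D \<ge> 0" using EE_nonneg[OF \<zeta>] by (simp add: D_def)
  have "ent \<mu> (\<lambda>\<omega>. (cell m y \<zeta> \<omega>, cell m (y + y') \<zeta> \<omega>)) \<le> h m (y + y') \<zeta> + ln (Kc m D)" if y: "y \<ge> 0" "y' \<ge> 0" for y y'
  proof -
    have f: "fin_rv \<mu> (cell m y \<zeta>)" "fin_rv \<mu> (cell m (y + y') \<zeta>)" using fin_rv_cell[OF \<zeta>] y by auto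
    have "ent \<mu> (\<lambda>\<omega>. (cell m (y + y') \<zeta> \<omega>, cell m y \<zeta> \<omega>)) \<le> h m (y + y') \<zeta> + ln (Kc m D)"
      unfolding h_def
    proof (rule ent_fibre_Pair[OF f Kc_pos[OF D] fcell_fibre[OF D]])
      fix u v j assume e: "cell m (y + y') \<zeta> u = cell m (y + y') \<zeta> v" and j: "j \<le> m"
      have "cmod (V j y \<zeta> u - V j y \<zeta> v) \<le> EE m (Re \<zeta>) * 2 * exp (- Re \<zeta> * y' / 2)"
        by (rule V_diff_coarsen[OF \<zeta> y(2) j fcell_eq_imp[OF e]])
      also have "\<dots> \<le> D * 1" unfolding D_def using \<zeta> y EE_nonneg[OF \<zeta>, of m] by (intro mult_left_mono) auto
      finally show "cmod (V j y \<zeta> u - V j y \<zeta> v) \<le> D" by simp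
    qed
    moreover have "ent \<mu> (\<lambda>\<omega>. (cell m y \<zeta> \<omega>, cell m (y + y') \<zeta> \<omega>)) \<le> ent \<mu> (\<lambda>\<omega>. (cell m (y + y') \<zeta> \<omega>, cell m y \<zeta> \<omega>))"
      using ent_comp_le[OF fin_rv_Pair[OF f(2,1)], of "\<lambda>(a,b). (b,a)"] by simp
    ultimately show ?thesis by linarith
  qed
  note e = this
  have "h m y \<zeta> + h m y' \<zeta> - (C + \<bar>ln (Kc m D)\<bar>) \<le> h m (y + y') \<zeta>" if "y \<ge> 0" "y' \<ge> 0" for y y'
    using C(2)[OF that] e[OF that] abs_ge_self[of "ln (Kc m D)"] by linarith
  then show ?thesis using C(1) by (intro exI[of _ "C + \<bar>ln (Kc m D)\<bar>"]) auto
qed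

text \<open>Counting cells. The crude bound (1 + y)^m \<le> exp (m y) worsens the slope for m > 0,
  but for m = 0 it leaves the slope \<open>2 * Re \<zeta>\<close> that \<open>beta0_le\<close>
  needs.\<close>

lemma h_upper:
  assumes \<zeta>: "Re \<zeta> > 0" and y: "y \<ge> 0"
  shows "h m y \<zeta> \<le> 2 * Suc m * ((Re \<zeta> + m) * y + ln (2 * CB m (Re \<zeta>) + 3))"
proof -
  define c where "c = CB m (Re \<zeta>)"
  have c: "c \<ge> 0" using CB_nonneg[OF \<zeta>] by (simp add: c_def)
  have p1: "(1 + y) ^ m \<le> exp (m * y)"
    using power_mono[OF exp_ge_add_one_self[of y], of m] y by (simp add: exp_of_nat_mult)
  have e1: "exp (Re \<zeta> * y) * (1 + y) ^ m \<le> exp ((Re \<zeta> + m) * y)"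
    using p1 by (simp add: exp_add algebra_simps)
  have e2: "1 \<le> exp ((Re \<zeta> + m) * y)" using \<zeta> y by simp
  have "h m y \<zeta> \<le> ln (Kc m (exp (Re \<zeta> * y) * (1 + y) ^ m * c))"
    unfolding h_def c_def by (rule ent_le_card[OF fin_rv_cell[OF \<zeta> y] cell_finite_range(2)[OF \<zeta> y]])
  also have "\<dots> = 2 * Suc m * ln (2 * (exp (Re \<zeta> * y) * (1 + y) ^ m * c) + 3)"
    unfolding Kc_def using c y by (subst ln_realpow) (auto intro!: add_nonneg_pos)
  also have "\<dots> \<le> 2 * Suc m * ln (exp ((Re \<zeta> + m) * y) * (2 * c + 3))"
  proof -
    have "exp (Re \<zeta> * y) * (1 + y) ^ m * c \<le> exp ((Re \<zeta> + m) * y) * c" using e1 c by (intro mult_right_mono)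
    moreover have "exp ((Re \<zeta> + m) * y) * (2 * c + 3) = 2 * (exp ((Re \<zeta> + m) * y) * c) + 3 * exp ((Re \<zeta> + m) * y)"
      by (simp add: distrib_left)
    ultimately have "2 * (exp (Re \<zeta> * y) * (1 + y) ^ m * c) + 3 \<le> exp ((Re \<zeta> + m) * y) * (2 * c + 3)"
      using e2 by linarith
    moreover have "0 < 2 * (exp (Re \<zeta> * y) * (1 + y) ^ m * c) + 3" using c y by (intro add_nonneg_pos) auto
    ultimately show ?thesis by (intro mult_left_mono) auto
  qed
  also have "ln (exp ((Re \<zeta> + m) * y) * (2 * c + 3)) = (Re \<zeta> + m) * y + ln (2 * c + 3)"
    using c by (subst ln_mult) auto
  finally show ?thesis by (simp add: c_def)
qed

text \<open>This is \<open>Re \<zeta>\<close> times the dimension d m of the overview, because level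
  \<open>y\<close> stands for resolution exp(- y Re \<zeta>). Accordingly d 0 \<le> 2 reads
  \<open>\<beta> 0 \<zeta> \<le> 2 * Re \<zeta>\<close>.\<close>

definition \<beta> :: "nat \<Rightarrow> complex \<Rightarrow> real" where "\<beta> m \<zeta> = lim (\<lambda>n. h m (real n) \<zeta> / n)"

lemma h_nonneg: "h m y \<zeta> \<ge> 0" by (simp add: h_def ent_nonneg)

lemma beta_limit:
  assumes \<zeta>: "Re \<zeta> > 0"
  shows "(\<lambda>n. h m (real n) \<zeta> / n) \<longlonglongrightarrow> \<beta> m \<zeta>" "\<exists>C. \<forall>n. h m (real n) \<zeta> \<le> \<beta> m \<zeta> * n + C"
proof -
  obtain C where C: "C \<ge> 0" "\<And>y y'. y \<ge> 0 \<Longrightarrow> y' \<ge> 0 \<Longrightarrow> h m y \<zeta> + h m y' \<zeta> - C \<le> h m (y + y') \<zeta>"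
    using h_superadditive[OF \<zeta>, of m] by blast
  define L where "L = 2 * Suc m * max (Re \<zeta> + m) (ln (2 * CB m (Re \<zeta>) + 3))"
  have "\<exists>b. (\<lambda>n. h m (real n) \<zeta> / n) \<longlonglongrightarrow> b \<and> (\<forall>n. h m (real n) \<zeta> \<le> b * n + C)"
  proof (rule fekete_superadditive[where L=L])
    show "h m (real n) \<zeta> + h m (real k) \<zeta> - C \<le> h m (real (n + k)) \<zeta>" for n k
      using C(2)[of "real n" "real k"] by simp
    show "h m (real n) \<zeta> \<le> L * real n + L" for n
    proof -
      define M where "M = max (Re \<zeta> + m) (ln (2 * CB m (Re \<zeta>) + 3))"
      have "(Re \<zeta> + m) * n \<le> M * n" by (intro mult_right_mono) (auto simp: M_def)
      moreover have "ln (2 * CB m (Re \<zeta>) + 3) \<le> M" by (simp add: M_def)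
      ultimately have "(Re \<zeta> + m) * n + ln (2 * CB m (Re \<zeta>) + 3) \<le> M * n + M" by linarith
      then have "2 * Suc m * ((Re \<zeta> + m) * n + ln (2 * CB m (Re \<zeta>) + 3)) \<le> 2 * Suc m * (M * n + M)"
        by (intro mult_left_mono) auto
      moreover have "2 * Suc m * (M * n + M) = L * n + L" by (simp add: L_def M_def algebra_simps)
      ultimately show ?thesis using h_upper[OF \<zeta>, of "real n" m] by linarith
    qed
  qed (use h_nonneg C in auto)
  then obtain \<beta>' where b: "(\<lambda>n. h m (real n) \<zeta> / n) \<longlonglongrightarrow> \<beta>'" "\<forall>n. h m (real n) \<zeta> \<le> \<beta>' * n + C" by blast
  then have "\<beta> m \<zeta> = \<beta>'" unfolding \<beta>_def by (intro limI)
  then show "(\<lambda>n. h m (real n) \<zeta> / n) \<longlonglongrightarrow> \<beta> m \<zeta>" "\<exists>C. \<forall>n. h m (real n) \<zeta> \<le> \<beta> m \<zeta> * n + C" using b by auto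
qed

lemma beta0_le: assumes \<zeta>: "Re \<zeta> > 0" shows "\<beta> 0 \<zeta> \<le> 2 * Re \<zeta>"
proof (rule LIMSEQ_le[OF beta_limit(1)[OF \<zeta>]])
  let ?c = "2 * ln (2 * CB 0 (Re \<zeta>) + 3)"
  have "(\<lambda>n. 2 * Re \<zeta> + ?c / real n) \<longlonglongrightarrow> 2 * Re \<zeta> + 0"
    by (intro tendsto_intros lim_const_over_n)
  then show "(\<lambda>n. 2 * Re \<zeta> + ?c / real n) \<longlonglongrightarrow> 2 * Re \<zeta>" by simp
  show "\<exists>N. \<forall>n\<ge>N. h 0 (real n) \<zeta> / n \<le> 2 * Re \<zeta> + ?c / real n"
    using h_upper[OF \<zeta>, of "real n" 0 for n] by (intro exI[of _ 1]) (auto simp: field_simps)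
qed

lemma beta_mono: assumes \<zeta>: "Re \<zeta> > 0" and m: "m \<le> m'" shows "\<beta> m \<zeta> \<le> \<beta> m' \<zeta>"
proof (rule LIMSEQ_le[OF beta_limit(1)[OF \<zeta>] beta_limit(1)[OF \<zeta>]])
  have "h m y \<zeta> \<le> h m' y \<zeta>" if "y \<ge> 0" for y
  proof -
    have "cell m y \<zeta> = (\<lambda>\<omega>. take (Suc m) (cell m' y \<zeta> \<omega>))"
      using m by (auto simp: fcell_def take_map simp del: upt_Suc)
    then show ?thesis unfolding h_def using ent_comp_le[OF fin_rv_cell[OF \<zeta> that], of "take (Suc m)" m'] by simp
  qed
  then show "\<exists>N. \<forall>n\<ge>N. h m (real n) \<zeta> / n \<le> h m' (real n) \<zeta> / n"
    by (auto intro!: divide_right_mono)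
qed

subsection \<open>Finitely many derivatives separate words\<close>

lemma V_prefix_close:
  assumes \<zeta>: "Re \<zeta> > 0" and st: "stake n u = stake n v"
  shows "cmod (V j 0 \<zeta> u - V j 0 \<zeta> v) \<le> EE j (Re \<zeta>) * CB j (Re \<zeta>) * exp (- Re \<zeta> * c0 / 2) ^ n"
proof -
  define w where "w = stake n u"
  have u: "u = w @- sdrop n u" "v = w @- sdrop n v" using st by (auto simp: w_def stake_sdrop) (metis stake_sdrop)
  have "Aw w \<le> - c0 * length w" 
  proof (induction w)
    case (Cons i w) then show ?case using a_le[of i] by (simp add: algebra_simps)
  qed simp
  then have A: "Aw w \<le> - c0 * n" by (simp add: w_def)
  then have A0: "- Aw w \<ge> 0" "- Aw w \<ge> c0 * n" using c0_pos by (auto intro: order_trans[of _ "- c0 * n"])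
  have "cmod (V j 0 \<zeta> u - V j 0 \<zeta> v) = cmod (V j (Aw w) \<zeta> (sdrop n u) - V j (Aw w) \<zeta> (sdrop n v))"
    by (subst u, subst u(2)) (simp add: V_shift_diff[OF \<zeta>] norm_mult)
  also have "\<dots> \<le> EE j (Re \<zeta>) * CB j (Re \<zeta>) * exp (- Re \<zeta> * (- Aw w) / 2)"
    using A0 by (intro V_diff_coarsen[OF \<zeta>, of _ _ j]) (auto intro!: V_diff_CB \<zeta>)
  also have "\<dots> \<le> EE j (Re \<zeta>) * CB j (Re \<zeta>) * exp (n * (- Re \<zeta> * c0 / 2))"
  proof -
    have "Re \<zeta> * (c0 * n) \<le> Re \<zeta> * (- Aw w)" using A0 \<zeta> by (intro mult_left_mono) auto
    then have "exp (- Re \<zeta> * (- Aw w) / 2) \<le> exp (n * (- Re \<zeta> * c0 / 2))" by (simp add: algebra_simps)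
    then show ?thesis using EE_nonneg[OF \<zeta>] CB_nonneg[OF \<zeta>] by (intro mult_left_mono) auto
  qed
  finally show ?thesis unfolding exp_of_nat_mult .
qed

lemma V_higher_deriv:
  assumes "Re z > 0"
  shows "(deriv ^^ j) (\<lambda>z. V 0 0 z u - V 0 0 z v) z = V j 0 z u - V j 0 z v"
  using assms
proof (induction j arbitrary: z)
  case (Suc j)
  have op: "open {z. Re z > 0}" by (rule open_halfspace_Re_gt)
  have "(deriv ^^ Suc j) (\<lambda>z. V 0 0 z u - V 0 0 z v) z = deriv ((deriv ^^ j) (\<lambda>z. V 0 0 z u - V 0 0 z v)) z" by simp
  also have "\<dots> = deriv (\<lambda>z. V j 0 z u - V j 0 z v) z"
    by (rule deriv_cong_ev) (use Suc eventually_nhds_in_open[OF op, of z] in \<open>auto elim!: eventually_mono\<close>)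
  also have "\<dots> = V (Suc j) 0 z u - V (Suc j) 0 z v"
    by (intro DERIV_imp_deriv DERIV_diff V_has_derivative Suc.prems)
  finally show ?case .
qed simp

text \<open>If all derivatives agreed at \<open>\<zeta>\<close>, the two series would agree on the
  whole half-plane. Along real parameters R tending to infinity all contractions vanish and the
  series of u tends to \<open>t (shd u)\<close>, so the first letters would have equal translations.
  This is where injectivity of \<open>t\<close> enters.\<close>

lemma jets_separate_limit:
  assumes \<zeta>: "Re \<zeta> > 0" and "shd u \<noteq> shd v" shows "\<exists>j. V j 0 \<zeta> u \<noteq> V j 0 \<zeta> v"
proof (rule ccontr)
  assume "\<not> ?thesis" then have z: "V j 0 \<zeta> u - V j 0 \<zeta> v = 0" for j by simp
  let ?f = "\<lambda>z. V 0 0 z u - V 0 0 z v" and ?S = "{z. Re z > 0}"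
  have hol: "?f holomorphic_on ?S"
  proof (rule holomorphic_onI, rule field_differentiable_at_within)
    fix z assume "z \<in> ?S"
    then have "(?f has_field_derivative V (Suc 0) 0 z u - V (Suc 0) 0 z v) (at z)"
      by (intro DERIV_diff V_has_derivative) auto
    then show "?f field_differentiable at z" by (auto simp: field_differentiable_def)
  qed
  have f0: "?f z = 0" if "Re z > 0" for z
    by (rule holomorphic_fun_eq_0_on_connected[OF hol open_halfspace_Re_gt _ _ CollectI[of "\<lambda>z. Re z > 0" \<zeta>, OF \<zeta>]])
       (use that z V_higher_deriv[OF \<zeta>] in \<open>auto intro: convex_connected convex_halfspace_Re_gt\<close>)
  have bd: "cmod (V 0 (a i) (of_real R) \<omega>) \<le> exp (- c0 * R) * Cb 0 1" if "R \<ge> 1" for R i \<omega>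
  proof -
    have "V 0 (0 + a i) (of_real R) \<omega> = exp (of_real R * of_real (a i)) * V 0 0 (of_real R) \<omega>"
      using that by (subst V_change) auto
    then have "cmod (V 0 (a i) (of_real R) \<omega>) = exp (R * a i) * cmod (V 0 0 (of_real R) \<omega>)"
      by (simp add: norm_mult flip: of_real_mult)
    also have "\<dots> \<le> exp (- c0 * R) * Cb 0 1"
    proof (intro mult_mono)
      have "R * a i \<le> R * (- c0)" using that a_le by (intro mult_left_mono) auto
      then show "exp (R * a i) \<le> exp (- c0 * R)" by (simp add: mult.commute)
    qed (use that V_bound[of 1 "of_real R" 0 0] in auto)
    finally show ?thesis .
  qed
  have le: "cmod (t (shd u) - t (shd v)) \<le> 2 * (exp (- c0 * R) * Cb 0 1)" if R: "R \<ge> 1" for R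
  proof -
    have e: "V 0 0 (of_real R) w = t (shd w) + cis (b (shd w)) * V 0 (a (shd w)) (of_real R) (stl w)" for w
      using V_Stream[of "of_real R" 0 0 "shd w" "stl w"] R by simp
    have "t (shd u) - t (shd v) = cis (b (shd v)) * V 0 (a (shd v)) (of_real R) (stl v) - cis (b (shd u)) * V 0 (a (shd u)) (of_real R) (stl u)"
      using f0[of "of_real R"] R e[of u] e[of v] by (simp add: algebra_simps)
    also have "cmod \<dots> \<le> cmod (V 0 (a (shd v)) (of_real R) (stl v)) + cmod (V 0 (a (shd u)) (of_real R) (stl u))"
      by (rule order_trans[OF norm_triangle_ineq4]) (simp add: norm_mult)
    also have "\<dots> \<le> 2 * (exp (- c0 * R) * Cb 0 1)"
      using bd[OF R, of "shd v" "stl v"] bd[OF R, of "shd u" "stl u"] by simp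
    finally show ?thesis .
  qed
  have "((\<lambda>R. 2 * (exp (- c0 * R) * Cb 0 1)) \<longlongrightarrow> 2 * (0 * Cb 0 1)) at_top"
    using c0_pos by (intro tendsto_intros filterlim_compose[OF exp_at_bot] filterlim_tendsto_neg_mult_at_bot[OF tendsto_const] filterlim_ident) auto
  then have "cmod (t (shd u) - t (shd v)) \<le> 2 * (0 * Cb 0 1)"
    by (rule tendsto_lowerbound) (use le in \<open>auto simp: eventually_at_top_linorder\<close>)
  then show False using assms(2) t_inj by (simp add: inj_eq)
qed

lemma jets_separate:
  assumes \<zeta>: "Re \<zeta> > 0"
  shows "\<exists>N c. c > 0 \<and> (\<forall>u v. shd u \<noteq> shd v \<longrightarrow> (\<exists>j\<le>N. cmod (V j 0 \<zeta> u - V j 0 \<zeta> v) \<ge> c))"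
proof (rule ccontr)
  assume "\<not> ?thesis"
  then have "\<forall>k. \<exists>u v. shd u \<noteq> shd v \<and> (\<forall>j\<le>k. cmod (V j 0 \<zeta> u - V j 0 \<zeta> v) < 1 / Suc k)"
    unfolding not_ex not_all de_Morgan_conj not_imp not_le
    by (metis (no_types, lifting) of_nat_0_less_iff zero_less_Suc zero_less_divide_1_iff not_le)
  then obtain U W where UW: "\<And>k. shd (U k) \<noteq> shd (W k)" "\<And>k j. j \<le> k \<Longrightarrow> cmod (V j 0 \<zeta> (U k) - V j 0 \<zeta> (W k)) < 1 / Suc k"
    by metis
  \<comment> \<open>Zipping the two sequences yields one limit for both coordinates along common
    indices.\<close>
  obtain s where s: "\<And>n. infinite {k. stake n (szip (U k) (W k)) = stake n s}"
    using stream_compactness[of "\<lambda>k. szip (U k) (W k)"] by blast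
  define u v where "u = smap fst s" and "v = smap snd s"
  have st: "infinite {k. stake n (U k) = stake n u \<and> stake n (W k) = stake n v}" for n
  proof (rule infinite_super[OF _ s[of n]], safe)
    fix k assume e: "stake n (szip (U k) (W k)) = stake n s"
    have l: "stake n (U k) = map fst (stake n (szip (U k) (W k)))" "stake n (W k) = map snd (stake n (szip (U k) (W k)))"
      by (auto intro!: nth_equalityI)
    show "stake n (U k) = stake n u" unfolding u_def stake_smap by (rule l(1)[unfolded e])
    show "stake n (W k) = stake n v" unfolding v_def stake_smap by (rule l(2)[unfolded e])
  qed
  have "shd u \<noteq> shd v"
  proof -
    have "{k. stake 1 (U k) = stake 1 u \<and> stake 1 (W k) = stake 1 v} \<noteq> {}"
      by (rule infinite_imp_nonempty[OF st])
    then obtain k where k: "stake 1 (U k) = stake 1 u" "stake 1 (W k) = stake 1 v" by blast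
    have "shd (U k) = shd u" "shd (W k) = shd v"
      using arg_cong[OF k(1), of hd] arg_cong[OF k(2), of hd] by simp_all
    then show ?thesis using UW(1)[of k] by simp
  qed
  moreover have "V j 0 \<zeta> u = V j 0 \<zeta> v" for j
  proof -
    let ?B = "EE j (Re \<zeta>) * CB j (Re \<zeta>)" and ?q = "exp (- Re \<zeta> * c0 / 2)"
    have "cmod (V j 0 \<zeta> u - V j 0 \<zeta> v) \<le> 1 / Suc n + 2 * (?B * ?q ^ n)" if "n \<ge> j" for n
    proof -
      obtain k where k: "k > n" "stake n (U k) = stake n u" "stake n (W k) = stake n v"
        using st[of n] unfolding infinite_nat_iff_unbounded by blast
      have "cmod (V j 0 \<zeta> (U k) - V j 0 \<zeta> (W k)) \<le> 1 / Suc n"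
      proof -
        have "cmod (V j 0 \<zeta> (U k) - V j 0 \<zeta> (W k)) \<le> 1 / Suc k" using UW(2)[of j k] k that by simp
        also have "\<dots> \<le> 1 / Suc n" using k by (intro divide_left_mono) auto
        finally show ?thesis .
      qed
      moreover have "cmod (V j 0 \<zeta> u - V j 0 \<zeta> v) \<le> cmod (V j 0 \<zeta> (U k) - V j 0 \<zeta> u)
          + cmod (V j 0 \<zeta> (U k) - V j 0 \<zeta> (W k)) + cmod (V j 0 \<zeta> (W k) - V j 0 \<zeta> v)"
        by norm
      ultimately show ?thesis
        using V_prefix_close[OF \<zeta> k(2), of j] V_prefix_close[OF \<zeta> k(3), of j] by linarith
    qed
    moreover have "(\<lambda>n. 1 / Suc n + 2 * (?B * ?q ^ n)) \<longlonglongrightarrow> 0 + 2 * (?B * 0)"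
      using \<zeta> c0_pos by (intro tendsto_intros LIMSEQ_inverse_real_of_nat[unfolded inverse_eq_divide] LIMSEQ_realpow_zero) auto
    ultimately have "cmod (V j 0 \<zeta> u - V j 0 \<zeta> v) \<le> 0 + 2 * (?B * 0)"
      by (intro LIMSEQ_le_const) auto
    then show ?thesis by simp
  qed
  ultimately show False using jets_separate_limit[OF \<zeta>] by blast
qed

text \<open>Two differently stopped words separate while the level is still positive, hence at a
  scale coarser than the stopping scale.\<close>

lemma stopn_neq_split:
  assumes "stopn a n x u \<noteq> stopn a n x v"
  shows "\<exists>w u' v'. u = w @- u' \<and> v = w @- v' \<and> shd u' \<noteq> shd v' \<and> x + Aw w > 0"
  using assms
proof (induction n arbitrary: x u v)
  case (Suc n)
  then have x: "x > 0" by (auto split: if_splits)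
  show ?case
  proof (cases "shd u = shd v")
    case False then show ?thesis using x by (intro exI[of _ "[]"]) auto
  next
    case True
    then have "stopn a n (x + a (shd u)) (stl u) \<noteq> stopn a n (x + a (shd u)) (stl v)" using Suc.prems x by auto
    from Suc.IH[OF this] obtain w u' v' where "stl u = w @- u'" "stl v = w @- v'" "shd u' \<noteq> shd v'" "x + a (shd u) + Aw w > 0" by blast
    then show ?thesis using True
      by (intro exI[of _ "shd u # w"] exI[of _ u'] exI[of _ v']) (auto simp: stream_eq_Stream_iff add.assoc)
  qed
qed simp

text \<open>For the separating order \<open>N\<close>, the cell at level \<open>x + y0\<close>
  determines the word stopped at level \<open>x\<close>, so the jet entropy is at least that of the
  stopped words. The margin \<open>y0\<close> is large enough that jets agreeing up to 2 at a level
  of at least \<open>y0\<close> differ by less than the separation constant \<open>c\<close> at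
  level 0.\<close>

lemma beta_large:
  assumes \<zeta>: "Re \<zeta> > 0" shows "\<exists>N. \<beta> N \<zeta> \<ge> p_entropy / lyap"
proof -
  obtain N c where Nc: "c > 0" "\<And>u v. shd u \<noteq> shd v \<Longrightarrow> \<exists>j\<le>N. cmod (V j 0 \<zeta> u - V j 0 \<zeta> v) \<ge> c"
    using jets_separate[OF \<zeta>] by blast
  have "((\<lambda>y. EE N (Re \<zeta>) * 2 * exp (- Re \<zeta> * y / 2)) \<longlongrightarrow> EE N (Re \<zeta>) * 2 * 0) at_top"
  proof -
    have "filterlim (\<lambda>y. (- Re \<zeta> / 2) * y) at_bot at_top"
      using \<zeta> by (intro filterlim_tendsto_neg_mult_at_bot[OF tendsto_const] filterlim_ident) auto
    then have "filterlim (\<lambda>y. - Re \<zeta> * y / 2) at_bot at_top" by simp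
    then show ?thesis by (intro tendsto_intros filterlim_compose[OF exp_at_bot])
  qed
  then have "eventually (\<lambda>y. EE N (Re \<zeta>) * 2 * exp (- Re \<zeta> * y / 2) < c) at_top"
    by (rule order_tendstoD) (use Nc in auto)
  then obtain y0 where y0: "\<And>y. y \<ge> y0 \<Longrightarrow> EE N (Re \<zeta>) * 2 * exp (- Re \<zeta> * y / 2) < c" "y0 \<ge> 0"
    unfolding eventually_at_top_linorder by (metis max.cobounded1 max.cobounded2 order_trans)
  have key: "ent \<mu> (stopw x) \<le> h N (x + y0) \<zeta>" if x: "x \<ge> 0" for x
  proof -
    have "stopw x u = stopw x v" if e: "cell N (x + y0) \<zeta> u = cell N (x + y0) \<zeta> v" for u v
    proof (rule ccontr)
      assume "stopw x u \<noteq> stopw x v"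
      then obtain w u' v' where w: "u = w @- u'" "v = w @- v'" "shd u' \<noteq> shd v'" "x + Aw w > 0"
        unfolding stopw_def using stopn_neq_split by blast
      define \<eta> where "\<eta> = x + y0 + Aw w"
      have \<eta>: "\<eta> \<ge> y0" "\<eta> \<ge> 0" using w y0 by (auto simp: \<eta>_def)
      have "cmod (V l (0 + \<eta>) \<zeta> u' - V l (0 + \<eta>) \<zeta> v') \<le> 2" if "l \<le> N" for l
        using fcell_eq_imp[OF e that] unfolding w V_shift_diff[OF \<zeta>] by (simp add: norm_mult \<eta>_def)
      then have "cmod (V j 0 \<zeta> u' - V j 0 \<zeta> v') < c" if "j \<le> N" for j
        using V_diff_coarsen[OF \<zeta> \<eta>(2) that, of 0 u' v' 2] y0(1)[OF \<eta>(1)] by simp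
      then show False using Nc(2)[OF w(3)] by force
    qed
    then have "\<forall>w\<in>{stopw x \<omega> |\<omega>. cell N (x + y0) \<zeta> \<omega> = d}. \<forall>w'\<in>{stopw x \<omega> |\<omega>. cell N (x + y0) \<zeta> \<omega> = d}. w = w'" for d
      by blast
    moreover have "finite {stopw x \<omega> |\<omega>. cell N (x + y0) \<zeta> \<omega> = d}" for d
      by (rule finite_subset[OF _ fin_rv_finite[OF fin_rv_stopw[of x]]]) auto
    ultimately have "card {stopw x \<omega> |\<omega>. cell N (x + y0) \<zeta> \<omega> = d} \<le> 1" for d
      by (simp only: One_nat_def card_le_Suc0_iff_eq)
    then have "ent \<mu> (stopw x) \<le> ent \<mu> (cell N (x + y0) \<zeta>) + ln 1"
      using x y0 by (intro ent_fibre[OF fin_rv_stopw fin_rv_cell[OF \<zeta>]]) auto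
    then show ?thesis by (simp add: h_def)
  qed
  have "p_entropy / lyap \<le> \<beta> N \<zeta>"
  proof (rule LIMSEQ_le[OF _ beta_limit(1)[OF \<zeta>]])
    have "(\<lambda>n. p_entropy / lyap - (p_entropy / lyap * y0) / real n) \<longlonglongrightarrow> p_entropy / lyap - 0"
      by (intro tendsto_intros lim_const_over_n)
    then show "(\<lambda>n. p_entropy / lyap - (p_entropy / lyap * y0) / real n) \<longlonglongrightarrow> p_entropy / lyap" by simp
    show "\<exists>k. \<forall>n\<ge>k. p_entropy / lyap - (p_entropy / lyap * y0) / real n \<le> h N (real n) \<zeta> / real n"
    proof (intro exI allI impI)
      fix n assume "n \<ge> nat \<lceil>y0\<rceil> + 1"
      then have n: "real n \<ge> y0" "n > 0" by linarith+
      have "p_entropy / lyap * (real n - y0) \<le> h N (real n) \<zeta>"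
        using key[of "real n - y0"] ent_stopw[of "real n - y0"] n by simp
      then have "p_entropy / lyap * (real n - y0) / n \<le> h N (real n) \<zeta> / n" by (intro divide_right_mono) auto
      moreover have "p_entropy / lyap * (real n - y0) / n = p_entropy / lyap - (p_entropy / lyap * y0) / real n"
        using n by (simp add: right_diff_distrib diff_divide_distrib)
      ultimately show "p_entropy / lyap - (p_entropy / lyap * y0) / real n \<le> h N (real n) \<zeta> / real n" by simp
    qed
  qed
  then show ?thesis by blast
qed

end

section \<open>The first derivative increases the entropy\<close>

context ifs
begin

text \<open>The sum of the constants produced in \<open>value_determined\<close> and
  \<open>jet_determined\<close>. It depends on the parameter only through the bounds
  \<open>s\<close> and \<open>K\<close>.\<close>

definition AA :: "nat \<Rightarrow> real \<Rightarrow> real \<Rightarrow> real" where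
  "AA r s K = exp (Suc r * (exp K / s)) * (2 * Suc r + 2 * Cb (Suc r) s * exp K ^ Suc r)
     + fact r * (2 * exp (Suc r * (exp K / s)) + 2 * Suc r + 2 * Cb (Suc (Suc r)) s * exp K ^ Suc r)"

lemma AA_nonneg: "s > 0 \<Longrightarrow> AA r s K \<ge> 0"
  unfolding AA_def using Cb_nonneg by (intro add_nonneg_nonneg mult_nonneg_nonneg) auto

lemma V_Taylor:
  assumes s: "0 < s" "s \<le> Re \<zeta>" "s \<le> Re \<zeta>'"
  shows "cmod ((V i 0 \<zeta>' u - V i 0 \<zeta>' v) - (\<Sum>j\<le>r. (V (i + j) 0 \<zeta> u - V (i + j) 0 \<zeta> v) * (\<zeta>' - \<zeta>) ^ j / fact j))
     \<le> 2 * Cb (i + Suc r) s * cmod (\<zeta>' - \<zeta>) ^ Suc r"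
proof -
  let ?S = "{z. Re z \<ge> s}"
  have "cmod ((\<lambda>j z. V (i + j) 0 z u - V (i + j) 0 z v) 0 \<zeta>' - (\<Sum>j\<le>r. (\<lambda>j z. V (i + j) 0 z u - V (i + j) 0 z v) j \<zeta> * (\<zeta>' - \<zeta>) ^ j / fact j))
     \<le> 2 * Cb (i + Suc r) s * cmod (\<zeta>' - \<zeta>) ^ Suc r / fact r"
  proof (rule field_Taylor[where S="?S"])
    show "convex ?S" by (rule convex_halfspace_Re_ge)
    show "((\<lambda>z. V (i + j) 0 z u - V (i + j) 0 z v) has_field_derivative V (i + Suc j) 0 z u - V (i + Suc j) 0 z v) (at z within ?S)"
      if "z \<in> ?S" for j z
    proof (rule has_field_derivative_at_within, rule DERIV_diff)
      have "Re z > 0" using that s(1) by simp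
      then have d: "((\<lambda>z. V (i + j) 0 z w) has_field_derivative V (i + Suc j) 0 z w) (at z)" for w
        using V_has_derivative[of z "i + j" 0 w] by simp
      show "((\<lambda>z. V (i + j) 0 z u) has_field_derivative V (i + Suc j) 0 z u) (at z)" by (rule d)
      show "((\<lambda>z. V (i + j) 0 z v) has_field_derivative V (i + Suc j) 0 z v) (at z)" by (rule d)
    qed
    show "cmod (V (i + Suc r) 0 z u - V (i + Suc r) 0 z v) \<le> 2 * Cb (i + Suc r) s" if "z \<in> ?S" for z
    proof -
      have "cmod (V (i + Suc r) 0 z u) \<le> Cb (i + Suc r) s" "cmod (V (i + Suc r) 0 z v) \<le> Cb (i + Suc r) s"
        using that s(1) by (auto intro: V_bound)
      then show ?thesis using norm_triangle_ineq4[of "V (i + Suc r) 0 z u" "V (i + Suc r) 0 z v"] by linarith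
    qed
  qed (use s in auto)
  moreover have "2 * Cb (i + Suc r) s * cmod (\<zeta>' - \<zeta>) ^ Suc r / fact r \<le> 2 * Cb (i + Suc r) s * cmod (\<zeta>' - \<zeta>) ^ Suc r / 1"
    using Cb_nonneg[OF s(1)] fact_ge_1[of r, where 'a=real] by (intro divide_left_mono) (auto simp: fact_ge_1)
  ultimately show ?thesis by simp
qed

section \<open>Transfer of information between jets at two nearby parameters\<close>

context
  fixes \<zeta> \<zeta>' :: complex and s K \<delta> :: real and r n :: nat
  assumes s: "0 < s" "s \<le> Re \<zeta>" "s \<le> Re \<zeta>'" and K: "Re \<zeta> \<le> K"
    and dl: "\<delta> = cmod (\<zeta>' - \<zeta>)" "\<delta> \<le> 1" "exp (- Re \<zeta> * n) \<le> \<delta>" "\<delta> \<le> exp K * exp (- Re \<zeta> * n)"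
    and r: "r \<ge> 1"
begin

text \<open>Level \<open>n\<close> resolves just the distance \<open>\<delta>\<close> of the two
  parameters. Hence level \<open>Suc r * n\<close>, whose resolution is \<open>Lm\<close>, resolves
  \<delta>^(r+1), the size of a Taylor remainder of order r. Polynomial losses are collected in
  powers of \<open>Nn\<close>.\<close>

definition "Nn = 1 + real (Suc r * n)"
definition "GG = exp K / s"
definition "Lm = exp (- Re \<zeta> * real (Suc r * n))"

lemma Nn_ge_1: "Nn \<ge> 1" by (simp add: Nn_def)

lemma zeta_pos: "Re \<zeta> > 0" "Re \<zeta>' > 0" using s by auto

lemma delta_pos: "\<delta> > 0" using dl(3) by (rule less_le_trans[rotated]) simp

text \<open>As \<open>\<delta>\<close> is about exp(- n Re \<zeta>), the product with
  \<open>n\<close> stays bounded. So level \<open>Suc r * n\<close> means the same resolution at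
  both parameters up to a constant factor, which is what \<open>exp_compare\<close>
  extracts.\<close>

lemma n_delta: "n * \<delta> \<le> GG"
proof -
  have e: "Re \<zeta> * n * exp (- (Re \<zeta> * n)) \<le> 1"
  proof -
    have "Re \<zeta> * n \<le> exp (Re \<zeta> * n)" using exp_ge_add_one_self[of "Re \<zeta> * n"] by linarith
    then have "Re \<zeta> * n * exp (- (Re \<zeta> * n)) \<le> exp (Re \<zeta> * n) * exp (- (Re \<zeta> * n))" by (intro mult_right_mono) auto
    then show ?thesis by (simp add: exp_minus_inverse)
  qed
  have "s * (n * \<delta>) \<le> Re \<zeta> * (n * \<delta>)" using s delta_pos by (intro mult_right_mono) auto
  also have "\<dots> \<le> Re \<zeta> * (n * (exp K * exp (- Re \<zeta> * n)))"
    using s dl(4) by (intro mult_left_mono) auto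
  also have "\<dots> = exp K * (Re \<zeta> * n * exp (- (Re \<zeta> * n)))" by simp
  also have "\<dots> \<le> exp K * 1" using e by (intro mult_left_mono) auto
  finally show ?thesis using s by (simp add: GG_def field_simps)
qed

lemma exp_compare: "exp (\<bar>Re \<zeta> - Re \<zeta>'\<bar> * real (Suc r * n)) \<le> exp (Suc r * GG)"
proof -
  have "\<bar>Re \<zeta> - Re \<zeta>'\<bar> \<le> \<delta>" using abs_Re_le_cmod[of "\<zeta>' - \<zeta>"] dl by simp
  then have "\<bar>Re \<zeta> - Re \<zeta>'\<bar> * real (Suc r * n) \<le> \<delta> * real (Suc r * n)" by (intro mult_right_mono) auto
  also have "\<dots> = Suc r * (n * \<delta>)" by (simp only: of_nat_mult mult_ac)
  also have "\<dots> \<le> Suc r * GG" using n_delta by (intro mult_left_mono) auto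
  finally show ?thesis by simp
qed

lemma exp_zeta': "exp (Re \<zeta>' * real (Suc r * n)) \<le> exp (Suc r * GG) / Lm" "exp (- Re \<zeta>' * real (Suc r * n)) \<le> exp (Suc r * GG) * Lm"
proof -
  let ?m = "real (Suc r * n)"
  have "exp (Re \<zeta>' * ?m) \<le> exp (\<bar>Re \<zeta> - Re \<zeta>'\<bar> * ?m + Re \<zeta> * ?m)"
    unfolding exp_le_cancel_iff distrib_right[symmetric] by (intro mult_right_mono) auto
  also have "\<dots> = exp (\<bar>Re \<zeta> - Re \<zeta>'\<bar> * ?m) / Lm"
    unfolding Lm_def exp_add mult_minus_left exp_minus by (simp only: divide_inverse inverse_inverse_eq)
  also have "\<dots> \<le> exp (Suc r * GG) / Lm" by (intro divide_right_mono exp_compare) (simp add: Lm_def)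
  finally show "exp (Re \<zeta>' * ?m) \<le> exp (Suc r * GG) / Lm" .
  have "exp (- Re \<zeta>' * ?m) \<le> exp (\<bar>Re \<zeta> - Re \<zeta>'\<bar> * ?m + - Re \<zeta> * ?m)"
    unfolding exp_le_cancel_iff distrib_right[symmetric] by (intro mult_right_mono) auto
  also have "\<dots> = exp (\<bar>Re \<zeta> - Re \<zeta>'\<bar> * ?m) * Lm" by (simp only: Lm_def exp_add)
  also have "\<dots> \<le> exp (Suc r * GG) * Lm" by (intro mult_right_mono exp_compare) (simp add: Lm_def)
  finally show "exp (- Re \<zeta>' * ?m) \<le> exp (Suc r * GG) * Lm" .
qed

lemma Lm_pos: "Lm > 0" by (simp add: Lm_def)

lemma Lm_eq: "Lm = exp (- Re \<zeta> * n) ^ Suc r"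
proof -
  have "- Re \<zeta> * real (Suc r * n) = real (Suc r) * (- Re \<zeta> * n)" by (simp only: of_nat_mult mult_ac)
  then show ?thesis unfolding Lm_def by (simp only: exp_of_nat_mult)
qed

lemma delta_power: "\<delta> ^ Suc r \<le> exp K ^ Suc r * Lm"
  using power_mono[OF dl(4), of "Suc r"] delta_pos by (simp only: Lm_eq power_mult_distrib less_imp_le)

lemma jet_diff_small:
  assumes "cell r (real (Suc r * n)) \<zeta> u = cell r (real (Suc r * n)) \<zeta> v" "j \<le> r"
  shows "cmod (V j 0 \<zeta> u - V j 0 \<zeta> v) \<le> 2 * Lm * Nn ^ r"
proof -
  let ?m = "real (Suc r * n)"
  have "cmod (V j (?m + - ?m) \<zeta> u - V j (?m + - ?m) \<zeta> v) \<le> exp (Re \<zeta> * - ?m) * (1 + \<bar>- ?m\<bar>) ^ j * 2"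
    by (rule V_change_diff[OF zeta_pos(1)]) (use fcell_eq_imp[OF assms(1)] assms(2) in auto)
  also have "\<dots> = 2 * Lm * Nn ^ j" unfolding Lm_def Nn_def by (simp only: abs_minus_cancel abs_of_nat mult_minus_right mult_minus_left mult_ac)
  also have "\<dots> \<le> 2 * Lm * Nn ^ r" using assms(2) Nn_ge_1 Lm_pos by (intro mult_left_mono power_increasing) auto
  finally show ?thesis by simp
qed

lemma Taylor_term_bound:
  assumes "cmod x \<le> B" "B \<ge> 0" shows "cmod (x * (\<zeta>' - \<zeta>) ^ j / fact j) \<le> B"
proof -
  have "cmod (x * (\<zeta>' - \<zeta>) ^ j / fact j) = cmod x * (\<delta> ^ j / fact j)"
    by (simp add: norm_mult norm_divide norm_power dl)
  also have "\<dots> \<le> B * 1"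
  proof (intro mult_mono assms)
    have "\<delta> ^ j \<le> 1" using delta_pos dl by (intro power_le_one) auto
    then show "\<delta> ^ j / fact j \<le> 1" using fact_ge_1[of j, where 'a=real] 
      by (simp only: divide_le_eq_1) (auto intro: order_trans)
  qed (use delta_pos in auto)
  finally show ?thesis by simp
qed

text \<open>The Taylor polynomial of degree r recovers the value at \<open>\<zeta>'\<close> from the
  r-jet at \<open>\<zeta>\<close>: the jet is known to precision \<open>Lm\<close>, and the
  remainder \<delta>^(r+1) is of the same size.\<close>

lemma value_determined:
  assumes Q: "cell r (real (Suc r * n)) \<zeta> u = cell r (real (Suc r * n)) \<zeta> v"
  shows "cmod (V 0 (real (Suc r * n)) \<zeta>' u - V 0 (real (Suc r * n)) \<zeta>' v) \<le> AA r s K * Nn ^ (2 * Suc r)"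
proof -
  let ?m = "real (Suc r * n)" and ?B = "2 * Cb (Suc r) s"
  have B: "?B \<ge> 0" using Cb_nonneg[OF s(1)] by simp
  have "cmod (V 0 0 \<zeta>' u - V 0 0 \<zeta>' v) \<le> cmod (\<Sum>j\<le>r. (V (0 + j) 0 \<zeta> u - V (0 + j) 0 \<zeta> v) * (\<zeta>' - \<zeta>) ^ j / fact j) + ?B * \<delta> ^ Suc r"
    using V_Taylor[OF s, of 0 u v r] dl(1)
    by (smt (verit) add_0 norm_triangle_sub)
  also have "cmod (\<Sum>j\<le>r. (V (0 + j) 0 \<zeta> u - V (0 + j) 0 \<zeta> v) * (\<zeta>' - \<zeta>) ^ j / fact j) \<le> (\<Sum>j\<le>r. 2 * Lm * Nn ^ r)"
    by (intro sum_norm_le Taylor_term_bound) (use jet_diff_small[OF Q] Lm_pos Nn_ge_1 in auto)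
  also have "(\<Sum>j\<le>r. 2 * Lm * Nn ^ r) = Lm * (2 * Suc r * Nn ^ r)" by simp
  also have "?B * \<delta> ^ Suc r \<le> Lm * (?B * exp K ^ Suc r)"
    using mult_left_mono[OF delta_power B] by (simp only: mult_ac)
  finally have F: "cmod (V 0 0 \<zeta>' u - V 0 0 \<zeta>' v) \<le> Lm * (2 * Suc r * Nn ^ r + ?B * exp K ^ Suc r)"
    by (simp only: distrib_left)
  have "cmod (V 0 (0 + ?m) \<zeta>' u - V 0 (0 + ?m) \<zeta>' v) \<le> exp (Re \<zeta>' * ?m) * (1 + \<bar>?m\<bar>) ^ 0 * (Lm * (2 * Suc r * Nn ^ r + ?B * exp K ^ Suc r))"
    by (rule V_change_diff[OF zeta_pos(2)]) (use F in simp)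
  also have "\<dots> = exp (Re \<zeta>' * ?m) * (Lm * (2 * Suc r * Nn ^ r + ?B * exp K ^ Suc r))" by simp
  also have "\<dots> \<le> exp (Suc r * GG) / Lm * (Lm * (2 * Suc r * Nn ^ r + ?B * exp K ^ Suc r))"
    using exp_zeta'(1) Lm_pos Nn_ge_1 B by (intro mult_right_mono) auto
  also have "\<dots> = exp (Suc r * GG) * (2 * Suc r * Nn ^ r + ?B * exp K ^ Suc r)" using Lm_pos by simp
  also have "\<dots> \<le> exp (Suc r * GG) * ((2 * Suc r + ?B * exp K ^ Suc r) * Nn ^ (2 * Suc r))"
  proof (intro mult_left_mono)
    have "Nn ^ r \<le> Nn ^ (2 * Suc r)" "1 \<le> Nn ^ (2 * Suc r)" using Nn_ge_1 by (auto intro!: power_increasing one_le_power simp del: power_Suc)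
    then have "2 * Suc r * Nn ^ r \<le> 2 * Suc r * Nn ^ (2 * Suc r)" "?B * exp K ^ Suc r * 1 \<le> ?B * exp K ^ Suc r * Nn ^ (2 * Suc r)"
      using B by (auto intro!: mult_left_mono simp del: power_Suc)
    then show "2 * Suc r * Nn ^ r + ?B * exp K ^ Suc r \<le> (2 * Suc r + ?B * exp K ^ Suc r) * Nn ^ (2 * Suc r)"
      unfolding distrib_right by linarith
  qed auto
  also have "\<dots> \<le> AA r s K * Nn ^ (2 * Suc r)"
    unfolding mult.assoc[symmetric]
    using Cb_nonneg[OF s(1)] Nn_ge_1 unfolding AA_def GG_def by (intro mult_right_mono) auto
  finally show ?thesis by simp
qed

text \<open>Expand the first derivative at \<open>\<zeta>'\<close> to order r around
  \<open>\<zeta>\<close>. Everything except the term with the derivative of order r + 1 is known to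
  precision about \<delta>^(r+1), so that derivative times \<delta>^r is known too. Dividing by
  \<delta>^r leaves precision about \<open>\<delta>\<close>, which is level
  \<open>n\<close>.\<close>

lemma jet_determined:
  assumes Q: "cell r (real (Suc r * n)) \<zeta> u = cell r (real (Suc r * n)) \<zeta> v"
    and Q': "cell 1 (real (Suc r * n)) \<zeta>' u = cell 1 (real (Suc r * n)) \<zeta>' v" and j: "j \<le> Suc r"
  shows "cmod (V j (real n) \<zeta> u - V j (real n) \<zeta> v) \<le> AA r s K * Nn ^ (2 * Suc r)"
proof -
  let ?m = "real (Suc r * n)" and ?B = "2 * Cb (Suc (Suc r)) s"
  let ?F = "\<lambda>j. V j 0 \<zeta> u - V j 0 \<zeta> v" and ?eg = "exp (Suc r * GG)"
  have B: "?B \<ge> 0" using Cb_nonneg[OF s(1)] by simp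
  define S where "S = fact r * (2 * ?eg * Nn + 2 * Suc r * Nn ^ r + ?B * exp K ^ Suc r)"
  have en: "exp (- Re \<zeta> * n) > 0" by simp
  have F1: "cmod (V 1 0 \<zeta>' u - V 1 0 \<zeta>' v) \<le> Lm * (2 * ?eg * Nn)"
  proof -
    have "cmod (V 1 (?m + - ?m) \<zeta>' u - V 1 (?m + - ?m) \<zeta>' v) \<le> exp (Re \<zeta>' * - ?m) * (1 + \<bar>- ?m\<bar>) ^ 1 * 2"
      by (rule V_change_diff[OF zeta_pos(2)]) (use fcell_eq_imp[OF Q'] in auto)
    also have "\<dots> = exp (- Re \<zeta>' * ?m) * (2 * Nn)"
      unfolding Nn_def by (simp only: abs_minus_cancel abs_of_nat mult_minus_right mult_minus_left mult_ac power_one_right)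
    also have "\<dots> \<le> ?eg * Lm * (2 * Nn)" using exp_zeta'(2) Nn_ge_1 by (intro mult_right_mono) auto
    finally show ?thesis by (simp add: mult_ac)
  qed
  \<comment> \<open>\<open>X\<close> is the derivative at the second parameter, \<open>Y\<close> the
    part of its Taylor polynomial that the r-jet controls, and \<open>Z\<close> the remainder. Only
    the top term is missing from \<open>Y\<close>.\<close>
  define X where "X = V 1 0 \<zeta>' u - V 1 0 \<zeta>' v"
  define Y where "Y = (\<Sum>j<r. ?F (1 + j) * (\<zeta>' - \<zeta>) ^ j / fact j)"
  define Z where "Z = X - (\<Sum>j\<le>r. ?F (1 + j) * (\<zeta>' - \<zeta>) ^ j / fact j)"
  have "?F (Suc r) * (\<zeta>' - \<zeta>) ^ r / fact r = X - Y - Z"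
    unfolding Z_def Y_def by (simp add: lessThan_Suc_atMost[symmetric])
  then have tri: "cmod (?F (Suc r) * (\<zeta>' - \<zeta>) ^ r / fact r) \<le> cmod X + cmod Y + cmod Z"
    by (metis add_right_mono norm_triangle_ineq4 order_trans)
  have "cmod Y \<le> (\<Sum>j<r. 2 * Lm * Nn ^ r)"
    unfolding Y_def
  proof (intro sum_norm_le Taylor_term_bound)
    show "cmod (?F (1 + j)) \<le> 2 * Lm * Nn ^ r" if "j \<in> {..<r}" for j
      using that by (intro jet_diff_small[OF Q]) auto
  qed (use Lm_pos Nn_ge_1 in auto)
  moreover have "(\<Sum>j<r. 2 * Lm * Nn ^ r) \<le> Lm * (2 * Suc r * Nn ^ r)"
  proof -
    have "(\<Sum>j<r. 2 * Lm * Nn ^ r) = Lm * (2 * real r * Nn ^ r)" by simp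
    also have "\<dots> \<le> Lm * (2 * real (Suc r) * Nn ^ r)"
      using Lm_pos Nn_ge_1 by (intro mult_left_mono mult_right_mono) auto
    finally show ?thesis by simp
  qed
  moreover have "cmod Z \<le> Lm * (?B * exp K ^ Suc r)"
  proof -
    have "cmod Z \<le> ?B * \<delta> ^ Suc r"
      unfolding Z_def X_def using V_Taylor[OF s, of 1 u v r] by (simp only: dl(1) plus_1_eq_Suc)
    also have "\<dots> \<le> ?B * (exp K ^ Suc r * Lm)" by (rule mult_left_mono[OF delta_power B])
    finally show ?thesis by (simp only: mult_ac)
  qed
  moreover have "cmod X \<le> Lm * (2 * ?eg * Nn)" unfolding X_def by (rule F1)
  ultimately have "cmod (?F (Suc r) * (\<zeta>' - \<zeta>) ^ r / fact r) \<le> Lm * (2 * ?eg * Nn) + Lm * (2 * Suc r * Nn ^ r) + Lm * (?B * exp K ^ Suc r)"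
    using tri by linarith
  then have "cmod (?F (Suc r) * (\<zeta>' - \<zeta>) ^ r / fact r) \<le> Lm * (2 * ?eg * Nn + 2 * Suc r * Nn ^ r + ?B * exp K ^ Suc r)"
    unfolding distrib_left .
  then have "fact r * cmod (?F (Suc r) * (\<zeta>' - \<zeta>) ^ r / fact r) \<le> fact r * (Lm * (2 * ?eg * Nn + 2 * Suc r * Nn ^ r + ?B * exp K ^ Suc r))"
    by (intro mult_left_mono) auto
  then have "cmod (?F (Suc r)) * \<delta> ^ r \<le> Lm * S"
    by (simp add: norm_mult norm_divide norm_power dl(1) S_def mult_ac)
  moreover have "cmod (?F (Suc r)) * exp (- Re \<zeta> * n) ^ r \<le> cmod (?F (Suc r)) * \<delta> ^ r"
    using dl(3) by (intro mult_left_mono power_mono) auto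
  ultimately have "cmod (?F (Suc r)) * exp (- Re \<zeta> * n) ^ r \<le> exp (- Re \<zeta> * n) ^ r * (exp (- Re \<zeta> * n) * S)"
    unfolding Lm_eq by (simp only: power_Suc mult_ac)
  then have Fm: "cmod (?F (Suc r)) \<le> exp (- Re \<zeta> * n) * S"
    using en by (simp only: mult.commute[of "cmod _"] mult_le_cancel_left_pos zero_less_power)
  have Lmle: "Lm \<le> exp (- Re \<zeta> * n)"
  proof -
    have "exp (- Re \<zeta> * n) ^ Suc r \<le> exp (- Re \<zeta> * n) ^ 1" using zeta_pos by (intro power_decreasing) auto
    then show ?thesis by (simp only: Lm_eq power_one_right)
  qed
  have Nr: "Nn ^ r \<ge> 1" "Nn ^ r \<ge> 0" using Nn_ge_1 by auto
  have SNr: "2 * Nn ^ r \<le> S"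
  proof -
    have "2 * Nn ^ r \<le> 2 * Suc r * Nn ^ r" using Nr by (intro mult_right_mono) auto
    also have "\<dots> \<le> 1 * (2 * ?eg * Nn + 2 * Suc r * Nn ^ r + ?B * exp K ^ Suc r)" using B Nn_ge_1 by simp
    also have "\<dots> \<le> S" unfolding S_def using B Nn_ge_1 by (intro mult_right_mono) (auto simp: fact_ge_1)
    finally show ?thesis .
  qed
  have S0: "S \<ge> 0" using SNr Nr by linarith
  have Fall: "cmod (?F l) \<le> exp (- Re \<zeta> * n) * S" if "l \<le> Suc r" for l
  proof (cases "l = Suc r")
    case False
    then have "cmod (?F l) \<le> Lm * (2 * Nn ^ r)" using jet_diff_small[OF Q, of l] that by (simp add: mult_ac)
    also have "\<dots> \<le> exp (- Re \<zeta> * n) * S" using Lmle SNr Nr by (intro mult_mono) auto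
    finally show ?thesis .
  qed (use Fm in simp)
  have S_le: "S \<le> fact r * (2 * ?eg + 2 * Suc r + ?B * exp K ^ Suc r) * Nn ^ Suc r"
  proof -
    have "Nn ^ 1 \<le> Nn ^ Suc r" "Nn ^ r \<le> Nn ^ Suc r" "1 \<le> Nn ^ Suc r"
      using Nn_ge_1 by (intro power_increasing one_le_power; simp)+
    then have "2 * ?eg * Nn \<le> 2 * ?eg * Nn ^ Suc r" "2 * Suc r * Nn ^ r \<le> 2 * Suc r * Nn ^ Suc r"
        "?B * exp K ^ Suc r * 1 \<le> ?B * exp K ^ Suc r * Nn ^ Suc r"
      using B by (auto intro!: mult_left_mono simp del: power_Suc)
    then have "2 * ?eg * Nn + 2 * Suc r * Nn ^ r + ?B * exp K ^ Suc r \<le> (2 * ?eg + 2 * Suc r + ?B * exp K ^ Suc r) * Nn ^ Suc r"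
      unfolding distrib_right by linarith
    then show ?thesis unfolding S_def mult.assoc by (intro mult_left_mono) auto
  qed
  have "cmod (V j (0 + real n) \<zeta> u - V j (0 + real n) \<zeta> v) \<le> exp (Re \<zeta> * n) * (1 + \<bar>real n\<bar>) ^ j * (exp (- Re \<zeta> * n) * S)"
    by (rule V_change_diff[OF zeta_pos(1)]) (use Fall j in auto)
  also have "\<dots> = (1 + real n) ^ j * S"
    by (simp add: exp_minus field_simps)
  also have "\<dots> \<le> Nn ^ Suc r * S"
  proof (intro mult_right_mono S0)
    have "(1 + real n) ^ j \<le> Nn ^ j" unfolding Nn_def by (intro power_mono) (auto simp: algebra_simps)
    also have "\<dots> \<le> Nn ^ Suc r" using Nn_ge_1 j by (intro power_increasing) auto
    finally show "(1 + real n) ^ j \<le> Nn ^ Suc r" .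
  qed
  also have "\<dots> \<le> Nn ^ Suc r * (fact r * (2 * ?eg + 2 * Suc r + ?B * exp K ^ Suc r) * Nn ^ Suc r)"
    using S_le Nn_ge_1 by (intro mult_left_mono) auto
  also have "Nn ^ Suc r * (fact r * (2 * ?eg + 2 * Suc r + ?B * exp K ^ Suc r) * Nn ^ Suc r)
      = fact r * (2 * ?eg + 2 * Suc r + ?B * exp K ^ Suc r) * Nn ^ (2 * Suc r)"
  proof -
    have "x * (c * x) = c * (x * x)" for x c :: real by simp
    then show ?thesis by (simp only: mult_2 power_add)
  qed
  also have "\<dots> \<le> AA r s K * Nn ^ (2 * Suc r)"
    using Cb_nonneg[OF s(1)] Nn_ge_1 unfolding AA_def GG_def by (intro mult_right_mono) auto
  finally show ?thesis using Nn_ge_1 by simp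
qed

text \<open>\<open>R\<close> is almost determined by \<open>Q\<close> and \<open>Q'\<close>, and
  \<open>P'\<close> by \<open>Q\<close>. Submodularity with \<open>P'\<close> in the middle bounds
  the entropy added by \<open>Q'\<close> by H(Q' | P'), that is by h 1 - h 0 at the second
  parameter. This is small if the first derivative brings no new entropy there.\<close>

lemma entropy_transfer:
  defines "D \<equiv> AA r s K * (1 + real (Suc r * n)) ^ (2 * Suc r)"
  shows "ent \<mu> (\<lambda>\<omega>. (cell (Suc r) (real n) \<zeta> \<omega>, cell r (real (Suc r * n)) \<zeta> \<omega>))
    \<le> h 1 (real (Suc r * n)) \<zeta>' - h 0 (real (Suc r * n)) \<zeta>' + h r (real (Suc r * n)) \<zeta> + ln (Kc 0 D) + ln (Kc (Suc r) D)"
proof -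
  let ?m = "real (Suc r * n)"
  define Q R P' Q' where "Q = cell r ?m \<zeta>" and "R = cell (Suc r) (real n) \<zeta>" and "P' = cell 0 ?m \<zeta>'" and "Q' = cell 1 ?m \<zeta>'"
  have D: "D = AA r s K * Nn ^ (2 * Suc r)" by (simp only: D_def Nn_def)
  have D0: "D \<ge> 0" unfolding D using AA_nonneg[OF s(1)] Nn_ge_1 by (intro mult_nonneg_nonneg) auto
  have f: "fin_rv \<mu> Q" "fin_rv \<mu> R" "fin_rv \<mu> P'" "fin_rv \<mu> Q'"
    unfolding Q_def R_def P'_def Q'_def using zeta_pos by (intro fin_rv_cell; simp)+
  note fQPQ = fin_rv_Pair[OF f(4) fin_rv_Pair[OF f(3) f(1)]]
  have "ent \<mu> (\<lambda>\<omega>. (R \<omega>, Q \<omega>)) \<le> ent \<mu> (\<lambda>\<omega>. ((Q' \<omega>, P' \<omega>, Q \<omega>), R \<omega>))"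
    using ent_comp_le[OF fin_rv_Pair[OF fQPQ f(2)], of "\<lambda>((a,b,c),d). (d,c)"] by simp
  also have "\<dots> \<le> ent \<mu> (\<lambda>\<omega>. (Q' \<omega>, P' \<omega>, Q \<omega>)) + ln (Kc (Suc r) D)"
  proof (rule ent_fibre_Pair[OF f(2) fQPQ Kc_pos[OF D0]])
    fix d show "real (card {R \<omega> |\<omega>. (Q' \<omega>, P' \<omega>, Q \<omega>) = d}) \<le> Kc (Suc r) D"
      unfolding R_def by (rule fcell_fibre[OF D0]) (use jet_determined in \<open>auto simp: D Q_def Q'_def\<close>)
  qed
  finally have a: "ent \<mu> (\<lambda>\<omega>. (R \<omega>, Q \<omega>)) \<le> ent \<mu> (\<lambda>\<omega>. (Q' \<omega>, P' \<omega>, Q \<omega>)) + ln (Kc (Suc r) D)" .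
  have b: "ent \<mu> (\<lambda>\<omega>. (Q' \<omega>, P' \<omega>, Q \<omega>)) + ent \<mu> P' \<le> ent \<mu> (\<lambda>\<omega>. (Q' \<omega>, P' \<omega>)) + ent \<mu> (\<lambda>\<omega>. (P' \<omega>, Q \<omega>))"
    by (rule ent_submodular[OF f(4,3,1)])
  have c: "ent \<mu> (\<lambda>\<omega>. (Q' \<omega>, P' \<omega>)) \<le> ent \<mu> Q'"
  proof -
    have "P' = (\<lambda>\<omega>. take 1 (Q' \<omega>))" by (auto simp: P'_def Q'_def fcell_def)
    then show ?thesis using ent_comp_le[OF f(4), of "\<lambda>x. (x, take 1 x)"] by simp
  qed
  have d: "ent \<mu> (\<lambda>\<omega>. (P' \<omega>, Q \<omega>)) \<le> ent \<mu> Q + ln (Kc 0 D)"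
  proof -
    have "ent \<mu> (\<lambda>\<omega>. (P' \<omega>, Q \<omega>)) \<le> ent \<mu> (\<lambda>\<omega>. (Q \<omega>, P' \<omega>))"
      using ent_comp_le[OF fin_rv_Pair[OF f(1) f(3)], of "\<lambda>(a,b). (b,a)"] by simp
    also have "\<dots> \<le> ent \<mu> Q + ln (Kc 0 D)"
    proof (rule ent_fibre_Pair[OF f(3,1) Kc_pos[OF D0]])
      fix d show "real (card {P' \<omega> |\<omega>. Q \<omega> = d}) \<le> Kc 0 D"
        unfolding P'_def by (rule fcell_fibre[OF D0]) (use value_determined in \<open>auto simp: D Q_def\<close>)
    qed
    finally show ?thesis .
  qed
  show ?thesis using a b c d by (simp add: Q_def R_def P'_def Q'_def h_def)
qed

end

text \<open>\<open>no_gain r k n0\<close> collects the quantitative information at a parameter \<open>\<zeta>\<close> that makes the constants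
  in the transfer argument uniform; such parameters cannot accumulate.\<close>

definition no_gain :: "nat \<Rightarrow> nat \<Rightarrow> nat \<Rightarrow> complex set" where
  "no_gain r k n0 = {\<zeta>. 1 / Suc k \<le> Re \<zeta> \<and> cmod \<zeta> \<le> k \<and> \<beta> 1 \<zeta> = \<beta> 0 \<zeta> \<and> \<beta> r \<zeta> + 1 / Suc k \<le> \<beta> (Suc r) \<zeta>
     \<and> (\<forall>y\<ge>0. \<forall>y'\<ge>0. h (Suc r) y \<zeta> + h r y' \<zeta> - k \<le> ent \<mu> (\<lambda>\<omega>. (cell (Suc r) y \<zeta> \<omega>, cell r (y + y') \<zeta> \<omega>)))
     \<and> (\<forall>n\<ge>n0. \<forall>j\<in>{0, 1, r, Suc r}. \<bar>h j (real n) \<zeta> - \<beta> j \<zeta> * n\<bar> \<le> 1 / (8 * real (Suc r) * real (Suc k)) * n)}"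

text \<open>For two parameters at distance exp(- n Re \<zeta>), \<open>entropy_transfer\<close>
  bounds the joint entropy by (r + 1) n \<beta> r up to errors, whereas superadditivity gives at
  least n \<beta> (r + 1) + r n \<beta> r. The uniform gap between \<beta> r and \<beta> (r + 1)
  contradicts this for large n, so the distance cannot be too small.\<close>

lemma no_gain_not_close:
  assumes r: "r \<ge> 1"
  shows "\<exists>\<epsilon>>0. \<forall>\<zeta>\<in>no_gain r k n0. \<forall>\<zeta>'\<in>no_gain r k n0. \<zeta> \<noteq> \<zeta>' \<longrightarrow> cmod (\<zeta>' - \<zeta>) \<ge> \<epsilon>"
proof -
  define s where "s = 1 / real (Suc k)"
  define K where "K = real (Suc k)"
  define A where "A = AA r s K"
  have s0: "s > 0" by (simp add: s_def)
  have A0: "A \<ge> 0" using AA_nonneg[OF s0] by (simp add: A_def)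
  define m where "m = real (Suc r)"
  \<comment> \<open>The error terms below add up to \<open>\<kappa> * (4 * m + 1)\<close>, which is
    less than the guaranteed gap \<open>8 * m * \<kappa>\<close>.\<close>
  define \<kappa> where "\<kappa> = 1 / (8 * m * real (Suc k))"
  have m0: "m \<ge> 1" by (simp add: m_def)
  have \<kappa>0: "\<kappa> > 0" using m0 by (simp add: \<kappa>_def)
  define D where "D n = A * (1 + m * real n) ^ (2 * Suc r)" for n :: nat
  define L where "L n = ln (Kc 0 (D n)) + ln (Kc (Suc r) (D n))" for n :: nat
  have "eventually (\<lambda>n. L n + k \<le> \<kappa> * n) sequentially"
  proof -
    define c1' where "c1' = real (2 * Suc 0 + 2 * Suc (Suc r))"
    define c2 where "c2 = real (2 * Suc r)"
    have Lle: "L n \<le> c1' * (ln (2 * A + 3) + c2 * ln (1 + m * real n))" for n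
    proof -
      have N1: "(1 + m * real n) ^ (2 * Suc r) \<ge> 1" using m0 by (intro one_le_power) simp
      have D0: "D n \<ge> 0" using A0 m0 by (simp add: D_def)
      have pos1: "1 + m * real n > 0" using m0 by (simp add: add_pos_nonneg)
      have "2 * D n + 3 \<le> (2 * A + 3) * (1 + m * real n) ^ (2 * Suc r)" unfolding D_def using N1
        by (simp add: distrib_right del: power_Suc mult_Suc_right)
      then have "ln (2 * D n + 3) \<le> ln ((2 * A + 3) * (1 + m * real n) ^ (2 * Suc r))"
        using D0 by (subst ln_le_cancel_iff) auto
      also have "\<dots> = ln (2 * A + 3) + c2 * ln (1 + m * real n)"
        using A0 pos1 N1 by (subst ln_mult) (auto simp: ln_realpow c2_def add_pos_nonneg simp del: power_Suc)
      finally have "ln (2 * D n + 3) \<le> ln (2 * A + 3) + c2 * ln (1 + m * real n)" .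
      then have "c1' * ln (2 * D n + 3) \<le> c1' * (ln (2 * A + 3) + c2 * ln (1 + m * real n))"
        unfolding c1'_def by (intro mult_left_mono) auto
      moreover have "L n = c1' * ln (2 * D n + 3)"
        unfolding L_def Kc_def c1'_def using D0 by (simp only: ln_realpow) (simp add: ln_realpow algebra_simps del: power_Suc)
      ultimately show ?thesis by simp
    qed
    have m0': "m > 0" using m0 by simp
    have "((\<lambda>x. (c1' * (ln (2 * A + 3) + c2 * ln (1 + m * x)) + k) / x) \<longlongrightarrow> 0) at_top"
      using m0' by real_asymp
    then have "((\<lambda>n. (c1' * (ln (2 * A + 3) + c2 * ln (1 + m * real n)) + k) / real n) \<longlongrightarrow> 0) sequentially"
      by (rule filterlim_compose[OF _ filterlim_real_sequentially])
    then have "eventually (\<lambda>n. (c1' * (ln (2 * A + 3) + c2 * ln (1 + m * real n)) + k) / real n < \<kappa>) sequentially"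
      using \<kappa>0 by (rule order_tendstoD)
    then show ?thesis
      using eventually_gt_at_top[of 0]
    proof eventually_elim
      case (elim n)
      then have "c1' * (ln (2 * A + 3) + c2 * ln (1 + m * real n)) + k < \<kappa> * n" by (simp add: divide_less_eq mult.commute)
      then show ?case using Lle[of n] by linarith
    qed
  qed
  then obtain n1 where n1: "\<And>n. n \<ge> n1 \<Longrightarrow> L n + k \<le> \<kappa> * n" by (auto simp: eventually_sequentially)
  \<comment> \<open>A distance below \<open>\<epsilon>\<close> forces the level \<open>n\<close>
    chosen below to be at least \<open>n0\<close> and \<open>n1\<close>, where the entropies are
    near their linear asymptotics and the logarithmic losses are below
    \<open>\<kappa> * n\<close>.\<close>
  define M where "M = real (max (max n0 n1) 1)"
  define \<epsilon> where "\<epsilon> = exp (- (K * M))"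
  have \<epsilon>: "\<epsilon> > 0" "\<epsilon> < 1" by (auto simp: \<epsilon>_def K_def M_def)
  have "\<not> cmod (\<zeta>' - \<zeta>) < \<epsilon>" if g: "\<zeta> \<in> no_gain r k n0" "\<zeta>' \<in> no_gain r k n0" "\<zeta> \<noteq> \<zeta>'" for \<zeta> \<zeta>'
  proof
    assume less: "cmod (\<zeta>' - \<zeta>) < \<epsilon>"
    define \<delta> where "\<delta> = cmod (\<zeta>' - \<zeta>)"
    have \<delta>: "\<delta> > 0" "\<delta> < \<epsilon>" using g(3) less by (auto simp: \<delta>_def)
    have sz: "s \<le> Re \<zeta>" "s \<le> Re \<zeta>'" using g by (auto simp: no_gain_def s_def)
    have Kz: "Re \<zeta> \<le> K" using g complex_Re_le_cmod[of \<zeta>] by (auto simp: no_gain_def K_def)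
    have zp: "Re \<zeta> > 0" using sz s0 by linarith
    \<comment> \<open>The first level whose resolution is at most \<open>\<delta>\<close>; rounding
      up costs a factor of at most \<open>exp K\<close>.\<close>
    define n where "n = nat \<lceil>- ln \<delta> / Re \<zeta>\<rceil>"
    have lnd: "- ln \<delta> > K * M" using \<delta> ln_less_cancel_iff[of \<delta> \<epsilon>] \<epsilon> by (simp add: \<epsilon>_def)
    have pos: "- ln \<delta> / Re \<zeta> > M"
    proof -
      have "Re \<zeta> * M \<le> K * M" using Kz by (intro mult_right_mono) (auto simp: M_def)
      then have "Re \<zeta> * M < - ln \<delta>" using lnd by linarith
      then show ?thesis using zp by (simp only: pos_less_divide_eq mult.commute)
    qed
    have M1: "M \<ge> 1" by (simp add: M_def)
    have nb: "real n \<ge> - ln \<delta> / Re \<zeta>" "real n \<le> - ln \<delta> / Re \<zeta> + 1"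
      using pos M1 by (auto simp: n_def) linarith+
    have nM: "real n \<ge> M" using nb pos by linarith
    then have nn: "n \<ge> n0" "n \<ge> n1" "n \<ge> 1" by (auto simp: M_def)
    have d1: "exp (- Re \<zeta> * n) \<le> \<delta>"
    proof -
      have "- ln \<delta> \<le> Re \<zeta> * n" using nb(1) zp by (simp only: pos_divide_le_eq mult.commute)
      then have "exp (- Re \<zeta> * n) \<le> exp (ln \<delta>)" by simp
      then show ?thesis using \<delta> by simp
    qed
    have d2: "\<delta> \<le> exp K * exp (- Re \<zeta> * n)"
    proof -
      have "Re \<zeta> * n \<le> Re \<zeta> * (- ln \<delta> / Re \<zeta> + 1)" using nb(2) zp by (intro mult_left_mono) auto
      also have "\<dots> = - ln \<delta> + Re \<zeta>" using zp by (simp add: field_simps)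
      finally have "ln \<delta> \<le> K + - Re \<zeta> * n" using Kz by simp
      then have "exp (ln \<delta>) \<le> exp (K + - Re \<zeta> * n)" by simp
      then show ?thesis using \<delta> unfolding exp_add[symmetric] by simp
    qed
    have mn: "real (Suc r * n) = m * n" by (simp only: m_def of_nat_mult)
    have snn: "Suc r * n \<ge> n0" "r * n \<ge> n0" using nn(1) r by (auto intro: order_trans[of _ n])
    have up: "ent \<mu> (\<lambda>\<omega>. (cell (Suc r) (real n) \<zeta> \<omega>, cell r (real (Suc r * n)) \<zeta> \<omega>))
      \<le> h 1 (real (Suc r * n)) \<zeta>' - h 0 (real (Suc r * n)) \<zeta>' + h r (real (Suc r * n)) \<zeta> + ln (Kc 0 (D n)) + ln (Kc (Suc r) (D n))"
      using entropy_transfer[OF s0 sz Kz \<delta>_def _ d1 d2 r] \<delta> \<epsilon> by (simp only: D_def A_def mn)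
    have lo: "h (Suc r) (real n) \<zeta> + h r (real (r * n)) \<zeta> - k \<le> ent \<mu> (\<lambda>\<omega>. (cell (Suc r) (real n) \<zeta> \<omega>, cell r (real (Suc r * n)) \<zeta> \<omega>))"
    proof -
      have "real n + real (r * n) = real (Suc r * n)" by simp
      moreover have "h (Suc r) (real n) \<zeta> + h r (real (r * n)) \<zeta> - k \<le> ent \<mu> (\<lambda>\<omega>. (cell (Suc r) (real n) \<zeta> \<omega>, cell r (real n + real (r * n)) \<zeta> \<omega>))"
        using g(1) unfolding no_gain_def mem_Collect_eq by (meson of_nat_0_le_iff)
      ultimately show ?thesis by simp
    qed
    have H: "\<bar>h j (real i) z - \<beta> j z * i\<bar> \<le> \<kappa> * i" if "z \<in> no_gain r k n0" "i \<ge> n0" "j \<in> {0, 1, r, Suc r}" for z i j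
      using that unfolding no_gain_def \<kappa>_def m_def by blast
    have j: "(0::nat) \<in> {0, 1, r, Suc r}" "(1::nat) \<in> {0, 1, r, Suc r}" "r \<in> {0, 1, r, Suc r}" "Suc r \<in> {0, 1, r, Suc r}"
      by auto
    have b1: "\<beta> 1 \<zeta>' = \<beta> 0 \<zeta>'" using g(2) by (simp add: no_gain_def)
    have e1: "h 1 (real (Suc r * n)) \<zeta>' - h 0 (real (Suc r * n)) \<zeta>' \<le> 2 * \<kappa> * (m * n)"
    proof -
      have "h 1 (real (Suc r * n)) \<zeta>' - \<beta> 0 \<zeta>' * (m * n) \<le> \<kappa> * (m * n)"
        using abs_le_D1[OF H[OF g(2) snn(1), of 1, OF j(2)]] unfolding mn b1 by simp
      moreover have "\<beta> 0 \<zeta>' * (m * n) - h 0 (real (Suc r * n)) \<zeta>' \<le> \<kappa> * (m * n)"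
        using abs_le_D2[OF H[OF g(2) snn(1), of 0, OF j(1)]] unfolding mn by simp
      ultimately show ?thesis by linarith
    qed
    have e2: "h r (real (Suc r * n)) \<zeta> \<le> (\<beta> r \<zeta> + \<kappa>) * (m * n)"
    proof -
      have "h r (real (Suc r * n)) \<zeta> - \<beta> r \<zeta> * (m * n) \<le> \<kappa> * (m * n)"
        using abs_le_D1[OF H[OF g(1) snn(1), of r, OF j(3)]] unfolding mn by simp
      then show ?thesis unfolding distrib_right by linarith
    qed
    have e3: "h (Suc r) (real n) \<zeta> \<ge> (\<beta> (Suc r) \<zeta> - \<kappa>) * n"
    proof -
      have "\<beta> (Suc r) \<zeta> * n - h (Suc r) (real n) \<zeta> \<le> \<kappa> * n"
        using abs_le_D2[OF H[OF g(1) nn(1), of "Suc r", OF j(4)]] by simp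
      then show ?thesis unfolding left_diff_distrib by linarith
    qed
    have e4: "h r (real (r * n)) \<zeta> \<ge> (\<beta> r \<zeta> - \<kappa>) * (real r * n)"
    proof -
      have "\<beta> r \<zeta> * real (r * n) - h r (real (r * n)) \<zeta> \<le> \<kappa> * real (r * n)"
        using abs_le_D2[OF H[OF g(1) snn(2), of r, OF j(3)]] by simp
      then show ?thesis unfolding left_diff_distrib of_nat_mult by linarith
    qed
    have Lk: "L n + k \<le> \<kappa> * n" using n1 nn by blast
    have "(\<beta> (Suc r) \<zeta> - \<kappa>) * n + (\<beta> r \<zeta> - \<kappa>) * (real r * n) \<le> 2 * \<kappa> * (m * n) + (\<beta> r \<zeta> + \<kappa>) * (m * n) + \<kappa> * n"
      using up lo e1 e2 e3 e4 Lk unfolding L_def by linarith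
    then have "((\<beta> (Suc r) \<zeta> - \<kappa>) + (\<beta> r \<zeta> - \<kappa>) * real r) * n \<le> (2 * \<kappa> * m + (\<beta> r \<zeta> + \<kappa>) * m + \<kappa>) * n"
      by (simp add: algebra_simps)
    then have "(\<beta> (Suc r) \<zeta> - \<kappa>) + (\<beta> r \<zeta> - \<kappa>) * real r \<le> 2 * \<kappa> * m + (\<beta> r \<zeta> + \<kappa>) * m + \<kappa>"
      using nn by simp
    then have "\<beta> (Suc r) \<zeta> - \<beta> r \<zeta> \<le> \<kappa> * (4 * m + 1)" by (simp add: m_def algebra_simps)
    moreover have "\<beta> (Suc r) \<zeta> - \<beta> r \<zeta> \<ge> 8 * m * \<kappa>"
      using g(1) m0 by (simp add: no_gain_def \<kappa>_def)
    ultimately have "\<kappa> * (8 * m) \<le> \<kappa> * (4 * m + 1)" by (simp add: mult_ac)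
    then have "8 * m \<le> 4 * m + 1" using \<kappa>0 by (simp only: mult_le_cancel_left_pos)
    then show False using m0 by simp
  qed
  then show ?thesis using \<epsilon>(1) by (intro exI[of _ \<epsilon>]) (auto simp: not_less)
qed

lemma finite_no_gain: assumes "r \<ge> 1" shows "finite (no_gain r k n0)"
proof (rule ccontr)
  assume inf: "infinite (no_gain r k n0)"
  have "no_gain r k n0 \<subseteq> cball 0 (real k)" by (auto simp: no_gain_def)
  then obtain x where x: "x islimpt no_gain r k n0"
    using inf compact_cball[of 0 "real k"] unfolding compact_eq_Bolzano_Weierstrass by metis
  obtain \<epsilon> where e: "\<epsilon> > 0" "\<And>\<zeta> \<zeta>'. \<zeta> \<in> no_gain r k n0 \<Longrightarrow> \<zeta>' \<in> no_gain r k n0 \<Longrightarrow> \<zeta> \<noteq> \<zeta>' \<Longrightarrow> cmod (\<zeta>' - \<zeta>) \<ge> \<epsilon>"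
    using no_gain_not_close[OF assms, of k n0] by blast
  obtain z1 where z1: "z1 \<in> no_gain r k n0" "z1 \<noteq> x" "dist z1 x < \<epsilon> / 2"
    using x e(1) unfolding islimpt_approachable by (meson half_gt_zero)
  obtain z2 where z2: "z2 \<in> no_gain r k n0" "z2 \<noteq> x" "dist z2 x < min (\<epsilon> / 2) (dist z1 x)"
    using x e(1) z1(2) unfolding islimpt_approachable by (metis half_gt_zero min_less_iff_conj zero_less_dist_iff)
  have "z1 \<noteq> z2" using z2 by auto
  moreover have "dist z2 z1 < \<epsilon>" using z1 z2 dist_triangle2[of z2 z1 x] by linarith
  ultimately show False using e(2)[OF z1(1) z2(1)] by (simp add: dist_norm)
qed

text \<open>Take the first order m at which \<beta> exceeds \<beta> 0; \<open>beta_large\<close>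
  supplies one, and m > 1 because \<beta> 1 = \<beta> 0. There is then a gap between r = m - 1 and
  m, and Archimedean choices of \<open>k\<close> and \<open>n0\<close> place the parameter in one of
  countably many finite sets.\<close>

lemma countable_no_gain:
  "countable {\<zeta>. Re \<zeta> > 0 \<and> \<beta> 1 \<zeta> = \<beta> 0 \<zeta> \<and> \<beta> 0 \<zeta> < p_entropy / lyap}"
proof (rule countable_subset)
  show "countable (\<Union>r\<in>{1..}. \<Union>k. \<Union>n0. no_gain r k n0)"
    by (intro countable_UN countableI_type countable_finite finite_no_gain) auto
  show "{\<zeta>. Re \<zeta> > 0 \<and> \<beta> 1 \<zeta> = \<beta> 0 \<zeta> \<and> \<beta> 0 \<zeta> < p_entropy / lyap} \<subseteq> (\<Union>r\<in>{1..}. \<Union>k. \<Union>n0. no_gain r k n0)"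
  proof safe
    fix \<zeta> assume \<zeta>: "Re \<zeta> > 0" "\<beta> 1 \<zeta> = \<beta> 0 \<zeta>" "\<beta> 0 \<zeta> < p_entropy / lyap"
    obtain N where N: "\<beta> N \<zeta> \<ge> p_entropy / lyap" using beta_large[OF \<zeta>(1)] by blast
    define m where "m = (LEAST m. \<beta> 0 \<zeta> < \<beta> m \<zeta>)"
    have m: "\<beta> 0 \<zeta> < \<beta> m \<zeta>" unfolding m_def by (rule LeastI[of _ N]) (use N \<zeta> in linarith)
    have ml: "\<not> \<beta> 0 \<zeta> < \<beta> j \<zeta>" if "j < m" for j using that not_less_Least unfolding m_def by blast
    have "m \<noteq> 0" using m by (metis less_irrefl)
    then obtain r where r: "m = Suc r" by (cases m) auto
    have r1: "r \<ge> 1" using m r \<zeta>(2) by (cases r) auto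
    have gap: "\<beta> r \<zeta> < \<beta> (Suc r) \<zeta>" using ml[of r] m r by simp
    obtain C where C: "\<And>y y'. y \<ge> 0 \<Longrightarrow> y' \<ge> 0 \<Longrightarrow> h (Suc r) y \<zeta> + h r y' \<zeta> - C \<le> ent \<mu> (\<lambda>\<omega>. (cell (Suc r) y \<zeta> \<omega>, cell r (y + y') \<zeta> \<omega>))"
      using joint_superadditive[OF \<zeta>(1), of "Suc r" r] by blast
    obtain k where k: "real k \<ge> 1 / Re \<zeta>" "real k \<ge> cmod \<zeta>" "real k \<ge> 1 / (\<beta> (Suc r) \<zeta> - \<beta> r \<zeta>)" "real k \<ge> C"
    proof -
      obtain k1 :: nat where "real k1 \<ge> max (max (1 / Re \<zeta>) (cmod \<zeta>)) (max (1 / (\<beta> (Suc r) \<zeta> - \<beta> r \<zeta>)) C)"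
        using real_arch_simple by blast
      then show thesis by (intro that[of k1]) auto
    qed
    define \<kappa> where "\<kappa> = 1 / (8 * real (Suc r) * real (Suc k))"
    have "\<kappa> > 0" by (simp add: \<kappa>_def)
    have "eventually (\<lambda>n. \<bar>h j (real n) \<zeta> - \<beta> j \<zeta> * n\<bar> \<le> \<kappa> * n) sequentially" for j
    proof -
      have "eventually (\<lambda>n. dist (h j (real n) \<zeta> / n) (\<beta> j \<zeta>) < \<kappa>) sequentially"
        using tendstoD[OF beta_limit(1)[OF \<zeta>(1)] \<open>\<kappa> > 0\<close>] .
      then show ?thesis using eventually_gt_at_top[of 0]
      proof eventually_elim
        case (elim n)
        have "h j (real n) \<zeta> - \<beta> j \<zeta> * n = (h j (real n) \<zeta> / n - \<beta> j \<zeta>) * n" using elim by (simp add: field_simps)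
        then have "\<bar>h j (real n) \<zeta> - \<beta> j \<zeta> * n\<bar> = \<bar>h j (real n) \<zeta> / n - \<beta> j \<zeta>\<bar> * n" by (simp add: abs_mult)
        also have "\<dots> \<le> \<kappa> * n" using elim by (intro mult_right_mono) (auto simp: dist_real_def)
        finally show ?case .
      qed
    qed
    then have "eventually (\<lambda>n. \<forall>j\<in>{0, 1, r, Suc r}. \<bar>h j (real n) \<zeta> - \<beta> j \<zeta> * n\<bar> \<le> \<kappa> * n) sequentially"
      by (intro eventually_ball_finite) auto
    then obtain n0 where n0: "\<And>n. n \<ge> n0 \<Longrightarrow> \<forall>j\<in>{0, 1, r, Suc r}. \<bar>h j (real n) \<zeta> - \<beta> j \<zeta> * n\<bar> \<le> \<kappa> * n"
      by (auto simp: eventually_sequentially)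
    have inv: "1 / real (Suc k) \<le> x" if "real k \<ge> 1 / x" "x > 0" for x :: real
    proof -
      have "1 / x \<le> real (Suc k)" using that by simp
      then show ?thesis using that(2) by (simp add: field_simps)
    qed
    have "\<zeta> \<in> no_gain r k n0"
      unfolding no_gain_def mem_Collect_eq
    proof (intro conjI)
      show "1 / real (Suc k) \<le> Re \<zeta>" using inv k(1) \<zeta>(1) by blast
      show "\<beta> r \<zeta> + 1 / real (Suc k) \<le> \<beta> (Suc r) \<zeta>" using inv[OF k(3)] gap by simp
      show "\<forall>y\<ge>0. \<forall>y'\<ge>0. h (Suc r) y \<zeta> + h r y' \<zeta> - k \<le> ent \<mu> (\<lambda>\<omega>. (cell (Suc r) y \<zeta> \<omega>, cell r (y + y') \<zeta> \<omega>))"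
        using C k(4) by (meson diff_left_mono order_trans)
      show "\<forall>n\<ge>n0. \<forall>j\<in>{0, 1, r, Suc r}. \<bar>h j (real n) \<zeta> - \<beta> j \<zeta> * n\<bar> \<le> 1 / (8 * real (Suc r) * real (Suc k)) * n"
        using n0 unfolding \<kappa>_def by blast
    qed (use k \<zeta> in auto)
    then show "\<zeta> \<in> (\<Union>r\<in>{1..}. \<Union>k. \<Union>n0. no_gain r k n0)" using r1 by auto
  qed
qed

end

section \<open>Masses of anisotropic boxes in the space of 1-jets\<close>

context fprob
begin

lemma powsum_le_1: assumes "fin_rv M f" "q \<ge> 1" shows "powsum q M f \<le> 1"
proof -
  have "powsum q M f \<le> (\<Sum>c\<in>range f. pr M f c) powr q"
    unfolding powsum_def using assms by (intro sum_powr_le_powr_sum) (auto simp: fin_rv_def)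
  then show ?thesis using sum_pr[OF assms(1)] by simp
qed

text \<open>Markov's inequality for power sums. If the neighbourhood of \<open>u\<close> has mass
  above \<open>\<rho>\<close>, so does the union \<open>N c\<close> of the cells it can meet, and
  \<open>Mc c powr (q - 1)\<close> exceeds \<open>\<rho> powr (q - 1)\<close>. Jensen over the at
  most \<open>K\<close> cells of \<open>N c\<close> gives \<open>K powr (q - 1)\<close>; by symmetry
  each cell occurs in at most \<open>K\<close> of the sets \<open>N c\<close>, which gives one more
  factor \<open>K\<close>.\<close>

lemma mass_tail:
  fixes near :: "'a \<Rightarrow> 'a \<Rightarrow> bool"
  assumes f: "fin_rv M f" and q: "1 < q" and \<rho>: "\<rho> > 0"
    and sym: "\<And>u v. near u v \<Longrightarrow> near v u"
    and meas: "\<And>u. {v. near u v} \<in> sets M"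
    and K: "\<And>c. real (card {f v |v. \<exists>u. f u = c \<and> near u v}) \<le> K"
  shows "\<exists>B\<in>sets M. {u. measure M {v. near u v} > \<rho>} \<subseteq> B \<and> measure M B \<le> \<rho> powr (1 - q) * ((1 + K powr q) * powsum q M f)"
proof -
  define P where "P = pr M f"
  define N where "N c = {f v |v. \<exists>u. f u = c \<and> near u v}" for c
  define Mc where "Mc c = (\<Sum>c'\<in>N c. P c')" for c
  define H where "H = {c\<in>range f. Mc c > \<rho>}"
  define B where "B = (\<Union>c\<in>H. {u. f u = c})"
  have fr: "finite (range f)" using f by (rule fin_rv_finite)
  have Nsub: "N c \<subseteq> range f" for c by (auto simp: N_def)
  have fN: "finite (N c)" for c using finite_subset[OF Nsub fr] .
  have fH: "finite H" using fr by (simp add: H_def)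
  have P0: "P c \<ge> 0" for c by (simp add: P_def)
  have Mc0: "Mc c \<ge> 0" for c unfolding Mc_def by (intro sum_nonneg P0)
  have K0: "K \<ge> 0" using K[of undefined] by linarith
  have Nsym: "c' \<in> N c \<longleftrightarrow> c \<in> N c'" if "c \<in> range f" "c' \<in> range f" for c c'
    unfolding N_def using sym by blast
  have sub: "{u. measure M {v. near u v} > \<rho>} \<subseteq> B"
  proof safe
    fix u assume u: "\<rho> < measure M {v. near u v}"
    have "measure M {v. near u v} \<le> measure M (\<Union>c'\<in>N (f u). {v. f v = c'})"
      by (intro finite_measure_mono) (auto simp: N_def intro!: sets.finite_UN fin_rv_sets[OF f] fN[unfolded N_def])
    also have "\<dots> = Mc (f u)" unfolding Mc_def P_def pr_def
      by (rule finite_measure_finite_Union) (use fN fin_rv_sets[OF f] in \<open>auto simp: disjoint_family_on_def\<close>)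
    finally show "u \<in> B" using u by (auto simp: B_def H_def)
  qed
  have mB: "measure M B = (\<Sum>c\<in>H. P c)" unfolding B_def P_def pr_def
    by (rule finite_measure_finite_Union) (use fH fin_rv_sets[OF f] in \<open>auto simp: disjoint_family_on_def\<close>)
  \<comment> \<open>\<open>N c\<close> need not contain \<open>c\<close> itself, so neither of
    \<open>P c\<close> and \<open>Mc c\<close> dominates the other in general, and both powers are
    kept.\<close>
  have step: "P c * Mc c powr (q - 1) \<le> P c powr q + Mc c powr q" for c
  proof -
    have e: "x * x powr (q - 1) = x powr q" if "x \<ge> 0" for x :: real
      using that q by (cases "x = 0") (auto simp: powr_mult_base)
    show ?thesis
    proof (cases "Mc c \<le> P c")
      case True
      then have "P c * Mc c powr (q - 1) \<le> P c * P c powr (q - 1)"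
        using P0 Mc0 q by (intro mult_left_mono powr_mono2) auto
      then show ?thesis using e[OF P0] by (metis add_increasing2 powr_ge_zero)
    next
      case False
      then have "P c * Mc c powr (q - 1) \<le> Mc c * Mc c powr (q - 1)"
        by (intro mult_right_mono) auto
      then show ?thesis using e[OF Mc0] by (metis add_increasing powr_ge_zero)
    qed
  qed
  have "(\<Sum>c\<in>H. P c) \<le> (\<Sum>c\<in>H. \<rho> powr (1 - q) * (P c * Mc c powr (q - 1)))"
  proof (intro sum_mono)
    fix c assume c: "c \<in> H"
    have "\<rho> powr (1 - q) * Mc c powr (q - 1) = (Mc c / \<rho>) powr (q - 1)"
      using c \<rho> by (simp add: powr_divide powr_diff H_def)
    also have "\<dots> \<ge> 1" using c \<rho> q by (intro ge_one_powr_ge_zero) (auto simp: H_def)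
    finally have "P c * 1 \<le> P c * (\<rho> powr (1 - q) * Mc c powr (q - 1))" by (intro mult_left_mono P0)
    then show "P c \<le> \<rho> powr (1 - q) * (P c * Mc c powr (q - 1))" by (simp add: mult_ac)
  qed
  also have "\<dots> \<le> (\<Sum>c\<in>range f. \<rho> powr (1 - q) * (P c * Mc c powr (q - 1)))"
    by (rule sum_mono2) (use fr P0 in \<open>auto simp: H_def\<close>)
  also have "\<dots> \<le> (\<Sum>c\<in>range f. \<rho> powr (1 - q) * (P c powr q + Mc c powr q))"
    by (intro sum_mono mult_left_mono step) auto
  also have "\<dots> = \<rho> powr (1 - q) * (powsum q M f + (\<Sum>c\<in>range f. Mc c powr q))"
    by (simp add: sum_distrib_left[symmetric] sum.distrib powsum_def P_def)
  finally have fin: "(\<Sum>c\<in>H. P c) \<le> \<rho> powr (1 - q) * (powsum q M f + (\<Sum>c\<in>range f. Mc c powr q))" .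
  have McK: "(\<Sum>c\<in>range f. Mc c powr q) \<le> K powr q * powsum q M f"
  proof -
    have "(\<Sum>c\<in>range f. Mc c powr q) \<le> (\<Sum>c\<in>range f. K powr (q - 1) * (\<Sum>c'\<in>N c. P c' powr q))"
      unfolding Mc_def by (intro sum_mono sum_powr_le_card) (use P0 q K in \<open>auto simp: N_def\<close>)
    also have "\<dots> = K powr (q - 1) * (\<Sum>c\<in>range f. \<Sum>c'\<in>range f. if c' \<in> N c then P c' powr q else 0)"
      unfolding sum_distrib_left[symmetric] using Nsub
      by (intro arg_cong[where f="\<lambda>x. K powr (q - 1) * x"] sum.cong refl sum.mono_neutral_cong_left) (use fr in auto)
    also have "\<dots> = K powr (q - 1) * (\<Sum>c'\<in>range f. \<Sum>c\<in>range f. if c \<in> N c' then P c' powr q else 0)"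
      by (subst sum.swap) (use Nsym in \<open>auto intro!: arg_cong[where f="\<lambda>x. K powr (q - 1) * x"] sum.cong\<close>)
    also have "\<dots> = K powr (q - 1) * (\<Sum>c'\<in>range f. real (card (N c')) * P c' powr q)"
    proof -
      have "(\<Sum>c\<in>range f. if c \<in> N c' then P c' powr q else 0) = real (card (N c')) * P c' powr q" for c'
      proof -
        have "(\<Sum>c\<in>range f. if c \<in> N c' then P c' powr q else 0) = (\<Sum>c\<in>N c'. P c' powr q)"
          by (rule sum.mono_neutral_cong_right) (use fr Nsub in auto)
        then show ?thesis by simp
      qed
      then show ?thesis by simp
    qed
    also have "\<dots> \<le> K powr (q - 1) * (\<Sum>c'\<in>range f. K * P c' powr q)"
      using K by (intro mult_left_mono sum_mono mult_right_mono) (auto simp: N_def)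
    also have "\<dots> = K powr (q - 1) * K * powsum q M f" by (simp add: sum_distrib_left[symmetric] powsum_def P_def)
    also have "K powr (q - 1) * K = K powr q" using K0 q by (cases "K = 0") (auto simp: powr_mult_base mult.commute)
    finally show ?thesis .
  qed
  have "measure M B \<le> \<rho> powr (1 - q) * (powsum q M f + K powr q * powsum q M f)"
    unfolding mB by (rule order_trans[OF fin]) (intro mult_left_mono add_left_mono McK, simp)
  moreover have "B \<in> sets M" unfolding B_def using fH fin_rv_sets[OF f] by (intro sets.finite_UN) auto
  ultimately show ?thesis using sub by (intro bexI[of _ B]) (auto simp: distrib_right)
qed

end

context ifs
begin

section \<open>Power sums of isotropic and anisotropic partitions\<close>

lemma stopn_fuel: "y \<le> c0 * real n \<Longrightarrow> n \<le> n' \<Longrightarrow> stopn a n' y \<omega> = stopn a n y \<omega>"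
proof (induction n arbitrary: y \<omega> n')
  case 0
  then show ?case by (cases n') auto
next
  case (Suc n)
  obtain k where k: "n' = Suc k" "n \<le> k" using Suc.prems(2) by (cases n') auto
  have "stopn a k (y + a (shd \<omega>)) (stl \<omega>) = stopn a n (y + a (shd \<omega>)) (stl \<omega>)"
    by (rule Suc.IH) (use Suc.prems(1) k a_le[of "shd \<omega>"] in \<open>auto simp: algebra_simps\<close>)
  then show ?case by (simp add: k(1))
qed

lemma stopn_mono: "y \<le> y' \<Longrightarrow> stopn a n y (stopn a n y' \<omega> @- \<omega>') = stopn a n y \<omega>"
  by (induction n arbitrary: y y' \<omega>) auto

lemma stopw_mono: assumes "y \<le> y'" shows "stopw y (stopw y' \<omega> @- \<omega>') = stopw y \<omega>"
proof -
  let ?N = "\<lambda>y. nat \<lceil>y / c0\<rceil>"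
  have b: "y \<le> c0 * real (?N y)" for y
  proof -
    have "y / c0 \<le> real (?N y)" by linarith
    then show ?thesis using c0_pos by (simp add: field_simps)
  qed
  have le: "?N y \<le> ?N y'" using assms c0_pos by (intro nat_mono ceiling_mono divide_right_mono) auto
  have "stopw y x = stopn a (?N y') y x" for x
    unfolding stopw_def using stopn_fuel[OF b le] by simp
  then show ?thesis unfolding stopw_def[of y'] using stopn_mono[OF assms] by simp
qed

abbreviation tc :: "nat \<Rightarrow> real \<Rightarrow> complex \<Rightarrow> 'n stream \<Rightarrow> (int \<times> int) list" where
  "tc m y \<zeta> \<omega> \<equiv> tcell m y \<zeta> (stopw y \<omega>)"

definition C3 :: "nat \<Rightarrow> complex \<Rightarrow> real" where
  "C3 m \<zeta> = exp (Re \<zeta> * c1) * (1 + c1) ^ m * (2 * CB m (Re \<zeta>) + 2)"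

definition C4 :: "nat \<Rightarrow> complex \<Rightarrow> real" where
  "C4 m \<zeta> = EE m (Re \<zeta>) * (2 * CB m (Re \<zeta>) + 2) + 2 * CB m (Re \<zeta>)"

lemma C34_nonneg: assumes "Re \<zeta> > 0" shows "C3 m \<zeta> \<ge> 0" "C4 m \<zeta> \<ge> 0"
  using CB_nonneg[OF assms, of m] EE_nonneg[OF assms, of m] c1_pos by (auto simp: C3_def C4_def)

lemma tc_fcell: "tc m y \<zeta> \<omega> = fcell m (\<lambda>j \<omega>. V j y \<zeta> (stopw y \<omega> @- u0)) \<omega>"
  using fun_cong[OF tcell_eq] .

text \<open>Behind the stopped prefix an independent copy is seen at level \<open>x\<close> up to
  the overshoot, so one more block multiplies the power sum by that of
  \<open>cell m x \<zeta>\<close>. The constant is raised to the power q - 1, so its contribution is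
  small against the entropy of a long block.\<close>

lemma powsum_refine:
  assumes \<zeta>: "Re \<zeta> > 0" and q: "q \<ge> 1" and y: "y \<ge> 0" "x \<ge> 0"
  shows "powsum q \<mu> (\<lambda>\<omega>. (\<Phi> (stopw y \<omega>), tc m (y + x) \<zeta> \<omega>)) \<le> powsum q \<mu> (\<lambda>\<omega>. \<Phi> (stopw y \<omega>)) * (Kc m (C3 m \<zeta>) powr (q - 1) * powsum q \<mu> (cell m x \<zeta>))"
proof (rule powsum_stopw_le[OF fin_rv_tcell q])
  fix w assume "w \<in> range (stopw y)"
  then obtain \<omega>0 where w: "w = stopw y \<omega>0" by auto
  define \<xi> where "\<xi> = - (y + Aw w)"
  have \<xi>: "0 \<le> \<xi>" "\<xi> \<le> c1" using stopw_Aw[of y \<omega>0] stopw_Aw_ge[OF y(1), of \<omega>0] by (auto simp: \<xi>_def w)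
  show "powsum q \<mu> (\<lambda>\<omega>. tc m (y + x) \<zeta> (w @- \<omega>)) \<le> Kc m (C3 m \<zeta>) powr (q - 1) * powsum q \<mu> (cell m x \<zeta>)"
  proof (rule powsum_fibre[OF fin_rv_shift[OF fin_rv_tcell] fin_rv_cell[OF \<zeta> y(2)] q])
    fix d
    show "real (card {cell m x \<zeta> \<omega> |\<omega>. tc m (y + x) \<zeta> (w @- \<omega>) = d}) \<le> Kc m (C3 m \<zeta>)"
    proof (rule fcell_fibre[OF C34_nonneg(1)[OF \<zeta>]])
      fix u v j assume e: "tc m (y + x) \<zeta> (w @- u) = tc m (y + x) \<zeta> (w @- v)" and j: "j \<le> m"
      have "cmod (V l (x - \<xi>) \<zeta> u - V l (x - \<xi>) \<zeta> v) \<le> 2 * CB m (Re \<zeta>) + 2" if "l \<le> m" for l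
      proof -
        have "cmod (V l (y + x) \<zeta> (w @- u) - V l (y + x) \<zeta> (w @- v)) \<le> 2 * CB m (Re \<zeta>) + 2"
          by (rule tcell_V_diff[OF \<zeta> that e])
        moreover have "y + x + Aw w = x - \<xi>" by (simp add: \<xi>_def)
        ultimately show ?thesis unfolding V_shift_diff[OF \<zeta>] by (simp add: norm_mult)
      qed
      then have "cmod (V j (x - \<xi> + \<xi>) \<zeta> u - V j (x - \<xi> + \<xi>) \<zeta> v) \<le> C3 m \<zeta>"
        unfolding C3_def by (intro V_diff_refine[OF \<zeta> \<xi> j])
      then show "cmod (V j x \<zeta> u - V j x \<zeta> v) \<le> C3 m \<zeta>" by simp
    qed
  qed
qed

text \<open>Cells of different levels are not nested, but a fine cell leaves only boundedly many
  coarse ones. This allows earlier levels to be forgotten after each refinement.\<close>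

lemma tc_coarse_fibre:
  assumes \<zeta>: "Re \<zeta> > 0" and x: "x \<ge> 0" and g: "\<And>u v. g u = g v \<Longrightarrow> tc m (y + x) \<zeta> u = tc m (y + x) \<zeta> v"
  shows "real (card {tc m y \<zeta> \<omega> |\<omega>. g \<omega> = d}) \<le> Kc m (C4 m \<zeta>)"
  unfolding tc_fcell
proof (rule fcell_fibre[OF C34_nonneg(2)[OF \<zeta>]])
  fix u v j assume e: "g u = g v" and j: "j \<le> m"
  let ?D = "2 * CB m (Re \<zeta>) + 2"
  have D: "?D \<ge> 0" using CB_nonneg[OF \<zeta>, of m] by simp
  have "cmod (V j y \<zeta> u - V j y \<zeta> v) \<le> EE m (Re \<zeta>) * ?D * exp (- Re \<zeta> * x / 2)"
    by (rule V_diff_coarsen[OF \<zeta> x j tcell_V_diff[OF \<zeta> _ g[OF e]]])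
  also have "\<dots> \<le> EE m (Re \<zeta>) * ?D * 1" using EE_nonneg[OF \<zeta>, of m] D \<zeta> x by (intro mult_left_mono) auto
  finally have "cmod (V j y \<zeta> u - V j y \<zeta> v) \<le> EE m (Re \<zeta>) * ?D" by simp
  moreover note V_stopw_diff[OF \<zeta> j, of y u] V_stopw_diff[OF \<zeta> j, of y v]
  moreover have "cmod (V j y \<zeta> (stopw y u @- u0) - V j y \<zeta> (stopw y v @- u0)) \<le> cmod (V j y \<zeta> u - V j y \<zeta> (stopw y u @- u0)) + cmod (V j y \<zeta> u - V j y \<zeta> v) + cmod (V j y \<zeta> v - V j y \<zeta> (stopw y v @- u0))"
    by norm
  ultimately show "cmod (V j y \<zeta> (stopw y u @- u0) - V j y \<zeta> (stopw y v @- u0)) \<le> C4 m \<zeta>"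
    unfolding C4_def by linarith
qed

definition KK :: "nat \<Rightarrow> complex \<Rightarrow> real" where "KK m \<zeta> = Kc m (C3 m \<zeta>) * Kc m (C4 m \<zeta>)"

lemma KK_pos: "Re \<zeta> > 0 \<Longrightarrow> KK m \<zeta> > 0"
  unfolding KK_def using Kc_pos C34_nonneg by (intro mult_pos_pos) auto

lemma powsum_phase1:
  assumes \<zeta>: "Re \<zeta> > 0" and q: "q \<ge> 1" and x: "x \<ge> 0"
  shows "powsum q \<mu> (tc m (real n * x) \<zeta>) \<le> (KK m \<zeta> powr (q - 1) * powsum q \<mu> (cell m x \<zeta>)) ^ n"
proof (induction n)
  case 0 show ?case using powsum_le_1[OF fin_rv_tcell q] by simp
next
  case (Suc n)
  let ?y = "real n * x" and ?S = "powsum q \<mu> (cell m x \<zeta>)"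
  have y: "?y \<ge> 0" "real (Suc n) * x = ?y + x" using x by (auto simp: algebra_simps)
  have "powsum q \<mu> (tc m (?y + x) \<zeta>) \<le> Kc m (C4 m \<zeta>) powr (q - 1) * powsum q \<mu> (\<lambda>\<omega>. (tc m ?y \<zeta> \<omega>, tc m (?y + x) \<zeta> \<omega>))"
  proof (rule powsum_fibre[OF fin_rv_tcell fin_rv_Pair[OF fin_rv_tcell fin_rv_tcell] q])
    fix d
    have f: "finite {tc m ?y \<zeta> \<omega> |\<omega>. tc m (?y + x) \<zeta> \<omega> = d}"
      by (rule finite_subset[OF _ fin_rv_finite[OF fin_rv_tcell[of m ?y \<zeta>]]]) auto
    have "card {(tc m ?y \<zeta> \<omega>, tc m (?y + x) \<zeta> \<omega>) |\<omega>. tc m (?y + x) \<zeta> \<omega> = d} \<le> card {tc m ?y \<zeta> \<omega> |\<omega>. tc m (?y + x) \<zeta> \<omega> = d}"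
      by (rule card_inj_on_le[where f=fst]) (auto simp: inj_on_def f)
    then show "real (card {(tc m ?y \<zeta> \<omega>, tc m (?y + x) \<zeta> \<omega>) |\<omega>. tc m (?y + x) \<zeta> \<omega> = d}) \<le> Kc m (C4 m \<zeta>)"
      using tc_coarse_fibre[OF \<zeta> x, of "tc m (?y + x) \<zeta>" m ?y d] by linarith
  qed
  also have "\<dots> \<le> Kc m (C4 m \<zeta>) powr (q - 1) * (powsum q \<mu> (tc m ?y \<zeta>) * (Kc m (C3 m \<zeta>) powr (q - 1) * ?S))"
    by (intro mult_left_mono powsum_refine[OF \<zeta> q y(1) x]) auto
  also have "\<dots> = (KK m \<zeta> powr (q - 1) * ?S) * powsum q \<mu> (tc m ?y \<zeta>)"
    unfolding KK_def using Kc_pos[OF C34_nonneg(1)[OF \<zeta>], of m] Kc_pos[OF C34_nonneg(2)[OF \<zeta>], of m] by (simp add: powr_mult)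
  also have "\<dots> \<le> (KK m \<zeta> powr (q - 1) * ?S) * (KK m \<zeta> powr (q - 1) * ?S) ^ n"
    using Suc by (intro mult_left_mono) (auto simp: powsum_nonneg)
  finally show ?case by (simp only: y(2) power_Suc)
qed

text \<open>Starting from the 1-jet at level \<open>z\<close>, the further blocks refine the value
  only. With \<open>z = n * x\<close> the value is resolved to the square of the scale of the
  derivative, which gives the anisotropic boxes.\<close>

lemma powsum_phase2:
  assumes \<zeta>: "Re \<zeta> > 0" and q: "q \<ge> 1" and x: "x \<ge> 0" "z \<ge> 0"
  shows "powsum q \<mu> (\<lambda>\<omega>. (tc 1 z \<zeta> \<omega>, tc 0 (z + real n * x) \<zeta> \<omega>)) \<le> powsum q \<mu> (tc 1 z \<zeta>) * (KK 0 \<zeta> powr (q - 1) * powsum q \<mu> (cell 0 x \<zeta>)) ^ n"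
proof (induction n)
  case 0
  have "powsum q \<mu> (\<lambda>\<omega>. (tc 1 z \<zeta> \<omega>, tc 0 z \<zeta> \<omega>)) \<le> 1 powr (q - 1) * powsum q \<mu> (tc 1 z \<zeta>)"
  proof (rule powsum_fibre[OF fin_rv_Pair[OF fin_rv_tcell fin_rv_tcell] fin_rv_tcell q])
    fix d
    have "{tc 1 z \<zeta> \<omega> |\<omega>. (tc 1 z \<zeta> \<omega>, tc 0 z \<zeta> \<omega>) = d} \<subseteq> {fst d}" by auto
    then have "card {tc 1 z \<zeta> \<omega> |\<omega>. (tc 1 z \<zeta> \<omega>, tc 0 z \<zeta> \<omega>) = d} \<le> card {fst d}" by (intro card_mono) auto
    then show "real (card {tc 1 z \<zeta> \<omega> |\<omega>. (tc 1 z \<zeta> \<omega>, tc 0 z \<zeta> \<omega>) = d}) \<le> 1" by simp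
  qed
  then show ?case by simp
next
  case (Suc n)
  define y where "y = z + real n * x"
  have y: "y \<ge> 0" "z \<le> y" "z + real (Suc n) * x = y + x" using x by (auto simp: y_def algebra_simps)
  let ?S = "powsum q \<mu> (cell 0 x \<zeta>)"
  \<comment> \<open>The jet cell at the lower level \<open>z\<close> is a function of the word
    stopped at \<open>y\<close>, because by \<open>stopw_mono\<close> that word determines the one
    stopped at \<open>z\<close>. So both coordinates can be carried as prefix information.\<close>
  let ?\<Phi> = "\<lambda>w. (tc 1 z \<zeta> (w @- u0), tcell 0 y \<zeta> w)"
  have \<Phi>: "?\<Phi> (stopw y \<omega>) = (tc 1 z \<zeta> \<omega>, tc 0 y \<zeta> \<omega>)" for \<omega>
    using stopw_mono[OF y(2)] by simp
  have "powsum q \<mu> (\<lambda>\<omega>. (tc 1 z \<zeta> \<omega>, tc 0 (y + x) \<zeta> \<omega>)) \<le> Kc 0 (C4 0 \<zeta>) powr (q - 1) * powsum q \<mu> (\<lambda>\<omega>. (?\<Phi> (stopw y \<omega>), tc 0 (y + x) \<zeta> \<omega>))"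
    unfolding \<Phi>
  proof (rule powsum_fibre[OF fin_rv_Pair[OF fin_rv_tcell fin_rv_tcell] fin_rv_Pair[OF fin_rv_Pair[OF fin_rv_tcell fin_rv_tcell] fin_rv_tcell] q])
    fix d
    let ?A = "{((tc 1 z \<zeta> \<omega>, tc 0 y \<zeta> \<omega>), tc 0 (y + x) \<zeta> \<omega>) |\<omega>. (tc 1 z \<zeta> \<omega>, tc 0 (y + x) \<zeta> \<omega>) = d}"
    let ?B = "{tc 0 y \<zeta> \<omega> |\<omega>. (tc 1 z \<zeta> \<omega>, tc 0 (y + x) \<zeta> \<omega>) = d}"
    have f: "finite ?B"
      by (rule finite_subset[OF _ fin_rv_finite[OF fin_rv_tcell[of 0 y \<zeta>]]]) auto
    have "card ?A \<le> card ?B"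
      by (rule card_inj_on_le[where f="\<lambda>z. snd (fst z)", OF _ _ f]) (auto simp: inj_on_def)
    then show "real (card ?A) \<le> Kc 0 (C4 0 \<zeta>)"
      using tc_coarse_fibre[OF \<zeta> x(1), of "\<lambda>\<omega>. (tc 1 z \<zeta> \<omega>, tc 0 (y + x) \<zeta> \<omega>)" 0 y d] by auto
  qed
  also have "\<dots> \<le> Kc 0 (C4 0 \<zeta>) powr (q - 1) * (powsum q \<mu> (\<lambda>\<omega>. ?\<Phi> (stopw y \<omega>)) * (Kc 0 (C3 0 \<zeta>) powr (q - 1) * ?S))"
    by (intro mult_left_mono powsum_refine[OF \<zeta> q y(1) x(1), where \<Phi>="?\<Phi>"]) auto
  also have "\<dots> = (KK 0 \<zeta> powr (q - 1) * ?S) * powsum q \<mu> (\<lambda>\<omega>. (tc 1 z \<zeta> \<omega>, tc 0 y \<zeta> \<omega>))"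
    unfolding \<Phi> KK_def using Kc_pos[OF C34_nonneg(1)[OF \<zeta>], of 0] Kc_pos[OF C34_nonneg(2)[OF \<zeta>], of 0] by (simp add: powr_mult)
  also have "\<dots> \<le> (KK 0 \<zeta> powr (q - 1) * ?S) * (powsum q \<mu> (tc 1 z \<zeta>) * (KK 0 \<zeta> powr (q - 1) * ?S) ^ n)"
    using Suc by (intro mult_left_mono) (auto simp: powsum_nonneg y_def)
  finally show ?case unfolding y(3) by (simp only: power_Suc mult_ac)
qed

section \<open>Masses of boxes around typical points\<close>

definition near :: "complex \<Rightarrow> real \<Rightarrow> real \<Rightarrow> 'n stream \<Rightarrow> 'n stream \<Rightarrow> bool" where
  "near \<zeta> r1 r2 u v \<longleftrightarrow> cmod (V 0 0 \<zeta> u - V 0 0 \<zeta> v) \<le> r1 \<and> cmod (V 1 0 \<zeta> u - V 1 0 \<zeta> v) \<le> r2"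

lemma near_sym: "near \<zeta> r1 r2 u v \<Longrightarrow> near \<zeta> r1 r2 v u"
  by (simp add: near_def norm_minus_commute)

lemma near_sets: "{v. near \<zeta> r1 r2 u v} \<in> sets \<mu>"
proof -
  have "Measurable.pred \<mu> (\<lambda>v. near \<zeta> r1 r2 u v)" unfolding near_def by measurable
  then show ?thesis by (simp add: pred_def)
qed

definition C5 :: "complex \<Rightarrow> real" where
  "C5 \<zeta> = 4 * CB 1 (Re \<zeta>) + 4 * CB 0 (Re \<zeta>) + 4 + 2 / Re \<zeta>"

text \<open>At level \<open>y\<close> the derivative picks up y times the difference of the values.
  That difference is at most exp(- 2 y Re \<zeta>), and y exp(- y Re \<zeta>) \<le> 1 / Re \<zeta>,
  so the leak is bounded; it accounts for the summand \<open>2 / Re \<zeta>\<close> in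
  \<open>C5\<close>.\<close>

lemma near_fibre:
  assumes \<zeta>: "Re \<zeta> > 0" and y: "y \<ge> 0"
  defines "f \<equiv> \<lambda>\<omega>. (tc 1 y \<zeta> \<omega>, tc 0 (2 * y) \<zeta> \<omega>)"
  shows "real (card {f v |v. \<exists>u. f u = c \<and> near \<zeta> (exp (- 2 * Re \<zeta> * y)) (exp (- Re \<zeta> * y)) u v}) \<le> Kc 1 (C5 \<zeta>) * Kc 0 (C5 \<zeta>)"
proof -
  let ?s = "Re \<zeta>" and ?near = "near \<zeta> (exp (- 2 * Re \<zeta> * y)) (exp (- Re \<zeta> * y))"
  define S where "S = {v. \<exists>u. f u = c \<and> ?near u v}"
  have C5: "C5 \<zeta> \<ge> 0" using CB_nonneg[OF \<zeta>] \<zeta> by (simp add: C5_def)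
  have bnd: "cmod (V j z \<zeta> (stopw z v @- u0) - V j z \<zeta> (stopw z v' @- u0)) \<le> C5 \<zeta>"
    if v: "v \<in> S" "v' \<in> S" and j: "j \<le> m" and m: "m \<le> 1"
      and tcm: "\<And>u u'. f u = f u' \<Longrightarrow> tc m z \<zeta> u = tc m z \<zeta> u'"
      and nr: "\<And>u v. ?near u v \<Longrightarrow> cmod (V j z \<zeta> u - V j z \<zeta> v) \<le> 1 + 1 / ?s" for v v' j m z
  proof -
    obtain u u' where u: "f u = c" "?near u v" "f u' = c" "?near u' v'" using v by (auto simp: S_def)
    have "cmod (V j z \<zeta> u - V j z \<zeta> u') \<le> 2 * CB m ?s + 2"
      by (rule tcell_V_diff[OF \<zeta> j tcm]) (use u in simp)
    moreover note nr[OF u(2)] nr[OF u(4)] V_stopw_diff[OF \<zeta> j, of z v] V_stopw_diff[OF \<zeta> j, of z v']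
    moreover have "cmod (V j z \<zeta> (stopw z v @- u0) - V j z \<zeta> (stopw z v' @- u0)) \<le>
        cmod (V j z \<zeta> v - V j z \<zeta> (stopw z v @- u0)) + cmod (V j z \<zeta> u - V j z \<zeta> v) + cmod (V j z \<zeta> u - V j z \<zeta> u')
        + cmod (V j z \<zeta> u' - V j z \<zeta> v') + cmod (V j z \<zeta> v' - V j z \<zeta> (stopw z v' @- u0))"
      by norm
    moreover have "4 * CB m ?s \<le> 4 * CB 1 ?s + 4 * CB 0 ?s" using m CB_nonneg[OF \<zeta>] by (cases m) auto
    moreover have "2 / ?s = 1 / ?s + 1 / ?s" by simp
    ultimately show ?thesis unfolding C5_def by linarith
  qed
  have n0: "cmod (V 0 z \<zeta> u - V 0 z \<zeta> v) = exp (?s * z) * cmod (V 0 0 \<zeta> u - V 0 0 \<zeta> v)" for z u v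
  proof -
    have e: "V 0 (0 + z) \<zeta> w = exp (\<zeta> * of_real z) * V 0 0 \<zeta> w" for w by (subst V_change[OF \<zeta>]) simp
    have "V 0 (0 + z) \<zeta> u - V 0 (0 + z) \<zeta> v = exp (\<zeta> * of_real z) * (V 0 0 \<zeta> u - V 0 0 \<zeta> v)"
      unfolding e by (simp only: right_diff_distrib)
    then show ?thesis by (simp add: norm_mult)
  qed
  have n1: "cmod (V 1 z \<zeta> u - V 1 z \<zeta> v) \<le> exp (?s * z) * (cmod (V 1 0 \<zeta> u - V 1 0 \<zeta> v) + \<bar>z\<bar> * cmod (V 0 0 \<zeta> u - V 0 0 \<zeta> v))" for z u v
  proof -
    have e: "V 1 (0 + z) \<zeta> w = exp (\<zeta> * of_real z) * (V 1 0 \<zeta> w + of_real z * V 0 0 \<zeta> w)" for w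
      by (subst V_change[OF \<zeta>]) (simp add: algebra_simps)
    have "V 1 (0 + z) \<zeta> u - V 1 (0 + z) \<zeta> v = exp (\<zeta> * of_real z) * ((V 1 0 \<zeta> u - V 1 0 \<zeta> v) + of_real z * (V 0 0 \<zeta> u - V 0 0 \<zeta> v))"
      unfolding e by (simp add: algebra_simps)
    then have "cmod (V 1 z \<zeta> u - V 1 z \<zeta> v) = exp (?s * z) * cmod ((V 1 0 \<zeta> u - V 1 0 \<zeta> v) + of_real z * (V 0 0 \<zeta> u - V 0 0 \<zeta> v))"
      by (simp add: norm_mult)
    also have "\<dots> \<le> exp (?s * z) * (cmod (V 1 0 \<zeta> u - V 1 0 \<zeta> v) + cmod (of_real z * (V 0 0 \<zeta> u - V 0 0 \<zeta> v)))"
      by (intro mult_left_mono norm_triangle_ineq) auto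
    finally show ?thesis by (simp add: norm_mult)
  qed
  have yexp: "y * exp (- ?s * y) \<le> 1 / ?s"
  proof -
    have "?s * y \<le> exp (?s * y)" using exp_ge_add_one_self[of "?s * y"] by linarith
    then have "?s * y * exp (- (?s * y)) \<le> exp (?s * y) * exp (- (?s * y))" by (intro mult_right_mono) auto
    then have "?s * (y * exp (- ?s * y)) \<le> 1" by (simp add: exp_minus_inverse mult_ac)
    then show ?thesis using \<zeta> by (simp add: field_simps)
  qed
  have s1: "1 / ?s > 0" using \<zeta> by simp
  have nr2: "cmod (V 0 (2 * y) \<zeta> u - V 0 (2 * y) \<zeta> v) \<le> 1 + 1 / ?s" if "?near u v" for u v
  proof -
    have "cmod (V 0 (2 * y) \<zeta> u - V 0 (2 * y) \<zeta> v) \<le> exp (?s * (2 * y)) * exp (- 2 * ?s * y)"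
      unfolding n0[of "2 * y"] using that by (intro mult_left_mono) (auto simp: near_def)
    also have "\<dots> = 1" unfolding exp_add[symmetric] by simp
    finally show ?thesis using s1 by linarith
  qed
  have nr0: "cmod (V 0 y \<zeta> u - V 0 y \<zeta> v) \<le> 1 + 1 / ?s" if "?near u v" for u v
  proof -
    have "cmod (V 0 y \<zeta> u - V 0 y \<zeta> v) \<le> exp (?s * y) * exp (- 2 * ?s * y)"
      unfolding n0[of y] using that by (intro mult_left_mono) (auto simp: near_def)
    also have "\<dots> \<le> exp 0" unfolding exp_add[symmetric] exp_le_cancel_iff using \<zeta> y by simp
    finally have "cmod (V 0 y \<zeta> u - V 0 y \<zeta> v) \<le> 1" by simp
    then show ?thesis using s1 by linarith
  qed
  have nr1: "cmod (V 1 y \<zeta> u - V 1 y \<zeta> v) \<le> 1 + 1 / ?s" if "?near u v" for u v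
  proof -
    have "cmod (V 1 y \<zeta> u - V 1 y \<zeta> v) \<le> exp (?s * y) * (cmod (V 1 0 \<zeta> u - V 1 0 \<zeta> v) + \<bar>y\<bar> * cmod (V 0 0 \<zeta> u - V 0 0 \<zeta> v))"
      by (rule n1)
    also have "\<dots> \<le> exp (?s * y) * (exp (- ?s * y) + y * exp (- 2 * ?s * y))"
      using that y by (intro mult_left_mono add_mono) (auto simp: near_def intro!: mult_left_mono)
    also have "\<dots> = exp (?s * y + - ?s * y) + y * exp (?s * y + - 2 * ?s * y)"
      by (simp only: exp_add distrib_left mult_ac)
    also have "\<dots> = 1 + y * exp (- ?s * y)" by simp
    finally show ?thesis using yexp by linarith
  qed
  have t1: "finite (tc 1 y \<zeta> ` S)" "real (card (tc 1 y \<zeta> ` S)) \<le> Kc 1 (C5 \<zeta>)"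
  proof -
    have b: "cmod (V j y \<zeta> (stopw y v @- u0) - V j y \<zeta> (stopw y v' @- u0)) \<le> C5 \<zeta>" if "v \<in> S" "v' \<in> S" "j \<le> 1" for v v' j
    proof (rule bnd[OF that order_refl])
      show "cmod (V j y \<zeta> u - V j y \<zeta> v) \<le> 1 + 1 / ?s" if "?near u v" for u v
        using nr0[OF that] nr1[OF that] \<open>j \<le> 1\<close> by (cases j) auto
    qed (auto simp: f_def)
    show "finite (tc 1 y \<zeta> ` S)" "real (card (tc 1 y \<zeta> ` S)) \<le> Kc 1 (C5 \<zeta>)"
      unfolding tc_fcell using fcell_card[OF C5, of S 1 "\<lambda>j \<omega>. V j y \<zeta> (stopw y \<omega> @- u0)"] b by auto
  qed
  have t2: "finite (tc 0 (2 * y) \<zeta> ` S)" "real (card (tc 0 (2 * y) \<zeta> ` S)) \<le> Kc 0 (C5 \<zeta>)"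
  proof -
    have b: "cmod (V j (2 * y) \<zeta> (stopw (2 * y) v @- u0) - V j (2 * y) \<zeta> (stopw (2 * y) v' @- u0)) \<le> C5 \<zeta>" if "v \<in> S" "v' \<in> S" "j \<le> 0" for v v' j
    proof (rule bnd[OF that])
      show "cmod (V j (2 * y) \<zeta> u - V j (2 * y) \<zeta> v) \<le> 1 + 1 / ?s" if "?near u v" for u v
        using nr2[OF that] \<open>j \<le> 0\<close> by simp
    qed (auto simp: f_def)
    show "finite (tc 0 (2 * y) \<zeta> ` S)" "real (card (tc 0 (2 * y) \<zeta> ` S)) \<le> Kc 0 (C5 \<zeta>)"
      unfolding tc_fcell using fcell_card[OF C5, of S 0 "\<lambda>j \<omega>. V j (2 * y) \<zeta> (stopw (2 * y) \<omega> @- u0)"] b by auto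
  qed
  have "{f v |v. \<exists>u. f u = c \<and> ?near u v} \<subseteq> (tc 1 y \<zeta> ` S) \<times> (tc 0 (2 * y) \<zeta> ` S)"
    unfolding S_def f_def by auto
  then have "card {f v |v. \<exists>u. f u = c \<and> ?near u v} \<le> card ((tc 1 y \<zeta> ` S) \<times> (tc 0 (2 * y) \<zeta> ` S))"
    using t1(1) t2(1) by (intro card_mono) auto
  then have "real (card {f v |v. \<exists>u. f u = c \<and> ?near u v}) \<le> real (card ((tc 1 y \<zeta> ` S) \<times> (tc 0 (2 * y) \<zeta> ` S)))"
    by (rule of_nat_mono)
  also have "\<dots> = real (card (tc 1 y \<zeta> ` S)) * real (card (tc 0 (2 * y) \<zeta> ` S))"
    unfolding card_cartesian_product by (rule of_nat_mult)
  also have "\<dots> \<le> Kc 1 (C5 \<zeta>) * Kc 0 (C5 \<zeta>)" using t1(2) t2(2) Kc_pos[OF C5, of 1] by (intro mult_mono) auto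
  finally show ?thesis .
qed

text \<open>First the block length \<open>x\<close> is taken so large that the two block entropies
  exceed \<open>(d + 2 * \<kappa>) * x\<close> even after paying \<open>L\<close>. Then q is taken
  close to 1, so that the power sum after n blocks is at most exp(- (q - 1) (d + 2 \<kappa>) n x).
  \<open>mass_tail\<close> with threshold exp(- d n x) leaves sets of summable measure, and
  Borel-Cantelli applies.\<close>

lemma box_mass_levels:
  assumes \<zeta>: "Re \<zeta> > 0" and d: "d < \<beta> 0 \<zeta> + \<beta> 1 \<zeta>"
  shows "\<exists>n1\<ge>1. AE u in \<mu>. \<forall>\<^sub>F n in sequentially.
    measure \<mu> {v. near \<zeta> (exp (- 2 * Re \<zeta> * (real n * real n1))) (exp (- Re \<zeta> * (real n * real n1))) u v} \<le> exp (- d * (real n * real n1))"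
proof -
  define \<kappa> where "\<kappa> = (\<beta> 0 \<zeta> + \<beta> 1 \<zeta> - d) / 3"
  have \<kappa>: "\<kappa> > 0" using d by (simp add: \<kappa>_def)
  define L where "L = ln (KK 0 \<zeta>) + ln (KK 1 \<zeta>)"
  have "(\<lambda>n. h 0 (real n) \<zeta> / n + h 1 (real n) \<zeta> / n - L / real n) \<longlonglongrightarrow> \<beta> 0 \<zeta> + \<beta> 1 \<zeta> - 0"
    by (intro tendsto_intros beta_limit(1)[OF \<zeta>] lim_const_over_n)
  then have "eventually (\<lambda>n. d + 2 * \<kappa> < h 0 (real n) \<zeta> / n + h 1 (real n) \<zeta> / n - L / real n) sequentially"
    by (rule order_tendstoD) (use \<kappa> in \<open>simp add: \<kappa>_def field_simps\<close>)
  then obtain n1 where n1: "n1 \<ge> 1" "d + 2 * \<kappa> < h 0 (real n1) \<zeta> / n1 + h 1 (real n1) \<zeta> / n1 - L / real n1"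
    unfolding eventually_sequentially by (metis max.cobounded1 max.cobounded2)
  define x where "x = real n1"
  have x: "x \<ge> 1" using n1 by (simp add: x_def)
  have "(d + 2 * \<kappa>) * x < (h 0 x \<zeta> / x + h 1 x \<zeta> / x - L / x) * x"
    using n1(2) x by (intro mult_strict_right_mono) (auto simp: x_def)
  also have "\<dots> = h 0 x \<zeta> + h 1 x \<zeta> - L" using x by (simp add: algebra_simps)
  finally have hx: "(d + 2 * \<kappa>) * x < h 0 x \<zeta> + h 1 x \<zeta> - L" .
  define e where "e = h 0 x \<zeta> + h 1 x \<zeta> - L - (d + 2 * \<kappa>) * x"
  have e: "e > 0" using hx by (simp add: e_def)
  have c: "fin_rv \<mu> (cell m x \<zeta>)" for m using fin_rv_cell[OF \<zeta>] x by simp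
  have "eventually (\<lambda>q. (powsum q \<mu> (cell 0 x \<zeta>) < exp (- (q - 1) * (h 0 x \<zeta> - e / 2)) \<and> powsum q \<mu> (cell 1 x \<zeta>) < exp (- (q - 1) * (h 1 x \<zeta> - e / 2))) \<and> q > 1) (at_right 1)"
    using e by (intro eventually_conj eventually_powsum_less[OF c] eventually_at_right_less) (auto simp: h_def)
  then obtain q where q: "powsum q \<mu> (cell 0 x \<zeta>) < exp (- (q - 1) * (h 0 x \<zeta> - e / 2))" "powsum q \<mu> (cell 1 x \<zeta>) < exp (- (q - 1) * (h 1 x \<zeta> - e / 2))" "q > 1"
    using eventually_happens'[OF trivial_limit_at_right_real] by blast
  define \<theta> where "\<theta> = q - 1"
  have \<theta>: "\<theta> > 0" using q by (simp add: \<theta>_def)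
  have KKp: "KK m \<zeta> powr (q - 1) = exp (\<theta> * ln (KK m \<zeta>))" for m
    using KK_pos[OF \<zeta>, of m] by (simp add: powr_def \<theta>_def)
  define S where "S m = KK m \<zeta> powr (q - 1) * powsum q \<mu> (cell m x \<zeta>)" for m
  have S0: "S m \<ge> 0" for m by (simp add: S_def powsum_nonneg)
  have S01: "S 1 * S 0 \<le> exp (- \<theta> * ((d + 2 * \<kappa>) * x))"
  proof -
    have "S 1 \<le> exp (\<theta> * ln (KK 1 \<zeta>)) * exp (- (q - 1) * (h 1 x \<zeta> - e / 2))" "S 0 \<le> exp (\<theta> * ln (KK 0 \<zeta>)) * exp (- (q - 1) * (h 0 x \<zeta> - e / 2))"
      unfolding S_def KKp using q by (auto intro!: mult_left_mono)
    then have "S 1 * S 0 \<le> (exp (\<theta> * ln (KK 1 \<zeta>)) * exp (- (q - 1) * (h 1 x \<zeta> - e / 2))) * (exp (\<theta> * ln (KK 0 \<zeta>)) * exp (- (q - 1) * (h 0 x \<zeta> - e / 2)))"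
      using S0 by (intro mult_mono) auto
    also have "\<dots> = exp (\<theta> * ln (KK 1 \<zeta>) + - (q - 1) * (h 1 x \<zeta> - e / 2) + (\<theta> * ln (KK 0 \<zeta>) + - (q - 1) * (h 0 x \<zeta> - e / 2)))"
      by (simp only: exp_add)
    also have "\<theta> * ln (KK 1 \<zeta>) + - (q - 1) * (h 1 x \<zeta> - e / 2) + (\<theta> * ln (KK 0 \<zeta>) + - (q - 1) * (h 0 x \<zeta> - e / 2)) = - \<theta> * ((d + 2 * \<kappa>) * x)"
      unfolding \<theta>_def[symmetric] e_def L_def by (simp add: field_simps)
    finally show ?thesis .
  qed
  define K where "K = Kc 1 (C5 \<zeta>) * Kc 0 (C5 \<zeta>)"
  define f where "f n = (\<lambda>\<omega>. (tc 1 (real n * x) \<zeta> \<omega>, tc 0 (2 * (real n * x)) \<zeta> \<omega>))" for n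
  have rf: "powsum q \<mu> (f n) \<le> exp (- \<theta> * ((d + 2 * \<kappa>) * x)) ^ n" for n
  proof -
    have "powsum q \<mu> (f n) \<le> powsum q \<mu> (tc 1 (real n * x) \<zeta>) * S 0 ^ n"
    proof -
      have "powsum q \<mu> (\<lambda>\<omega>. (tc 1 (real n * x) \<zeta> \<omega>, tc 0 (real n * x + real n * x) \<zeta> \<omega>)) \<le> powsum q \<mu> (tc 1 (real n * x) \<zeta>) * (KK 0 \<zeta> powr (q - 1) * powsum q \<mu> (cell 0 x \<zeta>)) ^ n"
        by (rule powsum_phase2[OF \<zeta>]) (use q x in auto)
      then show ?thesis by (simp only: f_def S_def mult_2)
    qed
    also have "\<dots> \<le> S 1 ^ n * S 0 ^ n"
      using powsum_phase1[OF \<zeta>, of q x 1 n] q x S0 by (intro mult_right_mono) (auto simp: S_def)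
    also have "\<dots> \<le> exp (- \<theta> * ((d + 2 * \<kappa>) * x)) ^ n"
      unfolding power_mult_distrib[symmetric] using S01 S0 by (intro power_mono) auto
    finally show ?thesis .
  qed
  define rho where "rho n = exp (- d * (real n * x))" for n
  let ?nr = "\<lambda>n. near \<zeta> (exp (- 2 * Re \<zeta> * (real n * x))) (exp (- Re \<zeta> * (real n * x)))"
  have "\<exists>B\<in>sets \<mu>. {u. measure \<mu> {v. ?nr n u v} > rho n} \<subseteq> B \<and> measure \<mu> B \<le> rho n powr (1 - q) * ((1 + K powr q) * powsum q \<mu> (f n))" for n
    by (rule mass_tail) (use near_fibre[OF \<zeta>, of "real n * x"] x q near_sym near_sets in \<open>auto simp: f_def K_def rho_def intro!: fin_rv_Pair fin_rv_tcell\<close>)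
  then obtain B where B: "\<And>n. B n \<in> sets \<mu>" "\<And>n. {u. measure \<mu> {v. ?nr n u v} > rho n} \<subseteq> B n"
      "\<And>n. measure \<mu> (B n) \<le> rho n powr (1 - q) * ((1 + K powr q) * powsum q \<mu> (f n))"
    by metis
  have Bsm: "measure \<mu> (B n) \<le> (1 + K powr q) * exp (- \<theta> * (2 * \<kappa> * x)) ^ n" for n
  proof -
    have "rho n powr (1 - q) = exp (\<theta> * (d * x)) ^ n"
      by (simp add: rho_def powr_def \<theta>_def exp_of_nat_mult[symmetric] algebra_simps)
    then have "measure \<mu> (B n) \<le> exp (\<theta> * (d * x)) ^ n * ((1 + K powr q) * powsum q \<mu> (f n))" using B(3)[of n] by simp
    also have "\<dots> \<le> exp (\<theta> * (d * x)) ^ n * ((1 + K powr q) * exp (- \<theta> * ((d + 2 * \<kappa>) * x)) ^ n)"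
      using rf by (intro mult_left_mono) (auto simp: add_nonneg_nonneg)
    also have "\<dots> = (1 + K powr q) * (exp (\<theta> * (d * x)) * exp (- \<theta> * ((d + 2 * \<kappa>) * x))) ^ n"
      by (simp only: power_mult_distrib mult_ac)
    also have "exp (\<theta> * (d * x)) * exp (- \<theta> * ((d + 2 * \<kappa>) * x)) = exp (- \<theta> * (2 * \<kappa> * x))"
      unfolding exp_add[symmetric] by (simp add: algebra_simps)
    finally show ?thesis .
  qed
  have lt1: "norm (exp (- \<theta> * (2 * \<kappa> * x))) < 1" using \<theta> \<kappa> x by (simp add: mult_pos_pos)
  have "AE u in \<mu>. eventually (\<lambda>n. u \<in> space \<mu> - B n) sequentially"
  proof (rule borel_cantelli_AE1)
    show "summable (\<lambda>n. measure \<mu> (B n))"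
      by (rule summable_comparison_test'[of "\<lambda>n. (1 + K powr q) * exp (- \<theta> * (2 * \<kappa> * x)) ^ n"])
         (use Bsm lt1 in \<open>auto intro!: summable_mult summable_geometric\<close>)
  qed (use B in \<open>auto simp: emeasure_eq_measure\<close>)
  then have "AE u in \<mu>. \<forall>\<^sub>F n in sequentially. measure \<mu> {v. ?nr n u v} \<le> rho n"
  proof eventually_elim
    case (elim u)
    then show ?case
    proof eventually_elim
      case (elim n) then show ?case using B(2)[of n] by (force simp: not_le)
    qed
  qed
  then show ?thesis using n1(1) by (intro exI[of _ n1]) (simp add: rho_def x_def)
qed

text \<open>Passage from multiples of the block length to dyadic scales. The room between
  \<open>Re \<zeta> * c\<close> and d absorbs the rounding to whole blocks and the constant
  \<open>C\<close>.\<close>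

lemma box_mass:
  assumes \<zeta>: "Re \<zeta> > 0" and c: "c \<ge> 0" "Re \<zeta> * c < \<beta> 0 \<zeta> + \<beta> 1 \<zeta>" and C: "C > 0"
  shows "AE u in \<mu>. \<forall>\<^sub>F j in sequentially. measure \<mu> {v. near \<zeta> (C * (1 / 4) ^ j) (C * (1 / 2) ^ j) u v} \<le> 2 powr (- c * real j)"
proof -
  define s where "s = Re \<zeta>"
  have s: "s > 0" using \<zeta> by (simp add: s_def)
  obtain d where d: "s * c < d" "d < \<beta> 0 \<zeta> + \<beta> 1 \<zeta>" using dense[OF c(2)] by (auto simp: s_def)
  have d0: "d > 0" using d c s by (smt (verit) mult_nonneg_nonneg)
  obtain n1 where n1: "n1 \<ge> 1" and ae: "AE u in \<mu>. \<forall>\<^sub>F n in sequentially.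
    measure \<mu> {v. near \<zeta> (exp (- 2 * s * (real n * real n1))) (exp (- s * (real n * real n1))) u v} \<le> exp (- d * (real n * real n1))"
    using box_mass_levels[OF \<zeta> d(2)] unfolding s_def by blast
  \<comment> \<open>Since \<open>C'\<close> is at least 1, \<open>C\<close> is also bounded by its
    square, which is what the value coordinate needs when the bound for the derivative is
    squared.\<close>
  define C' where "C' = max 1 C"
  have C': "C' \<ge> 1" "C' \<ge> C" "ln C' \<ge> 0" by (auto simp: C'_def)
  \<comment> \<open>The largest number of blocks for which the box of \<open>box_mass_levels\<close>
    still contains the dyadic box.\<close>
  define N where "N j = nat \<lfloor>(real j * ln 2 - ln C') / (s * n1)\<rfloor>" for j
  have sn: "s * n1 > 0" using s n1 by simp
  have l2: "ln (2::real) > 0" by simp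
  have big: "eventually (\<lambda>j. real j * ln 2 - ln C' \<ge> R) sequentially" for R
  proof -
    have "filterlim (\<lambda>j. real j * ln 2 - ln C') at_top sequentially" by real_asymp
    then show ?thesis by (simp add: filterlim_at_top)
  qed
  have Nlim: "filterlim N at_top sequentially"
    unfolding filterlim_at_top
  proof
    fix k :: nat
    show "eventually (\<lambda>j. k \<le> N j) sequentially"
      using big[of "real k * (s * n1)"]
    proof eventually_elim
      case (elim j)
      then have "real k \<le> (real j * ln 2 - ln C') / (s * n1)" using sn by (simp add: pos_le_divide_eq)
      then show ?case unfolding N_def by (rule le_nat_floor)
    qed
  qed
  define R where "R = d * (ln C' + s * n1) / s"
  have fin: "eventually (\<lambda>j. d * (real j * ln 2) / s - R \<ge> c * (real j * ln 2)) sequentially"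
  proof -
    have "d / s - c > 0" using d s by (simp add: field_simps)
    then have "filterlim (\<lambda>j. (d / s - c) * (real j * ln 2)) at_top sequentially" by real_asymp
    then have "eventually (\<lambda>j. (d / s - c) * (real j * ln 2) \<ge> R) sequentially" by (simp add: filterlim_at_top)
    then show ?thesis by eventually_elim (simp add: algebra_simps)
  qed
  from ae show ?thesis
  proof eventually_elim
    case (elim u)
    have "eventually (\<lambda>j. measure \<mu> {v. near \<zeta> (exp (- 2 * s * (real (N j) * real n1))) (exp (- s * (real (N j) * real n1))) u v} \<le> exp (- d * (real (N j) * real n1))) sequentially"
      by (rule eventually_compose_filterlim[OF elim Nlim])
    then show ?case using big[of 0] fin
    proof eventually_elim
      case (elim j)
      define x where "x = real (N j) * real n1"
      have q0: "(real j * ln 2 - ln C') / (s * n1) \<ge> 0" using elim sn by simp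
      have N1: "real (N j) \<le> (real j * ln 2 - ln C') / (s * n1)" "real (N j) \<ge> (real j * ln 2 - ln C') / (s * n1) - 1"
        using q0 unfolding N_def by linarith+
      have x1: "s * x \<le> real j * ln 2 - ln C'"
      proof -
        have "real (N j) * (s * n1) \<le> real j * ln 2 - ln C'" using N1(1) sn by (simp add: pos_le_divide_eq)
        then show ?thesis by (simp add: x_def mult_ac)
      qed
      have x2: "s * x \<ge> real j * ln 2 - ln C' - s * n1"
      proof -
        have "(real j * ln 2 - ln C') / (s * n1) \<le> real (N j) + 1" using N1(2) by simp
        then have "real j * ln 2 - ln C' \<le> (real (N j) + 1) * (s * n1)" using sn by (simp add: pos_divide_le_eq)
        then show ?thesis by (simp add: x_def algebra_simps)
      qed
      have ej: "exp (- (real j * ln 2)) = (1 / 2) ^ j"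
      proof -
        have "- (real j * ln 2) = real j * (- ln 2)" by simp
        moreover have "exp (- ln (2::real)) = 1 / 2" by (simp add: exp_minus)
        ultimately show ?thesis by (simp only: exp_of_nat_mult)
      qed
      have b2: "C * (1 / 2) ^ j \<le> exp (- s * x)"
      proof -
        have "C * (1 / 2) ^ j \<le> C' * exp (- (real j * ln 2))" unfolding ej using C' by (intro mult_right_mono) auto
        also have "\<dots> = exp (ln C' + - (real j * ln 2))" unfolding exp_add using C' by simp
        also have "\<dots> \<le> exp (- s * x)" using x1 by simp
        finally show ?thesis .
      qed
      have b1: "C * (1 / 4) ^ j \<le> exp (- 2 * s * x)"
      proof -
        have "(1 / 4 :: real) ^ j = (1 / 2) ^ j * (1 / 2) ^ j" by (simp flip: power_mult_distrib)
        then have "C * (1 / 4) ^ j = C * ((1 / 2) ^ j * (1 / 2) ^ j)" by simp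
        also have "\<dots> \<le> (C' * C') * ((1 / 2) ^ j * (1 / 2) ^ j)"
        proof (intro mult_right_mono)
          have "C \<le> C' * 1" using C' by simp
          also have "\<dots> \<le> C' * C'" using C' by (intro mult_left_mono) auto
          finally show "C \<le> C' * C'" .
        qed auto
        also have "\<dots> = exp (2 * (ln C' + - (real j * ln 2)))"
        proof -
          have e1: "exp (ln C' + - (real j * ln 2)) = C' * (1 / 2) ^ j"
            unfolding exp_add ej using C' by simp
          show ?thesis unfolding mult_2 exp_add[of "ln C' + - (real j * ln 2)"] e1 by (simp only: mult_ac)
        qed
        also have "\<dots> \<le> exp (- 2 * s * x)" using x1 by simp
        finally show ?thesis .
      qed
      have "measure \<mu> {v. near \<zeta> (C * (1 / 4) ^ j) (C * (1 / 2) ^ j) u v} \<le> measure \<mu> {v. near \<zeta> (exp (- 2 * s * x)) (exp (- s * x)) u v}"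
        using b1 b2 near_sets by (intro finite_measure_mono) (auto simp: near_def)
      also have "\<dots> \<le> exp (- d * x)" using elim(1) by (simp add: x_def)
      also have "\<dots> \<le> exp (- c * (real j * ln 2))"
      proof -
        have "d * (real j * ln 2 - ln C' - s * n1) \<le> d * (s * x)" using x2 d0 by (intro mult_left_mono) auto
        then have "d * (real j * ln 2 - ln C' - s * n1) / s \<le> d * x" using s by (simp add: pos_divide_le_eq mult_ac)
        moreover have "d * (real j * ln 2 - ln C' - s * n1) / s = d * (real j * ln 2) / s - R"
          unfolding R_def by (simp add: diff_divide_distrib[symmetric] algebra_simps)
        ultimately show ?thesis using elim(3) by simp
      qed
      also have "\<dots> = 2 powr (- c * real j)" by (simp add: powr_def mult_ac)
      finally show ?case .
    qed
  qed
qed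

end

section \<open>The energy estimate\<close>

lemma emeasure_lborel_small_diameter:
  fixes S :: "complex set"
  assumes "R \<ge> 0" "\<And>x y. x \<in> S \<Longrightarrow> y \<in> S \<Longrightarrow> cmod (x - y) \<le> R"
  shows "emeasure lborel S \<le> ennreal (4 * R\<^sup>2)"
proof (cases "S = {}")
  case False
  then obtain x where x: "x \<in> S" by auto
  have "S \<subseteq> cbox (x - Complex R R) (x + Complex R R)"
  proof
    fix y assume "y \<in> S"
    then have "cmod (y - x) \<le> R" using assms x by blast
    then have "\<bar>Re y - Re x\<bar> \<le> R" "\<bar>Im y - Im x\<bar> \<le> R"
      using abs_Re_le_cmod[of "y - x"] abs_Im_le_cmod[of "y - x"] by auto
    then show "y \<in> cbox (x - Complex R R) (x + Complex R R)" by (auto simp: in_cbox_complex_iff)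
  qed
  then have "emeasure lborel S \<le> emeasure lborel (cbox (x - Complex R R) (x + Complex R R))"
    by (intro emeasure_mono) auto
  also have "\<dots> = ennreal (4 * R\<^sup>2)"
    using assms(1) by (subst emeasure_lborel_cbox) (auto simp: Basis_complex_def power2_eq_square)
  finally show ?thesis .
qed simp

text \<open>Closed squares of side 1 / N. Their overlaps on edges do no harm, since only upper
  bounds are summed over the squares.\<close>

definition grid_sq :: "complex \<Rightarrow> nat \<Rightarrow> nat \<times> nat \<Rightarrow> complex set" where
  "grid_sq z0 N k = {z. real (fst k) / N \<le> Re z - Re z0 \<and> Re z - Re z0 \<le> (real (fst k) + 1) / N
     \<and> real (snd k) / N \<le> Im z - Im z0 \<and> Im z - Im z0 \<le> (real (snd k) + 1) / N}"

lemma grid_sq_sets [measurable]: "grid_sq z0 N k \<in> sets borel" unfolding grid_sq_def by measurable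

lemma grid_sq_diam: assumes "z \<in> grid_sq z0 N k" "z' \<in> grid_sq z0 N k" shows "cmod (z - z') \<le> 2 / N"
proof -
  have "\<bar>Re (z - z')\<bar> \<le> 1 / N" "\<bar>Im (z - z')\<bar> \<le> 1 / N"
    using assms by (auto simp: grid_sq_def add_divide_distrib)
  then have "cmod (z - z') \<le> 1 / N + 1 / N" using cmod_le[of "z - z'"] by linarith
  then show ?thesis by simp
qed

lemma grid_sq_cover: assumes "z \<in> cbox z0 (z0 + Complex 1 1)" "N \<ge> 1" shows "\<exists>k\<in>{..<N} \<times> {..<N}. z \<in> grid_sq z0 N k"
proof -
  have *: "\<exists>i<N. real i / N \<le> x \<and> x \<le> (real i + 1) / N" if "0 \<le> x" "x \<le> 1" for x :: real
  proof (cases "x = 1")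
    case True
    then show ?thesis using assms(2) by (intro exI[of _ "N - 1"]) (auto simp: of_nat_diff)
  next
    case False
    define i where "i = nat \<lfloor>x * N\<rfloor>"
    have "real i \<le> x * N" "x * N < real i + 1" using that by (auto simp: i_def)
    moreover have "x * real N < 1 * real N" using that False assms(2) by (intro mult_strict_right_mono) auto
    ultimately have "real i < real N" "real i \<le> x * N" "x * N \<le> real i + 1" by linarith+
    then show ?thesis using assms(2) by (intro exI[of _ i]) (auto simp: field_simps)
  qed
  obtain i where i: "i < N" "real i / N \<le> Re z - Re z0" "Re z - Re z0 \<le> (real i + 1) / N"
    using *[of "Re z - Re z0"] assms(1) by (auto simp: in_cbox_complex_iff)
  obtain k where k: "k < N" "real k / N \<le> Im z - Im z0" "Im z - Im z0 \<le> (real k + 1) / N"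
    using *[of "Im z - Im z0"] assms(1) by (auto simp: in_cbox_complex_iff)
  show ?thesis by (rule bexI[of _ "(i, k)"]) (use i k in \<open>auto simp: grid_sq_def\<close>)
qed

lemma grid_sq_Re: "z \<in> grid_sq z0 N k \<Longrightarrow> Re z \<ge> Re z0"
proof -
  assume "z \<in> grid_sq z0 N k"
  then have "real (fst k) / N \<le> Re z - Re z0" by (simp add: grid_sq_def)
  moreover have "real (fst k) / N \<ge> 0" by simp
  ultimately show ?thesis by linarith
qed

context ifs
begin

lemma measurable_V_comp [measurable]:
  "(\<lambda>x. V j y (fst (fst x)) (snd (fst x))) \<in> borel_measurable ((borel \<Otimes>\<^sub>M \<mu>) \<Otimes>\<^sub>M \<mu>)"
  "(\<lambda>x. V j y (fst (fst x)) (snd x)) \<in> borel_measurable ((borel \<Otimes>\<^sub>M \<mu>) \<Otimes>\<^sub>M \<mu>)"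
  by measurable

lemma near_mono: "near \<zeta> r1 r2 u v \<Longrightarrow> r1 \<le> r1' \<Longrightarrow> r2 \<le> r2' \<Longrightarrow> near \<zeta> r1' r2' u v"
  unfolding near_def by linarith

text \<open>The factors 4 leave room for moving the parameter inside a grid square, as in
  \<open>near_transfer\<close>.\<close>

definition small_boxes :: "real \<Rightarrow> nat \<Rightarrow> complex \<Rightarrow> 'n stream \<Rightarrow> bool" where
  "small_boxes c j0 \<zeta> u \<longleftrightarrow> (\<forall>j\<ge>j0. measure \<mu> {v. near \<zeta> (4 * (1 / 4) ^ j) (4 * (1 / 2) ^ j) u v} \<le> 2 powr (- c * real j))"

lemma measurable_emeasure_near [measurable]:
  "(\<lambda>x. emeasure \<mu> {v. near (fst x) r1 r2 (snd x) v}) \<in> borel_measurable (borel \<Otimes>\<^sub>M \<mu>)"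
proof -
  have p: "Measurable.pred ((borel \<Otimes>\<^sub>M \<mu>) \<Otimes>\<^sub>M \<mu>) (\<lambda>x. near (fst (fst x)) r1 r2 (snd (fst x)) (snd x))"
    unfolding near_def by measurable
  then have "{x \<in> space ((borel \<Otimes>\<^sub>M \<mu>) \<Otimes>\<^sub>M \<mu>). near (fst (fst x)) r1 r2 (snd (fst x)) (snd x)} \<in> sets ((borel \<Otimes>\<^sub>M \<mu>) \<Otimes>\<^sub>M \<mu>)"
    by (simp add: pred_def)
  from measurable_emeasure_Pair[OF this] show ?thesis
    by (simp add: space_pair_measure vimage_def)
qed

lemma measurable_emeasure_close [measurable]:
  "(\<lambda>x. emeasure \<mu> {v. cmod (V 0 0 (fst x) (snd x) - V 0 0 (fst x) v) \<le> r}) \<in> borel_measurable (borel \<Otimes>\<^sub>M \<mu>)"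
proof -
  have p: "Measurable.pred ((borel \<Otimes>\<^sub>M \<mu>) \<Otimes>\<^sub>M \<mu>) (\<lambda>x. cmod (V 0 0 (fst (fst x)) (snd (fst x)) - V 0 0 (fst (fst x)) (snd x)) \<le> r)"
    by measurable
  then have "{x \<in> space ((borel \<Otimes>\<^sub>M \<mu>) \<Otimes>\<^sub>M \<mu>). cmod (V 0 0 (fst (fst x)) (snd (fst x)) - V 0 0 (fst (fst x)) (snd x)) \<le> r} \<in> sets ((borel \<Otimes>\<^sub>M \<mu>) \<Otimes>\<^sub>M \<mu>)"
    by (simp add: pred_def)
  from measurable_emeasure_Pair[OF this] show ?thesis
    by (simp add: space_pair_measure vimage_def)
qed

lemma measurable_small_boxes [measurable]: "Measurable.pred (borel \<Otimes>\<^sub>M \<mu>) (\<lambda>x. small_boxes c j0 (fst x) (snd x))"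
proof -
  have "small_boxes c j0 \<zeta> u \<longleftrightarrow> (\<forall>j. j \<ge> j0 \<longrightarrow> emeasure \<mu> {v. near \<zeta> (4 * (1 / 4) ^ j) (4 * (1 / 2) ^ j) u v} \<le> ennreal (2 powr (- c * real j)))" for \<zeta> u
    unfolding small_boxes_def by (simp add: emeasure_eq_measure)
  then show ?thesis by simp
qed

text \<open>Fix \<open>v\<close> and one grid square. Where the derivative is at least
  \<open>\<tau>\<close> and the second-order term at most half of that, F = X u - X v expands
  distances by at least \<tau> / 2, so the parameters with |F| \<le> r have diameter at most 4 r /
  \<tau>. Only the \<open>v\<close> in a set of mass \<open>P\<close> contribute to this square;
  there are N^2 squares, and Fubini exchanges \<open>v\<close> with the parameter.\<close>

lemma level_integral:
  fixes u :: "'n stream"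
  assumes s: "0 < s" "s \<le> Re z0" and N: "N \<ge> 1" and \<tau>: "\<tau> > 0" "2 * Cb 2 s * (2 / N) \<le> \<tau> / 2" and r: "r \<ge> 0"
    and A: "\<And>\<zeta> v. A \<zeta> v \<Longrightarrow> cmod (V 0 0 \<zeta> u - V 0 0 \<zeta> v) \<le> r \<and> cmod (V 1 0 \<zeta> u - V 1 0 \<zeta> v) \<ge> \<tau>"
    and Am: "Measurable.pred (lborel \<Otimes>\<^sub>M \<mu>) (\<lambda>x. A (fst x) (snd x))"
    and G: "\<And>k. \<exists>Nb\<in>sets \<mu>. emeasure \<mu> Nb \<le> ennreal P \<and> (\<forall>\<zeta>\<in>grid_sq z0 N k. G \<zeta> \<longrightarrow> (\<forall>v. A \<zeta> v \<longrightarrow> v \<in> Nb))" and P: "P \<ge> 0"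
  shows "(\<integral>\<^sup>+\<zeta>. (if \<zeta> \<in> cbox z0 (z0 + Complex 1 1) \<and> G \<zeta> then emeasure \<mu> {v. A \<zeta> v} else 0) \<partial>lborel) \<le> ennreal (real N ^ 2 * (64 * (r / \<tau>)\<^sup>2 * P))"
proof -
  interpret pair_sigma_finite lborel \<mu> ..
  let ?I = "{..<N} \<times> {..<N}"
  obtain Nb where Nb: "\<And>k. Nb k \<in> sets \<mu>" "\<And>k. emeasure \<mu> (Nb k) \<le> ennreal P" "\<And>k \<zeta> v. \<zeta> \<in> grid_sq z0 N k \<Longrightarrow> G \<zeta> \<Longrightarrow> A \<zeta> v \<Longrightarrow> v \<in> Nb k"
    using G by metis
  note Nb(1)[measurable] Am[measurable]
  define g where "g k \<zeta> v = (indicator (grid_sq z0 N k) \<zeta> * indicator (Nb k) v * (if A \<zeta> v then 1 else 0) :: ennreal)" for k \<zeta> v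
  have gm [measurable]: "(\<lambda>x. g k (fst x) (snd x)) \<in> borel_measurable (lborel \<Otimes>\<^sub>M \<mu>)" for k
    unfolding g_def by measurable
  have Asec: "{v. A \<zeta> v} \<in> sets \<mu>" for \<zeta>
  proof -
    have "Measurable.pred \<mu> (\<lambda>v. A \<zeta> v)"
      using measurable_compose[OF measurable_Pair1'[of \<zeta> lborel \<mu>] Am] by simp
    then show ?thesis by (simp add: pred_def)
  qed
  have pt: "(if \<zeta> \<in> cbox z0 (z0 + Complex 1 1) \<and> G \<zeta> then emeasure \<mu> {v. A \<zeta> v} else 0) \<le> (\<Sum>k\<in>?I. \<integral>\<^sup>+v. g k \<zeta> v \<partial>\<mu>)" for \<zeta>
  proof (cases "\<zeta> \<in> cbox z0 (z0 + Complex 1 1) \<and> G \<zeta>")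
    case True
    then obtain k where k: "k \<in> ?I" "\<zeta> \<in> grid_sq z0 N k" using grid_sq_cover[OF _ N] by blast
    have "emeasure \<mu> {v. A \<zeta> v} = (\<integral>\<^sup>+v. indicator {v. A \<zeta> v} v \<partial>\<mu>)" using Asec by simp
    also have "\<dots> = (\<integral>\<^sup>+v. g k \<zeta> v \<partial>\<mu>)"
      using k True Nb(3)[OF k(2)] by (intro nn_integral_cong) (auto simp: g_def indicator_def)
    also have "\<dots> \<le> (\<Sum>k\<in>?I. \<integral>\<^sup>+v. g k \<zeta> v \<partial>\<mu>)" using k(1) by (intro member_le_sum) auto
    finally show ?thesis using True by simp
  next
    case False show ?thesis unfolding if_not_P[OF False] by simp
  qed
  have each: "(\<integral>\<^sup>+\<zeta>. \<integral>\<^sup>+v. g k \<zeta> v \<partial>\<mu> \<partial>lborel) \<le> ennreal (64 * (r / \<tau>)\<^sup>2 * P)" for k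
  proof -
    have "(\<integral>\<^sup>+\<zeta>. \<integral>\<^sup>+v. g k \<zeta> v \<partial>\<mu> \<partial>lborel) = (\<integral>\<^sup>+v. \<integral>\<^sup>+\<zeta>. g k \<zeta> v \<partial>lborel \<partial>\<mu>)"
      by (rule Fubini'[symmetric]) (use gm[of k] in \<open>simp add: case_prod_unfold\<close>)
    also have "\<dots> \<le> (\<integral>\<^sup>+v. ennreal (64 * (r / \<tau>)\<^sup>2) * indicator (Nb k) v \<partial>\<mu>)"
    proof (rule nn_integral_mono)
      fix v
      define S where "S = {\<zeta>. \<zeta> \<in> grid_sq z0 N k \<and> A \<zeta> v}"
      have Sm: "S \<in> sets lborel"
      proof -
        have "(\<lambda>\<zeta>. (\<zeta>, v)) \<in> lborel \<rightarrow>\<^sub>M lborel \<Otimes>\<^sub>M \<mu>" by (rule measurable_Pair2') simp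
        from measurable_compose[OF this Am] have "Measurable.pred lborel (\<lambda>\<zeta>. A \<zeta> v)" by simp
        then have "Measurable.pred lborel (\<lambda>\<zeta>. \<zeta> \<in> grid_sq z0 N k \<and> A \<zeta> v)" by measurable
        then show ?thesis by (simp add: S_def pred_def)
      qed
      have "(\<integral>\<^sup>+\<zeta>. g k \<zeta> v \<partial>lborel) = (\<integral>\<^sup>+\<zeta>. indicator (Nb k) v * indicator S \<zeta> \<partial>lborel)"
        by (intro nn_integral_cong) (auto simp: g_def S_def indicator_def)
      also have "\<dots> = indicator (Nb k) v * emeasure lborel S" using Sm by (simp add: nn_integral_cmult_indicator)
      also have "\<dots> \<le> indicator (Nb k) v * ennreal (4 * (4 * r / \<tau>)\<^sup>2)"
      proof (rule mult_left_mono)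
        show "emeasure lborel S \<le> ennreal (4 * (4 * r / \<tau>)\<^sup>2)"
        proof (rule emeasure_lborel_small_diameter)
        fix x y assume xy: "x \<in> S" "y \<in> S"
        let ?F = "\<lambda>i \<zeta>. V i 0 \<zeta> u - V i 0 \<zeta> v"
        have Re: "s \<le> Re x" "s \<le> Re y" using xy grid_sq_Re s unfolding S_def by (blast intro: order_trans)+
        have d: "cmod (x - y) \<le> 2 / N" using xy grid_sq_diam[of x z0 N k y] by (simp add: S_def)
        have "cmod (?F 0 x - (\<Sum>j\<le>1. ?F (0 + j) y * (x - y) ^ j / fact j)) \<le> 2 * Cb (0 + Suc 1) s * cmod (x - y) ^ Suc 1"
          by (rule V_Taylor[OF s(1) Re(2,1)])
        then have tl: "cmod (?F 0 x - ?F 0 y - ?F 1 y * (x - y)) \<le> 2 * Cb 2 s * (cmod (x - y) * cmod (x - y))"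
          by (simp add: numeral_2_eq_2 algebra_simps)
        have "2 * Cb 2 s * (cmod (x - y) * cmod (x - y)) \<le> 2 * Cb 2 s * (2 / N * cmod (x - y))"
          using d Cb_nonneg[OF s(1), of 2] by (intro mult_left_mono mult_right_mono) auto
        also have "\<dots> = 2 * Cb 2 s * (2 / N) * cmod (x - y)" by simp
        also have "\<dots> \<le> \<tau> / 2 * cmod (x - y)" using \<tau>(2) by (intro mult_right_mono) auto
        finally have rem: "cmod (?F 0 x - ?F 0 y - ?F 1 y * (x - y)) \<le> \<tau> / 2 * cmod (x - y)" using tl by linarith
        have "cmod (?F 1 y * (x - y)) \<le> cmod (?F 0 x) + cmod (?F 0 y) + cmod (?F 0 x - ?F 0 y - ?F 1 y * (x - y))" by norm
        also have "\<dots> \<le> r + r + \<tau> / 2 * cmod (x - y)" using rem A[of x v] A[of y v] xy by (auto simp: S_def intro!: add_mono)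
        finally have "cmod (?F 1 y) * cmod (x - y) \<le> r + r + \<tau> / 2 * cmod (x - y)" by (simp add: norm_mult)
        moreover have "\<tau> * cmod (x - y) \<le> cmod (?F 1 y) * cmod (x - y)" using A[of y v] xy by (intro mult_right_mono) (auto simp: S_def)
        ultimately have "\<tau> * cmod (x - y) \<le> 4 * r" by simp
        then show "cmod (x - y) \<le> 4 * r / \<tau>" using \<tau>(1) by (simp add: pos_le_divide_eq mult.commute)
        qed (use r \<tau> in auto)
      qed simp
      also have "4 * (4 * r / \<tau>)\<^sup>2 = 64 * (r / \<tau>)\<^sup>2" by (simp add: power2_eq_square)
      finally show "(\<integral>\<^sup>+\<zeta>. g k \<zeta> v \<partial>lborel) \<le> ennreal (64 * (r / \<tau>)\<^sup>2) * indicator (Nb k) v"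
        by (simp add: mult.commute)
    qed
    also have "\<dots> = ennreal (64 * (r / \<tau>)\<^sup>2) * emeasure \<mu> (Nb k)" by (simp add: nn_integral_cmult_indicator)
    also have "\<dots> \<le> ennreal (64 * (r / \<tau>)\<^sup>2) * ennreal P" by (intro mult_left_mono Nb(2)) auto
    also have "\<dots> = ennreal (64 * (r / \<tau>)\<^sup>2 * P)" using P by (simp add: ennreal_mult)
    finally show ?thesis .
  qed
  have "(\<integral>\<^sup>+\<zeta>. (if \<zeta> \<in> cbox z0 (z0 + Complex 1 1) \<and> G \<zeta> then emeasure \<mu> {v. A \<zeta> v} else 0) \<partial>lborel) \<le> (\<integral>\<^sup>+\<zeta>. (\<Sum>k\<in>?I. \<integral>\<^sup>+v. g k \<zeta> v \<partial>\<mu>) \<partial>lborel)"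
    by (intro nn_integral_mono pt)
  also have "\<dots> = (\<Sum>k\<in>?I. \<integral>\<^sup>+\<zeta>. \<integral>\<^sup>+v. g k \<zeta> v \<partial>\<mu> \<partial>lborel)"
  proof (rule nn_integral_sum)
    fix k
    have "sigma_finite_measure \<mu>" by unfold_locales
    from sigma_finite_measure.borel_measurable_nn_integral_fst[OF this gm[of k]]
    show "(\<lambda>\<zeta>. \<integral>\<^sup>+v. g k \<zeta> v \<partial>\<mu>) \<in> borel_measurable lborel" by simp
  qed
  also have "\<dots> \<le> (\<Sum>k\<in>?I. ennreal (64 * (r / \<tau>)\<^sup>2 * P))" by (intro sum_mono each)
  also have "\<dots> = ennreal (real N ^ 2 * (64 * (r / \<tau>)\<^sup>2 * P))"
    using P by (subst sum_ennreal) (auto simp: card_cartesian_product power2_eq_square)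
  finally show ?thesis .
qed

text \<open>Moving the parameter by D changes the derivative by O(D) and the value by |F'| D +
  O(D^2), which is O(4^-j) when D and F' are O(2^-j). The integer \<open>k0\<close> makes the
  squares small compared with the bound on the second derivative, so that the total growth stays
  below the factor 4.\<close>

lemma near_transfer:
  assumes s: "0 < s" "s \<le> Re \<zeta>" "s \<le> Re \<zeta>'" and k0: "2 ^ k0 \<ge> 16 * max 1 (2 * Cb 2 s)"
    and d: "cmod (\<zeta>' - \<zeta>) \<le> 2 / 2 ^ (j + k0)" and jl: "j \<le> l"
    and F: "cmod (V 0 0 \<zeta> u - V 0 0 \<zeta> v) \<le> (1 / 4) ^ l" "cmod (V 1 0 \<zeta> u - V 1 0 \<zeta> v) \<le> (1 / 2) ^ j"
  shows "near \<zeta>' (4 * (1 / 4) ^ j) (4 * (1 / 2) ^ j) u v"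
proof -
  let ?F = "\<lambda>i \<zeta>. V i 0 \<zeta> u - V i 0 \<zeta> v" and ?B = "2 * Cb 2 s"
  define D where "D = cmod (\<zeta>' - \<zeta>)"
  define p where "p = (1 / 2 :: real) ^ j"
  define e where "e = (1 / 2 :: real) ^ k0"
  have p: "p > 0" "(1 / 4 :: real) ^ j = p * p" by (auto simp: p_def simp flip: power_mult_distrib)
  have e: "e > 0" "e \<le> 1 / 16" "?B * e \<le> 1 / 16"
  proof -
    have k1: "(2::real) ^ k0 \<ge> 16" "2 ^ k0 \<ge> 16 * ?B" using k0 by auto
    have e': "e = 1 / 2 ^ k0" by (simp add: e_def power_one_over)
    show "e > 0" by (simp add: e_def)
    show "e \<le> 1 / 16" unfolding e' using k1 by (intro divide_left_mono) auto
    show "?B * e \<le> 1 / 16" unfolding e' using k1 by (simp add: field_simps)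
  qed
  have B: "?B \<ge> 0" using Cb_nonneg[OF s(1)] by simp
  have D: "D \<le> 2 * (p * e)" "D \<ge> 0" using d by (auto simp: D_def p_def e_def power_add power_one_over field_simps)
  have t1: "cmod (?F 1 \<zeta>' - ?F 1 \<zeta>) \<le> ?B * D"
  proof -
    have "cmod (?F 1 \<zeta>' - (\<Sum>j\<le>0. ?F (1 + j) \<zeta> * (\<zeta>' - \<zeta>) ^ j / fact j)) \<le> 2 * Cb (1 + Suc 0) s * cmod (\<zeta>' - \<zeta>) ^ Suc 0"
      by (rule V_Taylor[OF s])
    then show ?thesis by (simp add: numeral_2_eq_2 D_def)
  qed
  have t0: "cmod (?F 0 \<zeta>' - ?F 0 \<zeta> - ?F 1 \<zeta> * (\<zeta>' - \<zeta>)) \<le> ?B * (D * D)"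
  proof -
    have "cmod (?F 0 \<zeta>' - (\<Sum>j\<le>1. ?F (0 + j) \<zeta> * (\<zeta>' - \<zeta>) ^ j / fact j)) \<le> 2 * Cb (0 + Suc 1) s * cmod (\<zeta>' - \<zeta>) ^ Suc 1"
      by (rule V_Taylor[OF s])
    then show ?thesis by (simp add: numeral_2_eq_2 D_def algebra_simps)
  qed
  have BD: "?B * D \<le> p"
  proof -
    have "?B * D \<le> ?B * (2 * (p * e))" using D B by (intro mult_left_mono) auto
    also have "\<dots> = 2 * p * (?B * e)" by simp
    also have "\<dots> \<le> 2 * p * (1 / 16)" using e p by (intro mult_left_mono) auto
    finally show ?thesis using p by simp
  qed
  have Dp: "D \<le> p"
  proof -
    have "2 * (p * e) \<le> 2 * (p * (1 / 16))" using e p by (intro mult_left_mono) auto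
    then have "D \<le> p * (1 / 8)" using D(1) by simp
    then show ?thesis using p(1) by linarith
  qed
  have "cmod (?F 1 \<zeta>') \<le> cmod (?F 1 \<zeta>) + cmod (?F 1 \<zeta>' - ?F 1 \<zeta>)" by norm
  then have n1: "cmod (?F 1 \<zeta>') \<le> 4 * p" using F(2) t1 BD p unfolding p_def[symmetric] by linarith
  have "cmod (?F 0 \<zeta>') \<le> cmod (?F 0 \<zeta>) + cmod (?F 1 \<zeta> * (\<zeta>' - \<zeta>)) + cmod (?F 0 \<zeta>' - ?F 0 \<zeta> - ?F 1 \<zeta> * (\<zeta>' - \<zeta>))" by norm
  moreover have "cmod (?F 0 \<zeta>) \<le> p * p"
  proof -
    have "(1 / 4 :: real) ^ l \<le> (1 / 4) ^ j" using jl by (intro power_decreasing) auto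
    then show ?thesis using F(1) p(2) by linarith
  qed
  moreover have "cmod (?F 1 \<zeta> * (\<zeta>' - \<zeta>)) \<le> p * p"
    unfolding norm_mult D_def[symmetric] using F(2) Dp D(2) p(1) by (intro mult_mono) (auto simp: p_def)
  moreover have "?B * (D * D) \<le> p * p"
    unfolding mult.assoc[symmetric] using BD Dp D(2) p(1) by (intro mult_mono) auto
  ultimately have n0: "cmod (?F 0 \<zeta>') \<le> 4 * (p * p)" using t0 p by (smt (verit) mult_pos_pos)
  show ?thesis unfolding near_def using n0 n1 p(2) by (simp add: p_def)
qed

text \<open>The pairs are split by the size of F'. Below 2^-l the box bound at scale l applies
  directly. Between 2^-(j+1) and 2^-j, \<open>level_integral\<close> with N = 2^(j + k0), \<tau> =
  2^-(j+1), r = 4^-l and P = 2^(-cj) gives a multiple of 16^-l 2^((4-c)j). Above 2^-j0 the trivial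
  mass P = 1 suffices, at the price of the factor 16^j0 in \<open>K\<close>.\<close>

lemma energy:
  assumes s: "0 < s" "s \<le> Re z0"
  shows "\<exists>K\<ge>0. \<forall>l\<ge>j0. \<forall>u. (\<integral>\<^sup>+\<zeta>. (if \<zeta> \<in> cbox z0 (z0 + Complex 1 1) \<and> small_boxes c j0 \<zeta> u then emeasure \<mu> {v. cmod (V 0 0 \<zeta> u - V 0 0 \<zeta> v) \<le> (1 / 4) ^ l} else 0) \<partial>lborel)
     \<le> ennreal (2 powr (- c * l) + K * (1 / 16) ^ l * (1 + (\<Sum>j=j0..<l. 2 powr ((4 - c) * real j))))"
proof -
  obtain k0 :: nat where k0: "2 ^ k0 \<ge> 16 * max 1 (2 * Cb 2 s)"
    using real_arch_pow[of 2 "16 * max 1 (2 * Cb 2 s)"] by (auto intro: less_imp_le)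
  define U where "U = cbox z0 (z0 + Complex 1 1)"
  define K where "K = 256 * 4 ^ k0 * 16 ^ j0 + 256 * (4::real) ^ k0"
  have "(\<integral>\<^sup>+\<zeta>. (if \<zeta> \<in> U \<and> small_boxes c j0 \<zeta> u then emeasure \<mu> {v. cmod (V 0 0 \<zeta> u - V 0 0 \<zeta> v) \<le> (1 / 4) ^ l} else 0) \<partial>lborel)
     \<le> ennreal (2 powr (- c * l) + K * (1 / 16) ^ l * (1 + (\<Sum>j=j0..<l. 2 powr ((4 - c) * real j))))" if l: "l \<ge> j0" for l u
  proof -
    let ?F = "\<lambda>i \<zeta> v. V i 0 \<zeta> u - V i 0 \<zeta> v" and ?r = "(1 / 4 :: real) ^ l"
    have sq4: "real (2 ^ n) ^ 2 = 4 ^ n" for n by (simp add: power2_eq_square flip: power_mult_distrib)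
    define A where "A j \<zeta> v \<longleftrightarrow> cmod (?F 0 \<zeta> v) \<le> ?r \<and> (1 / 2) ^ Suc j \<le> cmod (?F 1 \<zeta> v) \<and> cmod (?F 1 \<zeta> v) \<le> (1 / 2) ^ j" for j \<zeta> v
    define A' where "A' \<zeta> v \<longleftrightarrow> cmod (?F 0 \<zeta> v) \<le> ?r \<and> (1 / 2) ^ j0 \<le> cmod (?F 1 \<zeta> v)" for \<zeta> v
    have [measurable]: "Measurable.pred (lborel \<Otimes>\<^sub>M \<mu>) (\<lambda>x. A j (fst x) (snd x))" for j unfolding A_def by measurable
    have [measurable]: "Measurable.pred (lborel \<Otimes>\<^sub>M \<mu>) (\<lambda>x. A' (fst x) (snd x))" unfolding A'_def by measurable
    have Asec [measurable]: "{v. A j \<zeta> v} \<in> sets \<mu>" "{v. A' \<zeta> v} \<in> sets \<mu>" for j \<zeta>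
    proof -
      have "Measurable.pred \<mu> (A j \<zeta>)" "Measurable.pred \<mu> (A' \<zeta>)" unfolding A_def A'_def by measurable
      then show "{v. A j \<zeta> v} \<in> sets \<mu>" "{v. A' \<zeta> v} \<in> sets \<mu>" by (auto simp: pred_def)
    qed
    define I where "I B = (\<integral>\<^sup>+\<zeta>. (if \<zeta> \<in> U \<and> small_boxes c j0 \<zeta> u then emeasure \<mu> {v. B \<zeta> v} else 0) \<partial>lborel)" for B :: "complex \<Rightarrow> 'n stream \<Rightarrow> bool"
    have Bk: "2 * Cb 2 s * (2 / real (2 ^ (i + k0))) \<le> (1 / 2) ^ Suc i / 2" for i
    proof -
      have "8 * (2 * Cb 2 s) \<le> 2 ^ k0" using k0 by simp
      then have "8 * (2 * Cb 2 s) / (4 * 2 ^ (i + k0)) * 2 ^ k0 \<le> 2 ^ k0 / (4 * 2 ^ (i + k0)) * 2 ^ k0"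
        by (intro mult_right_mono divide_right_mono) auto
      then show ?thesis by (simp add: power_add power_one_over field_simps)
    qed
    have IA: "I (A j) \<le> ennreal (256 * 4 ^ k0 * ((1 / 16) ^ l * 2 powr ((4 - c) * real j)))" if j: "j0 \<le> j" "j < l" for j
    proof -
      have "I (A j) \<le> ennreal (real (2 ^ (j + k0)) ^ 2 * (64 * (?r / (1 / 2) ^ Suc j)\<^sup>2 * 2 powr (- c * real j)))"
        unfolding I_def U_def
      proof (rule level_integral[OF s _ _ Bk])
        fix k
        show "\<exists>Nb\<in>sets \<mu>. emeasure \<mu> Nb \<le> ennreal (2 powr (- c * real j)) \<and>
            (\<forall>\<zeta>\<in>grid_sq z0 (2 ^ (j + k0)) k. small_boxes c j0 \<zeta> u \<longrightarrow> (\<forall>v. A j \<zeta> v \<longrightarrow> v \<in> Nb))"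
        proof (cases "\<exists>\<zeta>'\<in>grid_sq z0 (2 ^ (j + k0)) k. small_boxes c j0 \<zeta>' u")
          case False then show ?thesis by (intro bexI[of _ "{}"]) auto
        next
          case True
          \<comment> \<open>One parameter of the square at which \<open>u\<close> has small boxes
            serves as reference: by \<open>near_transfer\<close> its box catches every
            \<open>v\<close> that matters anywhere in the square.\<close>
          then obtain \<zeta>' where z: "\<zeta>' \<in> grid_sq z0 (2 ^ (j + k0)) k" "small_boxes c j0 \<zeta>' u" by blast
          show ?thesis
          proof (intro bexI[of _ "{v. near \<zeta>' (4 * (1 / 4) ^ j) (4 * (1 / 2) ^ j) u v}"] conjI ballI impI allI near_sets)
            show "emeasure \<mu> {v. near \<zeta>' (4 * (1 / 4) ^ j) (4 * (1 / 2) ^ j) u v} \<le> ennreal (2 powr (- c * real j))"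
              using z(2) j(1) by (simp add: small_boxes_def emeasure_eq_measure)
            fix \<zeta> v assume \<zeta>: "\<zeta> \<in> grid_sq z0 (2 ^ (j + k0)) k" and v: "A j \<zeta> v"
            have "cmod (\<zeta>' - \<zeta>) \<le> 2 / 2 ^ (j + k0)" using grid_sq_diam[OF z(1) \<zeta>] by simp
            then have "near \<zeta>' (4 * (1 / 4) ^ j) (4 * (1 / 2) ^ j) u v"
              using v j grid_sq_Re[OF z(1)] grid_sq_Re[OF \<zeta>] s by (intro near_transfer[OF s(1) _ _ k0, of \<zeta> \<zeta>' j l]) (auto simp: A_def)
            then show "v \<in> {v. near \<zeta>' (4 * (1 / 4) ^ j) (4 * (1 / 2) ^ j) u v}" by simp
          qed
        qed
      qed (auto simp: A_def)
      also have "real (2 ^ (j + k0)) ^ 2 * (64 * (?r / (1 / 2) ^ Suc j)\<^sup>2 * 2 powr (- c * real j)) = 256 * 4 ^ k0 * ((1 / 16) ^ l * 2 powr ((4 - c) * real j))"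
      proof -
        have e1: "real (2 ^ (j + k0)) ^ 2 = 4 ^ j * 4 ^ k0" unfolding sq4 by (rule power_add)
        have e2: "(?r / (1 / 2) ^ Suc j)\<^sup>2 = 4 * 4 ^ j * (1 / 16) ^ l"
        proof -
          have "(?r / (1 / 2) ^ Suc j) = 2 * 2 ^ j * ?r" by (simp add: power_one_over field_simps)
          then have "(?r / (1 / 2) ^ Suc j)\<^sup>2 = 4 * (2 ^ j * 2 ^ j) * (?r * ?r)" by (simp add: power2_eq_square)
          also have "(2::real) ^ j * 2 ^ j = 4 ^ j" by (simp flip: power_mult_distrib)
          also have "?r * ?r = (1 / 16) ^ l" by (simp flip: power_mult_distrib)
          finally show ?thesis .
        qed
        have e3: "2 powr ((4 - c) * real j) = 4 ^ j * 4 ^ j * 2 powr (- c * real j)"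
        proof -
          have "(4 - c) * real j = real (4 * j) + - c * real j" by (simp add: algebra_simps)
          then have "2 powr ((4 - c) * real j) = 2 powr (real (4 * j)) * 2 powr (- c * real j)" by (simp only: powr_add)
          also have "2 powr (real (4 * j)) = (2::real) ^ (4 * j)" by (rule powr_realpow) simp
          also have "\<dots> = 4 ^ j * 4 ^ j" by (simp add: power_mult flip: power_mult_distrib)
          finally show ?thesis .
        qed
        show ?thesis unfolding e1 e2 e3 by simp
      qed
      finally show ?thesis .
    qed
    have IA': "I A' \<le> ennreal (256 * 4 ^ k0 * 16 ^ j0 * (1 / 16) ^ l)"
    proof -
      have "I A' \<le> ennreal (real (2 ^ (j0 + k0)) ^ 2 * (64 * (?r / (1 / 2) ^ Suc j0)\<^sup>2 * 1))"
        unfolding I_def U_def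
      proof (rule level_integral[OF s _ _ Bk])
        show "\<exists>Nb\<in>sets \<mu>. emeasure \<mu> Nb \<le> ennreal 1 \<and> (\<forall>\<zeta>\<in>grid_sq z0 (2 ^ (j0 + k0)) k. small_boxes c j0 \<zeta> u \<longrightarrow> (\<forall>v. A' \<zeta> v \<longrightarrow> v \<in> Nb))" for k
          using emeasure_space_1 by (intro bexI[of _ UNIV]) (auto intro: sets.top[of \<mu>, simplified])
        show "A' \<zeta> v \<Longrightarrow> cmod (V 0 0 \<zeta> u - V 0 0 \<zeta> v) \<le> ?r \<and> (1 / 2) ^ Suc j0 \<le> cmod (V 1 0 \<zeta> u - V 1 0 \<zeta> v)" for \<zeta> v
        proof -
          have "(1 / 2 :: real) ^ Suc j0 \<le> (1 / 2) ^ j0" by (intro power_decreasing) auto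
          then show "A' \<zeta> v \<Longrightarrow> cmod (V 0 0 \<zeta> u - V 0 0 \<zeta> v) \<le> ?r \<and> (1 / 2) ^ Suc j0 \<le> cmod (V 1 0 \<zeta> u - V 1 0 \<zeta> v)"
            unfolding A'_def by linarith
        qed
      qed auto
      also have "real (2 ^ (j0 + k0)) ^ 2 * (64 * (?r / (1 / 2) ^ Suc j0)\<^sup>2 * 1) = 256 * 4 ^ k0 * 16 ^ j0 * (1 / 16) ^ l"
      proof -
        have e1: "real (2 ^ (j0 + k0)) ^ 2 = 4 ^ j0 * 4 ^ k0" unfolding sq4 by (rule power_add)
        have "(?r / (1 / 2) ^ Suc j0) = 2 * 2 ^ j0 * ?r" by (simp add: power_one_over field_simps)
        then have "(?r / (1 / 2) ^ Suc j0)\<^sup>2 = 4 * (2 ^ j0 * 2 ^ j0) * (?r * ?r)" by (simp add: power2_eq_square)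
        also have "(2::real) ^ j0 * 2 ^ j0 = 4 ^ j0" by (simp flip: power_mult_distrib)
        also have "?r * ?r = (1 / 16) ^ l" by (simp flip: power_mult_distrib)
        finally have e2: "(?r / (1 / 2) ^ Suc j0)\<^sup>2 = 4 * 4 ^ j0 * (1 / 16) ^ l" .
        have e3: "(16::real) ^ j0 = 4 ^ j0 * 4 ^ j0" by (simp flip: power_mult_distrib)
        show ?thesis unfolding e1 e2 e3 by simp
      qed
      finally show ?thesis .
    qed
    let ?N = "\<lambda>\<zeta> v. near \<zeta> ?r ((1 / 2) ^ l) u v"
    have IN: "I ?N \<le> ennreal (2 powr (- c * l))"
    proof -
      have "I ?N \<le> (\<integral>\<^sup>+\<zeta>. ennreal (2 powr (- c * l)) * indicator U \<zeta> \<partial>lborel)"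
        unfolding I_def
      proof (rule nn_integral_mono)
        fix \<zeta>
        have "emeasure \<mu> {v. ?N \<zeta> v} \<le> ennreal (2 powr (- c * l))" if "small_boxes c j0 \<zeta> u"
        proof -
          have "(1 / 4 :: real) ^ l \<le> 4 * (1 / 4) ^ l" "(1 / 2 :: real) ^ l \<le> 4 * (1 / 2) ^ l" by auto
          then have "{v. ?N \<zeta> v} \<subseteq> {v. near \<zeta> (4 * (1 / 4) ^ l) (4 * (1 / 2) ^ l) u v}"
            using near_mono by blast
          then have "emeasure \<mu> {v. ?N \<zeta> v} \<le> emeasure \<mu> {v. near \<zeta> (4 * (1 / 4) ^ l) (4 * (1 / 2) ^ l) u v}"
            by (intro emeasure_mono near_sets)
          also have "\<dots> \<le> ennreal (2 powr (- c * l))" using that l by (simp add: small_boxes_def emeasure_eq_measure)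
          finally show ?thesis .
        qed
        then show "(if \<zeta> \<in> U \<and> small_boxes c j0 \<zeta> u then emeasure \<mu> {v. ?N \<zeta> v} else 0) \<le> ennreal (2 powr (- c * l)) * indicator U \<zeta>" by auto
      qed
      also have "\<dots> = ennreal (2 powr (- c * l)) * emeasure lborel U" by (simp add: nn_integral_cmult_indicator U_def)
      also have "emeasure lborel U = 1" unfolding U_def by (subst emeasure_lborel_cbox) (auto simp: Basis_complex_def)
      finally show ?thesis by simp
    qed
    define Lh where "Lh B \<zeta> = (if \<zeta> \<in> U \<and> small_boxes c j0 \<zeta> u then emeasure \<mu> {v. B \<zeta> v} else 0)" for B :: "complex \<Rightarrow> 'n stream \<Rightarrow> bool" and \<zeta>
    have Gm [measurable]: "Measurable.pred lborel (\<lambda>\<zeta>. small_boxes c j0 \<zeta> u)"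
    proof -
      have "(\<lambda>\<zeta>. (\<zeta>, u)) \<in> lborel \<rightarrow>\<^sub>M borel \<Otimes>\<^sub>M \<mu>" by measurable
      from measurable_compose[OF this measurable_small_boxes] show ?thesis by simp
    qed
    have Lm: "Lh B \<in> borel_measurable lborel" if B: "Measurable.pred (lborel \<Otimes>\<^sub>M \<mu>) (\<lambda>x. B (fst x) (snd x))" for B
    proof -
      have "{x \<in> space (lborel \<Otimes>\<^sub>M \<mu>). B (fst x) (snd x)} \<in> sets (lborel \<Otimes>\<^sub>M \<mu>)" using B by (simp add: pred_def)
      from measurable_emeasure_Pair[OF this] have [measurable]: "(\<lambda>\<zeta>. emeasure \<mu> {v. B \<zeta> v}) \<in> borel_measurable lborel"
        by (simp add: space_pair_measure vimage_def)
      have [measurable]: "U \<in> sets borel" by (simp add: U_def)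
      show ?thesis unfolding Lh_def by measurable
    qed
    have mN: "Measurable.pred (lborel \<Otimes>\<^sub>M \<mu>) (\<lambda>x. ?N (fst x) (snd x))" unfolding near_def by measurable
    have split: "Lh (\<lambda>\<zeta> v. cmod (?F 0 \<zeta> v) \<le> ?r) \<zeta> \<le> Lh ?N \<zeta> + (Lh A' \<zeta> + (\<Sum>j=j0..<l. Lh (A j) \<zeta>))" for \<zeta>
    proof -
      have "{v. cmod (?F 0 \<zeta> v) \<le> ?r} \<subseteq> {v. ?N \<zeta> v} \<union> ({v. A' \<zeta> v} \<union> (\<Union>j\<in>{j0..<l}. {v. A j \<zeta> v}))"
      proof
        fix v assume v: "v \<in> {v. cmod (?F 0 \<zeta> v) \<le> ?r}"
        let ?x = "cmod (?F 1 \<zeta> v)"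
        show "v \<in> {v. ?N \<zeta> v} \<union> ({v. A' \<zeta> v} \<union> (\<Union>j\<in>{j0..<l}. {v. A j \<zeta> v}))"
        proof (cases "?x \<ge> (1 / 2) ^ j0")
          case True then show ?thesis using v by (simp add: A'_def)
        next
          case False
          have "?x \<le> (1 / 2) ^ l \<or> (\<exists>j\<in>{j0..<l}. (1 / 2) ^ Suc j \<le> ?x \<and> ?x \<le> (1 / 2) ^ j)"
            using l False
          proof (induction l rule: dec_induct)
            case base then show ?case by simp
          next
            case (step n)
            show ?case
            proof (cases "?x \<le> (1 / 2) ^ n")
              case True
              then show ?thesis using step by (cases "?x \<le> (1 / 2) ^ Suc n") (auto intro!: bexI[of _ n] simp del: power_Suc)
            next
              case False
              then have "\<exists>j\<in>{j0..<n}. (1 / 2) ^ Suc j \<le> ?x \<and> ?x \<le> (1 / 2) ^ j" using step by blast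
              then show ?thesis by (auto simp del: power_Suc intro: less_SucI)
            qed
          qed
          then show ?thesis using v by (auto simp: A_def near_def simp del: power_Suc)
        qed
      qed
      then have "emeasure \<mu> {v. cmod (?F 0 \<zeta> v) \<le> ?r} \<le> emeasure \<mu> ({v. ?N \<zeta> v} \<union> ({v. A' \<zeta> v} \<union> (\<Union>j\<in>{j0..<l}. {v. A j \<zeta> v})))"
        by (intro emeasure_mono sets.Un near_sets Asec sets.finite_UN) auto
      also have "\<dots> \<le> emeasure \<mu> {v. ?N \<zeta> v} + (emeasure \<mu> {v. A' \<zeta> v} + emeasure \<mu> (\<Union>j\<in>{j0..<l}. {v. A j \<zeta> v}))"
        by (intro order_trans[OF emeasure_subadditive] add_left_mono emeasure_subadditive near_sets Asec sets.Un sets.finite_UN) auto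
      also have "\<dots> \<le> emeasure \<mu> {v. ?N \<zeta> v} + (emeasure \<mu> {v. A' \<zeta> v} + (\<Sum>j=j0..<l. emeasure \<mu> {v. A j \<zeta> v}))"
        by (intro add_left_mono emeasure_subadditive_finite) (auto intro: Asec)
      finally show ?thesis unfolding Lh_def by auto
    qed
    have "(\<integral>\<^sup>+\<zeta>. Lh (\<lambda>\<zeta> v. cmod (?F 0 \<zeta> v) \<le> ?r) \<zeta> \<partial>lborel) \<le> (\<integral>\<^sup>+\<zeta>. Lh ?N \<zeta> + (Lh A' \<zeta> + (\<Sum>j=j0..<l. Lh (A j) \<zeta>)) \<partial>lborel)"
      by (intro nn_integral_mono split)
    also have "\<dots> = I ?N + (I A' + (\<Sum>j=j0..<l. I (A j)))"
    proof -
      have IL: "I B = (\<integral>\<^sup>+\<zeta>. Lh B \<zeta> \<partial>lborel)" for B by (simp add: I_def Lh_def)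
      have [measurable]: "Lh ?N \<in> borel_measurable lborel" by (rule Lm[OF mN])
      have [measurable]: "Lh A' \<in> borel_measurable lborel" by (rule Lm) measurable
      have [measurable]: "Lh (A j) \<in> borel_measurable lborel" for j by (rule Lm) measurable
      show ?thesis unfolding IL by (simp add: nn_integral_add nn_integral_sum)
    qed
    also have "\<dots> \<le> ennreal (2 powr (- c * l)) + (ennreal (256 * 4 ^ k0 * 16 ^ j0 * (1 / 16) ^ l) + (\<Sum>j=j0..<l. ennreal (256 * 4 ^ k0 * ((1 / 16) ^ l * 2 powr ((4 - c) * real j)))))"
      by (intro add_mono IN IA' sum_mono IA) auto
    also have "\<dots> = ennreal (2 powr (- c * l) + (256 * 4 ^ k0 * 16 ^ j0 * (1 / 16) ^ l + (\<Sum>j=j0..<l. 256 * 4 ^ k0 * ((1 / 16) ^ l * 2 powr ((4 - c) * real j)))))"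
      by (simp add: sum_ennreal ennreal_plus sum_nonneg)
    also have "\<dots> \<le> ennreal (2 powr (- c * l) + K * (1 / 16) ^ l * (1 + (\<Sum>j=j0..<l. 2 powr ((4 - c) * real j))))"
    proof (intro ennreal_leI add_left_mono)
      define S where "S = (\<Sum>j=j0..<l. 2 powr ((4 - c) * real j))"
      have S: "S \<ge> 0" by (simp add: S_def sum_nonneg)
      have "(\<Sum>j=j0..<l. 256 * 4 ^ k0 * ((1 / 16) ^ l * 2 powr ((4 - c) * real j))) = (256 * 4 ^ k0) * (1 / 16) ^ l * S"
        by (simp add: S_def sum_distrib_left mult_ac)
      also have "\<dots> \<le> K * (1 / 16) ^ l * S" using S by (intro mult_right_mono) (auto simp: K_def)
      finally have "(\<Sum>j=j0..<l. 256 * 4 ^ k0 * ((1 / 16) ^ l * 2 powr ((4 - c) * real j))) \<le> K * (1 / 16) ^ l * S" .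
      moreover have "256 * 4 ^ k0 * 16 ^ j0 * (1 / 16) ^ l \<le> K * (1 / 16) ^ l" by (intro mult_right_mono) (auto simp: K_def)
      ultimately show "256 * 4 ^ k0 * 16 ^ j0 * (1 / 16) ^ l + (\<Sum>j=j0..<l. 256 * 4 ^ k0 * ((1 / 16) ^ l * 2 powr ((4 - c) * real j))) \<le> K * (1 / 16) ^ l * (1 + (\<Sum>j=j0..<l. 2 powr ((4 - c) * real j)))"
        unfolding S_def[symmetric] distrib_left mult_1_right by linarith
    qed
    finally show ?thesis by (simp add: Lh_def)
  qed
  then show ?thesis unfolding U_def by (intro exI[of _ K]) (auto simp: K_def)
qed

end

section \<open>Almost every parameter\<close>

context fprob
begin

text \<open>The sum is the probability that an independent pair falls into one cell with the first
  point in \<open>G\<close>, and points of one cell have images within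
  \<open>\<rho>\<close>.\<close>

lemma sum_cell_mass_le:
  fixes X :: "'a \<Rightarrow> complex"
  assumes f: "fin_rv M f" and G: "G \<in> sets M" and w: "w \<ge> 0"
    and X: "X \<in> borel_measurable M" and fX: "\<And>u v. f u = f v \<Longrightarrow> cmod (X u - X v) \<le> \<rho>"
    and W: "(\<integral>\<^sup>+u. (if u \<in> G then emeasure M {v. cmod (X u - X v) \<le> \<rho>} else 0) \<partial>M) \<le> ennreal w"
  shows "(\<Sum>d\<in>range f. measure M (G \<inter> {u. f u = d}) * pr M f d) \<le> w"
proof -
  note fs = fin_rv_sets[OF f]
  have fr: "finite (range f)" using f by (rule fin_rv_finite)
  have "ennreal (\<Sum>d\<in>range f. measure M (G \<inter> {u. f u = d}) * pr M f d) = (\<Sum>d\<in>range f. ennreal (pr M f d) * emeasure M (G \<inter> {u. f u = d}))"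
    by (subst sum_ennreal[symmetric]) (auto simp: emeasure_eq_measure ennreal_mult' mult.commute intro!: sum.cong)
  also have "\<dots> = (\<integral>\<^sup>+u. (\<Sum>d\<in>range f. ennreal (pr M f d) * indicator (G \<inter> {u. f u = d}) u) \<partial>M)"
    using G fs by (subst nn_integral_sum) (auto simp: nn_integral_cmult_indicator)
  also have "\<dots> \<le> (\<integral>\<^sup>+u. (if u \<in> G then emeasure M {v. cmod (X u - X v) \<le> \<rho>} else 0) \<partial>M)"
  proof (rule nn_integral_mono)
    fix u
    have "(\<Sum>d\<in>range f. ennreal (pr M f d) * indicator (G \<inter> {u. f u = d}) u) = (\<Sum>d\<in>{f u}. ennreal (pr M f d) * indicator (G \<inter> {u. f u = d}) u)"
      by (rule sum.mono_neutral_right) (use fr in auto)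
    also have "\<dots> = (if u \<in> G then ennreal (pr M f (f u)) else 0)" by (auto simp: indicator_def)
    also have "\<dots> \<le> (if u \<in> G then emeasure M {v. cmod (X u - X v) \<le> \<rho>} else 0)"
    proof -
      note X[measurable]
      have "Measurable.pred M (\<lambda>v. cmod (X u - X v) \<le> \<rho>)" by measurable
      then have "{v. cmod (X u - X v) \<le> \<rho>} \<in> sets M" by (simp add: pred_def space_UNIV)
      then have "emeasure M {v. f v = f u} \<le> emeasure M {v. cmod (X u - X v) \<le> \<rho>}"
        using fX by (intro emeasure_mono) (auto simp: eq_commute)
      then show ?thesis by (simp add: pr_def emeasure_eq_measure)
    qed
    finally show "(\<Sum>d\<in>range f. ennreal (pr M f d) * indicator (G \<inter> {u. f u = d}) u) \<le> (if u \<in> G then emeasure M {v. cmod (X u - X v) \<le> \<rho>} else 0)" .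
  qed
  also note W
  finally show ?thesis using w by (simp add: ennreal_le_iff)
qed

lemma measure_eq_sum_cells:
  assumes f: "fin_rv M f" and G: "G \<in> sets M"
  shows "measure M (G \<inter> {u. f u \<in> D}) = (\<Sum>d\<in>range f \<inter> D. measure M (G \<inter> {u. f u = d}))"
proof -
  have "G \<inter> {u. f u \<in> D} = (\<Union>d\<in>range f \<inter> D. G \<inter> {u. f u = d})" by auto
  then have "measure M (G \<inter> {u. f u \<in> D}) = measure M (\<Union>d\<in>range f \<inter> D. G \<inter> {u. f u = d})" by simp
  also have "\<dots> = (\<Sum>d\<in>range f \<inter> D. measure M (G \<inter> {u. f u = d}))"
    by (rule finite_measure_finite_Union)
       (use fin_rv_finite[OF f] fin_rv_sets[OF f] G in \<open>auto simp: disjoint_family_on_def\<close>)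
  finally show ?thesis .
qed

text \<open>On the mass inside \<open>G\<close> one has - ln P \<ge> 1 - ln w - P / w, where the
  last term integrates to at most 1. The mass outside \<open>G\<close> contributes a nonnegative
  amount, as P \<le> 1.\<close>

lemma ent_ge_of_energy:
  fixes X :: "'a \<Rightarrow> complex"
  assumes f: "fin_rv M f" and G: "G \<in> sets M" and w: "w > 0"
    and X: "X \<in> borel_measurable M" and fX: "\<And>u v. f u = f v \<Longrightarrow> cmod (X u - X v) \<le> \<rho>"
    and W: "(\<integral>\<^sup>+u. (if u \<in> G then emeasure M {v. cmod (X u - X v) \<le> \<rho>} else 0) \<partial>M) \<le> ennreal w"
  shows "ent M f \<ge> measure M G * (1 - ln w) - 1"
proof -
  define m where "m d = measure M (G \<inter> {u. f u = d})" for d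
  have fs: "{u. f u = d} \<in> sets M" for d using fin_rv_sets[OF f] .
  have m: "0 \<le> m d" "m d \<le> pr M f d" for d
    unfolding m_def pr_def using fs by (auto intro!: finite_measure_mono)
  have sm: "(\<Sum>d\<in>range f. m d) = measure M G"
    using measure_eq_sum_cells[OF f G, of UNIV] by (simp add: m_def)
  have S: "(\<Sum>d\<in>range f. m d * pr M f d) \<le> w"
    unfolding m_def by (rule sum_cell_mass_le[OF f G _ X fX W]) (use w in auto)
  have t: "m d * (1 - ln w) - (1 / w) * (m d * pr M f d) \<le> - (pr M f d * ln (pr M f d))" for d
  proof (cases "pr M f d = 0")
    case True then show ?thesis using m[of d] by simp
  next
    case False
    then have p: "pr M f d > 0" using pr_nonneg[of M f d] by linarith
    have "ln (pr M f d / w) \<le> pr M f d / w - 1" using p w by (intro ln_le_minus_one) auto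
    then have "1 - ln w - pr M f d / w \<le> - ln (pr M f d)" using p w by (simp add: ln_div)
    then have "m d * (1 - ln w - pr M f d / w) \<le> m d * (- ln (pr M f d))" using m by (intro mult_left_mono)
    also have "\<dots> \<le> pr M f d * (- ln (pr M f d))" using m[of d] p pr_le_1[of f d] by (intro mult_right_mono) auto
    finally show ?thesis by (simp add: algebra_simps)
  qed
  have "(\<Sum>d\<in>range f. m d * (1 - ln w) - (1 / w) * (m d * pr M f d)) \<le> ent M f"
    unfolding ent_def sum_negf[symmetric] by (intro sum_mono t)
  moreover have "(\<Sum>d\<in>range f. m d * (1 - ln w) - (1 / w) * (m d * pr M f d)) = measure M G * (1 - ln w) - (1 / w) * (\<Sum>d\<in>range f. m d * pr M f d)"
    by (simp only: sum_subtractf sum_distrib_left[symmetric] sum_distrib_right[symmetric] sm)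
  moreover have "(1 / w) * (\<Sum>d\<in>range f. m d * pr M f d) \<le> (1 / w) * w" using S w by (intro mult_left_mono) auto
  moreover have "(1 / w) * w = 1" using w by simp
  ultimately show ?thesis by linarith
qed

text \<open>Cauchy--Schwarz over the grid squares contained in the open set.\<close>

lemma open_mass:
  fixes X :: "'a \<Rightarrow> complex"
  assumes X: "X \<in> borel_measurable M" and bX: "\<And>u. cmod (X u) \<le> B" and G: "G \<in> sets M" and K: "K \<ge> 0"
    and W: "\<exists>\<^sub>F l in sequentially. (\<integral>\<^sup>+u. (if u \<in> G then emeasure M {v. cmod (X u - X v) \<le> (1 / 4) ^ l} else 0) \<partial>M) \<le> ennreal (K * (1 / 16) ^ l)"
    and O: "open Op" "emeasure lborel Op < \<infinity>"
  shows "(measure M (G \<inter> {u. X u \<in> Op}))\<^sup>2 \<le> 4 * K * measure lborel Op"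
proof -
  note X[measurable]
  \<comment> \<open>Half of 4^-l, since points with the same \<open>fl\<close> are at distance at
    most 2 by \<open>fl_eq_imp\<close>.\<close>
  define hh where "hh l = (1 / 4 :: real) ^ l / 2" for l
  have hh: "hh l > 0" for l by (simp add: hh_def)
  define e where "e l u = fl (X u / of_real (hh l))" for l u
  define D where "D l = {d. {z. fl (z / of_real (hh l)) = d} \<subseteq> Op}" for l
  define E where "E l = G \<inter> {u. e l u \<in> D l}" for l
  have fle: "cmod (z - z') \<le> (1 / 4) ^ l" if "fl (z / of_real (hh l)) = fl (z' / of_real (hh l))" for l z z'
  proof -
    have "cmod (z / of_real (hh l) - z' / of_real (hh l)) \<le> 2" by (rule fl_eq_imp[OF that])
    then have "cmod (z - z') / hh l \<le> 2" using hh[of l] by (simp add: norm_divide flip: diff_divide_distrib)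
    then show ?thesis using hh[of l] by (simp add: pos_divide_le_eq hh_def)
  qed
  have fin: "fin_rv M (e l)" for l
    unfolding fin_rv_def
  proof (intro conjI allI)
    have B0: "B \<ge> 0" using bX[of undefined] norm_ge_zero order_trans by blast
    define R where "R = \<lceil>B / hh l\<rceil> + 1"
    have "range (e l) \<subseteq> {-R..R} \<times> {-R..R}"
    proof
      fix d assume "d \<in> range (e l)"
      then obtain u where d: "d = e l u" by auto
      have "cmod (X u / of_real (hh l)) \<le> B / hh l" using bX[of u] hh[of l] by (simp add: norm_divide divide_right_mono)
      then have "\<bar>Re (X u / of_real (hh l))\<bar> \<le> B / hh l" "\<bar>Im (X u / of_real (hh l))\<bar> \<le> B / hh l"
        using abs_Re_le_cmod abs_Im_le_cmod order_trans by blast+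
      moreover have "\<lfloor>x\<rfloor> \<in> {- R..R}" if "\<bar>x\<bar> \<le> B / hh l" for x
        using that unfolding R_def atLeastAtMost_iff by linarith
      ultimately show "d \<in> {-R..R} \<times> {-R..R}" unfolding d e_def fl_def mem_Times_iff fst_conv snd_conv by blast
    qed
    then show "finite (range (e l))" by (rule finite_subset) auto
    fix c
    have "Measurable.pred M (\<lambda>x. \<lfloor>Re (X x / of_real (hh l))\<rfloor> = fst c \<and> \<lfloor>Im (X x / of_real (hh l))\<rfloor> = snd c)" by measurable
    moreover have "{x. e l x = c} = {x. \<lfloor>Re (X x / of_real (hh l))\<rfloor> = fst c \<and> \<lfloor>Im (X x / of_real (hh l))\<rfloor> = snd c}"
      by (auto simp: e_def fl_def)
    ultimately show "{x. e l x = c} \<in> sets M" by (simp add: pred_def space_UNIV)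
  qed
  have Esets: "E l \<in> sets M" for l
  proof -
    have "{u. e l u \<in> D l} = (\<Union>d\<in>range (e l) \<inter> D l. {u. e l u = d})" by auto
    moreover have "\<dots> \<in> sets M" using fin_rv_finite[OF fin] fin_rv_sets[OF fin] by (intro sets.finite_UN) auto
    ultimately show ?thesis using G by (simp add: E_def sets.Int)
  qed
  have no_gain: "(measure M (E l))\<^sup>2 \<le> 4 * K * measure lborel Op"
    if l: "(\<integral>\<^sup>+u. (if u \<in> G then emeasure M {v. cmod (X u - X v) \<le> (1 / 4) ^ l} else 0) \<partial>M) \<le> ennreal (K * (1 / 16) ^ l)" for l
  proof -
    define I where "I = range (e l) \<inter> D l"
    define m where "m d = measure M (G \<inter> {u. e l u = d})" for d
    have fI: "finite I" using fin_rv_finite[OF fin] by (simp add: I_def)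
    have "measure M (E l) = (\<Sum>d\<in>I. m d)"
      unfolding E_def I_def m_def by (rule measure_eq_sum_cells[OF fin G])
    then have f1: "(measure M (E l))\<^sup>2 \<le> (\<Sum>d\<in>I. (m d)\<^sup>2) * card I"
      using sum_squared_le_sum_of_squares[of m I] by simp
    have f2: "(\<Sum>d\<in>I. (m d)\<^sup>2) \<le> K * (1 / 16) ^ l"
    proof -
      have "(\<Sum>d\<in>I. (m d)\<^sup>2) \<le> (\<Sum>d\<in>I. m d * pr M (e l) d)"
        unfolding power2_eq_square by (intro sum_mono mult_left_mono) (auto simp: m_def pr_def intro!: finite_measure_mono fin_rv_sets[OF fin])
      also have "\<dots> \<le> (\<Sum>d\<in>range (e l). m d * pr M (e l) d)"
        by (rule sum_mono2) (use fin_rv_finite[OF fin] in \<open>auto simp: I_def m_def\<close>)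
      also have "\<dots> \<le> K * (1 / 16) ^ l"
        unfolding m_def by (rule sum_cell_mass_le[OF fin G _ X _ l]) (use K fle in \<open>auto simp: e_def\<close>)
      finally show ?thesis .
    qed
    have 2: "real (card I) * (hh l)\<^sup>2 \<le> measure lborel Op"
    proof -
      define Bx where "Bx d = box (Complex (of_int (fst d) * hh l) (of_int (snd d) * hh l)) (Complex ((of_int (fst d) + 1) * hh l) ((of_int (snd d) + 1) * hh l))" for d :: "int \<times> int"
      have Bfl: "fl (z / of_real (hh l)) = d" if "z \<in> Bx d" for z d
      proof -
        have "of_int (fst d) < Re z / hh l" "Re z / hh l < of_int (fst d) + 1" "of_int (snd d) < Im z / hh l" "Im z / hh l < of_int (snd d) + 1"
          using that hh[of l] by (auto simp: Bx_def in_box_complex_iff pos_less_divide_eq pos_divide_less_eq)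
        then have "\<lfloor>Re z / hh l\<rfloor> = fst d" "\<lfloor>Im z / hh l\<rfloor> = snd d" by (auto simp: floor_eq_iff)
        then show ?thesis by (simp add: fl_def)
      qed
      have eB: "emeasure lborel (Bx d) = ennreal ((hh l)\<^sup>2)" for d
        unfolding Bx_def using hh[of l] by (subst emeasure_lborel_box) (auto simp: Basis_complex_def algebra_simps power2_eq_square)
      have "ennreal (real (card I) * (hh l)\<^sup>2) = (\<Sum>d\<in>I. emeasure lborel (Bx d))"
        unfolding eB by (subst sum_ennreal) auto
      also have "\<dots> = emeasure lborel (\<Union>d\<in>I. Bx d)"
      proof (rule sum_emeasure[OF _ _ fI])
        show "Bx ` I \<subseteq> sets lborel" by (auto simp: Bx_def)
        have "d = d'" if "z \<in> Bx d" "z \<in> Bx d'" for z d d' using Bfl[OF that(1)] Bfl[OF that(2)] by simp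
        then show "disjoint_family_on Bx I" unfolding disjoint_family_on_def by blast
      qed
      also have "\<dots> \<le> emeasure lborel Op"
        using Bfl O(1) by (intro emeasure_mono) (auto simp: I_def D_def)
      also have "\<dots> = ennreal (measure lborel Op)" using O(2) by (simp add: emeasure_eq_ennreal_measure less_top)
      finally show ?thesis by (simp add: ennreal_le_iff)
    qed
    have 1: "(measure M (E l))\<^sup>2 \<le> K * (1 / 16) ^ l * card I"
      by (rule order_trans[OF f1]) (intro mult_right_mono f2, simp)
    have h2: "(hh l)\<^sup>2 = (1 / 16) ^ l / 4"
      by (simp add: hh_def power2_eq_square flip: power_mult_distrib)
    have "K * (1 / 16) ^ l * card I = 4 * K * (real (card I) * (hh l)\<^sup>2)" unfolding h2 by simp
    also have "\<dots> \<le> 4 * K * measure lborel Op" using 2 K by (intro mult_left_mono) auto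
    finally show ?thesis using 1 by linarith
  qed
  \<comment> \<open>The energy bound is available only for infinitely many \<open>l\<close>. Each
    \<open>A n\<close> lies in \<open>E l\<close> for one such \<open>l\<close>, and the
    \<open>A n\<close> increase to a set containing all points of \<open>G\<close> that map into the
    open set.\<close>
  define A where "A n = (\<Inter>l\<in>{n..}. E l)" for n
  have Asets: "A n \<in> sets M" for n unfolding A_def using Esets by (intro sets.countable_INT) auto
  have incA: "incseq A" by (rule incseq_SucI) (auto simp: A_def)
  have Abound: "measure M (A n) \<le> sqrt (4 * K * measure lborel Op)" for n
  proof -
    obtain l where l: "l \<ge> n" "(\<integral>\<^sup>+u. (if u \<in> G then emeasure M {v. cmod (X u - X v) \<le> (1 / 4) ^ l} else 0) \<partial>M) \<le> ennreal (K * (1 / 16) ^ l)"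
      using W unfolding frequently_sequentially by blast
    have "measure M (A n) \<le> measure M (E l)" using l(1) Esets by (intro finite_measure_mono) (auto simp: A_def)
    also have "\<dots> \<le> sqrt (4 * K * measure lborel Op)" using no_gain[OF l(2)] by (rule real_le_rsqrt)
    finally show ?thesis .
  qed
  have sub: "G \<inter> {u. X u \<in> Op} \<subseteq> (\<Union>n. A n)"
  proof
    fix u assume u: "u \<in> G \<inter> {u. X u \<in> Op}"
    then have "X u \<in> Op" by simp
    with O(1) obtain r where r: "r > 0" "ball (X u) r \<subseteq> Op" by (rule openE)
    obtain n where n: "(1 / 4 :: real) ^ n < r" using real_arch_pow_inv[OF r(1), of "1 / 4"] by auto
    have "e l u \<in> D l" if "l \<ge> n" for l
    proof -
      have p: "(1 / 4 :: real) ^ l \<le> (1 / 4) ^ n" using that by (intro power_decreasing) auto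
      have "z \<in> ball (X u) r" if "fl (z / of_real (hh l)) = e l u" for z
      proof -
        have "cmod (X u - z) \<le> (1 / 4) ^ l" by (rule fle) (use that in \<open>simp add: e_def\<close>)
        then have "cmod (X u - z) < r" using p n by linarith
        then show ?thesis by (simp add: dist_norm)
      qed
      then show ?thesis using r(2) by (auto simp: D_def)
    qed
    then show "u \<in> (\<Union>n. A n)" using u by (auto simp: A_def E_def)
  qed
  have "(\<lambda>n. measure M (A n)) \<longlonglongrightarrow> measure M (\<Union>n. A n)"
    using Asets incA by (intro finite_Lim_measure_incseq) auto
  then have "measure M (\<Union>n. A n) \<le> sqrt (4 * K * measure lborel Op)"
    using Abound by (intro LIMSEQ_le_const2) auto
  moreover have "measure M (G \<inter> {u. X u \<in> Op}) \<le> measure M (\<Union>n. A n)"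
    using sub Asets by (intro finite_measure_mono) auto
  ultimately have "measure M (G \<inter> {u. X u \<in> Op}) \<le> sqrt (4 * K * measure lborel Op)" by linarith
  then have "(measure M (G \<inter> {u. X u \<in> Op}))\<^sup>2 \<le> (sqrt (4 * K * measure lborel Op))\<^sup>2" by (intro power_mono) auto
  then show ?thesis using K by simp
qed

end

context ifs
begin

section \<open>Energy bounds for almost every parameter\<close>

definition W :: "real \<Rightarrow> nat \<Rightarrow> nat \<Rightarrow> complex \<Rightarrow> ennreal" where
  "W c j0 l \<zeta> = (\<integral>\<^sup>+u. (if small_boxes c j0 \<zeta> u then emeasure \<mu> {v. cmod (V 0 0 \<zeta> u - V 0 0 \<zeta> v) \<le> (1 / 4) ^ l} else 0) \<partial>\<mu>)"

lemma W_pair_meas [measurable]: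
  "(\<lambda>x. if small_boxes c j0 (fst x) (snd x) then emeasure \<mu> {v. cmod (V 0 0 (fst x) (snd x) - V 0 0 (fst x) v) \<le> r} else 0) \<in> borel_measurable (borel \<Otimes>\<^sub>M \<mu>)"
  by measurable

lemma W_meas [measurable]: "W c j0 l \<in> borel_measurable borel"
proof -
  have "sigma_finite_measure \<mu>" by unfold_locales
  from sigma_finite_measure.borel_measurable_nn_integral_fst[OF this W_pair_meas[of c j0 "(1 / 4) ^ l"]]
  show ?thesis by (simp add: W_def[abs_def])
qed

abbreviation Us :: "complex \<Rightarrow> complex set" where "Us z0 \<equiv> cbox z0 (z0 + Complex 1 1)"

lemma W_integral:
  assumes "0 < Re z0"
  shows "\<exists>K\<ge>0. \<forall>l\<ge>j0. (\<integral>\<^sup>+\<zeta>. W c j0 l \<zeta> * indicator (Us z0) \<zeta> \<partial>lborel)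
     \<le> ennreal (2 powr (- c * l) + K * (1 / 16) ^ l * (1 + (\<Sum>j=j0..<l. 2 powr ((4 - c) * real j))))"
proof -
  interpret pair_sigma_finite lborel \<mu> ..
  obtain K where K: "K \<ge> 0" "\<And>l u. l \<ge> j0 \<Longrightarrow> (\<integral>\<^sup>+\<zeta>. (if \<zeta> \<in> Us z0 \<and> small_boxes c j0 \<zeta> u then emeasure \<mu> {v. cmod (V 0 0 \<zeta> u - V 0 0 \<zeta> v) \<le> (1 / 4) ^ l} else 0) \<partial>lborel)
     \<le> ennreal (2 powr (- c * l) + K * (1 / 16) ^ l * (1 + (\<Sum>j=j0..<l. 2 powr ((4 - c) * real j))))"
    using energy[OF assms order_refl] by blast
  have "(\<integral>\<^sup>+\<zeta>. W c j0 l \<zeta> * indicator (Us z0) \<zeta> \<partial>lborel) \<le> ennreal (2 powr (- c * l) + K * (1 / 16) ^ l * (1 + (\<Sum>j=j0..<l. 2 powr ((4 - c) * real j))))" (is "_ \<le> ?b")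
    if l: "l \<ge> j0" for l
  proof -
    define g where "g \<zeta> u = (if \<zeta> \<in> Us z0 \<and> small_boxes c j0 \<zeta> u then emeasure \<mu> {v. cmod (V 0 0 \<zeta> u - V 0 0 \<zeta> v) \<le> (1 / 4) ^ l} else 0)" for \<zeta> u
    have gm: "(\<lambda>x. g (fst x) (snd x)) \<in> borel_measurable (lborel \<Otimes>\<^sub>M \<mu>)"
      unfolding g_def by measurable
    have "W c j0 l \<zeta> * indicator (Us z0) \<zeta> = (\<integral>\<^sup>+u. g \<zeta> u \<partial>\<mu>)" for \<zeta>
      by (cases "\<zeta> \<in> Us z0") (auto simp: W_def g_def)
    then have "(\<integral>\<^sup>+\<zeta>. W c j0 l \<zeta> * indicator (Us z0) \<zeta> \<partial>lborel) = (\<integral>\<^sup>+\<zeta>. \<integral>\<^sup>+u. g \<zeta> u \<partial>\<mu> \<partial>lborel)" by simp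
    also have "\<dots> = (\<integral>\<^sup>+u. \<integral>\<^sup>+\<zeta>. g \<zeta> u \<partial>lborel \<partial>\<mu>)"
      by (rule Fubini'[symmetric]) (use gm in \<open>simp add: case_prod_unfold\<close>)
    also have "\<dots> \<le> (\<integral>\<^sup>+u. ?b \<partial>\<mu>)" unfolding g_def by (intro nn_integral_mono K(2) l)
    also have "\<dots> = ?b" using emeasure_space_1 by simp
    finally show ?thesis .
  qed
  then show ?thesis using K(1) by blast
qed

lemma powr_sixteen: "(1 / 16 :: real) ^ l = 2 powr (- 4 * real l)"
proof -
  have "2 powr (- 4 * real l) = 1 / 2 powr (real (4 * l))" by (simp add: powr_minus divide_inverse)
  also have "2 powr (real (4 * l)) = (2::real) ^ (4 * l)" by (rule powr_realpow) simp
  finally show ?thesis by (simp add: power_mult power_one_over)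
qed

text \<open>For c > 4 the sum over the levels is geometric, so the mean of W is of order 16^-l.
  Fatou's lemma then bounds 16^l W along a sequence of l that depends on the parameter, and
  \<open>open_mass\<close> asks for no more.\<close>

lemma AE_energy_large:
  assumes z0: "0 < Re z0" and c: "c > 4"
  shows "AE \<zeta> in lborel. \<zeta> \<in> Us z0 \<longrightarrow> (\<exists>K\<ge>0. \<exists>\<^sub>F l in sequentially. W c j0 l \<zeta> \<le> ennreal (K * (1 / 16) ^ l))"
proof -
  obtain K where K: "K \<ge> 0" "\<And>l. l \<ge> j0 \<Longrightarrow> (\<integral>\<^sup>+\<zeta>. W c j0 l \<zeta> * indicator (Us z0) \<zeta> \<partial>lborel)
     \<le> ennreal (2 powr (- c * l) + K * (1 / 16) ^ l * (1 + (\<Sum>j=j0..<l. 2 powr ((4 - c) * real j))))"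
    using W_integral[OF z0] by blast
  define q where "q = 2 powr (4 - c)"
  have q: "0 < q" "q < 1" using c by (auto simp: q_def powr_less_one)
  define K' where "K' = 1 + K * (1 + 1 / (1 - q))"
  have K': "K' \<ge> 0" using K(1) q by (simp add: K'_def)
  have b: "2 powr (- c * l) + K * (1 / 16) ^ l * (1 + (\<Sum>j=j0..<l. 2 powr ((4 - c) * real j))) \<le> K' * (1 / 16) ^ l" for l
  proof -
    have "(\<Sum>j=j0..<l. 2 powr ((4 - c) * real j)) = (\<Sum>j=j0..<l. q ^ j)"
      unfolding q_def by (simp add: powr_powr[symmetric] powr_realpow)
    also have "\<dots> \<le> (\<Sum>j. q ^ j)" using q by (intro sum_le_suminf summable_geometric) auto
    also have "\<dots> = 1 / (1 - q)" using q by (intro suminf_geometric) auto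
    finally have "K * (1 / 16) ^ l * (1 + (\<Sum>j=j0..<l. 2 powr ((4 - c) * real j))) \<le> K * (1 / 16) ^ l * (1 + 1 / (1 - q))"
      using K(1) by (intro mult_left_mono) auto
    moreover have "2 powr (- c * l) \<le> (1 / 16) ^ l"
      unfolding powr_sixteen using c by (intro powr_mono mult_right_mono) auto
    ultimately show ?thesis unfolding K'_def by (simp add: algebra_simps)
  qed
  define f where "f l \<zeta> = ennreal (16 ^ l) * (W c j0 l \<zeta> * indicator (Us z0) \<zeta>)" for l \<zeta>
  have fm [measurable]: "f l \<in> borel_measurable lborel" for l unfolding f_def by measurable
  have fi: "(\<integral>\<^sup>+\<zeta>. f l \<zeta> \<partial>lborel) \<le> ennreal K'" if "l \<ge> j0" for l
  proof -
    have "(\<integral>\<^sup>+\<zeta>. f l \<zeta> \<partial>lborel) = ennreal (16 ^ l) * (\<integral>\<^sup>+\<zeta>. W c j0 l \<zeta> * indicator (Us z0) \<zeta> \<partial>lborel)"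
      unfolding f_def by (rule nn_integral_cmult) measurable
    also have "\<dots> \<le> ennreal (16 ^ l) * ennreal (K' * (1 / 16) ^ l)"
      using K(2)[OF that] b[of l] by (intro mult_left_mono) (auto intro: order_trans ennreal_leI)
    also have "\<dots> = ennreal (16 ^ l * (K' * (1 / 16) ^ l))" using K' by (simp add: ennreal_mult)
    also have "16 ^ l * (K' * (1 / 16) ^ l) = K'" by (simp add: power_one_over)
    finally show ?thesis .
  qed
  have "(\<integral>\<^sup>+\<zeta>. liminf (\<lambda>l. f l \<zeta>) \<partial>lborel) \<le> liminf (\<lambda>l. \<integral>\<^sup>+\<zeta>. f l \<zeta> \<partial>lborel)"
    by (rule nn_integral_liminf) measurable
  also have "\<dots> \<le> ennreal K'"
  proof (rule Liminf_le)
    show "\<forall>\<^sub>F l in sequentially. (\<integral>\<^sup>+\<zeta>. f l \<zeta> \<partial>lborel) \<le> ennreal K'"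
      using fi by (auto simp: eventually_sequentially)
  qed simp
  finally have "(\<integral>\<^sup>+\<zeta>. liminf (\<lambda>l. f l \<zeta>) \<partial>lborel) \<noteq> \<infinity>" by (auto simp: top_unique)
  then have "AE \<zeta> in lborel. liminf (\<lambda>l. f l \<zeta>) \<noteq> \<infinity>" by (intro nn_integral_PInf_AE) measurable
  then show ?thesis
  proof eventually_elim
    case (elim \<zeta>)
    show ?case
    proof
      assume z: "\<zeta> \<in> Us z0"
      obtain K2 where K2: "liminf (\<lambda>l. f l \<zeta>) < ennreal K2" "K2 \<ge> 0"
      proof -
        define x where "x = liminf (\<lambda>l. f l \<zeta>)"
        have "x \<noteq> top" using elim by (simp add: x_def)
        then have "x < ennreal (enn2real x + 1)"
          by (cases x) (auto simp: ennreal_less_iff)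
        then show thesis by (intro that[of "enn2real x + 1"]) (auto simp: x_def)
      qed
      have "\<exists>\<^sub>F l in sequentially. f l \<zeta> \<le> ennreal K2"
      proof (rule ccontr)
        assume "\<not> ?thesis"
        then have "\<forall>\<^sub>F l in sequentially. ennreal K2 \<le> f l \<zeta>" by (auto simp: frequently_def elim!: eventually_mono)
        then have "ennreal K2 \<le> liminf (\<lambda>l. f l \<zeta>)" by (rule Liminf_bounded)
        then show False using K2(1) by simp
      qed
      then have "\<exists>\<^sub>F l in sequentially. W c j0 l \<zeta> \<le> ennreal (K2 * (1 / 16) ^ l)"
      proof (rule frequently_elim1)
        fix l assume "f l \<zeta> \<le> ennreal K2"
        then have "ennreal ((1 / 16) ^ l) * (ennreal (16 ^ l) * W c j0 l \<zeta>) \<le> ennreal ((1 / 16) ^ l) * ennreal K2"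
          using z by (intro mult_left_mono) (auto simp: f_def)
        moreover have "ennreal ((1 / 16) ^ l) * (ennreal (16 ^ l) * W c j0 l \<zeta>) = W c j0 l \<zeta>"
        proof -
          have "ennreal ((1 / 16) ^ l) * ennreal (16 ^ l) = 1"
            by (subst ennreal_mult[symmetric]) (auto simp flip: power_mult_distrib)
          then show ?thesis by (simp flip: mult.assoc)
        qed
        ultimately show "W c j0 l \<zeta> \<le> ennreal (K2 * (1 / 16) ^ l)" using K2(2) by (simp add: ennreal_mult mult.commute)
      qed
      then show "\<exists>K\<ge>0. \<exists>\<^sub>F l in sequentially. W c j0 l \<zeta> \<le> ennreal (K * (1 / 16) ^ l)" using K2(2) by blast
    qed
  qed
qed

text \<open>For c \<le> 4 each level contributes at most as much as level l, so the mean of W is of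
  order l 2^(-cl). Any smaller exponent c' makes the means of 2^(c'l) W summable, whence a bound for
  all l almost everywhere.\<close>

lemma AE_energy_small:
  assumes z0: "0 < Re z0" and c: "c \<le> 4" "c' < c"
  shows "AE \<zeta> in lborel. \<zeta> \<in> Us z0 \<longrightarrow> (\<exists>K>0. \<forall>l\<ge>j0. W c j0 l \<zeta> \<le> ennreal (K * 2 powr (- c' * l)))"
proof -
  obtain K where K: "K \<ge> 0" "\<And>l. l \<ge> j0 \<Longrightarrow> (\<integral>\<^sup>+\<zeta>. W c j0 l \<zeta> * indicator (Us z0) \<zeta> \<partial>lborel)
     \<le> ennreal (2 powr (- c * l) + K * (1 / 16) ^ l * (1 + (\<Sum>j=j0..<l. 2 powr ((4 - c) * real j))))"
    using W_integral[OF z0] by blast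
  have b: "2 powr (- c * l) + K * (1 / 16) ^ l * (1 + (\<Sum>j=j0..<l. 2 powr ((4 - c) * real j))) \<le> (1 + K * (1 + l)) * 2 powr (- c * l)" for l :: nat
  proof -
    have l1: "(1 / 16) ^ l * 2 powr ((4 - c) * l) = 2 powr (- c * l)"
      unfolding powr_sixteen by (simp add: powr_add[symmetric] algebra_simps)
    have "(\<Sum>j=j0..<l. 2 powr ((4 - c) * real j)) \<le> (\<Sum>j=j0..<l. 2 powr ((4 - c) * l))"
      using c by (intro sum_mono powr_mono mult_left_mono) auto
    also have "\<dots> \<le> l * 2 powr ((4 - c) * l)" by simp
    finally have "1 + (\<Sum>j=j0..<l. 2 powr ((4 - c) * real j)) \<le> (1 + real l) * 2 powr ((4 - c) * l)"
      using c ge_one_powr_ge_zero[of 2 "(4 - c) * l"] by (simp add: distrib_right)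
    then have "K * (1 / 16) ^ l * (1 + (\<Sum>j=j0..<l. 2 powr ((4 - c) * real j))) \<le> K * (1 / 16) ^ l * ((1 + real l) * 2 powr ((4 - c) * l))"
      using K(1) by (intro mult_left_mono) auto
    also have "\<dots> = K * (1 + real l) * ((1 / 16) ^ l * 2 powr ((4 - c) * l))" by simp
    finally show ?thesis unfolding l1 by (simp add: algebra_simps)
  qed
  \<comment> \<open>The index is shifted by \<open>j0\<close> because the integral bound holds only
    from \<open>j0\<close> on.\<close>
  define f where "f l \<zeta> = ennreal (2 powr (c' * real (l + j0))) * (W c j0 (l + j0) \<zeta> * indicator (Us z0) \<zeta>)" for l \<zeta>
  have fm [measurable]: "f l \<in> borel_measurable lborel" for l unfolding f_def by measurable
  define q where "q = 2 powr (c' - c)"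
  have q: "0 < q" "q < 1" using c by (auto simp: q_def powr_less_one)
  define a where "a l = (1 + K * (1 + real (l + j0))) * q ^ (l + j0)" for l
  have a0: "a l \<ge> 0" for l using K(1) q by (simp add: a_def)
  have fi: "(\<integral>\<^sup>+\<zeta>. f l \<zeta> \<partial>lborel) \<le> ennreal (a l)" for l
  proof -
    let ?l = "l + j0"
    have "(\<integral>\<^sup>+\<zeta>. f l \<zeta> \<partial>lborel) = ennreal (2 powr (c' * real ?l)) * (\<integral>\<^sup>+\<zeta>. W c j0 ?l \<zeta> * indicator (Us z0) \<zeta> \<partial>lborel)"
      unfolding f_def by (rule nn_integral_cmult) measurable
    also have "\<dots> \<le> ennreal (2 powr (c' * real ?l)) * ennreal ((1 + K * (1 + ?l)) * 2 powr (- c * ?l))"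
      using K(2)[of ?l] b[of ?l] by (intro mult_left_mono) (auto intro: order_trans ennreal_leI)
    also have "\<dots> = ennreal (2 powr (c' * real ?l) * ((1 + K * (1 + ?l)) * 2 powr (- c * ?l)))"
      using K(1) by (intro ennreal_mult[symmetric]) auto
    also have "2 powr (c' * real ?l) * ((1 + K * (1 + ?l)) * 2 powr (- c * ?l)) = a l"
    proof -
      have "q ^ ?l = 2 powr (c' * real ?l + - c * real ?l)"
        unfolding q_def by (subst powr_realpow[symmetric]) (auto simp: powr_powr algebra_simps)
      also have "\<dots> = 2 powr (c' * real ?l) * 2 powr (- c * real ?l)" by (rule powr_add)
      finally show ?thesis by (simp add: a_def mult_ac)
    qed
    finally show ?thesis .
  qed
  have sa: "summable a"
  proof -
    have "summable (\<lambda>l. q ^ l)" using q by (intro summable_geometric) auto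
    moreover have "summable (\<lambda>l. real (Suc l) * q ^ l)"
      using geometric_deriv_sums[of q] q by (auto simp: sums_iff)
    ultimately have "summable (\<lambda>l. q ^ l + K * (real (Suc l) * q ^ l))" by (intro summable_add summable_mult)
    then have "summable (\<lambda>l. (1 + K * (1 + real l)) * q ^ l)" by (simp add: algebra_simps)
    then show ?thesis unfolding a_def by (rule summable_ignore_initial_segment)
  qed
  have "(\<integral>\<^sup>+\<zeta>. (\<Sum>l. f l \<zeta>) \<partial>lborel) = (\<Sum>l. \<integral>\<^sup>+\<zeta>. f l \<zeta> \<partial>lborel)" by (rule nn_integral_suminf) measurable
  also have "\<dots> \<le> (\<Sum>l. ennreal (a l))" by (intro suminf_le fi) auto
  also have "\<dots> = ennreal (\<Sum>l. a l)" by (rule suminf_ennreal2[OF a0 sa])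
  finally have "(\<integral>\<^sup>+\<zeta>. (\<Sum>l. f l \<zeta>) \<partial>lborel) \<noteq> \<infinity>" by (auto simp: top_unique)
  then have "AE \<zeta> in lborel. (\<Sum>l. f l \<zeta>) \<noteq> \<infinity>" by (intro nn_integral_PInf_AE) measurable
  then show ?thesis
  proof eventually_elim
    case (elim \<zeta>)
    show ?case
    proof
      assume z: "\<zeta> \<in> Us z0"
      define K2 where "K2 = enn2real (\<Sum>l. f l \<zeta>) + 1"
      have K2: "K2 > 0" "(\<Sum>l. f l \<zeta>) \<le> ennreal K2"
      proof -
        show "K2 > 0" by (simp add: K2_def add_nonneg_pos)
        have "(\<Sum>l. f l \<zeta>) = ennreal (enn2real (\<Sum>l. f l \<zeta>))" using elim by (simp add: less_top)
        also have "\<dots> \<le> ennreal K2" unfolding K2_def by (intro ennreal_leI) auto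
        finally show "(\<Sum>l. f l \<zeta>) \<le> ennreal K2" .
      qed
      have "W c j0 l \<zeta> \<le> ennreal (K2 * 2 powr (- c' * l))" if "l \<ge> j0" for l
      proof -
        have "f (l - j0) \<zeta> \<le> (\<Sum>l. f l \<zeta>)"
          using sum_le_suminf[of "\<lambda>l. f l \<zeta>" "{l - j0}"] by (simp add: summableI)
        also note K2(2)
        finally have "ennreal (2 powr (c' * real l)) * W c j0 l \<zeta> \<le> ennreal K2" using z that by (simp add: f_def)
        then have "ennreal (2 powr (- c' * l)) * (ennreal (2 powr (c' * real l)) * W c j0 l \<zeta>) \<le> ennreal (2 powr (- c' * l)) * ennreal K2"
          by (intro mult_left_mono) auto
        moreover have "ennreal (2 powr (- c' * l)) * (ennreal (2 powr (c' * real l)) * W c j0 l \<zeta>) = W c j0 l \<zeta>"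
        proof -
          have "ennreal (2 powr (- c' * l)) * ennreal (2 powr (c' * real l)) = 1"
            by (subst ennreal_mult[symmetric]) (auto simp flip: powr_add)
          then show ?thesis by (simp flip: mult.assoc)
        qed
        ultimately show ?thesis using K2(1) by (simp add: ennreal_mult mult.commute)
      qed
      then show "\<exists>K>0. \<forall>l\<ge>j0. W c j0 l \<zeta> \<le> ennreal (K * 2 powr (- c' * l))" using K2(1) by blast
    qed
  qed
qed

section \<open>From energy bounds to dimension and absolute continuity\<close>

lemma small_boxes_sets: "{u. small_boxes c j0 \<zeta> u} \<in> sets \<mu>"
proof -
  have "(\<lambda>u. (\<zeta>, u)) \<in> \<mu> \<rightarrow>\<^sub>M borel \<Otimes>\<^sub>M \<mu>" by measurable
  from measurable_compose[OF this measurable_small_boxes] have "Measurable.pred \<mu> (\<lambda>u. small_boxes c j0 \<zeta> u)" by simp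
  then show ?thesis by (simp add: pred_def)
qed

lemma small_boxes_measure_limit:
  assumes \<zeta>: "Re \<zeta> > 0" and c: "c \<ge> 0" "Re \<zeta> * c < \<beta> 0 \<zeta> + \<beta> 1 \<zeta>"
  shows "(\<lambda>j0. measure \<mu> {u. small_boxes c j0 \<zeta> u}) \<longlonglongrightarrow> 1"
proof -
  have inc: "incseq (\<lambda>j0. {u. small_boxes c j0 \<zeta> u})" by (auto simp: incseq_def small_boxes_def)
  have "AE u in \<mu>. u \<in> (\<Union>j0. {u. small_boxes c j0 \<zeta> u})"
    using box_mass[OF \<zeta> c, of 4] by (auto simp: small_boxes_def eventually_sequentially elim!: AE_mp)
  then have "measure \<mu> (\<Union>j0. {u. small_boxes c j0 \<zeta> u}) = 1"
    using small_boxes_sets by (intro prob_eq_1[THEN iffD2] sets.countable_UN) auto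
  moreover have "(\<lambda>j0. measure \<mu> {u. small_boxes c j0 \<zeta> u}) \<longlonglongrightarrow> measure \<mu> (\<Union>j0. {u. small_boxes c j0 \<zeta> u})"
    using inc small_boxes_sets by (intro finite_Lim_measure_incseq) auto
  ultimately show ?thesis by simp
qed

text \<open>With W of order 2^(-c'l), \<open>ent_ge_of_energy\<close> gives entropy at least g c' l
  ln 2 up to a constant, where g is the mass with small boxes. The scale 4^-l is reached at a level
  near l ln 4 / Re \<zeta>. Letting l tend to infinity gives \<beta> 0 \<ge> g c' Re \<zeta> / 2,
  and then g tends to 1 with \<open>j0\<close>.\<close>

lemma beta0_ge:
  assumes \<zeta>: "Re \<zeta> > 0" and c: "c \<ge> 0" "Re \<zeta> * c < \<beta> 0 \<zeta> + \<beta> 1 \<zeta>" "c' \<ge> 0"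
    and W: "\<And>j0. \<exists>K>0. \<forall>l\<ge>j0. W c j0 l \<zeta> \<le> ennreal (K * 2 powr (- c' * l))"
  shows "\<beta> 0 \<zeta> \<ge> c' * Re \<zeta> / 2"
proof -
  define s where "s = Re \<zeta>"
  have s: "s > 0" using \<zeta> by (simp add: s_def)
  obtain C where C: "\<And>n. h 0 (real n) \<zeta> \<le> \<beta> 0 \<zeta> * n + C" using beta_limit(2)[OF \<zeta>] by blast
  have b0: "\<beta> 0 \<zeta> \<ge> 0"
    by (rule LIMSEQ_le_const[OF beta_limit(1)[OF \<zeta>]]) (auto simp: h_nonneg)
  have "measure \<mu> {u. small_boxes c j0 \<zeta> u} * (c' * s / 2) \<le> \<beta> 0 \<zeta>" for j0
  proof -
    define g where "g = measure \<mu> {u. small_boxes c j0 \<zeta> u}"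
    obtain K where K: "K > 0" "\<And>l. l \<ge> j0 \<Longrightarrow> W c j0 l \<zeta> \<le> ennreal (K * 2 powr (- c' * l))" using W by blast
    have ineq: "g * (1 - ln K) + g * c' * (l * ln 2) - 1 \<le> \<beta> 0 \<zeta> * ((l * ln 4 + ln 2) / s + 1) + C" if l: "l \<ge> j0" for l :: nat
    proof -
      \<comment> \<open>The first level whose unit cells have diameter at most 4^-l at level 0; the
        summand \<open>ln 2\<close> accounts for the bound 2 on the diameter.\<close>
      define n where "n = nat \<lceil>(l * ln 4 + ln 2) / s\<rceil>"
      have nn: "(l * ln 4 + ln 2) / s \<ge> 0" using s by simp
      then have n: "real n \<ge> (l * ln 4 + ln 2) / s" "real n \<le> (l * ln 4 + ln 2) / s + 1" unfolding n_def by linarith+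
      have en: "2 * exp (- s * n) \<le> (1 / 4) ^ l"
      proof -
        have "l * ln 4 + ln 2 \<le> s * n" using n(1) s by (simp add: pos_divide_le_eq mult.commute)
        then have "exp (- s * n) \<le> exp (- (l * ln 4) - ln 2)" by simp
        also have "\<dots> = (1 / 4) ^ l / 2"
        proof -
          have "- (l * ln 4) - ln 2 = real l * (- ln 4) + (- ln (2::real))" by simp
          moreover have "exp (- ln (4::real)) = 1 / 4" "exp (- ln (2::real)) = 1 / 2" by (simp_all add: exp_minus)
          ultimately show ?thesis by (simp only: exp_add exp_of_nat_mult)
        qed
        finally show ?thesis by linarith
      qed
      have "ent \<mu> (cell 0 (real n) \<zeta>) \<ge> measure \<mu> {u. small_boxes c j0 \<zeta> u} * (1 - ln (K * 2 powr (- c' * l))) - 1"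
      proof (rule ent_ge_of_energy[OF fin_rv_cell[OF \<zeta>] small_boxes_sets])
        show "(\<lambda>u. V 0 0 \<zeta> u) \<in> borel_measurable \<mu>" by measurable
        show "(\<integral>\<^sup>+u. (if u \<in> {u. small_boxes c j0 \<zeta> u} then emeasure \<mu> {v. cmod (V 0 0 \<zeta> u - V 0 0 \<zeta> v) \<le> (1 / 4) ^ l} else 0) \<partial>\<mu>) \<le> ennreal (K * 2 powr (- c' * l))"
          using K(2)[OF l] by (simp add: W_def)
        fix u v assume e: "cell 0 (real n) \<zeta> u = cell 0 (real n) \<zeta> v"
        have "cmod (V 0 (real n) \<zeta> u - V 0 (real n) \<zeta> v) \<le> 2" by (rule fcell_eq_imp[OF e]) simp
        then have "cmod (V 0 (real n + - real n) \<zeta> u - V 0 (real n + - real n) \<zeta> v) \<le> exp (Re \<zeta> * - real n) * (1 + \<bar>- real n\<bar>) ^ 0 * 2"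
          by (intro V_change_diff[OF \<zeta>]) auto
        then have "cmod (V 0 0 \<zeta> u - V 0 0 \<zeta> v) \<le> 2 * exp (- s * n)" by (simp add: s_def mult.commute)
        then show "cmod (V 0 0 \<zeta> u - V 0 0 \<zeta> v) \<le> (1 / 4) ^ l" using en by linarith
      qed (use K in auto)
      also have "ln (K * 2 powr (- c' * l)) = ln K - c' * l * ln 2" using K(1) by (simp add: ln_mult ln_powr)
      finally have "g * (1 - (ln K - c' * l * ln 2)) - 1 \<le> \<beta> 0 \<zeta> * n + C" using C[of n] by (simp add: h_def g_def)
      also have "\<dots> \<le> \<beta> 0 \<zeta> * ((l * ln 4 + ln 2) / s + 1) + C" using n(2) b0 by (intro add_right_mono mult_left_mono) auto
      finally show ?thesis by (simp add: algebra_simps)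
    qed
    have l4: "ln (4::real) = 2 * ln 2" using ln_realpow[of 2 2] by simp
    define A where "A = g * c' * ln 2"
    define B where "B = \<beta> 0 \<zeta> * (2 * ln 2) / s"
    define D where "D = \<beta> 0 \<zeta> * (ln 2 / s + 1) + C + 1 - g * (1 - ln K)"
    have "A * l \<le> B * l + D" if "l \<ge> j0" for l :: nat
    proof -
      have "\<beta> 0 \<zeta> * ((l * ln 4 + ln 2) / s + 1) = B * l + \<beta> 0 \<zeta> * (ln 2 / s + 1)"
        unfolding l4 B_def by (simp add: add_divide_distrib distrib_left mult_ac)
      moreover have "g * c' * (l * ln 2) = A * l" by (simp add: A_def mult_ac)
      ultimately show ?thesis using ineq[OF that] unfolding D_def by linarith
    qed
    then have "A \<le> B + D / real l" if "l \<ge> max j0 1" for l :: nat using that by (simp add: field_simps)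
    then have "\<exists>N. \<forall>l\<ge>N. A \<le> B + D / real l" by blast
    moreover have "(\<lambda>l. B + D / real l) \<longlonglongrightarrow> B + 0" by (intro tendsto_intros lim_const_over_n)
    ultimately have "A \<le> B + 0" by (intro LIMSEQ_le_const)
    then have "(g * c') * ln 2 \<le> (\<beta> 0 \<zeta> * 2 / s) * ln 2" by (simp add: A_def B_def)
    then have "g * c' \<le> \<beta> 0 \<zeta> * 2 / s" by (rule mult_right_le_imp_le) simp
    then have "g * c' * s \<le> \<beta> 0 \<zeta> * 2" using s by (simp add: pos_le_divide_eq)
    then show ?thesis by (simp add: g_def)
  qed
  moreover have "(\<lambda>j0. measure \<mu> {u. small_boxes c j0 \<zeta> u} * (c' * s / 2)) \<longlonglongrightarrow> 1 * (c' * s / 2)"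
    by (intro tendsto_intros small_boxes_measure_limit[OF \<zeta> c(1,2)])
  ultimately have "1 * (c' * s / 2) \<le> \<beta> 0 \<zeta>" by (intro LIMSEQ_le_const2) auto
  then show ?thesis by (simp add: s_def)
qed

text \<open>Absolute continuity in epsilon-delta form, tested on open sets only; null sets are
  reached through open sets of small measure.\<close>

definition unif_ac :: "complex \<Rightarrow> bool" where
  "unif_ac \<zeta> \<longleftrightarrow> (\<forall>\<epsilon>>0. \<exists>\<delta>>0. \<forall>Op. open Op \<and> emeasure lborel Op < ennreal \<delta> \<longrightarrow> measure \<mu> {u. V 0 0 \<zeta> u \<in> Op} \<le> \<epsilon>)"

lemma unif_acI:
  assumes \<zeta>: "Re \<zeta> > 0" and c: "c \<ge> 0" "Re \<zeta> * c < \<beta> 0 \<zeta> + \<beta> 1 \<zeta>"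
    and W: "\<And>j0. \<exists>K\<ge>0. \<exists>\<^sub>F l in sequentially. W c j0 l \<zeta> \<le> ennreal (K * (1 / 16) ^ l)"
  shows "unif_ac \<zeta>"
  unfolding unif_ac_def
proof (intro allI impI)
  fix \<epsilon> :: real assume \<epsilon>: "\<epsilon> > 0"
  have "eventually (\<lambda>j0. measure \<mu> {u. small_boxes c j0 \<zeta> u} > 1 - \<epsilon> / 2) sequentially"
    using order_tendstoD(1)[OF small_boxes_measure_limit[OF \<zeta> c], of "1 - \<epsilon> / 2"] \<epsilon> by simp
  then obtain j0 where j0: "measure \<mu> {u. small_boxes c j0 \<zeta> u} > 1 - \<epsilon> / 2" by (auto simp: eventually_sequentially)
  define G where "G = {u. small_boxes c j0 \<zeta> u}"
  have G: "G \<in> sets \<mu>" using small_boxes_sets by (simp add: G_def)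
  obtain K where K: "K \<ge> 0" "\<exists>\<^sub>F l in sequentially. W c j0 l \<zeta> \<le> ennreal (K * (1 / 16) ^ l)" using W by blast
  \<comment> \<open>Chosen so that \<open>4 * (K + 1) * \<delta>\<close> is the square of \<epsilon>
    / 2; the other half of \<epsilon> pays for the points without small boxes.\<close>
  define \<delta> where "\<delta> = \<epsilon>\<^sup>2 / (16 * (K + 1))"
  have \<delta>: "\<delta> > 0" using \<epsilon> K by (simp add: \<delta>_def)
  have "measure \<mu> {u. V 0 0 \<zeta> u \<in> Op} \<le> \<epsilon>" if O: "open Op" "emeasure lborel Op < ennreal \<delta>" for Op
  proof -
    have fO: "emeasure lborel Op < \<infinity>" using O(2) less_trans[OF _ ennreal_less_top] by (simp add: less_top)
    have "ennreal (measure lborel Op) < ennreal \<delta>" using O(2) fO by (simp add: emeasure_eq_ennreal_measure less_top)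
    then have mO: "measure lborel Op < \<delta>" using \<delta> by (simp add: ennreal_less_iff)
    have "(measure \<mu> (G \<inter> {u. V 0 0 \<zeta> u \<in> Op}))\<^sup>2 \<le> 4 * K * measure lborel Op"
    proof (rule open_mass[OF _ _ G K(1) _ O(1) fO])
      show "(\<lambda>u. V 0 0 \<zeta> u) \<in> borel_measurable \<mu>" by measurable
      show "cmod (V 0 0 \<zeta> u) \<le> Cb 0 (Re \<zeta>)" for u using V_bound[OF \<zeta>] by simp
      show "\<exists>\<^sub>F l in sequentially. (\<integral>\<^sup>+u. (if u \<in> G then emeasure \<mu> {v. cmod (V 0 0 \<zeta> u - V 0 0 \<zeta> v) \<le> (1 / 4) ^ l} else 0) \<partial>\<mu>) \<le> ennreal (K * (1 / 16) ^ l)"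
        using K(2) by (simp add: W_def G_def)
    qed
    also have "\<dots> \<le> 4 * (K + 1) * \<delta>" using mO K by (intro mult_mono) auto
    also have "\<dots> = (\<epsilon> / 2)\<^sup>2" using K by (simp add: \<delta>_def power2_eq_square field_simps)
    finally have m1: "measure \<mu> (G \<inter> {u. V 0 0 \<zeta> u \<in> Op}) \<le> \<epsilon> / 2" by (rule power2_le_imp_le) (use \<epsilon> in auto)
    have Om: "{u. V 0 0 \<zeta> u \<in> Op} \<in> sets \<mu>"
    proof -
      have [measurable]: "Op \<in> sets borel" using O(1) by simp
      have "Measurable.pred \<mu> (\<lambda>u. V 0 0 \<zeta> u \<in> Op)" by measurable
      then show ?thesis by (simp add: pred_def)
    qed
    have "measure \<mu> {u. V 0 0 \<zeta> u \<in> Op} \<le> measure \<mu> ((G \<inter> {u. V 0 0 \<zeta> u \<in> Op}) \<union> (space \<mu> - G))"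
      using Om by (intro finite_measure_mono sets.Un sets.Int sets.compl_sets G) auto
    also have "\<dots> \<le> measure \<mu> (G \<inter> {u. V 0 0 \<zeta> u \<in> Op}) + measure \<mu> (space \<mu> - G)"
      by (intro measure_Un_le sets.Int sets.compl_sets G Om)
    also have "measure \<mu> (space \<mu> - G) = 1 - measure \<mu> G" by (rule prob_compl[OF G])
    finally show ?thesis using m1 j0 by (simp add: G_def)
  qed
  then show "\<exists>\<delta>>0. \<forall>Op. open Op \<and> emeasure lborel Op < ennreal \<delta> \<longrightarrow> measure \<mu> {u. V 0 0 \<zeta> u \<in> Op} \<le> \<epsilon>"
    using \<delta> by blast
qed

text \<open>The energy statements hold outside null sets that depend on the unit square, the
  exponents and \<open>j0\<close>. Squares with rational corner and rational exponents suffice, so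
  countably many null sets are united before a parameter is fixed.\<close>

theorem AE_unif_ac: "AE \<zeta> in lborel. Re \<zeta> > 0 \<and> 2 * Re \<zeta> < p_entropy / lyap \<longrightarrow> unif_ac \<zeta>"
proof -
  define Z :: "(real \<times> real) set" where "Z = {(x, y). x \<in> \<rat> \<and> y \<in> \<rat> \<and> x > 0}"
  have cZ: "countable Z"
    by (rule countable_subset[of _ "\<rat> \<times> \<rat>"]) (auto simp: Z_def countable_rat)
  have cov: "\<exists>(x, y)\<in>Z. \<zeta> \<in> Us (Complex x y)" if r: "Re \<zeta> > 0" for \<zeta>
  proof -
    obtain x where x: "x \<in> \<rat>" "max 0 (Re \<zeta> - 1) < x" "x < Re \<zeta>" using Rats_dense_in_real[of "max 0 (Re \<zeta> - 1)" "Re \<zeta>"] r by auto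
    obtain y where y: "y \<in> \<rat>" "Im \<zeta> - 1 < y" "y < Im \<zeta>" using Rats_dense_in_real[of "Im \<zeta> - 1" "Im \<zeta>"] by auto
    show ?thesis by (rule bexI[of _ "(x, y)"]) (use x y in \<open>auto simp: Z_def in_cbox_complex_iff\<close>)
  qed
  define R1 where "R1 = \<rat> \<inter> {4::real<..}"
  define R2 :: "(real \<times> real) set" where "R2 = {(c, c'). c \<in> \<rat> \<and> c' \<in> \<rat> \<and> c \<le> 4 \<and> c' < c}"
  have cR1: "countable R1" by (rule countable_subset[OF _ countable_rat]) (auto simp: R1_def)
  have cR2: "countable R2"
    by (rule countable_subset[of _ "\<rat> \<times> \<rat>"]) (auto simp: R2_def countable_rat)
  have A1: "AE \<zeta> in lborel. \<forall>z\<in>Z. \<forall>c\<in>R1. \<forall>j0. \<zeta> \<in> Us (Complex (fst z) (snd z)) \<longrightarrow> (\<exists>K\<ge>0. \<exists>\<^sub>F l in sequentially. W c j0 l \<zeta> \<le> ennreal (K * (1 / 16) ^ l))"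
  proof (rule AE_ball_countable'[OF _ cZ], rule AE_ball_countable'[OF _ cR1], rule AE_all_countable[THEN iffD2], rule allI)
    fix z c and j0 :: nat assume "z \<in> Z" "c \<in> R1"
    then show "AE \<zeta> in lborel. \<zeta> \<in> Us (Complex (fst z) (snd z)) \<longrightarrow> (\<exists>K\<ge>0. \<exists>\<^sub>F l in sequentially. W c j0 l \<zeta> \<le> ennreal (K * (1 / 16) ^ l))"
      by (intro AE_energy_large) (auto simp: Z_def R1_def)
  qed
  have A2: "AE \<zeta> in lborel. \<forall>z\<in>Z. \<forall>c\<in>R2. \<forall>j0. \<zeta> \<in> Us (Complex (fst z) (snd z)) \<longrightarrow> (\<exists>K>0. \<forall>l\<ge>j0. W (fst c) j0 l \<zeta> \<le> ennreal (K * 2 powr (- snd c * real l)))"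
  proof (rule AE_ball_countable'[OF _ cZ], rule AE_ball_countable'[OF _ cR2], rule AE_all_countable[THEN iffD2], rule allI)
    fix z c and j0 :: nat assume "z \<in> Z" "c \<in> R2"
    then show "AE \<zeta> in lborel. \<zeta> \<in> Us (Complex (fst z) (snd z)) \<longrightarrow> (\<exists>K>0. \<forall>l\<ge>j0. W (fst c) j0 l \<zeta> \<le> ennreal (K * 2 powr (- snd c * real l)))"
      by (intro AE_energy_small) (auto simp: Z_def R2_def)
  qed
  have A3: "AE \<zeta> in lborel. \<zeta> \<notin> {\<zeta>. Re \<zeta> > 0 \<and> \<beta> 1 \<zeta> = \<beta> 0 \<zeta> \<and> \<beta> 0 \<zeta> < p_entropy / lyap}"
    by (rule AE_not_in) (rule countable_imp_null_set_lborel[OF countable_no_gain])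
  from A1 A2 A3 show ?thesis
  proof eventually_elim
    case (elim \<zeta>)
    show ?case
    proof
      assume as: "Re \<zeta> > 0 \<and> 2 * Re \<zeta> < p_entropy / lyap"
      define s where "s = Re \<zeta>"
      have s: "s > 0" using as by (simp add: s_def)
      obtain z where z: "z \<in> Z" "\<zeta> \<in> Us (Complex (fst z) (snd z))" using cov[of \<zeta>] as by force
      have le: "\<beta> 0 \<zeta> \<le> 2 * s" using beta0_le as by (simp add: s_def)
      have gt: "\<beta> 0 \<zeta> < \<beta> 1 \<zeta>"
      proof -
        have "\<beta> 1 \<zeta> \<noteq> \<beta> 0 \<zeta>" using elim(3) as le by (auto simp: s_def)
        moreover have "\<beta> 0 \<zeta> \<le> \<beta> 1 \<zeta>" using as by (intro beta_mono) auto
        ultimately show ?thesis by simp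
      qed
      have b0: "\<beta> 0 \<zeta> \<ge> 0"
        by (rule LIMSEQ_le_const[OF beta_limit(1)]) (use as in \<open>auto simp: h_nonneg\<close>)
      show "unif_ac \<zeta>"
      proof (cases "\<beta> 0 \<zeta> = 2 * s")
        case True
        then have "4 < (\<beta> 0 \<zeta> + \<beta> 1 \<zeta>) / s" using gt s by (simp add: less_divide_eq)
        then obtain c where c: "c \<in> \<rat>" "4 < c" "c < (\<beta> 0 \<zeta> + \<beta> 1 \<zeta>) / s" using Rats_dense_in_real by blast
        have c2: "Re \<zeta> * c < \<beta> 0 \<zeta> + \<beta> 1 \<zeta>" using c(3) s by (simp add: less_divide_eq s_def mult.commute)
        have "c \<in> R1" using c by (simp add: R1_def)
        then have W1: "\<exists>K\<ge>0. \<exists>\<^sub>F l in sequentially. W c j0 l \<zeta> \<le> ennreal (K * (1 / 16) ^ l)" for j0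
          using elim(1) z by blast
        show ?thesis by (rule unif_acI[OF _ _ c2 W1]) (use as c in auto)
      next
        case False
        then have lt: "\<beta> 0 \<zeta> < 2 * s" using le by simp
        \<comment> \<open>Between these bounds fit rationals c' < c with \<beta> 0 < c' Re \<zeta> /
          2, which contradicts the conclusion of \<open>beta0_ge\<close>.\<close>
        have "2 * \<beta> 0 \<zeta> / s < min 4 ((\<beta> 0 \<zeta> + \<beta> 1 \<zeta>) / s)"
          using lt gt s by (simp add: divide_less_eq divide_strict_right_mono)
        then obtain c where c: "c \<in> \<rat>" "2 * \<beta> 0 \<zeta> / s < c" "c < min 4 ((\<beta> 0 \<zeta> + \<beta> 1 \<zeta>) / s)" using Rats_dense_in_real by blast
        obtain c' where c': "c' \<in> \<rat>" "2 * \<beta> 0 \<zeta> / s < c'" "c' < c" using Rats_dense_in_real[OF c(2)] by blast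
        have "2 * \<beta> 0 \<zeta> / s \<ge> 0" using b0 s by simp
        then have p: "c \<ge> 0" "c' \<ge> 0" using c c' by linarith+
        have c2: "Re \<zeta> * c < \<beta> 0 \<zeta> + \<beta> 1 \<zeta>" using c(3) s by (simp add: less_divide_eq s_def mult.commute)
        have "\<beta> 0 \<zeta> \<ge> c' * Re \<zeta> / 2"
        proof (rule beta0_ge[OF _ p(1) c2 p(2)])
          have "(c, c') \<in> R2" using c c' by (simp add: R2_def)
          then have "\<exists>K>0. \<forall>l\<ge>j0. W (fst (c, c')) j0 l \<zeta> \<le> ennreal (K * 2 powr (- snd (c, c') * real l))" for j0
            using elim(2) z by blast
          then show "\<exists>K>0. \<forall>l\<ge>j0. W c j0 l \<zeta> \<le> ennreal (K * 2 powr (- c' * real l))" for j0 by simp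
        qed (use as in auto)
        moreover have "2 * \<beta> 0 \<zeta> < c' * s" using c'(2) s by (simp add: divide_less_eq)
        ultimately show ?thesis by (simp add: s_def)
      qed
    qed
  qed
qed

end

section \<open>Identification of the self-similar measure\<close>

context ifs
begin

lemma V_self_similar:
  assumes "Re \<zeta> > 0"
  shows "V 0 0 \<zeta> (i ## \<omega>) = exp (\<zeta> * of_real (a i) + \<i> * of_real (b i)) * V 0 0 \<zeta> \<omega> + t i"
proof -
  have "V 0 (0 + a i) \<zeta> \<omega> = exp (\<zeta> * of_real (a i)) * V 0 0 \<zeta> \<omega>" by (subst V_change[OF assms]) simp
  then show ?thesis using V_Stream[OF assms, of 0 0 i \<omega>]
    by (simp add: exp_add cis_conv_exp mult_ac)
qed

text \<open>The composition of the maps belonging to the first \<open>n\<close> letters, outermost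
  first, applied to \<open>z\<close>.\<close>

definition prefix_map :: "complex \<Rightarrow> nat \<Rightarrow> 'n stream \<Rightarrow> complex \<Rightarrow> complex" where
  "prefix_map \<zeta> n \<omega> z = (\<Sum>k<n. trm 0 0 \<zeta> \<omega> k) + exp (\<zeta> * of_real (As \<omega> n) + \<i> * of_real (Bs \<omega> n)) * z"

lemma prefix_map_Stream: "prefix_map \<zeta> (Suc n) (i ## \<omega>) z = exp (\<zeta> * of_real (a i) + \<i> * of_real (b i)) * prefix_map \<zeta> n \<omega> z + t i"
proof -
  have e: "exp (\<zeta> * of_real (As (i ## \<omega>) (Suc k)) + \<i> * of_real (Bs (i ## \<omega>) (Suc k)))
     = exp (\<zeta> * of_real (a i) + \<i> * of_real (b i)) * exp (\<zeta> * of_real (As \<omega> k) + \<i> * of_real (Bs \<omega> k))" for k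
    by (simp add: As_Stream exp_add[symmetric] algebra_simps)
  have "trm 0 0 \<zeta> (i ## \<omega>) (Suc k) = exp (\<zeta> * of_real (a i) + \<i> * of_real (b i)) * trm 0 0 \<zeta> \<omega> k" for k
    using e[of k] by (simp add: trm_def)
  moreover have "trm 0 0 \<zeta> (i ## \<omega>) 0 = t i" by (simp add: trm_def)
  ultimately have "(\<Sum>k<Suc n. trm 0 0 \<zeta> (i ## \<omega>) k)
      = t i + exp (\<zeta> * of_real (a i) + \<i> * of_real (b i)) * (\<Sum>k<n. trm 0 0 \<zeta> \<omega> k)"
    unfolding sum.lessThan_Suc_shift sum_distrib_left by simp
  then show ?thesis unfolding prefix_map_def e by (simp only: distrib_left mult.assoc add.assoc add.commute add.left_commute)
qed

lemma prefix_map_tendsto: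
  assumes "Re \<zeta> > 0" shows "(\<lambda>n. prefix_map \<zeta> n \<omega> z) \<longlonglongrightarrow> V 0 0 \<zeta> \<omega>"
proof -
  have "(\<lambda>n. \<Sum>k<n. trm 0 0 \<zeta> \<omega> k) \<longlonglongrightarrow> V 0 0 \<zeta> \<omega>"
    unfolding V_def using summable_trm[OF assms] by (rule summable_LIMSEQ)
  moreover have "(\<lambda>n. exp (\<zeta> * of_real (As \<omega> n) + \<i> * of_real (Bs \<omega> n)) * z) \<longlonglongrightarrow> 0 * z"
  proof (intro tendsto_mult tendsto_const)
    show "(\<lambda>n. exp (\<zeta> * of_real (As \<omega> n) + \<i> * of_real (Bs \<omega> n))) \<longlonglongrightarrow> 0"
    proof (rule Lim_null_comparison[where g="\<lambda>n. exp (- Re \<zeta> * c0) ^ n"])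
      show "\<forall>\<^sub>F n in sequentially. norm (exp (\<zeta> * of_real (As \<omega> n) + \<i> * of_real (Bs \<omega> n))) \<le> exp (- Re \<zeta> * c0) ^ n"
      proof (intro always_eventually allI)
        fix n
        have "Re \<zeta> * As \<omega> n \<le> Re \<zeta> * (- c0 * n)" using assms As_le[of \<omega> n] by (intro mult_left_mono) auto
        then have "exp (Re \<zeta> * As \<omega> n) \<le> exp (n * (- Re \<zeta> * c0))" by (simp add: mult_ac)
        then show "norm (exp (\<zeta> * of_real (As \<omega> n) + \<i> * of_real (Bs \<omega> n))) \<le> exp (- Re \<zeta> * c0) ^ n"
          unfolding exp_of_nat_mult by simp
      qed
      show "(\<lambda>n. exp (- Re \<zeta> * c0) ^ n) \<longlonglongrightarrow> 0" using assms c0_pos by (intro LIMSEQ_realpow_zero) auto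
    qed
  qed
  ultimately have "(\<lambda>n. (\<Sum>k<n. trm 0 0 \<zeta> \<omega> k) + exp (\<zeta> * of_real (As \<omega> n) + \<i> * of_real (Bs \<omega> n)) * z) \<longlonglongrightarrow> V 0 0 \<zeta> \<omega> + 0 * z"
    by (rule tendsto_add)
  then show ?thesis by (simp add: prefix_map_def)
qed

lemma prefix_map_measurable [measurable]:
  "(\<lambda>x. prefix_map \<zeta> n (fst x) (snd x)) \<in> borel_measurable (\<mu> \<Otimes>\<^sub>M borel)"
  unfolding prefix_map_def trm_def by measurable

section \<open>Existence and uniqueness of the stationary measure\<close>

definition stationary :: "complex \<Rightarrow> complex measure \<Rightarrow> bool" where
  "stationary \<zeta> \<nu> \<longleftrightarrow> sets \<nu> = sets borel \<and> prob_space \<nu> \<and> (\<forall>A\<in>sets borel. emeasure \<nu> A =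
     (\<Sum>i\<in>UNIV. ennreal (pmf p i) * emeasure (distr \<nu> borel (\<lambda>z. exp (\<zeta> * of_real (a i) + \<i> * of_real (b i)) * z + t i)) A))"

definition law :: "complex \<Rightarrow> complex measure" where "law \<zeta> = distr \<mu> borel (V 0 0 \<zeta>)"

lemma stationary_law: assumes "Re \<zeta> > 0" shows "stationary \<zeta> (law \<zeta>)"
  unfolding stationary_def
proof (intro conjI ballI)
  show "sets (law \<zeta>) = sets borel" by (simp add: law_def)
  show "prob_space (law \<zeta>)" unfolding law_def by (rule prob_space_distr) measurable
  fix A :: "complex set" assume A [measurable]: "A \<in> sets borel"
  have "emeasure (law \<zeta>) A = emeasure \<mu> {\<omega>. V 0 0 \<zeta> \<omega> \<in> A}"
    unfolding law_def by (subst emeasure_distr) (auto simp: vimage_def)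
  also have "\<dots> = (\<Sum>i\<in>UNIV. ennreal (pmf p i) * emeasure \<mu> {\<omega>. V 0 0 \<zeta> (i ## \<omega>) \<in> A})"
    by (rule emeasure_Stream) measurable
  also have "\<dots> = (\<Sum>i\<in>UNIV. ennreal (pmf p i) * emeasure (distr (law \<zeta>) borel (\<lambda>z. exp (\<zeta> * of_real (a i) + \<i> * of_real (b i)) * z + t i)) A)"
  proof (intro sum.cong refl arg_cong2[where f="(*)"])
    fix i
    have "emeasure (distr (law \<zeta>) borel (\<lambda>z. exp (\<zeta> * of_real (a i) + \<i> * of_real (b i)) * z + t i)) A
       = emeasure (distr \<mu> borel (\<lambda>\<omega>. exp (\<zeta> * of_real (a i) + \<i> * of_real (b i)) * V 0 0 \<zeta> \<omega> + t i)) A"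
      unfolding law_def by (subst distr_distr) (auto simp: comp_def)
    also have "\<dots> = emeasure \<mu> {\<omega>. V 0 0 \<zeta> (i ## \<omega>) \<in> A}"
      unfolding V_self_similar[OF assms] by (subst emeasure_distr) (auto simp: vimage_def)
    finally show "emeasure \<mu> {\<omega>. V 0 0 \<zeta> (i ## \<omega>) \<in> A} = emeasure (distr (law \<zeta>) borel (\<lambda>z. exp (\<zeta> * of_real (a i) + \<i> * of_real (b i)) * z + t i)) A" by simp
  qed
  finally show "emeasure (law \<zeta>) A = (\<Sum>i\<in>UNIV. ennreal (pmf p i) * emeasure (distr (law \<zeta>) borel (\<lambda>z. exp (\<zeta> * of_real (a i) + \<i> * of_real (b i)) * z + t i)) A)" .
qed

text \<open>Iterating the stationarity equation \<open>n\<close> times writes a stationary measure as the law of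
  \<open>prefix_map \<zeta> n \<omega> z\<close>, with \<open>z\<close> drawn from that measure, and these points converge to \<open>V 0 0 \<zeta> \<omega>\<close>.\<close>

lemma stationary_unique: assumes \<zeta>: "Re \<zeta> > 0" and st: "stationary \<zeta> \<nu>" shows "\<nu> = law \<zeta>"
proof -
  have s\<nu>: "sets \<nu> = sets borel" and "prob_space \<nu>" using st by (auto simp: stationary_def)
  then interpret N: prob_space \<nu> by simp
  interpret P: pair_prob_space \<mu> \<nu> ..
  have sp\<nu> [simp]: "space \<nu> = UNIV" using sets_eq_imp_space_eq[OF s\<nu>] by simp
  note s\<nu>[measurable_cong]
  have Gm: "(\<lambda>x. prefix_map \<zeta> n (fst x) (snd x)) \<in> borel_measurable (\<mu> \<Otimes>\<^sub>M \<nu>)" for n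
  proof -
    have "sets (\<mu> \<Otimes>\<^sub>M \<nu>) = sets (\<mu> \<Otimes>\<^sub>M borel)" by (intro sets_pair_measure_cong refl s\<nu>)
    then show ?thesis using measurable_cong_sets[OF _ refl, of "\<mu> \<Otimes>\<^sub>M \<nu>" "\<mu> \<Otimes>\<^sub>M borel"] prefix_map_measurable by simp
  qed
  note Gm[measurable]
  have step: "emeasure \<nu> A = (\<Sum>i\<in>UNIV. ennreal (pmf p i) * emeasure \<nu> {z. exp (\<zeta> * of_real (a i) + \<i> * of_real (b i)) * z + t i \<in> A})" if A [measurable]: "A \<in> sets borel" for A
  proof -
    have "emeasure (distr \<nu> borel (\<lambda>z. exp (\<zeta> * of_real (a i) + \<i> * of_real (b i)) * z + t i)) A = emeasure \<nu> {z. exp (\<zeta> * of_real (a i) + \<i> * of_real (b i)) * z + t i \<in> A}" for i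
      by (subst emeasure_distr) (auto simp: vimage_def)
    then show ?thesis using st A by (simp add: stationary_def)
  qed
  have iter: "emeasure \<nu> A = (\<integral>\<^sup>+\<omega>. emeasure \<nu> {z. prefix_map \<zeta> n \<omega> z \<in> A} \<partial>\<mu>)" if A: "A \<in> sets borel" for A n
    using A
  proof (induction n arbitrary: A)
    case 0
    show ?case using emeasure_space_1 by (simp add: prefix_map_def)
  next
    case (Suc n)
    note Suc.prems[measurable]
    let ?g = "\<lambda>i z. exp (\<zeta> * of_real (a i) + \<i> * of_real (b i)) * z + t i"
    have m: "(\<lambda>\<omega>. emeasure \<nu> {z. prefix_map \<zeta> (Suc n) \<omega> z \<in> A}) \<in> borel_measurable \<mu>"
    proof -
      have "Measurable.pred (\<mu> \<Otimes>\<^sub>M \<nu>) (\<lambda>x. prefix_map \<zeta> (Suc n) (fst x) (snd x) \<in> A)" by measurable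
      then have "{x \<in> space (\<mu> \<Otimes>\<^sub>M \<nu>). prefix_map \<zeta> (Suc n) (fst x) (snd x) \<in> A} \<in> sets (\<mu> \<Otimes>\<^sub>M \<nu>)" by (simp add: pred_def)
      from N.measurable_emeasure_Pair[OF this] show ?thesis by (simp add: space_pair_measure vimage_def)
    qed
    have "emeasure \<nu> A = (\<Sum>i\<in>UNIV. ennreal (pmf p i) * emeasure \<nu> {z. ?g i z \<in> A})" by (rule step) fact
    also have "\<dots> = (\<Sum>i\<in>UNIV. ennreal (pmf p i) * (\<integral>\<^sup>+\<omega>. emeasure \<nu> {z. prefix_map \<zeta> (Suc n) (i ## \<omega>) z \<in> A} \<partial>\<mu>))"
    proof (intro sum.cong refl arg_cong2[where f="(*)"])
      fix i
      have "{z. ?g i z \<in> A} \<in> sets borel"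
      proof -
        have "Measurable.pred borel (\<lambda>z. ?g i z \<in> A)" by measurable
        then show ?thesis by (simp add: pred_def)
      qed
      then show "emeasure \<nu> {z. ?g i z \<in> A} = (\<integral>\<^sup>+\<omega>. emeasure \<nu> {z. prefix_map \<zeta> (Suc n) (i ## \<omega>) z \<in> A} \<partial>\<mu>)"
        using Suc.IH by (simp add: prefix_map_Stream)
    qed
    also have "\<dots> = (\<integral>\<^sup>+i. \<integral>\<^sup>+\<omega>. emeasure \<nu> {z. prefix_map \<zeta> (Suc n) (i ## \<omega>) z \<in> A} \<partial>\<mu> \<partial>p)"
      by (subst nn_integral_measure_pmf) (simp add: nn_integral_count_space_finite)
    also have "\<dots> = (\<integral>\<^sup>+\<omega>. emeasure \<nu> {z. prefix_map \<zeta> (Suc n) \<omega> z \<in> A} \<partial>\<mu>)"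
      using prob_space.nn_integral_stream_space[OF prob_space_measure_pmf m] by simp
    finally show ?case .
  qed
  \<comment> \<open>Pointwise convergence and Fatou's lemma give only one inequality, and only on
    open sets. Outer regularity extends it to Borel sets, and complements turn it into an equality
    of probability measures.\<close>
  have openle: "emeasure (law \<zeta>) U \<le> emeasure \<nu> U" if U: "open U" for U
  proof -
    have [measurable]: "U \<in> sets borel" using U by simp
    define f where "f n x = (indicator U (prefix_map \<zeta> n (fst x) (snd x)) :: ennreal)" for n x
    have fm [measurable]: "f n \<in> borel_measurable (\<mu> \<Otimes>\<^sub>M \<nu>)" for n unfolding f_def by measurable
    have fi: "(\<integral>\<^sup>+x. f n x \<partial>(\<mu> \<Otimes>\<^sub>M \<nu>)) = emeasure \<nu> U" for n
    proof -
      have "(\<integral>\<^sup>+x. f n x \<partial>(\<mu> \<Otimes>\<^sub>M \<nu>)) = (\<integral>\<^sup>+\<omega>. \<integral>\<^sup>+z. f n (\<omega>, z) \<partial>\<nu> \<partial>\<mu>)"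
        by (rule N.nn_integral_fst[symmetric]) measurable
      also have "\<dots> = (\<integral>\<^sup>+\<omega>. emeasure \<nu> {z. prefix_map \<zeta> n \<omega> z \<in> U} \<partial>\<mu>)"
      proof (rule nn_integral_cong)
        fix \<omega>
        have "(\<lambda>z. prefix_map \<zeta> n \<omega> z) \<in> borel_measurable \<nu>" unfolding prefix_map_def by measurable
        then have "Measurable.pred \<nu> (\<lambda>z. prefix_map \<zeta> n \<omega> z \<in> U)" by measurable
        then have "{z. prefix_map \<zeta> n \<omega> z \<in> U} \<in> sets \<nu>" by (simp add: pred_def)
        moreover have "(\<integral>\<^sup>+z. f n (\<omega>, z) \<partial>\<nu>) = (\<integral>\<^sup>+z. indicator {z. prefix_map \<zeta> n \<omega> z \<in> U} z \<partial>\<nu>)"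
          by (intro nn_integral_cong) (auto simp: f_def indicator_def)
        ultimately show "(\<integral>\<^sup>+z. f n (\<omega>, z) \<partial>\<nu>) = emeasure \<nu> {z. prefix_map \<zeta> n \<omega> z \<in> U}" by simp
      qed
      also have "\<dots> = emeasure \<nu> U" by (rule iter[symmetric]) simp
      finally show ?thesis .
    qed
    have "emeasure (law \<zeta>) U = emeasure \<mu> {\<omega>. V 0 0 \<zeta> \<omega> \<in> U}"
      unfolding law_def by (subst emeasure_distr) (auto simp: vimage_def)
    also have "\<dots> = (\<integral>\<^sup>+\<omega>. indicator {\<omega>. V 0 0 \<zeta> \<omega> \<in> U} \<omega> \<partial>\<mu>)"
    proof -
      have "Measurable.pred \<mu> (\<lambda>\<omega>. V 0 0 \<zeta> \<omega> \<in> U)" by measurable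
      then show ?thesis by (simp add: pred_def)
    qed
    also have "\<dots> = (\<integral>\<^sup>+\<omega>. \<integral>\<^sup>+z. indicator U (V 0 0 \<zeta> (fst (\<omega>, z))) \<partial>\<nu> \<partial>\<mu>)"
      using N.emeasure_space_1 by (intro nn_integral_cong) (auto simp: indicator_def)
    also have "\<dots> = (\<integral>\<^sup>+x. indicator U (V 0 0 \<zeta> (fst x)) \<partial>(\<mu> \<Otimes>\<^sub>M \<nu>))"
      by (rule N.nn_integral_fst) measurable
    also have "\<dots> \<le> (\<integral>\<^sup>+x. liminf (\<lambda>n. f n x) \<partial>(\<mu> \<Otimes>\<^sub>M \<nu>))"
    proof (rule nn_integral_mono)
      fix x :: "'n stream \<times> complex"
      show "indicator U (V 0 0 \<zeta> (fst x)) \<le> liminf (\<lambda>n. f n x)"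
      proof (cases "V 0 0 \<zeta> (fst x) \<in> U")
        case True
        have "eventually (\<lambda>n. prefix_map \<zeta> n (fst x) (snd x) \<in> U) sequentially"
          by (rule topological_tendstoD[OF prefix_map_tendsto[OF \<zeta>] U True])
        then have "eventually (\<lambda>n. 1 \<le> f n x) sequentially" by eventually_elim (simp add: f_def)
        then have "1 \<le> liminf (\<lambda>n. f n x)" by (rule Liminf_bounded)
        then show ?thesis using True by simp
      qed simp
    qed
    also have "\<dots> \<le> liminf (\<lambda>n. \<integral>\<^sup>+x. f n x \<partial>(\<mu> \<Otimes>\<^sub>M \<nu>))" by (rule nn_integral_liminf) measurable
    also have "\<dots> = emeasure \<nu> U" unfolding fi by (rule Liminf_const) simp
    finally show ?thesis .
  qed
  have pl: "prob_space (law \<zeta>)" unfolding law_def by (rule prob_space_distr) measurable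
  then interpret L: prob_space "law \<zeta>" .
  have sl: "sets (law \<zeta>) = sets borel" by (simp add: law_def)
  have le: "emeasure (law \<zeta>) A \<le> emeasure \<nu> A" if A: "A \<in> sets borel" for A
  proof -
    have "emeasure \<nu> A = (INF U\<in>{U. A \<subseteq> U \<and> open U}. emeasure \<nu> U)"
      by (rule outer_regular[OF s\<nu>]) (use A N.emeasure_finite in \<open>auto simp: s\<nu>\<close>)
    also have "\<dots> \<ge> emeasure (law \<zeta>) A"
    proof (rule INF_greatest)
      fix U assume U: "U \<in> {U. A \<subseteq> U \<and> open U}"
      then have "emeasure (law \<zeta>) A \<le> emeasure (law \<zeta>) U" by (intro emeasure_mono) (auto simp: sl)
      also have "\<dots> \<le> emeasure \<nu> U" using U by (intro openle) auto
      finally show "emeasure (law \<zeta>) A \<le> emeasure \<nu> U" .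
    qed
    finally show ?thesis .
  qed
  show ?thesis
  proof (rule measure_eqI)
    show "sets \<nu> = sets (law \<zeta>)" by (simp add: s\<nu> sl)
    fix A assume "A \<in> sets \<nu>"
    then have A: "A \<in> sets borel" by (simp add: s\<nu>)
    have m1: "measure (law \<zeta>) A \<le> measure \<nu> A" using le[OF A] by (simp add: N.emeasure_eq_measure L.emeasure_eq_measure)
    have "measure (law \<zeta>) (UNIV - A) \<le> measure \<nu> (UNIV - A)"
      using le[of "UNIV - A"] A by (simp add: N.emeasure_eq_measure L.emeasure_eq_measure)
    moreover have "space (law \<zeta>) = UNIV" by (simp add: law_def)
    moreover have "measure (law \<zeta>) (space (law \<zeta>) - A) = 1 - measure (law \<zeta>) A" by (rule L.prob_compl) (simp add: sl A)
    moreover have "measure \<nu> (space \<nu> - A) = 1 - measure \<nu> A" by (rule N.prob_compl) (simp add: s\<nu> A)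
    ultimately have "measure \<nu> A = measure (law \<zeta>) A" using m1 by simp
    then show "emeasure \<nu> A = emeasure (law \<zeta>) A" by (simp add: N.emeasure_eq_measure L.emeasure_eq_measure)
  qed
qed

end

section \<open>The exceptional set\<close>

text \<open>The series of \<open>V 0 0\<close> as a function of the ratios alone, free of a choice
  of logarithms. The exceptional set can thus be defined in the space of ratios.\<close>

definition coding :: "complex^'n \<Rightarrow> complex^'n \<Rightarrow> 'n stream \<Rightarrow> complex" where
  "coding t lam \<omega> = (\<Sum>n. (\<Prod>k<n. lam $ (\<omega> !! k)) * t $ (\<omega> !! n))"

text \<open>For fixed \<open>\<kappa>\<close> a holomorphic curve in \<open>\<zeta>\<close>; for
  fixed \<open>\<zeta>\<close> in the right half-plane a smooth map that covers the punctured
  polydisc. The Fubini argument plays these two views against each other.\<close>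

definition curve :: "complex \<Rightarrow> complex^'n \<Rightarrow> complex^'n" where
  "curve \<zeta> \<kappa> = (\<chi> i. exp (\<zeta> * of_real (Re (\<kappa> $ i)) + \<i> * of_real (Im (\<kappa> $ i))))"

lemma (in ifs) V_eq_coding:
  assumes "\<And>i. lam $ i = exp (\<zeta> * of_real (a i) + \<i> * of_real (b i))" "\<And>i. t i = tv $ i"
  shows "V 0 0 \<zeta> \<omega> = coding tv lam \<omega>"
proof -
  have "exp (\<zeta> * of_real (As \<omega> n) + \<i> * of_real (Bs \<omega> n)) = (\<Prod>k<n. lam $ (\<omega> !! k))" for n
    unfolding assms(1) As_def Bs_def
    by (simp add: exp_sum[symmetric] sum.distrib sum_distrib_left)
  then show ?thesis unfolding V_def coding_def trm_def by (simp add: assms(2))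
qed

lemma curve_onto:
  assumes \<zeta>: "Re \<zeta> > 0" and lam: "lam \<in> punctured_polydisc"
  shows "\<exists>\<kappa>. (\<forall>i. Re (\<kappa> $ i) < 0) \<and> curve \<zeta> \<kappa> = lam"
proof -
  define x where "x i = ln (cmod (lam $ i)) / Re \<zeta>" for i
  define \<kappa> where "\<kappa> = (\<chi> i. Complex (x i) (Arg (lam $ i) - Im \<zeta> * x i))"
  have l: "0 < cmod (lam $ i)" "cmod (lam $ i) < 1" for i using lam by (auto simp: punctured_polydisc_def)
  have "exp (\<zeta> * of_real (x i) + \<i> * of_real (Arg (lam $ i) - Im \<zeta> * x i)) = lam $ i" for i
  proof -
    have "\<zeta> * of_real (x i) + \<i> * of_real (Arg (lam $ i) - Im \<zeta> * x i) = of_real (Re \<zeta> * x i) + \<i> * of_real (Arg (lam $ i))"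
      by (simp add: complex_eq_iff)
    also have "Re \<zeta> * x i = ln (cmod (lam $ i))" using \<zeta> by (simp add: x_def)
    finally have "exp (\<zeta> * of_real (x i) + \<i> * of_real (Arg (lam $ i) - Im \<zeta> * x i)) = of_real (cmod (lam $ i)) * exp (\<i> * of_real (Arg (lam $ i)))"
      using l[of i] by (simp add: exp_add exp_of_real)
    also have "\<dots> = lam $ i" using l[of i] Arg_eq[of "lam $ i"] by auto
    finally show ?thesis .
  qed
  then have "curve \<zeta> \<kappa> = lam" by (simp add: curve_def \<kappa>_def vec_eq_iff)
  moreover have "Re (\<kappa> $ i) < 0" for i using l[of i] \<zeta> by (simp add: \<kappa>_def x_def divide_neg_pos)
  ultimately show ?thesis by blast
qed

lemma curve_differentiable:
  fixes S :: "(complex^'n::finite) set"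
  shows "curve \<zeta> differentiable_on S"
  unfolding differentiable_on_def
proof
  fix x :: "complex^'n"
  show "curve \<zeta> differentiable at x within S"
  proof (rule differentiable_componentwise_within[THEN iffD2], rule ballI)
    fix e :: "complex^'n" assume "e \<in> Basis"
    then obtain i b where e: "e = axis i b" "b \<in> Basis" by (auto simp: Basis_vec_def)
    have 1: "(\<lambda>\<kappa>. curve \<zeta> \<kappa> \<bullet> e) = (\<lambda>\<kappa>. exp (\<zeta> * of_real (Re (\<kappa> $ i)) + \<i> * of_real (Im (\<kappa> $ i))) \<bullet> b)"
      by (rule ext) (simp add: e inner_axis curve_def)
    have bl: "bounded_linear (\<lambda>\<kappa>::complex^'n. \<zeta> * of_real (Re (\<kappa> $ i)) + \<i> * of_real (Im (\<kappa> $ i)))"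
      by (intro bounded_linear_add bounded_linear_const_mult bounded_linear_compose[OF bounded_linear_of_real]
          bounded_linear_compose[OF bounded_linear_Re bounded_linear_vec_nth] bounded_linear_compose[OF bounded_linear_Im bounded_linear_vec_nth])
    have "((\<lambda>\<kappa>::complex^'n. exp (\<zeta> * of_real (Re (\<kappa> $ i)) + \<i> * of_real (Im (\<kappa> $ i)))) has_derivative
        (\<lambda>d::complex^'n. exp (\<zeta> * of_real (Re (x $ i)) + \<i> * of_real (Im (x $ i))) * (\<zeta> * of_real (Re (d $ i)) + \<i> * of_real (Im (d $ i))))) (at x within S)"
      using has_derivative_compose[OF bounded_linear_imp_has_derivative[OF bl] DERIV_exp[unfolded has_field_derivative_def]] by simp
    from bounded_linear.has_derivative[OF bounded_linear_inner_left[of b] this]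
    show "(\<lambda>\<kappa>. curve \<zeta> \<kappa> \<bullet> e) differentiable at x within S" unfolding 1 differentiable_def by blast
  qed
qed

lemma vec_nth_measurable [measurable]: "(\<lambda>v::complex^'n. v $ i) \<in> borel_measurable borel"
  by (intro borel_measurable_continuous_onI continuous_intros)

lemma vec_nth_measurable_comp [measurable (raw)]:
  fixes f :: "'a \<Rightarrow> complex^'n::finite"
  assumes "f \<in> N \<rightarrow>\<^sub>M borel" "g \<in> N \<rightarrow>\<^sub>M count_space UNIV"
  shows "(\<lambda>x. f x $ g x) \<in> borel_measurable N"
proof -
  have "(\<lambda>x. f x $ i) \<in> borel_measurable N" for i using measurable_compose[OF assms(1) vec_nth_measurable] .
  then show ?thesis by (rule measurable_compose_countable[OF _ assms(2)])
qed

lemma coding_measurable [measurable]: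
  "(\<lambda>x. coding t (fst x) (snd x)) \<in> borel_measurable (borel \<Otimes>\<^sub>M stream_space (measure_pmf (p :: 'n::finite pmf)))"
  unfolding coding_def by measurable

lemma region_R_measurable:
  fixes p :: "real^'n::finite"
  shows "region_R p \<in> sets borel"
proof -
  have [measurable]: "(\<lambda>lam. sim_dim lam p) \<in> borel_measurable borel" unfolding sim_dim_def by measurable
  have "{lam \<in> space borel. (\<forall>i\<in>(UNIV :: 'n set). 0 < cmod (lam $ i) \<and> cmod (lam $ i) < 1) \<and> sim_dim lam p > 2} \<in> sets borel"
    by measurable
  also have "{lam \<in> space borel. (\<forall>i\<in>(UNIV :: 'n set). 0 < cmod (lam $ i) \<and> cmod (lam $ i) < 1) \<and> sim_dim lam p > 2} = region_R p"
    unfolding region_R_def punctured_polydisc_def by (simp only: space_borel UNIV_I mem_Collect_eq ball_UNIV simp_thms)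
  finally show ?thesis .
qed

section \<open>Absolute continuity tested on countably many open sets\<close>

lemma outer_open_small:
  fixes N :: "complex set"
  assumes "N \<in> null_sets lborel" "\<delta> > 0"
  shows "\<exists>T. open T \<and> N \<subseteq> T \<and> emeasure lborel T < ennreal \<delta>"
proof -
  have N: "N \<in> sets lborel" "emeasure lborel N = 0" using assms(1) by auto
  then have "N \<in> sets lebesgue" by (simp add: sets_completionI_sets)
  then obtain T where T: "open T" "N \<subseteq> T" "emeasure lebesgue (T - N) < ennreal \<delta>"
    using sets_lebesgue_outer_open[OF _ assms(2)] by metis
  have s: "T - N \<in> sets lborel" using T(1) N by auto
  have "emeasure lborel T \<le> emeasure lborel (N \<union> (T - N))" using T N s by (intro emeasure_mono) auto
  also have "\<dots> \<le> emeasure lborel N + emeasure lborel (T - N)" using N s by (intro emeasure_subadditive) auto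
  also have "\<dots> = emeasure lebesgue (T - N)" using N s by simp
  finally show ?thesis using T by (intro exI[of _ T]) auto
qed

text \<open>Finite unions of members of a countable base form a countable family, and every open set
  is an increasing union of such sets.\<close>

lemma countable_open_approximation:
  "\<exists>e :: nat \<Rightarrow> complex set. (\<forall>n. open (e n)) \<and>
     (\<forall>U. open U \<longrightarrow> (\<exists>g :: nat \<Rightarrow> nat. incseq (\<lambda>n. e (g n)) \<and> (\<Union>n. e (g n)) = U))"
proof -
  obtain B :: "complex set set" where B: "countable B" "topological_basis B" using ex_countable_basis by blast
  define S where "S = Union ` {F. finite F \<and> F \<subseteq> B}"
  have S: "countable S" unfolding S_def by (intro countable_image countable_Collect_finite_subset B)
  have ne: "S \<noteq> {}" unfolding S_def by blast
  define e where "e = from_nat_into S"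
  have eS: "e n \<in> S" for n unfolding e_def by (rule from_nat_into[OF ne])
  have "open (e n)" for n
  proof -
    obtain F where "e n = \<Union>F" "F \<subseteq> B" using eS[of n] unfolding S_def by blast
    then show ?thesis using topological_basis_open[OF B(2)] by (auto intro!: open_Union)
  qed
  moreover have "\<exists>g :: nat \<Rightarrow> nat. incseq (\<lambda>n. e (g n)) \<and> (\<Union>n. e (g n)) = U" if U: "open U" for U
  proof -
    obtain B' where B': "B' \<subseteq> B" "\<Union>B' = U" using topological_basis[THEN iffD1, OF B(2), rule_format, THEN iffD1, OF U] by blast
    \<comment> \<open>The empty set is added so that the enumeration also works for an empty open
      set.\<close>
    define C where "C = insert {} B'"
    define c where "c = from_nat_into C"
    have cC: "countable C" unfolding C_def using B' B(1) by (simp add: countable_subset)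
    have "C \<noteq> {}" by (simp add: C_def)
    then have rc: "range c = C" unfolding c_def using cC by (rule range_from_nat_into)
    define G where "G n = (\<Union>k<n. c k)" for n
    have "G n \<in> S" for n
    proof -
      have "G n = \<Union>(c ` {..<n} - {{}})" unfolding G_def by auto
      moreover have "c ` {..<n} - {{}} \<subseteq> B" using rc B' unfolding C_def by blast
      ultimately show ?thesis unfolding S_def by blast
    qed
    then have "\<exists>m. e m = G n" for n using from_nat_into_surj[OF S] unfolding e_def by blast
    then obtain g where g: "\<And>n. e (g n) = G n" by metis
    have "incseq G" unfolding G_def incseq_def by fastforce
    moreover have "(\<Union>n. G n) = U"
    proof -
      have "(\<Union>n. G n) = \<Union>(range c)" unfolding G_def by blast
      then show ?thesis unfolding rc C_def using B' by simp
    qed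
    ultimately show ?thesis using g by (intro exI[of _ g]) simp
  qed
  ultimately show ?thesis by blast
qed

text \<open>The condition in \<open>unif_ac\<close> with only countable quantifiers: \<epsilon> and
  \<delta> run through reciprocals and the open sets through one sequence. This makes the
  exceptional set Borel, as Fubini requires.\<close>

definition test_ac :: "(nat \<Rightarrow> complex set) \<Rightarrow> 'a measure \<Rightarrow> ('a \<Rightarrow> complex) \<Rightarrow> bool" where
  "test_ac e M X \<longleftrightarrow> (\<forall>k::nat. \<exists>l::nat. \<forall>n. emeasure lborel (e n) < ennreal (1 / Suc l) \<longrightarrow> measure M {u. X u \<in> e n} \<le> 1 / Suc k)"

lemma test_acI:
  assumes "\<And>n. open (e n)"
    and "\<forall>\<epsilon>>0. \<exists>\<delta>>0. \<forall>U. open U \<and> emeasure lborel U < ennreal \<delta> \<longrightarrow> measure M {u. X u \<in> U} \<le> \<epsilon>"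
  shows "test_ac e M X"
  unfolding test_ac_def
proof
  fix k :: nat
  have "1 / real (Suc k) > 0" by simp
  then obtain \<delta> where d: "\<delta> > 0" "\<And>U. open U \<Longrightarrow> emeasure lborel U < ennreal \<delta> \<Longrightarrow> measure M {u. X u \<in> U} \<le> 1 / Suc k"
    using assms(2) by blast
  obtain l where l: "1 / real (Suc l) < \<delta>" using nat_approx_posE[OF d(1)] by blast
  have "measure M {u. X u \<in> e n} \<le> 1 / Suc k" if "emeasure lborel (e n) < ennreal (1 / Suc l)" for n
  proof (rule d(2)[OF assms(1)])
    show "emeasure lborel (e n) < ennreal \<delta>"
      using that l by (meson ennreal_leI less_imp_le less_le_trans)
  qed
  then show "\<exists>l. \<forall>n. emeasure lborel (e n) < ennreal (1 / real (Suc l)) \<longrightarrow> measure M {u. X u \<in> e n} \<le> 1 / real (Suc k)"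
    by blast
qed

lemma test_ac_imp_absolutely_continuous:
  assumes e: "\<And>n. open (e n)" "\<And>U. open U \<Longrightarrow> \<exists>g :: nat \<Rightarrow> nat. incseq (\<lambda>n. e (g n)) \<and> (\<Union>n. e (g n)) = U"
    and M: "prob_space M" "space M = UNIV" and X [measurable]: "X \<in> borel_measurable M"
    and ac: "test_ac e M X"
  shows "absolutely_continuous lborel (distr M borel X)"
  unfolding absolutely_continuous_def
proof
  interpret prob_space M by fact
  fix N :: "complex set" assume N: "N \<in> null_sets lborel"
  then have [measurable]: "N \<in> sets borel" by auto
  have ms: "{u. X u \<in> A} \<in> sets M" if "A \<in> sets borel" for A
    using measurable_sets[OF X that] M(2) by (simp add: vimage_def)
  have small: "measure M {u. X u \<in> N} \<le> 1 / Suc k" for k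
  proof -
    obtain l :: nat where l: "\<And>n. emeasure lborel (e n) < ennreal (1 / Suc l) \<Longrightarrow> measure M {u. X u \<in> e n} \<le> 1 / Suc k"
      using ac unfolding test_ac_def by blast
    obtain U where U: "open U" "N \<subseteq> U" "emeasure lborel U < ennreal (1 / Suc l)"
      using outer_open_small[OF N, of "1 / Suc l"] by auto
    obtain g :: "nat \<Rightarrow> nat" where g: "incseq (\<lambda>n. e (g n))" "(\<Union>n. e (g n)) = U" using e(2)[OF U(1)] by blast
    have b: "measure M {u. X u \<in> e (g n)} \<le> 1 / Suc k" for n
    proof (rule l)
      have "emeasure lborel (e (g n)) \<le> emeasure lborel U" using g U e(1) by (intro emeasure_mono) auto
      then show "emeasure lborel (e (g n)) < ennreal (1 / Suc l)" using U(3) by (rule le_less_trans)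
    qed
    have "(\<lambda>n. measure M {u. X u \<in> e (g n)}) \<longlonglongrightarrow> measure M (\<Union>n. {u. X u \<in> e (g n)})"
    proof (rule finite_Lim_measure_incseq)
      show "range (\<lambda>n. {u. X u \<in> e (g n)}) \<subseteq> sets M" using e(1) by (auto intro!: ms)
      show "incseq (\<lambda>n. {u. X u \<in> e (g n)})" using g(1) unfolding incseq_def by blast
    qed
    then have "measure M (\<Union>n. {u. X u \<in> e (g n)}) \<le> 1 / Suc k"
      by (rule LIMSEQ_le_const2) (use b in auto)
    moreover have "measure M {u. X u \<in> N} \<le> measure M (\<Union>n. {u. X u \<in> e (g n)})"
      using U(2) g(2) e(1) by (intro finite_measure_mono sets.countable_UN) (auto intro!: ms)
    ultimately show ?thesis by simp
  qed
  have "measure M {u. X u \<in> N} \<le> 0"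
  proof (rule ccontr)
    assume "\<not> measure M {u. X u \<in> N} \<le> 0"
    then obtain k where "1 / real (Suc k) < measure M {u. X u \<in> N}" using nat_approx_posE by (metis not_le)
    with small[of k] show False by simp
  qed
  then have "measure M {u. X u \<in> N} = 0" using measure_nonneg[of M "{u. X u \<in> N}"] by linarith
  then have "emeasure M {u. X u \<in> N} = 0" by (simp add: emeasure_eq_measure)
  then have "emeasure (distr M borel X) N = 0" using M(2) by (subst emeasure_distr) (auto simp: vimage_def)
  then show "N \<in> null_sets (distr M borel X)" by (intro null_setsI) auto
qed

lemma test_ac_coding_measurable:
  fixes pm :: "'n::finite pmf" and t :: "complex^'n"
  assumes "\<And>n. open (e n)"
  shows "{lam. test_ac e (stream_space (measure_pmf pm)) (coding t lam)} \<in> sets borel"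
proof -
  let ?M = "stream_space (measure_pmf pm)"
  interpret prob_space ?M by (rule prob_space.prob_space_stream_space[OF prob_space_measure_pmf])
  have m: "(\<lambda>lam. measure ?M {u. coding t lam u \<in> e n}) \<in> borel_measurable borel" for n
  proof -
    have [measurable]: "e n \<in> sets borel" using assms by simp
    have "{x \<in> space (borel \<Otimes>\<^sub>M ?M). coding t (fst x) (snd x) \<in> e n} \<in> sets (borel \<Otimes>\<^sub>M ?M)" by measurable
    from measurable_emeasure_Pair[OF this] show ?thesis
      unfolding measure_def by (simp add: space_pair_measure space_stream_space vimage_def)
  qed
  have "{lam \<in> space borel. measure ?M {u. coding t lam u \<in> e n} \<le> 1 / Suc k} \<in> sets borel" for n k
    using m[of n] by measurable
  then have s: "{lam. measure ?M {u. coding t lam u \<in> e n} \<le> 1 / Suc k} \<in> sets borel" for n k by simp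
  have s: "{lam. emeasure lborel (e n) < ennreal (1 / Suc l) \<longrightarrow> measure ?M {u. coding t lam u \<in> e n} \<le> 1 / Suc k} \<in> sets borel" for n k l
    using s[of n k] by (cases "emeasure lborel (e n) < ennreal (1 / Suc l)") simp_all
  have "{lam. test_ac e ?M (coding t lam)} = (\<Inter>k. \<Union>l. \<Inter>n. {lam. emeasure lborel (e n) < ennreal (1 / Suc l) \<longrightarrow> measure ?M {u. coding t lam u \<in> e n} \<le> 1 / Suc k})"
    by (simp only: test_ac_def Collect_all_eq Collect_ex_eq)
  also have "\<dots> \<in> sets borel"
    by (intro sets.countable_INT'' sets.countable_UN'' s) simp_all
  finally show ?thesis .
qed

lemma ex_pmf_of_vec:
  fixes p :: "real^'n::finite"
  assumes "\<forall>i. p $ i > 0" "(\<Sum>i\<in>UNIV. p $ i) = 1"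
  shows "\<exists>pm :: 'n pmf. \<forall>i. pmf pm i = p $ i"
proof (intro exI allI)
  fix i
  show "pmf (embed_pmf (\<lambda>i. p $ i)) i = p $ i"
  proof (rule pmf_embed_pmf)
    show "0 \<le> p $ i" for i using assms(1) by (simp add: less_imp_le)
    show "(\<integral>\<^sup>+ i. ennreal (p $ i) \<partial>count_space UNIV) = 1"
      using assms by (simp add: nn_integral_count_space_finite sum_ennreal less_imp_le)
  qed
qed

section \<open>Nullity of the exceptional set of ratios\<close>

context
  fixes t :: "complex^'n::finite" and p :: "real^'n" and pm :: "'n pmf"
  assumes inj: "inj (\<lambda>i. t $ i)" and pos: "\<forall>i. p $ i > 0" and pm: "\<forall>i. pmf pm i = p $ i"
begin

lemma ifs_curve:
  fixes \<kappa> :: "complex^'n"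
  assumes "\<forall>i. Re (\<kappa> $ i) < 0" shows "ifs pm (\<lambda>i. Re (\<kappa> $ i)) (\<lambda>i. t $ i)"
  using assms inj pos pm by unfold_locales auto

lemma self_similar_measure_curve:
  fixes \<kappa> :: "complex^'n"
  assumes k: "\<forall>i. Re (\<kappa> $ i) < 0" and z: "Re \<zeta> > 0"
  shows "self_similar_measure p (curve \<zeta> \<kappa>) t = distr (stream_space (measure_pmf pm)) borel (coding t (curve \<zeta> \<kappa>))"
proof -
  interpret ifs pm "\<lambda>i. Re (\<kappa> $ i)" "\<lambda>i. Im (\<kappa> $ i)" "\<lambda>i. t $ i" by (rule ifs_curve[OF k])
  have c: "curve \<zeta> \<kappa> $ i = exp (\<zeta> * of_real (Re (\<kappa> $ i)) + \<i> * of_real (Im (\<kappa> $ i)))" for i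
    by (simp add: curve_def)
  have "ssm_fixed p (curve \<zeta> \<kappa>) t \<nu> \<longleftrightarrow> stationary \<zeta> \<nu>" for \<nu>
    unfolding ssm_fixed_def stationary_def c using pm by simp
  then have "self_similar_measure p (curve \<zeta> \<kappa>) t = (THE \<nu>. stationary \<zeta> \<nu>)"
    by (simp add: self_similar_measure_def)
  also have "\<dots> = law \<zeta>"
    using stationary_law[OF z] stationary_unique[OF z] by (rule the_equality)
  also have "\<dots> = distr \<mu> borel (coding t (curve \<zeta> \<kappa>))"
    unfolding law_def by (intro distr_cong refl) (rule V_eq_coding[OF c refl])
  finally show ?thesis .
qed

lemma AE_curve_test_ac:
  fixes \<kappa> :: "complex^'n"
  assumes k: "\<forall>i. Re (\<kappa> $ i) < 0" and e: "\<And>n. open (e n)"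
  shows "AE \<zeta> in lborel. Re \<zeta> > 0 \<and> curve \<zeta> \<kappa> \<in> region_R p \<longrightarrow> test_ac e (stream_space (measure_pmf pm)) (coding t (curve \<zeta> \<kappa>))"
proof -
  interpret ifs pm "\<lambda>i. Re (\<kappa> $ i)" "\<lambda>i. Im (\<kappa> $ i)" "\<lambda>i. t $ i" by (rule ifs_curve[OF k])
  have c: "curve \<zeta> \<kappa> $ i = exp (\<zeta> * of_real (Re (\<kappa> $ i)) + \<i> * of_real (Im (\<kappa> $ i)))" for i \<zeta>
    by (simp add: curve_def)
  have V: "V 0 0 \<zeta> = coding t (curve \<zeta> \<kappa>)" for \<zeta> by (rule ext) (rule V_eq_coding[OF c refl])
  have sd: "2 * Re \<zeta> < p_entropy / lyap" if z: "Re \<zeta> > 0" and r: "curve \<zeta> \<kappa> \<in> region_R p" for \<zeta>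
  proof -
    have "ln (cmod (curve \<zeta> \<kappa> $ i)) = Re \<zeta> * Re (\<kappa> $ i)" for i by (simp add: c)
    then have "(\<Sum>i\<in>UNIV. p $ i * ln (cmod (curve \<zeta> \<kappa> $ i))) = - (Re \<zeta> * lyap)"
      unfolding lyap_def using pm by (simp add: sum_distrib_left mult_ac)
    moreover have "(\<Sum>i\<in>UNIV. p $ i * ln (p $ i)) = - p_entropy" unfolding p_entropy_def using pm by simp
    ultimately have "sim_dim (curve \<zeta> \<kappa>) p = p_entropy / (Re \<zeta> * lyap)" by (simp add: sim_dim_def)
    then have "2 < p_entropy / (Re \<zeta> * lyap)" using r by (simp add: region_R_def)
    then show ?thesis using z lyap_pos by (simp add: field_simps)
  qed
  show ?thesis using AE_unif_ac
  proof eventually_elim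
    case (elim \<zeta>)
    show ?case
    proof
      assume a: "Re \<zeta> > 0 \<and> curve \<zeta> \<kappa> \<in> region_R p"
      then have "unif_ac \<zeta>" using elim sd by blast
      then show "test_ac e \<mu> (coding t (curve \<zeta> \<kappa>))" unfolding unif_ac_def V by (rule test_acI[OF e])
    qed
  qed
qed

lemma curve_measurable: "(\<lambda>x. curve (fst x) (snd x) :: complex^'n) \<in> borel_measurable (borel \<Otimes>\<^sub>M borel)"
proof -
  have "continuous_on UNIV (\<lambda>x :: complex \<times> (complex^'n). curve (fst x) (snd x))"
    unfolding curve_def by (intro continuous_intros)
  then show ?thesis by (simp add: borel_prod borel_measurable_continuous_onI)
qed

text \<open>Along each curve almost every \<open>\<zeta>\<close> is good, so by Fubini for almost
  every \<open>\<zeta>\<close> almost every \<open>\<kappa>\<close> is good. One such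
  \<open>\<zeta>\<close> in the right half-plane suffices: its map \<open>curve \<zeta>\<close>
  covers the whole polydisc, hence the exceptional set lies in the smooth image of a null
  set.\<close>

theorem exceptional_set_null:
  assumes e: "\<And>n. open (e n)"
  shows "{lam \<in> region_R p. \<not> test_ac e (stream_space (measure_pmf pm)) (coding t lam)} \<in> null_sets lborel"
proof -
  define E where "E = {lam \<in> region_R p. \<not> test_ac e (stream_space (measure_pmf pm)) (coding t lam)}"
  have Eb: "E \<in> sets borel"
  proof -
    have "E = region_R p - {lam. test_ac e (stream_space (measure_pmf pm)) (coding t lam)}" by (auto simp: E_def)
    then show ?thesis using region_R_measurable test_ac_coding_measurable[of e pm t, OF e] by auto
  qed
  note Eb[measurable] curve_measurable[measurable]
  define P where "P \<zeta> \<kappa> \<longleftrightarrow> (Re \<zeta> > 0 \<and> (\<forall>i\<in>UNIV. Re (\<kappa> $ i) < 0) \<longrightarrow> curve \<zeta> \<kappa> \<notin> E)" for \<zeta> and \<kappa> :: "complex^'n"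
  have "{x \<in> space (borel \<Otimes>\<^sub>M borel). P (fst x) (snd x)} \<in> sets (borel \<Otimes>\<^sub>M borel)"
    unfolding P_def by measurable
  then have Pm: "{x \<in> space (lborel \<Otimes>\<^sub>M lborel). P (fst x) (snd x)} \<in> sets (lborel \<Otimes>\<^sub>M lborel)"
    by (simp add: space_pair_measure cong: sets_pair_measure_cong)
  have "AE \<kappa> in lborel. AE \<zeta> in lborel. P \<zeta> \<kappa>"
  proof (rule AE_I2)
    fix \<kappa> :: "complex^'n"
    show "AE \<zeta> in lborel. P \<zeta> \<kappa>"
    proof (cases "\<forall>i. Re (\<kappa> $ i) < 0")
      case True
      from AE_curve_test_ac[OF True e] show ?thesis by eventually_elim (auto simp: P_def E_def)
    next
      case False
      then show ?thesis by (auto simp: P_def)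
    qed
  qed
  then have "AE \<zeta> in lborel. AE \<kappa> in lborel. P \<zeta> \<kappa>" using lborel_pair.AE_commute[OF Pm] by simp
  then obtain Z where Z: "Z \<in> null_sets lborel" "{\<zeta>. \<not> (AE \<kappa> in lborel. P \<zeta> \<kappa>)} \<subseteq> Z"
    by (auto simp: eventually_ae_filter)
  \<comment> \<open>The right half-plane is open and nonempty, so it is not contained in a null
    set.\<close>
  have "\<exists>\<zeta>. Re \<zeta> > 0 \<and> \<zeta> \<notin> Z"
  proof (rule ccontr)
    assume "\<nexists>\<zeta>. Re \<zeta> > 0 \<and> \<zeta> \<notin> Z"
    then have "{\<zeta>. Re \<zeta> > 0} \<subseteq> Z" by blast
    moreover have "Z \<in> null_sets lebesgue" using Z(1) by (rule null_sets_completionI)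
    ultimately have "negligible {\<zeta>. Re \<zeta> > 0}" using negligible_iff_null_sets negligible_subset by metis
    moreover have "open {\<zeta>. Re \<zeta> > 0}" by (rule open_halfspace_Re_gt)
    moreover have "1 \<in> {\<zeta>. Re \<zeta> > 0}" by simp
    ultimately show False using open_not_negligible by blast
  qed
  then obtain \<zeta> where z: "Re \<zeta> > 0" and ae: "AE \<kappa> in lborel. P \<zeta> \<kappa>" using Z(2) by blast
  define N where "N = {\<kappa>. \<not> P \<zeta> \<kappa>}"
  obtain N' where "N' \<in> null_sets lborel" "N \<subseteq> N'" using ae by (auto simp: eventually_ae_filter N_def)
  then have "negligible N" using negligible_iff_null_sets null_sets_completionI negligible_subset by metis
  then have "negligible (curve \<zeta> ` N)"
    by (rule negligible_differentiable_image_negligible[OF order_refl _ curve_differentiable])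
  moreover have "E \<subseteq> curve \<zeta> ` N"
  proof
    fix lam assume lam: "lam \<in> E"
    then have "lam \<in> punctured_polydisc" by (simp add: E_def region_R_def)
    then obtain \<kappa> :: "complex^'n" where "\<forall>i. Re (\<kappa> $ i) < 0" "curve \<zeta> \<kappa> = lam" using curve_onto[OF z] by blast
    then have "\<not> P \<zeta> \<kappa>" using lam z by (simp add: P_def)
    then show "lam \<in> curve \<zeta> ` N" using \<open>curve \<zeta> \<kappa> = lam\<close> by (auto simp: N_def)
  qed
  ultimately have "negligible E" by (rule negligible_subset)
  then have "E \<in> null_sets lebesgue" by (simp add: negligible_iff_null_sets)
  then have "E \<in> null_sets lborel" using Eb by (simp add: null_sets_completion_iff)
  then show ?thesis by (simp add: E_def)
qed

end

theorem theorem1p1: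
  fixes t :: "complex^'n::finite" and p :: "real^'n"
  assumes "CARD('n) \<ge> 2"
    and "inj (\<lambda>i. t$i)"
    and "\<forall>i. p$i > 0"
    and "(\<Sum>i\<in>UNIV. p$i) = 1"
  shows "\<exists>E. E \<subseteq> region_R p \<and> E \<in> null_sets lborel \<and>
           (\<forall>lam \<in> region_R p - E.
              absolutely_continuous lborel (self_similar_measure p lam t))"
proof -
  obtain pm :: "'n pmf" where pm: "\<forall>i. pmf pm i = p $ i" using ex_pmf_of_vec[OF assms(3,4)] by blast
  obtain e :: "nat \<Rightarrow> complex set" where e: "\<And>n. open (e n)"
    "\<And>U. open U \<Longrightarrow> \<exists>g :: nat \<Rightarrow> nat. incseq (\<lambda>n. e (g n)) \<and> (\<Union>n. e (g n)) = U"
    using countable_open_approximation by blast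
  define M where "M = stream_space (measure_pmf pm)"
  define E where "E = {lam \<in> region_R p. \<not> test_ac e M (coding t lam)}"
  have M: "prob_space M" unfolding M_def by (rule prob_space.prob_space_stream_space[OF prob_space_measure_pmf])
  have sM: "space M = UNIV" by (simp add: M_def space_stream_space)
  have "absolutely_continuous lborel (self_similar_measure p lam t)" if l: "lam \<in> region_R p - E" for lam
  proof -
    have "lam \<in> punctured_polydisc" using l by (simp add: region_R_def)
    \<comment> \<open>Self-similar measure and test depend on the ratios only, so the parameter 1
      may be used to place \<open>lam\<close> on a curve.\<close>
    then obtain \<kappa> :: "complex^'n" where k: "\<forall>i. Re (\<kappa> $ i) < 0" "curve 1 \<kappa> = lam" using curve_onto[of 1 lam] by auto
    have s: "self_similar_measure p lam t = distr M borel (coding t lam)"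
      using self_similar_measure_curve[OF assms(2,3) pm k(1), of 1] k(2) by (simp add: M_def)
    have m: "coding t lam \<in> borel_measurable M"
      using measurable_Pair2[OF coding_measurable[of t pm], of lam] by (simp add: M_def)
    have "test_ac e M (coding t lam)" using l by (simp add: E_def)
    then show ?thesis unfolding s by (intro test_ac_imp_absolutely_continuous[where e = e] e M sM m)
  qed
  moreover have "E \<in> null_sets lborel"
    unfolding E_def M_def by (rule exceptional_set_null[OF assms(2,3) pm e(1)])
  moreover have "E \<subseteq> region_R p" by (auto simp: E_def)
  ultimately show ?thesis by blast
qed

end
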